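(* Let $\mathfrak r\subset\mathfrak k$ be a reductive subalgebra of $\mathfrak g$ with $B|_{\mathfrak r\times\mathfrak r}$ nondegenerate, and let $\mathfrak s$ be the $B$-orthogonal complement of $\mathfrak r$ in $\mathfrak g$. Assume that either $\dim\mathfrak p$ is even or $\dim(\mathfrak s\cap\mathfrak k)$ is even. Let $V$ be an irreducible unitary $(\mathfrak g,K)$-module. Then $$H_D(\mathfrak g,\mathfrak r;V)=H_D(\mathfrak k,\mathfrak r;H_D(\mathfrak g,\mathfrak k;V)),$$ i.e., the Dirac cohomology can be calculated in stages, as the $D(\mathfrak k,\mathfrak r)$-cohomology of the $D(\mathfrak g,\mathfrak k)$-cohomology.
   Context: $G$ is a connected semisimple Lie group with finite center, Lie algebra $\mathfrak g_0$, complexification $\mathfrak g$; $\theta$ a Cartan involution, $K=G^\theta$, $\mathfrak g=\mathfrak k\oplus\mathfrak p$ the complexified Cartan decomposition; $B$ the Killing form. A $(\mathfrak g,K)$-module is unitary if it carries a positive definite $K$-invariant Hermitian form for which $\mathfrak g_0$ acts by skew-Hermitian operators. Equalities of cohomology spaces are natural identifications. Clifford algebras $C(\cdot)$ are taken with respect to $B$, with relations $vw+wv=2B(v,w)$. If $\mathfrak b\subset\mathfrak a$ are reductive with $B$ nondegenerate on both and $W_i$ is an orthonormal basis of the orthogonal complement $\mathfrak b^\perp$ of $\mathfrak b$ in $\mathfrak a$, the cubic Dirac operator is $$D(\mathfrak a,\mathfrak b)=\sum_k W_k\otimes W_k-\tfrac12\sum_{i<j<k}B([W_i,W_j],W_k)\otimes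 W_iW_jW_k\in U(\mathfrak a)\otimes C(\mathfrak b^\perp).$$ For an $\mathfrak a$-module $M$, $H_D(\mathfrak a,\mathfrak b;M)=\operatorname{Ker}D(\mathfrak a,\mathfrak b)/(\operatorname{Im}D(\mathfrak a,\mathfrak b)\cap\operatorname{Ker}D(\mathfrak a,\mathfrak b))$ for the action on $M\otimes S_{\mathfrak b^\perp}$, where $S_{\mathfrak b^\perp}$ is a spin module (a simple $C(\mathfrak b^\perp)$-module). Here $\mathfrak s=\mathfrak p\oplus(\mathfrak s\cap\mathfrak k)$, $C(\mathfrak s)=C(\mathfrak p)\bar\otimes C(\mathfrak s\cap\mathfrak k)$ (graded tensor product), and by the parity assumption the spin module for $C(\mathfrak s)$ is taken to be $S=S_{\mathfrak p}\otimes S_{\mathfrak s\cap\mathfrak k}$. $H_D(\mathfrak g,\mathfrak k;V)$ (computed on $V\otimes S_{\mathfrak p}$) is a module for the spin double cover $\tilde K$, with $X\in\mathfrak k$ acting as $X\otimes1+1\otimes\alpha(X)$, where $\alpha:\mathfrak k\to\mathfrak{so}(\mathfrak p)\hookrightarrow C(\mathfrak p)$ is the adjoint action followed by the standard inclusion $E_{ij}-E_{ji}\mapsto\frac12Z_iZ_j$ (for an orthonormal basis $Z_i$ of $\mathfrak p$, $E_{ij}$ matrix units). *)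

theory Defs
  imports "HOL-Analysis.Analysis" "HOL-Library.Poly_Mapping"
    "HOL-Algebra.AbelCoset" "HOL-Algebra.Module"
begin

section \<open>Lie groups\<close>

fun Ck_on :: "nat \<Rightarrow> ('a::real_normed_vector \<Rightarrow> 'b::real_normed_vector) \<Rightarrow> 'a set \<Rightarrow> bool" where
  "Ck_on 0 f S \<longleftrightarrow> continuous_on S f"
| "Ck_on (Suc n) f S \<longleftrightarrow> (\<forall>x\<in>S. f differentiable (at x)) \<and>
     (\<forall>v. Ck_on n (\<lambda>x. frechet_derivative f (at x) v) S)"

text \<open>Only used for open \<open>S\<close>.\<close>

definition smooth_on :: "('a::real_normed_vector \<Rightarrow> 'b::real_normed_vector) \<Rightarrow> 'a set \<Rightarrow> bool" where
  "smooth_on f S \<longleftrightarrow> (\<forall>n. Ck_on n f S)"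

text \<open>An atlas is a set of charts \<open>(U, \<phi>)\<close>. Charts take values in the Euclidean space that
  also underlies the Lie algebra; both have the same dimension.\<close>

type_synonym ('g, 'l) atlas = "('g set \<times> ('g \<Rightarrow> 'l)) set"

definition smooth_atlas :: "('g::topological_space, 'l::euclidean_space) atlas \<Rightarrow> bool" where
  "smooth_atlas A \<longleftrightarrow> (\<Union>(U, \<phi>)\<in>A. U) = UNIV \<and>
     (\<forall>(U, \<phi>)\<in>A. open U \<and> open (\<phi> ` U) \<and> homeomorphism U (\<phi> ` U) \<phi> (inv_into U \<phi>)) \<and>
     (\<forall>(U, \<phi>)\<in>A. \<forall>(V, \<psi>)\<in>A. smooth_on (\<lambda>x. \<psi> (inv_into U \<phi> x)) (\<phi> ` (U \<inter> V)))"

definition smooth_fun :: "('g, 'l::euclidean_space) atlas \<Rightarrow> ('g \<Rightarrow> real) \<Rightarrow> bool" where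
  "smooth_fun A f \<longleftrightarrow> (\<forall>(U, \<phi>)\<in>A. smooth_on (\<lambda>x. f (inv_into U \<phi> x)) (\<phi> ` U))"

definition smooth_map :: "('g::topological_space, 'l::euclidean_space) atlas \<Rightarrow> ('g \<Rightarrow> 'g) \<Rightarrow> bool" where
  "smooth_map A f \<longleftrightarrow> continuous_on UNIV f \<and>
     (\<forall>(U, \<phi>)\<in>A. \<forall>(V, \<psi>)\<in>A.
        smooth_on (\<lambda>x. \<psi> (f (inv_into U \<phi> x))) (\<phi> ` (U \<inter> f -` V)))"

definition lie_group ::
  "'g::{t2_space, second_countable_topology} monoid \<Rightarrow> ('g, 'l::euclidean_space) atlas \<Rightarrow> bool" where
  "lie_group G A \<longleftrightarrow> group G \<and> carrier G = UNIV \<and> smooth_atlas A \<and>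
     continuous_on UNIV (\<lambda>(g, h). g \<otimes>\<^bsub>G\<^esub> h) \<and>
     (\<forall>(U, \<phi>)\<in>A. \<forall>(V, \<psi>)\<in>A. \<forall>(W, \<eta>)\<in>A.
        smooth_on (\<lambda>(x, y). \<eta> (inv_into U \<phi> x \<otimes>\<^bsub>G\<^esub> inv_into V \<psi> y))
          {(\<phi> g, \<psi> h) | g h. g \<in> U \<and> h \<in> V \<and> g \<otimes>\<^bsub>G\<^esub> h \<in> W}) \<and>
     smooth_map A (\<lambda>g. inv\<^bsub>G\<^esub> g)"

definition group_center :: "'g monoid \<Rightarrow> 'g set" where
  "group_center G = {z \<in> carrier G. \<forall>g\<in>carrier G. z \<otimes>\<^bsub>G\<^esub> g = g \<otimes>\<^bsub>G\<^esub> z}"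

text \<open>Left-invariant vector fields, as derivations of the algebra of smooth functions. The value
  on a non-smooth function is normalized to \<open>0\<close>.\<close>

definition left_inv_fields ::
  "'g monoid \<Rightarrow> ('g, 'l::euclidean_space) atlas \<Rightarrow> (('g \<Rightarrow> real) \<Rightarrow> 'g \<Rightarrow> real) set" where
  "left_inv_fields G A = {D.
     (\<forall>f. smooth_fun A f \<longrightarrow> smooth_fun A (D f)) \<and>
     (\<forall>f. \<not> smooth_fun A f \<longrightarrow> D f = (\<lambda>_. 0)) \<and>
     (\<forall>f h. smooth_fun A f \<longrightarrow> smooth_fun A h \<longrightarrow> D (\<lambda>g. f g + h g) = (\<lambda>g. D f g + D h g)) \<and>
     (\<forall>f c. smooth_fun A f \<longrightarrow> D (\<lambda>g. c * f g) = (\<lambda>g. c * D f g)) \<and>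
     (\<forall>f h. smooth_fun A f \<longrightarrow> smooth_fun A h \<longrightarrow>
        D (\<lambda>g. f g * h g) = (\<lambda>g. D f g * h g + f g * D h g)) \<and>
     (\<forall>f a. smooth_fun A f \<longrightarrow> D (\<lambda>g. f (a \<otimes>\<^bsub>G\<^esub> g)) = (\<lambda>g. D f (a \<otimes>\<^bsub>G\<^esub> g)))}"

definition field_of ::
  "'g monoid \<Rightarrow> ('g, 'l::euclidean_space) atlas \<Rightarrow> ('l \<Rightarrow> 'g) \<Rightarrow> 'l \<Rightarrow> ('g \<Rightarrow> real) \<Rightarrow> 'g \<Rightarrow> real" where
  "field_of G A ex X f =
     (if smooth_fun A f then (\<lambda>g. deriv (\<lambda>t. f (g \<otimes>\<^bsub>G\<^esub> ex (t *\<^sub>R X))) 0) else (\<lambda>_. 0))"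

definition real_lie_algebra :: "('l::real_vector \<Rightarrow> 'l \<Rightarrow> 'l) \<Rightarrow> bool" where
  "real_lie_algebra br \<longleftrightarrow> (\<forall>X. linear (br X)) \<and> (\<forall>Y. linear (\<lambda>X. br X Y)) \<and> (\<forall>X. br X X = 0) \<and>
     (\<forall>X Y Z. br X (br Y Z) + br Y (br Z X) + br Z (br X Y) = 0)"

text \<open>The type \<open>'l\<close> with bracket \<open>br\<close> is the Lie algebra of \<open>G\<close>, with exponential map \<open>ex\<close>:
  \<open>t \<mapsto> ex (t X)\<close> is a smooth one-parameter subgroup, and sending \<open>X\<close> to the left-invariant
  vector field \<open>f \<mapsto> (g \<mapsto> d/dt f(g ex(t X)) at t = 0)\<close> is an isomorphism of Lie algebras.\<close>

definition lie_algebra_of ::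
  "'g monoid \<Rightarrow> ('g, 'l::euclidean_space) atlas \<Rightarrow> ('l \<Rightarrow> 'l \<Rightarrow> 'l) \<Rightarrow> ('l \<Rightarrow> 'g) \<Rightarrow> bool" where
  "lie_algebra_of G A br ex \<longleftrightarrow> real_lie_algebra br \<and>
     (\<forall>X s t. ex ((s + t) *\<^sub>R X) = ex (s *\<^sub>R X) \<otimes>\<^bsub>G\<^esub> ex (t *\<^sub>R X)) \<and>
     (\<forall>X f. smooth_fun A f \<longrightarrow> smooth_on (\<lambda>t. f (ex (t *\<^sub>R X))) UNIV) \<and>
     bij_betw (field_of G A ex) UNIV (left_inv_fields G A) \<and>
     (\<forall>f. smooth_fun A f \<longrightarrow>
        (\<forall>X Y. field_of G A ex (X + Y) f = (\<lambda>g. field_of G A ex X f g + field_of G A ex Y f g)) \<and>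
        (\<forall>c X. field_of G A ex (c *\<^sub>R X) f = (\<lambda>g. c * field_of G A ex X f g)) \<and>
        (\<forall>X Y. field_of G A ex (br X Y) f =
           (\<lambda>g. field_of G A ex X (field_of G A ex Y f) g - field_of G A ex Y (field_of G A ex X f) g)))"

text \<open>\<open>L\<close> is the differential of the smooth homomorphism \<open>\<Phi>\<close>: the left-invariant fields of
  \<open>X\<close> and \<open>L X\<close> are \<open>\<Phi>\<close>-related.\<close>

definition is_differential ::
  "'g monoid \<Rightarrow> ('g, 'l::euclidean_space) atlas \<Rightarrow> ('l \<Rightarrow> 'g) \<Rightarrow> ('g \<Rightarrow> 'g) \<Rightarrow> ('l \<Rightarrow> 'l) \<Rightarrow> bool" where
  "is_differential G A ex \<Phi> L \<longleftrightarrow> (\<forall>X f g. smooth_fun A f \<longrightarrow>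
     field_of G A ex X (\<lambda>h. f (\<Phi> h)) g = field_of G A ex (L X) f (\<Phi> g))"

definition Ad ::
  "'g monoid \<Rightarrow> ('g, 'l::euclidean_space) atlas \<Rightarrow> ('l \<Rightarrow> 'g) \<Rightarrow> 'g \<Rightarrow> 'l \<Rightarrow> 'l" where
  "Ad G A ex k = (THE L. is_differential G A ex (\<lambda>g. k \<otimes>\<^bsub>G\<^esub> g \<otimes>\<^bsub>G\<^esub> inv\<^bsub>G\<^esub> k) L)"

definition lie_ideal :: "('l::real_vector \<Rightarrow> 'l \<Rightarrow> 'l) \<Rightarrow> 'l set \<Rightarrow> bool" where
  "lie_ideal br I \<longleftrightarrow> subspace I \<and> (\<forall>X. \<forall>Y\<in>I. br X Y \<in> I)"

definition lie_solvable :: "('l::real_vector \<Rightarrow> 'l \<Rightarrow> 'l) \<Rightarrow> 'l set \<Rightarrow> bool" where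
  "lie_solvable br I \<longleftrightarrow> (\<exists>n. ((\<lambda>J. span {br X Y | X Y. X \<in> J \<and> Y \<in> J}) ^^ n) I = {0})"

definition semisimple :: "('l::real_vector \<Rightarrow> 'l \<Rightarrow> 'l) \<Rightarrow> bool" where
  "semisimple br \<longleftrightarrow> (\<forall>I. lie_ideal br I \<and> lie_solvable br I \<longrightarrow> I = {0})"

definition killing_real :: "('l::euclidean_space \<Rightarrow> 'l \<Rightarrow> 'l) \<Rightarrow> 'l \<Rightarrow> 'l \<Rightarrow> real" where
  "killing_real br X Y = (\<Sum>b\<in>Basis. br X (br Y b) \<bullet> b)"

text \<open>The form \<open>(X, Y) \<mapsto> - B(X, \<theta> Y)\<close> is positive definite.\<close>

definition cartan_involution :: "('l::euclidean_space \<Rightarrow> 'l \<Rightarrow> 'l) \<Rightarrow> ('l \<Rightarrow> 'l) \<Rightarrow> bool" where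
  "cartan_involution br \<theta> \<longleftrightarrow> linear \<theta> \<and> (\<forall>X. \<theta> (\<theta> X) = X) \<and>
     (\<forall>X Y. \<theta> (br X Y) = br (\<theta> X) (\<theta> Y)) \<and> (\<forall>X. X \<noteq> 0 \<longrightarrow> - killing_real br X (\<theta> X) > 0)"

definition global_cartan_involution ::
  "'g::topological_space monoid \<Rightarrow> ('g, 'l::euclidean_space) atlas \<Rightarrow> ('l \<Rightarrow> 'g) \<Rightarrow> ('g \<Rightarrow> 'g) \<Rightarrow> ('l \<Rightarrow> 'l) \<Rightarrow> bool"
  where
  "global_cartan_involution G A ex \<Theta> \<theta> \<longleftrightarrow> \<Theta> \<in> hom G G \<and> smooth_map A \<Theta> \<and>
     (\<forall>g. \<Theta> (\<Theta> g) = g) \<and> is_differential G A ex \<Theta> \<theta>"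

definition fixed_group :: "('g \<Rightarrow> 'g) \<Rightarrow> 'g set" where
  "fixed_group \<Theta> = {g. \<Theta> g = g}"

section \<open>The complexified Lie algebra\<close>

text \<open>The pair \<open>(X, Y)\<close> stands for \<open>X + i Y\<close>.\<close>

definition cscale :: "complex \<Rightarrow> 'l::real_vector \<times> 'l \<Rightarrow> 'l \<times> 'l" where
  "cscale c x = (Re c *\<^sub>R fst x - Im c *\<^sub>R snd x, Re c *\<^sub>R snd x + Im c *\<^sub>R fst x)"

definition cbr :: "('l::real_vector \<Rightarrow> 'l \<Rightarrow> 'l) \<Rightarrow> 'l \<times> 'l \<Rightarrow> 'l \<times> 'l \<Rightarrow> 'l \<times> 'l" where
  "cbr br x y = (br (fst x) (fst y) - br (snd x) (snd y), br (fst x) (snd y) + br (snd x) (fst y))"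

definition cmap :: "('l \<Rightarrow> 'l) \<Rightarrow> 'l \<times> 'l \<Rightarrow> 'l \<times> 'l" where
  "cmap L x = (L (fst x), L (snd x))"

abbreviation csubspace :: "('l::real_vector \<times> 'l) set \<Rightarrow> bool" where
  "csubspace \<equiv> Modules.module.subspace cscale"

abbreviation cdim :: "('l::real_vector \<times> 'l) set \<Rightarrow> nat" where
  "cdim \<equiv> Vector_Spaces.vector_space.dim cscale"

text \<open>Complex trace, computed in the complex basis \<open>(b, 0)\<close>, \<open>b \<in> Basis\<close>.\<close>

definition ctrace :: "('l::euclidean_space \<times> 'l \<Rightarrow> 'l \<times> 'l) \<Rightarrow> complex" where
  "ctrace f = (\<Sum>b\<in>Basis. Complex (fst (f (b, 0)) \<bullet> b) (snd (f (b, 0)) \<bullet> b))"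

definition killing :: "('l::euclidean_space \<Rightarrow> 'l \<Rightarrow> 'l) \<Rightarrow> 'l \<times> 'l \<Rightarrow> 'l \<times> 'l \<Rightarrow> complex" where
  "killing br x y = ctrace (\<lambda>z. cbr br x (cbr br y z))"

definition k_part :: "('l::real_vector \<Rightarrow> 'l) \<Rightarrow> ('l \<times> 'l) set" where
  "k_part \<theta> = {x. cmap \<theta> x = x}"

definition p_part :: "('l::real_vector \<Rightarrow> 'l) \<Rightarrow> ('l \<times> 'l) set" where
  "p_part \<theta> = {x. cmap \<theta> x = - x}"

definition orth :: "('l::euclidean_space \<Rightarrow> 'l \<Rightarrow> 'l) \<Rightarrow> ('l \<times> 'l) set \<Rightarrow> ('l \<times> 'l) set \<Rightarrow> ('l \<times> 'l) set" where
  "orth br \<aa> \<bb> = {x \<in> \<aa>. \<forall>y\<in>\<bb>. killing br x y = 0}"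

definition nondegenerate_on :: "('l::euclidean_space \<Rightarrow> 'l \<Rightarrow> 'l) \<Rightarrow> ('l \<times> 'l) set \<Rightarrow> bool" where
  "nondegenerate_on br \<bb> \<longleftrightarrow> (\<forall>x\<in>\<bb>. (\<forall>y\<in>\<bb>. killing br x y = 0) \<longrightarrow> x = 0)"

definition subalgebra :: "('l::real_vector \<Rightarrow> 'l \<Rightarrow> 'l) \<Rightarrow> ('l \<times> 'l) set \<Rightarrow> bool" where
  "subalgebra br \<bb> \<longleftrightarrow> csubspace \<bb> \<and> (\<forall>x\<in>\<bb>. \<forall>y\<in>\<bb>. cbr br x y \<in> \<bb>)"

definition ideal_in :: "('l::real_vector \<Rightarrow> 'l \<Rightarrow> 'l) \<Rightarrow> ('l \<times> 'l) set \<Rightarrow> ('l \<times> 'l) set \<Rightarrow> bool" where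
  "ideal_in br \<bb> I \<longleftrightarrow> I \<subseteq> \<bb> \<and> csubspace I \<and> (\<forall>x\<in>\<bb>. \<forall>y\<in>I. cbr br x y \<in> I)"

text \<open>Every ideal has a complementary ideal.\<close>

definition reductive :: "('l::real_vector \<Rightarrow> 'l \<Rightarrow> 'l) \<Rightarrow> ('l \<times> 'l) set \<Rightarrow> bool" where
  "reductive br \<bb> \<longleftrightarrow> (\<forall>I. ideal_in br \<bb> I \<longrightarrow>
     (\<exists>J. ideal_in br \<bb> J \<and> I \<inter> J = {0} \<and> \<bb> = {x + y | x y. x \<in> I \<and> y \<in> J}))"

definition orthonormal_basis ::
  "('l::euclidean_space \<Rightarrow> 'l \<Rightarrow> 'l) \<Rightarrow> ('l \<times> 'l) set \<Rightarrow> ('l \<times> 'l) list \<Rightarrow> bool" where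
  "orthonormal_basis br W ws \<longleftrightarrow> Modules.module.span cscale (set ws) = W \<and>
     (\<forall>i<length ws. \<forall>j<length ws. killing br (ws ! i) (ws ! j) = (if i = j then 1 else 0))"

section \<open>Complex vector spaces, quotients and tensor products\<close>

definition cring_complex :: "complex ring" where
  "cring_complex = \<lparr>carrier = UNIV, mult = (*), one = 1, zero = 0, add = (+)\<rparr>"

abbreviation cvspace :: "(complex, 'a) module \<Rightarrow> bool" where
  "cvspace M \<equiv> Module.module cring_complex M"

abbreviation csub :: "'a set \<Rightarrow> (complex, 'a) module \<Rightarrow> bool" where
  "csub N M \<equiv> submodule N cring_complex M"

definition lin_map :: "(complex, 'a) module \<Rightarrow> (complex, 'b) module \<Rightarrow> ('a \<Rightarrow> 'b) \<Rightarrow> bool" where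
  "lin_map M N f \<longleftrightarrow> f \<in> carrier M \<rightarrow> carrier N \<and>
     (\<forall>x\<in>carrier M. \<forall>y\<in>carrier M. f (x \<oplus>\<^bsub>M\<^esub> y) = f x \<oplus>\<^bsub>N\<^esub> f y) \<and>
     (\<forall>c. \<forall>x\<in>carrier M. f (c \<odot>\<^bsub>M\<^esub> x) = c \<odot>\<^bsub>N\<^esub> f x)"

definition lin_functional :: "(complex, 'a) module \<Rightarrow> ('a \<Rightarrow> complex) \<Rightarrow> bool" where
  "lin_functional M f \<longleftrightarrow>
     (\<forall>x\<in>carrier M. \<forall>y\<in>carrier M. f (x \<oplus>\<^bsub>M\<^esub> y) = f x + f y) \<and>
     (\<forall>c. \<forall>x\<in>carrier M. f (c \<odot>\<^bsub>M\<^esub> x) = c * f x)"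

text \<open>The multiplicative fields of the module record carry no meaning for vector spaces.\<close>

definition quot_space :: "(complex, 'a) module \<Rightarrow> 'a set \<Rightarrow> (complex, 'a set) module" where
  "quot_space M N = \<lparr>carrier = a_rcosets\<^bsub>M\<^esub> N, mult = undefined, one = undefined,
     zero = N, add = set_add M, smult = (\<lambda>c C. \<Union>x\<in>C. N +>\<^bsub>M\<^esub> (c \<odot>\<^bsub>M\<^esub> x))\<rparr>"

definition pm_scale :: "complex \<Rightarrow> ('x \<Rightarrow>\<^sub>0 complex) \<Rightarrow> ('x \<Rightarrow>\<^sub>0 complex)" where
  "pm_scale c p = Poly_Mapping.map ((*) c) p"

definition free_space :: "'x set \<Rightarrow> (complex, 'x \<Rightarrow>\<^sub>0 complex) module" where
  "free_space X = \<lparr>carrier = {p. Poly_Mapping.keys p \<subseteq> X}, mult = undefined, one = undefined,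
     zero = 0, add = (+), smult = pm_scale\<rparr>"

abbreviation basis_elt :: "'x \<Rightarrow> 'x \<Rightarrow>\<^sub>0 complex" where
  "basis_elt x \<equiv> Poly_Mapping.single x 1"

definition bilinear_relations ::
  "(complex, 'a) module \<Rightarrow> (complex, 'b) module \<Rightarrow> ('a \<times> 'b \<Rightarrow>\<^sub>0 complex) set" where
  "bilinear_relations M N = Modules.module.span pm_scale
     ({basis_elt (x \<oplus>\<^bsub>M\<^esub> x', y) - basis_elt (x, y) - basis_elt (x', y) | x x' y.
         x \<in> carrier M \<and> x' \<in> carrier M \<and> y \<in> carrier N} \<union>
      {basis_elt (x, y \<oplus>\<^bsub>N\<^esub> y') - basis_elt (x, y) - basis_elt (x, y') | x y y'.
         x \<in> carrier M \<and> y \<in> carrier N \<and> y' \<in> carrier N} \<union>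
      {basis_elt (c \<odot>\<^bsub>M\<^esub> x, y) - pm_scale c (basis_elt (x, y)) | c x y.
         x \<in> carrier M \<and> y \<in> carrier N} \<union>
      {basis_elt (x, c \<odot>\<^bsub>N\<^esub> y) - pm_scale c (basis_elt (x, y)) | c x y.
         x \<in> carrier M \<and> y \<in> carrier N})"

definition tensor ::
  "(complex, 'a) module \<Rightarrow> (complex, 'b) module \<Rightarrow> (complex, ('a \<times> 'b \<Rightarrow>\<^sub>0 complex) set) module" where
  "tensor M N = quot_space (free_space (carrier M \<times> carrier N)) (bilinear_relations M N)"

definition tens ::
  "(complex, 'a) module \<Rightarrow> (complex, 'b) module \<Rightarrow> 'a \<Rightarrow> 'b \<Rightarrow> ('a \<times> 'b \<Rightarrow>\<^sub>0 complex) set" where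
  "tens M N x y =
     bilinear_relations M N +>\<^bsub>free_space (carrier M \<times> carrier N)\<^esub> basis_elt (x, y)"

text \<open>The linear map \<open>f \<otimes> h : M \<otimes> N \<rightarrow> M' \<otimes> N'\<close>; the summand for each representative
  \<open>p\<close> of \<open>t\<close> is the same coset.\<close>

definition tensor_map ::
  "(complex, 'a) module \<Rightarrow> (complex, 'b) module \<Rightarrow> (complex, 'c) module \<Rightarrow> (complex, 'd) module \<Rightarrow>
   ('a \<Rightarrow> 'c) \<Rightarrow> ('b \<Rightarrow> 'd) \<Rightarrow> ('a \<times> 'b \<Rightarrow>\<^sub>0 complex) set \<Rightarrow> ('c \<times> 'd \<Rightarrow>\<^sub>0 complex) set" where
  "tensor_map M N M' N' f h t =
     (\<Union>p\<in>t. bilinear_relations M' N' +>\<^bsub>free_space (carrier M' \<times> carrier N')\<^esub>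
        (\<Sum>(x, y)\<in>Poly_Mapping.keys p. pm_scale (Poly_Mapping.lookup p (x, y)) (basis_elt (f x, h y))))"

text \<open>For \<open>x \<in> M \<otimes> N\<close> and \<open>y \<in> N'\<close>, the element \<open>x \<otimes> y\<close> read in \<open>M \<otimes> (N \<otimes> N')\<close>.\<close>

definition tens_assoc where
  "tens_assoc M N N' x y = tensor_map M N M (tensor N N') id (\<lambda>s. tens N N' s y) x"

section \<open>Enveloping and Clifford algebras\<close>

text \<open>Words form the free monoid, so \<open>'x word \<Rightarrow>\<^sub>0 complex\<close> is the free associative algebra.\<close>

datatype 'x word = Word (letters: "'x list")

instantiation word :: (type) monoid_add
begin
definition "0 = Word []"
definition "u + v = Word (letters u @ letters v)"
instance by standard (auto simp: zero_word_def plus_word_def)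
end

definition words :: "'x set \<Rightarrow> 'x word set" where
  "words X = {w. set (letters w) \<subseteq> X}"

abbreviation gen :: "'x \<Rightarrow> 'x word \<Rightarrow>\<^sub>0 complex" where
  "gen x \<equiv> basis_elt (Word [x])"

definition two_sided_ideal :: "'x set \<Rightarrow> ('x word \<Rightarrow>\<^sub>0 complex) set \<Rightarrow> ('x word \<Rightarrow>\<^sub>0 complex) set" where
  "two_sided_ideal X R = Modules.module.span pm_scale
     {p * r * q | p r q. r \<in> R \<and> p \<in> carrier (free_space (words X)) \<and> q \<in> carrier (free_space (words X))}"

text \<open>The algebra with generators \<open>X\<close> and relations \<open>R\<close>, and in it the product of a list of
  generators. Only the vector space structure is recorded.\<close>

definition presented_algebra ::
  "'x set \<Rightarrow> ('x word \<Rightarrow>\<^sub>0 complex) set \<Rightarrow> (complex, ('x word \<Rightarrow>\<^sub>0 complex) set) module" where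
  "presented_algebra X R = quot_space (free_space (words X)) (two_sided_ideal X R)"

definition gen_prod ::
  "'x set \<Rightarrow> ('x word \<Rightarrow>\<^sub>0 complex) set \<Rightarrow> 'x list \<Rightarrow> ('x word \<Rightarrow>\<^sub>0 complex) set" where
  "gen_prod X R w = two_sided_ideal X R +>\<^bsub>free_space (words X)\<^esub> basis_elt (Word w)"

text \<open>Action of the presented algebra on a vector space \<open>M\<close> on which the generators act by \<open>\<rho>\<close>
  compatibly with the relations; it does not depend on the chosen representative.\<close>

definition alg_act ::
  "(complex, 'm) module \<Rightarrow> ('x \<Rightarrow> 'm \<Rightarrow> 'm) \<Rightarrow> ('x word \<Rightarrow>\<^sub>0 complex) set \<Rightarrow> 'm \<Rightarrow> 'm" where
  "alg_act M \<rho> u m = (let p = (SOME p. p \<in> u) in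
     finsum M (\<lambda>w. Poly_Mapping.lookup p w \<odot>\<^bsub>M\<^esub> foldr \<rho> (letters w) m) (Poly_Mapping.keys p))"

definition linearity_relations :: "('l::real_vector \<times> 'l) set \<Rightarrow> (('l \<times> 'l) word \<Rightarrow>\<^sub>0 complex) set" where
  "linearity_relations X =
     {gen (x + y) - gen x - gen y | x y. x \<in> X \<and> y \<in> X} \<union>
     {gen (cscale c x) - pm_scale c (gen x) | c x. x \<in> X}"

definition U_relations ::
  "('l::real_vector \<Rightarrow> 'l \<Rightarrow> 'l) \<Rightarrow> ('l \<times> 'l) set \<Rightarrow> (('l \<times> 'l) word \<Rightarrow>\<^sub>0 complex) set" where
  "U_relations br \<aa> = linearity_relations \<aa> \<union>
     {gen x * gen y - gen y * gen x - gen (cbr br x y) | x y. x \<in> \<aa> \<and> y \<in> \<aa>}"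

definition Cl_relations ::
  "('l::euclidean_space \<Rightarrow> 'l \<Rightarrow> 'l) \<Rightarrow> ('l \<times> 'l) set \<Rightarrow> (('l \<times> 'l) word \<Rightarrow>\<^sub>0 complex) set" where
  "Cl_relations br W = linearity_relations W \<union>
     {gen x * gen y + gen y * gen x - pm_scale (2 * killing br x y) 1 | x y. x \<in> W \<and> y \<in> W}"

abbreviation "U_alg br \<aa> \<equiv> presented_algebra \<aa> (U_relations br \<aa>)"
abbreviation "U_prod br \<aa> \<equiv> gen_prod \<aa> (U_relations br \<aa>)"
abbreviation "Cl_alg br W \<equiv> presented_algebra W (Cl_relations br W)"
abbreviation "Cl_prod br W \<equiv> gen_prod W (Cl_relations br W)"

definition generators_act ::
  "('l::real_vector \<times> 'l) set \<Rightarrow> (complex, 'm) module \<Rightarrow> ('l \<times> 'l \<Rightarrow> 'm \<Rightarrow> 'm) \<Rightarrow> bool" where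
  "generators_act X M \<rho> \<longleftrightarrow> cvspace M \<and> (\<forall>x\<in>X. lin_map M M (\<rho> x)) \<and>
     (\<forall>x\<in>X. \<forall>y\<in>X. \<forall>m\<in>carrier M. \<rho> (x + y) m = \<rho> x m \<oplus>\<^bsub>M\<^esub> \<rho> y m) \<and>
     (\<forall>c. \<forall>x\<in>X. \<forall>m\<in>carrier M. \<rho> (cscale c x) m = c \<odot>\<^bsub>M\<^esub> \<rho> x m)"

definition lie_module ::
  "('l::real_vector \<Rightarrow> 'l \<Rightarrow> 'l) \<Rightarrow> ('l \<times> 'l) set \<Rightarrow> (complex, 'm) module \<Rightarrow> ('l \<times> 'l \<Rightarrow> 'm \<Rightarrow> 'm) \<Rightarrow> bool" where
  "lie_module br \<aa> M \<rho> \<longleftrightarrow> generators_act \<aa> M \<rho> \<and>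
     (\<forall>x\<in>\<aa>. \<forall>y\<in>\<aa>. \<forall>m\<in>carrier M. \<rho> (cbr br x y) m = \<rho> x (\<rho> y m) \<ominus>\<^bsub>M\<^esub> \<rho> y (\<rho> x m))"

definition clifford_module ::
  "('l::euclidean_space \<Rightarrow> 'l \<Rightarrow> 'l) \<Rightarrow> ('l \<times> 'l) set \<Rightarrow> (complex, 's) module \<Rightarrow> ('l \<times> 'l \<Rightarrow> 's \<Rightarrow> 's) \<Rightarrow> bool" where
  "clifford_module br W S \<gamma> \<longleftrightarrow> generators_act W S \<gamma> \<and>
     (\<forall>x\<in>W. \<forall>y\<in>W. \<forall>m\<in>carrier S. \<gamma> x (\<gamma> y m) \<oplus>\<^bsub>S\<^esub> \<gamma> y (\<gamma> x m) = (2 * killing br x y) \<odot>\<^bsub>S\<^esub> m)"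

definition spin_module ::
  "('l::euclidean_space \<Rightarrow> 'l \<Rightarrow> 'l) \<Rightarrow> ('l \<times> 'l) set \<Rightarrow> (complex, 's) module \<Rightarrow> ('l \<times> 'l \<Rightarrow> 's \<Rightarrow> 's) \<Rightarrow> bool" where
  "spin_module br W S \<gamma> \<longleftrightarrow> clifford_module br W S \<gamma> \<and> carrier S \<noteq> {\<zero>\<^bsub>S\<^esub>} \<and>
     (\<forall>N. csub N S \<and> (\<forall>c\<in>carrier (Cl_alg br W). \<forall>n\<in>N. alg_act S \<gamma> c n \<in> N) \<longrightarrow>
        N = {\<zero>\<^bsub>S\<^esub>} \<or> N = carrier S)"

text \<open>\<open>\<epsilon>\<close> is the parity operator \<open>s \<mapsto> (-1)^|s| s\<close> of a grading of the Clifford module \<open>S\<close>.\<close>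

definition parity_operator ::
  "('l \<times> 'l) set \<Rightarrow> (complex, 's) module \<Rightarrow> ('l \<times> 'l \<Rightarrow> 's \<Rightarrow> 's) \<Rightarrow> ('s \<Rightarrow> 's) \<Rightarrow> bool" where
  "parity_operator W S \<gamma> \<epsilon> \<longleftrightarrow> lin_map S S \<epsilon> \<and> (\<forall>s\<in>carrier S. \<epsilon> (\<epsilon> s) = s) \<and>
     (\<forall>x\<in>W. \<forall>s\<in>carrier S. \<epsilon> (\<gamma> x s) = \<ominus>\<^bsub>S\<^esub> \<gamma> x (\<epsilon> s))"

section \<open>Cubic Dirac operators and Dirac cohomology\<close>

text \<open>Throughout, \<open>ws\<close> is an orthonormal basis of the orthogonal complement of \<open>\<bb>\<close> in \<open>\<aa>\<close>.\<close>

abbreviation "UC br \<aa> \<bb> \<equiv> tensor (U_alg br \<aa>) (Cl_alg br (orth br \<aa> \<bb>))"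

abbreviation "uc br \<aa> \<bb> u c \<equiv> tens (U_alg br \<aa>) (Cl_alg br (orth br \<aa> \<bb>))
  (U_prod br \<aa> u) (Cl_prod br (orth br \<aa> \<bb>) c)"

definition dirac :: "('l::euclidean_space \<Rightarrow> 'l \<Rightarrow> 'l) \<Rightarrow> ('l \<times> 'l) set \<Rightarrow> ('l \<times> 'l) set \<Rightarrow> ('l \<times> 'l) list \<Rightarrow>
    ((('l \<times> 'l) word \<Rightarrow>\<^sub>0 complex) set \<times> (('l \<times> 'l) word \<Rightarrow>\<^sub>0 complex) set \<Rightarrow>\<^sub>0 complex) set" where
  "dirac br \<aa> \<bb> ws =
     finsum (UC br \<aa> \<bb>) (\<lambda>k. uc br \<aa> \<bb> [ws ! k] [ws ! k]) {..<length ws} \<ominus>\<^bsub>UC br \<aa> \<bb>\<^esub>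
     (1/2) \<odot>\<^bsub>UC br \<aa> \<bb>\<^esub> finsum (UC br \<aa> \<bb>)
        (\<lambda>(i, j, k). killing br (cbr br (ws ! i) (ws ! j)) (ws ! k)
            \<odot>\<^bsub>UC br \<aa> \<bb>\<^esub> uc br \<aa> \<bb> [] [ws ! i, ws ! j, ws ! k])
        {(i, j, k). i < j \<and> j < k \<and> k < length ws}"

text \<open>Action on \<open>M \<otimes> S\<close> of an element of the tensor product of two algebras acting on \<open>M\<close> and
  \<open>S\<close>, with \<open>(u \<otimes> c)(m \<otimes> s) = u m \<otimes> c s\<close>.\<close>

definition tensor_act ::
  "(complex, 'm) module \<Rightarrow> ('x \<Rightarrow> 'm \<Rightarrow> 'm) \<Rightarrow> (complex, 's) module \<Rightarrow> ('y \<Rightarrow> 's \<Rightarrow> 's) \<Rightarrow>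
   (('x word \<Rightarrow>\<^sub>0 complex) set \<times> ('y word \<Rightarrow>\<^sub>0 complex) set \<Rightarrow>\<^sub>0 complex) set \<Rightarrow>
   ('m \<times> 's \<Rightarrow>\<^sub>0 complex) set \<Rightarrow> ('m \<times> 's \<Rightarrow>\<^sub>0 complex) set" where
  "tensor_act M \<rho> S \<gamma> t z = (let p = (SOME p. p \<in> t) in
     finsum (tensor M S)
       (\<lambda>(u, c). Poly_Mapping.lookup p (u, c) \<odot>\<^bsub>tensor M S\<^esub>
          tensor_map M S M S (alg_act M \<rho> u) (alg_act S \<gamma> c) z)
       (Poly_Mapping.keys p))"

definition dirac_ker where
  "dirac_ker br \<aa> \<bb> ws M \<rho> S \<gamma> =
     {z \<in> carrier (tensor M S). tensor_act M \<rho> S \<gamma> (dirac br \<aa> \<bb> ws) z = \<zero>\<^bsub>tensor M S\<^esub>}"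

definition dirac_im where
  "dirac_im br \<aa> \<bb> ws M \<rho> S \<gamma> =
     tensor_act M \<rho> S \<gamma> (dirac br \<aa> \<bb> ws) ` carrier (tensor M S)"

definition dirac_cohomology where
  "dirac_cohomology br \<aa> \<bb> ws M \<rho> S \<gamma> =
     quot_space ((tensor M S)\<lparr>carrier := dirac_ker br \<aa> \<bb> ws M \<rho> S \<gamma>\<rparr>)
       (dirac_im br \<aa> \<bb> ws M \<rho> S \<gamma> \<inter> dirac_ker br \<aa> \<bb> ws M \<rho> S \<gamma>)"

definition dirac_class where
  "dirac_class br \<aa> \<bb> ws M \<rho> S \<gamma> z =
     (dirac_im br \<aa> \<bb> ws M \<rho> S \<gamma> \<inter> dirac_ker br \<aa> \<bb> ws M \<rho> S \<gamma>) +>\<^bsub>tensor M S\<^esub> z"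

text \<open>A skew-symmetric matrix in the orthonormal basis \<open>ws\<close> of \<open>W\<close> is
  \<open>\<Sum>i<j. A i j (E_ij - E_ji)\<close>; the inclusion into the Clifford algebra sends
  \<open>E_ij - E_ji\<close> to half of \<open>ws ! i * ws ! j\<close>.\<close>

definition so_inclusion where
  "so_inclusion br W ws A = finsum (Cl_alg br W)
     (\<lambda>(i, j). (A i j * (1/2)) \<odot>\<^bsub>Cl_alg br W\<^esub> Cl_prod br W [ws ! i, ws ! j])
     {(i, j). i < j \<and> j < length ws}"

definition ad_matrix :: "('l::euclidean_space \<Rightarrow> 'l \<Rightarrow> 'l) \<Rightarrow> ('l \<times> 'l) list \<Rightarrow> 'l \<times> 'l \<Rightarrow> nat \<Rightarrow> nat \<Rightarrow> complex" where
  "ad_matrix br ws x i j = killing br (cbr br x (ws ! j)) (ws ! i)"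

text \<open>The element \<open>X \<otimes> 1 + 1 \<otimes> \<alpha>(X)\<close>, and the action of \<open>\<bb>\<close> on Dirac cohomology that it induces.\<close>

definition diagonal where
  "diagonal br \<aa> \<bb> ws x = uc br \<aa> \<bb> [x] [] \<oplus>\<^bsub>UC br \<aa> \<bb>\<^esub>
     tens (U_alg br \<aa>) (Cl_alg br (orth br \<aa> \<bb>)) (U_prod br \<aa> [])
       (so_inclusion br (orth br \<aa> \<bb>) ws (ad_matrix br ws x))"

definition cohomology_action where
  "cohomology_action br \<aa> \<bb> ws M \<rho> S \<gamma> x C =
     (\<Union>z\<in>C. dirac_class br \<aa> \<bb> ws M \<rho> S \<gamma> (tensor_act M \<rho> S \<gamma> (diagonal br \<aa> \<bb> ws x) z))"

section \<open>Spin modules of orthogonal sums\<close>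

text \<open>The action of \<open>C(\<ss>) = C(\<pp>) \<otimes> C(\<ss> \<inter> \<kk>)\<close> (graded tensor product) on
  \<open>Sp \<otimes> Sk\<close>, given on \<open>x = x_p + x_k\<close> in \<open>\<ss>\<close>. If \<open>Sp\<close> is graded, with parity operator \<open>\<epsilon>\<close>,
  then \<open>(a \<otimes> b)(s \<otimes> t) = (-1)^(|b| |s|) a s \<otimes> b t\<close>; if \<open>Sk\<close> is graded, then
  \<open>(a \<otimes> b)(s \<otimes> t) = (-1)^(|a| |b t|) a s \<otimes> b t\<close>.\<close>

definition graded_left ::
  "('l::real_vector \<Rightarrow> 'l) \<Rightarrow> (complex, 's) module \<Rightarrow> ('l \<times> 'l \<Rightarrow> 's \<Rightarrow> 's) \<Rightarrow> ('s \<Rightarrow> 's) \<Rightarrow>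
   (complex, 't) module \<Rightarrow> ('l \<times> 'l \<Rightarrow> 't \<Rightarrow> 't) \<Rightarrow>
   'l \<times> 'l \<Rightarrow> ('s \<times> 't \<Rightarrow>\<^sub>0 complex) set \<Rightarrow> ('s \<times> 't \<Rightarrow>\<^sub>0 complex) set" where
  "graded_left \<theta> Sp \<gamma>p \<epsilon> Sk \<gamma>k x z =
     tensor_map Sp Sk Sp Sk (\<gamma>p ((1/2) *\<^sub>R (x - cmap \<theta> x))) id z \<oplus>\<^bsub>tensor Sp Sk\<^esub>
     tensor_map Sp Sk Sp Sk \<epsilon> (\<gamma>k ((1/2) *\<^sub>R (x + cmap \<theta> x))) z"

definition graded_right ::
  "('l::real_vector \<Rightarrow> 'l) \<Rightarrow> (complex, 's) module \<Rightarrow> ('l \<times> 'l \<Rightarrow> 's \<Rightarrow> 's) \<Rightarrow>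
   (complex, 't) module \<Rightarrow> ('l \<times> 'l \<Rightarrow> 't \<Rightarrow> 't) \<Rightarrow> ('t \<Rightarrow> 't) \<Rightarrow>
   'l \<times> 'l \<Rightarrow> ('s \<times> 't \<Rightarrow>\<^sub>0 complex) set \<Rightarrow> ('s \<times> 't \<Rightarrow>\<^sub>0 complex) set" where
  "graded_right \<theta> Sp \<gamma>p Sk \<gamma>k \<epsilon> x z =
     tensor_map Sp Sk Sp Sk (\<gamma>p ((1/2) *\<^sub>R (x - cmap \<theta> x))) \<epsilon> z \<oplus>\<^bsub>tensor Sp Sk\<^esub>
     tensor_map Sp Sk Sp Sk id (\<gamma>k ((1/2) *\<^sub>R (x + cmap \<theta> x))) z"

text \<open>The spin module of an even-dimensional space has a parity operator, unique up to sign; the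
  spin modules of an odd-dimensional space have none. \<open>P\<close> and \<open>Q\<close> are the two summands.\<close>

definition graded_spin_action where
  "graded_spin_action \<theta> P Q Sp \<gamma>p Sk \<gamma>k \<gamma> \<longleftrightarrow>
     even (cdim P) \<and> (\<exists>\<epsilon>. parity_operator P Sp \<gamma>p \<epsilon> \<and> \<gamma> = graded_left \<theta> Sp \<gamma>p \<epsilon> Sk \<gamma>k) \<or>
     even (cdim Q) \<and> (\<exists>\<epsilon>. parity_operator Q Sk \<gamma>k \<epsilon> \<and> \<gamma> = graded_right \<theta> Sp \<gamma>p Sk \<gamma>k \<epsilon>)"

section \<open>Unitary modules\<close>

text \<open>The \<open>K\<close>-action is locally finite; on the finite-dimensional span of an orbit, continuity and
  derivatives are those of all matrix coefficients. The Lie algebra of the closed subgroup \<open>K\<close>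
  consists of the \<open>X\<close> with \<open>ex (t X) \<in> K\<close> for all \<open>t\<close>.\<close>

definition gK_module ::
  "'g::topological_space monoid \<Rightarrow> ('g, 'l::euclidean_space) atlas \<Rightarrow> ('l \<Rightarrow> 'l \<Rightarrow> 'l) \<Rightarrow> ('l \<Rightarrow> 'g) \<Rightarrow> 'g set \<Rightarrow>
   (complex, 'v) module \<Rightarrow> ('l \<times> 'l \<Rightarrow> 'v \<Rightarrow> 'v) \<Rightarrow> ('g \<Rightarrow> 'v \<Rightarrow> 'v) \<Rightarrow> bool" where
  "gK_module G A br ex K V \<pi> \<kappa> \<longleftrightarrow> lie_module br UNIV V \<pi> \<and>
     (\<forall>k\<in>K. lin_map V V (\<kappa> k)) \<and>
     (\<forall>v\<in>carrier V. \<kappa> \<one>\<^bsub>G\<^esub> v = v) \<and>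
     (\<forall>k\<in>K. \<forall>k'\<in>K. \<forall>v\<in>carrier V. \<kappa> (k \<otimes>\<^bsub>G\<^esub> k') v = \<kappa> k (\<kappa> k' v)) \<and>
     (\<forall>v\<in>carrier V. \<exists>F. finite F \<and> F \<subseteq> carrier V \<and>
        (\<forall>k\<in>K. \<exists>c. \<kappa> k v = finsum V (\<lambda>f. c f \<odot>\<^bsub>V\<^esub> f) F)) \<and>
     (\<forall>v\<in>carrier V. \<forall>l. lin_functional V l \<longrightarrow> continuous_on K (\<lambda>k. l (\<kappa> k v))) \<and>
     (\<forall>X v l. (\<forall>t. ex (t *\<^sub>R X) \<in> K) \<longrightarrow> v \<in> carrier V \<longrightarrow> lin_functional V l \<longrightarrow>
        ((\<lambda>t. l (\<kappa> (ex (t *\<^sub>R X)) v)) has_vector_derivative l (\<pi> (X, 0) v)) (at 0)) \<and>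
     (\<forall>k\<in>K. \<forall>x. \<forall>v\<in>carrier V. \<kappa> k (\<pi> x v) = \<pi> (cmap (Ad G A ex k) x) (\<kappa> k v))"

definition gK_irreducible ::
  "'g set \<Rightarrow> (complex, 'v) module \<Rightarrow> ('l \<times> 'l \<Rightarrow> 'v \<Rightarrow> 'v) \<Rightarrow> ('g \<Rightarrow> 'v \<Rightarrow> 'v) \<Rightarrow> bool" where
  "gK_irreducible K V \<pi> \<kappa> \<longleftrightarrow> carrier V \<noteq> {\<zero>\<^bsub>V\<^esub>} \<and>
     (\<forall>N. csub N V \<and> (\<forall>x. \<forall>n\<in>N. \<pi> x n \<in> N) \<and> (\<forall>k\<in>K. \<forall>n\<in>N. \<kappa> k n \<in> N) \<longrightarrow>
        N = {\<zero>\<^bsub>V\<^esub>} \<or> N = carrier V)"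

definition gK_unitary ::
  "'g set \<Rightarrow> (complex, 'v) module \<Rightarrow> ('l::real_vector \<times> 'l \<Rightarrow> 'v \<Rightarrow> 'v) \<Rightarrow> ('g \<Rightarrow> 'v \<Rightarrow> 'v) \<Rightarrow> bool" where
  "gK_unitary K V \<pi> \<kappa> \<longleftrightarrow> (\<exists>h.
     (\<forall>v\<in>carrier V. lin_functional V (\<lambda>u. h u v)) \<and>
     (\<forall>u\<in>carrier V. \<forall>v\<in>carrier V. h u v = cnj (h v u)) \<and>
     (\<forall>v\<in>carrier V. v \<noteq> \<zero>\<^bsub>V\<^esub> \<longrightarrow> Re (h v v) > 0) \<and>
     (\<forall>k\<in>K. \<forall>u\<in>carrier V. \<forall>v\<in>carrier V. h (\<kappa> k u) (\<kappa> k v) = h u v) \<and>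
     (\<forall>X. \<forall>u\<in>carrier V. \<forall>v\<in>carrier V. h (\<pi> (X, 0) u) v = - h u (\<pi> (X, 0) v)))"

end

theory Submission
  imports Defs "HOL-Computational_Algebra.Fundamental_Theorem_Algebra"
begin

text \<open>Unitarity makes \<open>D(\<gg>, \<kk>)\<close> skew-adjoint for a positive definite form on \<open>V \<otimes> S\<^sub>p\<close>. Its square
  is \<open>Cas\<^sub>g \<otimes> 1\<close> plus a term built from \<open>\<kk>\<close> and the Clifford algebra; \<open>Cas\<^sub>g\<close> is a scalar by Dixmier's form
  of Schur's lemma and \<open>\<kk>\<close> acts locally finitely, so \<open>D(\<gg>, \<kk>)\<^sup>2\<close> is locally finite and
  \<open>V \<otimes> S\<^sub>p = Ker \<oplus> Im\<close>. In particular \<open>H_D(\<gg>, \<kk>; V)\<close> is the kernel. Up to parity operators,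
  \<open>D(\<gg>, \<rr>) = D(\<gg>, \<kk>) + D'\<close> where \<open>D'\<close> is \<open>D(\<kk>, \<rr>)\<close> with \<open>\<kk>\<close> acting diagonally, and the two summands
  anticommute. Hence \<open>D(\<gg>, \<rr>)\<close> preserves \<open>Ker \<otimes> S\<^sub>k\<close>, on which it is \<open>D(\<kk>, \<rr>)\<close>, and \<open>Im \<otimes> S\<^sub>k\<close>, on which it is
  acyclic because the inverse of \<open>D(\<gg>, \<kk>)\<close> provides a contracting homotopy.\<close>

section \<open>Complex vector spaces\<close>

text \<open>Vectors live in carriers of module records and in cosets, where algebraic simplification
  has no hold. Every identity between vectors is therefore tested against all linear functionals
  (\<open>functional_eqI\<close>), which turns it into an equation between complex numbers.

  \<open>V\<close> is not complete, so a skew operator need not split the space into kernel and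
  image; local finiteness of its square takes the place of completeness. Nor does \<open>Sp\<close>
  come with an inner product: a form on the tensor product is built from that of \<open>V\<close>
  and averaged until a real orthonormal basis of \<pp> acts by unitary operators.

  The smooth structure of \<open>G\<close> enters at two points only: \<theta>-fixed vectors
  exponentiate into \<open>K\<close>, so that \<open>K\<close>-stable subspaces are \<kk>-stable,
  and \<open>Ad\<close> preserves the Killing form, so that the Casimir operator commutes with
  \<open>K\<close>. Both rest on derivations of smooth functions, since that is how the Lie algebra
  is given.

  The cubic term of \<open>D(g, r)\<close> is what makes the stages fit together: its mixed part is
  the spin action that completes \<kk> acting on \<open>V\<close> to the diagonal action.\<close>

lemma cring_complex_simps [simp]:
  "carrier cring_complex = UNIV" "x \<oplus>\<^bsub>cring_complex\<^esub> y = x + y"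
  "x \<otimes>\<^bsub>cring_complex\<^esub> y = x * y" "\<one>\<^bsub>cring_complex\<^esub> = 1" "\<zero>\<^bsub>cring_complex\<^esub> = 0"
  by (simp_all add: cring_complex_def)

lemma cring_cring_complex: "cring cring_complex"
proof (rule cringI)
  show "abelian_group cring_complex"
  proof (rule abelian_groupI)
    fix x :: complex
    show "\<exists>y\<in>carrier cring_complex. y \<oplus>\<^bsub>cring_complex\<^esub> x = \<zero>\<^bsub>cring_complex\<^esub>"
      by (rule bexI[of _ "- x"]) auto
  qed auto
  show "comm_monoid cring_complex"
    by (rule comm_monoidI) auto
qed (auto simp: algebra_simps)

lemma cring_complex_minus [simp]: "\<ominus>\<^bsub>cring_complex\<^esub> x = - x"
proof -
  interpret cring cring_complex by (rule cring_cring_complex)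
  show ?thesis by (rule add.inv_equality) auto
qed

text \<open>Additive inverses are not among the axioms to check: \<open>(- 1) \<odot> x\<close> is
  one, because scalar multiplication distributes over \<open>- 1 + 1\<close> and
  \<open>0 \<odot> x\<close> is the zero vector.\<close>

lemma cvspaceI:
  fixes M :: "(complex, 'a) module" (structure)
  assumes "\<And>x y. x \<in> carrier M \<Longrightarrow> y \<in> carrier M \<Longrightarrow> x \<oplus> y \<in> carrier M" and "\<zero> \<in> carrier M"
    and "\<And>x y z. x \<in> carrier M \<Longrightarrow> y \<in> carrier M \<Longrightarrow> z \<in> carrier M \<Longrightarrow> (x \<oplus> y) \<oplus> z = x \<oplus> (y \<oplus> z)"
    and "\<And>x y. x \<in> carrier M \<Longrightarrow> y \<in> carrier M \<Longrightarrow> x \<oplus> y = y \<oplus> x"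
    and "\<And>x. x \<in> carrier M \<Longrightarrow> \<zero> \<oplus> x = x"
    and "\<And>c x. x \<in> carrier M \<Longrightarrow> c \<odot> x \<in> carrier M"
    and "\<And>a b x. x \<in> carrier M \<Longrightarrow> (a + b) \<odot> x = a \<odot> x \<oplus> b \<odot> x"
    and "\<And>a x y. x \<in> carrier M \<Longrightarrow> y \<in> carrier M \<Longrightarrow> a \<odot> (x \<oplus> y) = a \<odot> x \<oplus> a \<odot> y"
    and "\<And>a b x. x \<in> carrier M \<Longrightarrow> (a * b) \<odot> x = a \<odot> (b \<odot> x)"
    and "\<And>x. x \<in> carrier M \<Longrightarrow> 1 \<odot> x = x"
    and "\<And>x. x \<in> carrier M \<Longrightarrow> 0 \<odot> x = \<zero>"
  shows "cvspace M"
proof (rule moduleI)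
  show "cring cring_complex" by (rule cring_cring_complex)
  show "abelian_group M"
  proof (rule abelian_groupI)
    fix x assume x: "x \<in> carrier M"
    have "(- 1) \<odot> x \<oplus> x = (- 1) \<odot> x \<oplus> 1 \<odot> x" using x assms by simp
    also have "\<dots> = (- 1 + 1) \<odot> x" using x assms(7)[of x "- 1" 1] by simp
    also have "\<dots> = \<zero>" using x assms by simp
    finally show "\<exists>y\<in>carrier M. y \<oplus> x = \<zero>" using x assms by blast
  qed (use assms in blast)+
qed (use assms in auto)

context
  fixes M :: "(complex, 'a) module" (structure)
  assumes M: "cvspace M"
begin

interpretation module cring_complex M by (rule M)

lemma cv_abelian_group: "abelian_group M"
  by (rule abelian_group_axioms)

lemma cv_add_closed [simp]: "x \<in> carrier M \<Longrightarrow> y \<in> carrier M \<Longrightarrow> x \<oplus> y \<in> carrier M"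
  and cv_zero_closed [simp]: "\<zero> \<in> carrier M"
  and cv_minus_closed [simp]: "x \<in> carrier M \<Longrightarrow> \<ominus> x \<in> carrier M"
  and cv_diff_closed [simp]: "x \<in> carrier M \<Longrightarrow> y \<in> carrier M \<Longrightarrow> x \<ominus> y \<in> carrier M"
  and cv_smult_closed [simp]: "x \<in> carrier M \<Longrightarrow> c \<odot> x \<in> carrier M"
  and cv_finsum_closed [simp]: "f \<in> I \<rightarrow> carrier M \<Longrightarrow> finsum M f I \<in> carrier M"
  and cv_l_zero [simp]: "x \<in> carrier M \<Longrightarrow> \<zero> \<oplus> x = x"
  and cv_r_zero [simp]: "x \<in> carrier M \<Longrightarrow> x \<oplus> \<zero> = x"
  and cv_add_assoc: "x \<in> carrier M \<Longrightarrow> y \<in> carrier M \<Longrightarrow> z \<in> carrier M \<Longrightarrow> (x \<oplus> y) \<oplus> z = x \<oplus> (y \<oplus> z)"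
  and cv_add_commute: "x \<in> carrier M \<Longrightarrow> y \<in> carrier M \<Longrightarrow> x \<oplus> y = y \<oplus> x"
  and cv_smult_add: "x \<in> carrier M \<Longrightarrow> (a + b) \<odot> x = a \<odot> x \<oplus> b \<odot> x"
  and cv_add_smult: "x \<in> carrier M \<Longrightarrow> y \<in> carrier M \<Longrightarrow> a \<odot> (x \<oplus> y) = a \<odot> x \<oplus> a \<odot> y"
  and cv_smult_smult: "x \<in> carrier M \<Longrightarrow> a \<odot> (b \<odot> x) = (a * b) \<odot> x"
  and cv_one [simp]: "x \<in> carrier M \<Longrightarrow> 1 \<odot> x = x"
  and cv_zero_smult [simp]: "x \<in> carrier M \<Longrightarrow> 0 \<odot> x = \<zero>"
  and cv_smult_zero [simp]: "a \<odot> \<zero> = \<zero>"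
  using smult_assoc1[of a b x] smult_l_distr[of a b x] smult_r_distr[of a x y] smult_l_null[of x] smult_r_null[of a] smult_one[of x]
  by (auto simp: a_ac minus_eq intro!: finsum_closed)

lemma cv_minus_eq: "x \<in> carrier M \<Longrightarrow> \<ominus> x = (- 1) \<odot> x"
  using smult_l_minus[of 1 x] by simp

lemma cv_diff_eq: "x \<in> carrier M \<Longrightarrow> y \<in> carrier M \<Longrightarrow> x \<ominus> y = x \<oplus> (- 1) \<odot> y"
  using cv_minus_eq by (simp add: minus_eq)

lemma lf_zero: "lin_functional M l \<Longrightarrow> l \<zero> = 0"
  unfolding lin_functional_def by (metis cv_zero_smult cv_zero_closed mult_zero_left)

lemma lf_minus: "lin_functional M l \<Longrightarrow> x \<in> carrier M \<Longrightarrow> l (\<ominus> x) = - l x"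
  by (simp add: cv_minus_eq lin_functional_def)

lemma lf_diff: "lin_functional M l \<Longrightarrow> x \<in> carrier M \<Longrightarrow> y \<in> carrier M \<Longrightarrow> l (x \<ominus> y) = l x - l y"
  by (simp add: cv_diff_eq lin_functional_def)

lemma lf_finsum: "lin_functional M l \<Longrightarrow> f \<in> I \<rightarrow> carrier M \<Longrightarrow> l (finsum M f I) = (\<Sum>i\<in>I. l (f i))"
proof (induction I rule: infinite_finite_induct)
  case (infinite I)
  then show ?case by (simp add: lf_zero)
next
  case (insert x F)
  then have "f \<in> F \<rightarrow> carrier M" "f x \<in> carrier M" by auto
  with insert show ?case by (simp add: lin_functional_def)
qed (simp add: lf_zero)

end

lemma lf_add: "lin_functional M l \<Longrightarrow> x \<in> carrier M \<Longrightarrow> y \<in> carrier M \<Longrightarrow> l (x \<oplus>\<^bsub>M\<^esub> y) = l x + l y"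
  and lf_smult: "lin_functional M l \<Longrightarrow> x \<in> carrier M \<Longrightarrow> l (c \<odot>\<^bsub>M\<^esub> x) = c * l x"
  by (auto simp: lin_functional_def)

lemmas lf_simps = lf_add lf_smult lf_zero lf_minus lf_diff

lemma lin_map_closed: "lin_map M N f \<Longrightarrow> x \<in> carrier M \<Longrightarrow> f x \<in> carrier N"
  and lin_map_add: "lin_map M N f \<Longrightarrow> x \<in> carrier M \<Longrightarrow> y \<in> carrier M \<Longrightarrow> f (x \<oplus>\<^bsub>M\<^esub> y) = f x \<oplus>\<^bsub>N\<^esub> f y"
  and lin_map_smult: "lin_map M N f \<Longrightarrow> x \<in> carrier M \<Longrightarrow> f (c \<odot>\<^bsub>M\<^esub> x) = c \<odot>\<^bsub>N\<^esub> f x"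
  by (auto simp: lin_map_def)

lemma lin_map_zero: "cvspace M \<Longrightarrow> cvspace N \<Longrightarrow> lin_map M N f \<Longrightarrow> f \<zero>\<^bsub>M\<^esub> = \<zero>\<^bsub>N\<^esub>"
  using lin_map_smult[of M N f "\<zero>\<^bsub>M\<^esub>" 0] by (simp add: lin_map_closed)

lemma lin_map_diff: "cvspace M \<Longrightarrow> cvspace N \<Longrightarrow> lin_map M N f \<Longrightarrow> x \<in> carrier M \<Longrightarrow> y \<in> carrier M \<Longrightarrow>
    f (x \<ominus>\<^bsub>M\<^esub> y) = f x \<ominus>\<^bsub>N\<^esub> f y"
  by (simp add: cv_diff_eq lin_map_closed lin_map_add lin_map_smult)

lemma lin_map_id: "lin_map M M id" "lin_map M M (\<lambda>x. x)"
  by (auto simp: lin_map_def)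

lemma lin_map_comp: "lin_map M N f \<Longrightarrow> lin_map N P h \<Longrightarrow> lin_map M P (\<lambda>x. h (f x))"
  by (auto simp: lin_map_def Pi_def)

lemma lf_comp: "lin_map M N f \<Longrightarrow> lin_functional N l \<Longrightarrow> lin_functional M (\<lambda>x. l (f x))"
  by (auto simp: lin_map_def lin_functional_def Pi_def)

lemma lin_map_finsum:
  "cvspace M \<Longrightarrow> cvspace N \<Longrightarrow> lin_map M N h \<Longrightarrow> f \<in> I \<rightarrow> carrier M \<Longrightarrow>
   h (finsum M f I) = finsum N (\<lambda>i. h (f i)) I"
proof (induction I rule: infinite_finite_induct)
  case (infinite I)
  then show ?case by (simp add: abelian_monoid.finsum_infinite abelian_group.axioms(1) cv_abelian_group lin_map_zero)
next
  case empty
  then show ?case by (simp add: abelian_monoid.finsum_empty abelian_group.axioms(1) cv_abelian_group lin_map_zero)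
next
  case (insert x F)
  then have f: "f \<in> F \<rightarrow> carrier M" "f x \<in> carrier M" by auto
  then have "h (f x) \<in> carrier N" "(\<lambda>i. h (f i)) \<in> F \<rightarrow> carrier N" using insert.prems by (auto simp: lin_map_def)
  with f insert show ?case
    by (simp add: abelian_monoid.finsum_insert abelian_group.axioms(1) cv_abelian_group lin_map_add)
qed

lemma csubD:
  assumes "csub N M"
  shows "N \<subseteq> carrier M" "x \<in> N \<Longrightarrow> y \<in> N \<Longrightarrow> x \<oplus>\<^bsub>M\<^esub> y \<in> N" "x \<in> N \<Longrightarrow> c \<odot>\<^bsub>M\<^esub> x \<in> N" "\<zero>\<^bsub>M\<^esub> \<in> N"
proof -
  interpret submodule N cring_complex M by fact
  show "N \<subseteq> carrier M" using subset by simp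
  show "x \<in> N \<Longrightarrow> y \<in> N \<Longrightarrow> x \<oplus>\<^bsub>M\<^esub> y \<in> N" using m_closed by simp
  show "x \<in> N \<Longrightarrow> c \<odot>\<^bsub>M\<^esub> x \<in> N" by simp
  show "\<zero>\<^bsub>M\<^esub> \<in> N" using one_closed by simp
qed

lemma csubI:
  assumes "cvspace M" "N \<subseteq> carrier M" "\<zero>\<^bsub>M\<^esub> \<in> N"
    and "\<And>x y. x \<in> N \<Longrightarrow> y \<in> N \<Longrightarrow> x \<oplus>\<^bsub>M\<^esub> y \<in> N" "\<And>c x. x \<in> N \<Longrightarrow> c \<odot>\<^bsub>M\<^esub> x \<in> N"
  shows "csub N M"
  using assms cv_minus_eq[OF assms(1)] by (intro module.submoduleI) (auto simp: subset_iff)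

lemma csub_diff: "cvspace M \<Longrightarrow> csub N M \<Longrightarrow> x \<in> N \<Longrightarrow> y \<in> N \<Longrightarrow> x \<ominus>\<^bsub>M\<^esub> y \<in> N"
  using csubD[of N M] cv_diff_eq[of M x y] by (auto simp: subset_iff)

lemma csub_finsum:
  assumes "cvspace M" "csub N M" "f \<in> I \<rightarrow> N"
  shows "finsum M f I \<in> N"
  using assms(3)
proof (induction I rule: infinite_finite_induct)
  case (insert x F)
  then have "f \<in> F \<rightarrow> carrier M" "f x \<in> carrier M" using csubD(1)[OF assms(2)] by auto
  with insert assms csubD[OF assms(2)] show ?case
    by (simp add: abelian_monoid.finsum_insert abelian_group.axioms(1) cv_abelian_group)
qed (use assms csubD[OF assms(2)] in \<open>auto simp: abelian_monoid.finsum_infinite abelian_monoid.finsum_empty abelian_group.axioms(1) cv_abelian_group\<close>)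

lemma csub_cvspace: "cvspace M \<Longrightarrow> csub N M \<Longrightarrow> cvspace (M\<lparr>carrier := N\<rparr>)"
  by (intro cvspaceI) (auto simp: csubD subsetD[OF csubD(1)] cv_add_assoc cv_smult_add cv_add_smult cv_smult_smult
      intro: cv_add_commute)

lemma csub_range:
  assumes "cvspace M" "cvspace N" "lin_map M N f"
  shows "csub (f ` carrier M) N"
proof (rule csubI)
  show "\<zero>\<^bsub>N\<^esub> \<in> f ` carrier M"
    using lin_map_zero[OF assms] assms by (metis cv_zero_closed imageI)
next
  fix x y assume "x \<in> f ` carrier M" "y \<in> f ` carrier M"
  then show "x \<oplus>\<^bsub>N\<^esub> y \<in> f ` carrier M"
    using lin_map_add[OF assms(3)] assms by (metis (no_types, lifting) cv_add_closed image_iff)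
next
  fix c x assume "x \<in> f ` carrier M"
  then show "c \<odot>\<^bsub>N\<^esub> x \<in> f ` carrier M"
    using lin_map_smult[OF assms(3)] assms by (metis (no_types, lifting) cv_smult_closed image_iff)
qed (use assms lin_map_closed in auto)

lemma csub_kernel: "cvspace M \<Longrightarrow> cvspace N \<Longrightarrow> lin_map M N f \<Longrightarrow> csub {x \<in> carrier M. f x = \<zero>\<^bsub>N\<^esub>} M"
  by (rule csubI) (auto simp: lin_map_add lin_map_smult lin_map_zero)

lemma csub_Int: "cvspace M \<Longrightarrow> csub N M \<Longrightarrow> csub N' M \<Longrightarrow> csub (N \<inter> N') M"
  by (rule csubI) (auto simp: csubD subsetD[OF csubD(1)])

section \<open>Free spaces and linear extension\<close>

lemma lookup_pm_scale [simp]: "Poly_Mapping.lookup (pm_scale c p) x = c * Poly_Mapping.lookup p x"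
  by (simp add: pm_scale_def map.rep_eq when_def)

interpretation pm: vector_space "pm_scale :: complex \<Rightarrow> ('x \<Rightarrow>\<^sub>0 complex) \<Rightarrow> _"
  by standard (auto intro!: poly_mapping_eqI simp: lookup_add algebra_simps)

lemma keys_pm_scale: "Poly_Mapping.keys (pm_scale c p) \<subseteq> Poly_Mapping.keys p"
  by (auto simp: in_keys_iff)

lemma free_space_simps [simp]:
  "carrier (free_space X) = {p. Poly_Mapping.keys p \<subseteq> X}" "zero (free_space X) = 0"
  "p \<oplus>\<^bsub>free_space X\<^esub> q = p + q" "c \<odot>\<^bsub>free_space X\<^esub> p = pm_scale c p"
  by (simp_all add: free_space_def)

lemma subspace_free_space: "pm.subspace {p :: 'x \<Rightarrow>\<^sub>0 complex. Poly_Mapping.keys p \<subseteq> X}"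
  unfolding pm.subspace_def
proof (intro conjI ballI allI)
  show "p + q \<in> {p. Poly_Mapping.keys p \<subseteq> X}"
    if "p \<in> {p. Poly_Mapping.keys p \<subseteq> X}" "q \<in> {p. Poly_Mapping.keys p \<subseteq> X}" for p q :: "'x \<Rightarrow>\<^sub>0 complex"
    using that keys_add[of p q] by auto
  show "pm_scale c p \<in> {p. Poly_Mapping.keys p \<subseteq> X}"
    if "p \<in> {p. Poly_Mapping.keys p \<subseteq> X}" for c and p :: "'x \<Rightarrow>\<^sub>0 complex"
    using that keys_pm_scale[of c p] by auto
qed simp

lemma cvspace_free_space: "cvspace (free_space X)"
  using subspace_free_space[of X]
  by (intro cvspaceI) (auto simp: pm.subspace_def algebra_simps pm.scale_left_distrib pm.scale_right_distrib)

text \<open>Linear extension of \<open>g\<close> from basis elements to finitely supported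
  functions. The actions of presented algebras and the maps out of tensor products below are this
  function composed with a choice of representative.\<close>

definition lext :: "(complex, 'a) module \<Rightarrow> ('x \<Rightarrow> 'a) \<Rightarrow> ('x \<Rightarrow>\<^sub>0 complex) \<Rightarrow> 'a" where
  "lext P g p = finsum P (\<lambda>x. Poly_Mapping.lookup p x \<odot>\<^bsub>P\<^esub> g x) (Poly_Mapping.keys p)"

context
  fixes P :: "(complex, 'a) module" and g :: "'x \<Rightarrow> 'a" and X
  assumes P: "cvspace P" and g: "g \<in> X \<rightarrow> carrier P"
begin

interpretation abelian_group P by (rule cv_abelian_group[OF P])

text \<open>Two arguments have different supports; additivity needs both sums over a common finite
  index set.\<close>

lemma lext_superset:
  assumes "finite S" "Poly_Mapping.keys p \<subseteq> S" "S \<subseteq> X"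
  shows "lext P g p = finsum P (\<lambda>x. Poly_Mapping.lookup p x \<odot>\<^bsub>P\<^esub> g x) S"
  unfolding lext_def using assms g P
  by (intro add.finprod_mono_neutral_cong_left) (auto simp: in_keys_iff Pi_def subset_iff)

lemma lext_closed: "Poly_Mapping.keys p \<subseteq> X \<Longrightarrow> lext P g p \<in> carrier P"
  unfolding lext_def using g P by (intro finsum_closed) (auto simp: Pi_iff subset_iff)

lemma lext_add:
  assumes "Poly_Mapping.keys p \<subseteq> X" "Poly_Mapping.keys q \<subseteq> X"
  shows "lext P g (p + q) = lext P g p \<oplus>\<^bsub>P\<^esub> lext P g q"
proof -
  let ?S = "Poly_Mapping.keys p \<union> Poly_Mapping.keys q"
  have "lext P g (p + q) = finsum P (\<lambda>x. Poly_Mapping.lookup (p + q) x \<odot>\<^bsub>P\<^esub> g x) ?S"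
    using assms keys_add[of p q] by (intro lext_superset) auto
  also have "\<dots> = finsum P (\<lambda>x. Poly_Mapping.lookup p x \<odot>\<^bsub>P\<^esub> g x \<oplus>\<^bsub>P\<^esub> Poly_Mapping.lookup q x \<odot>\<^bsub>P\<^esub> g x) ?S"
    using assms g P by (intro finsum_cong') (auto simp: lookup_add cv_smult_add subset_iff Pi_def)
  also have "\<dots> = finsum P (\<lambda>x. Poly_Mapping.lookup p x \<odot>\<^bsub>P\<^esub> g x) ?S \<oplus>\<^bsub>P\<^esub> finsum P (\<lambda>x. Poly_Mapping.lookup q x \<odot>\<^bsub>P\<^esub> g x) ?S"
    using assms g P by (intro finsum_addf) (auto simp: subset_iff Pi_def)
  also have "\<dots> = lext P g p \<oplus>\<^bsub>P\<^esub> lext P g q"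
    using assms by (subst (1 2) lext_superset[where S = ?S]) auto
  finally show ?thesis .
qed

lemma lext_scale:
  assumes "Poly_Mapping.keys p \<subseteq> X"
  shows "lext P g (pm_scale c p) = c \<odot>\<^bsub>P\<^esub> lext P g p"
proof -
  have "lext P g (pm_scale c p) = finsum P (\<lambda>x. Poly_Mapping.lookup (pm_scale c p) x \<odot>\<^bsub>P\<^esub> g x) (Poly_Mapping.keys p)"
    using assms keys_pm_scale[of c p] by (intro lext_superset) auto
  also have "\<dots> = finsum P (\<lambda>x. c \<odot>\<^bsub>P\<^esub> (Poly_Mapping.lookup p x \<odot>\<^bsub>P\<^esub> g x)) (Poly_Mapping.keys p)"
    using assms g P by (intro finsum_cong') (auto simp: cv_smult_smult subset_iff Pi_def)
  also have "\<dots> = c \<odot>\<^bsub>P\<^esub> lext P g p"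
    unfolding lext_def using assms g P
    by (intro module.finsum_smult_ldistr[OF P, symmetric]) (auto simp: subset_iff Pi_def)
  finally show ?thesis .
qed

lemma lext_single: "x \<in> X \<Longrightarrow> lext P g (Poly_Mapping.single x c) = c \<odot>\<^bsub>P\<^esub> g x"
  using g P by (cases "c = 0") (auto simp: lext_def Pi_def)

lemma lext_linear: "lin_map (free_space X) P (lext P g)"
  by (auto simp: lin_map_def lext_closed lext_add lext_scale)

lemma lext_diff: "Poly_Mapping.keys p \<subseteq> X \<Longrightarrow> Poly_Mapping.keys q \<subseteq> X \<Longrightarrow>
    lext P g (p - q) = lext P g p \<ominus>\<^bsub>P\<^esub> lext P g q"
proof -
  assume *: "Poly_Mapping.keys p \<subseteq> X" "Poly_Mapping.keys q \<subseteq> X"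
  have "p - q = p + pm_scale (- 1) q" by (simp add: poly_mapping_eqI lookup_add lookup_minus)
  moreover have "Poly_Mapping.keys (pm_scale (- 1) q) \<subseteq> X" using * keys_pm_scale[of "- 1" q] by auto
  then have "lext P g (p + pm_scale (- 1) q) = lext P g p \<ominus>\<^bsub>P\<^esub> lext P g q"
    using * by (simp only: lext_add lext_scale cv_diff_eq[OF P] lext_closed)
  ultimately show ?thesis by metis
qed

lemma lext_span_zero:
  assumes "p \<in> pm.span R" "R \<subseteq> carrier (free_space X)" "\<And>r. r \<in> R \<Longrightarrow> lext P g r = \<zero>\<^bsub>P\<^esub>"
  shows "Poly_Mapping.keys p \<subseteq> X \<and> lext P g p = \<zero>\<^bsub>P\<^esub>"
  using assms(1)
proof (induction rule: pm.span_induct_alt)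
  case base
  then show ?case by (simp add: lext_def)
next
  case (step c x y)
  then have "Poly_Mapping.keys x \<subseteq> X" "lext P g x = \<zero>\<^bsub>P\<^esub>" using assms by auto
  with step P keys_pm_scale[of c x] keys_add[of "pm_scale c x" y] show ?case
    by (auto simp: lext_add lext_scale subset_trans)
qed

end

text \<open>\<open>S\<close>, the preimage of \<open>N\<close> under evaluation of formal
  combinations, contains every linear relation of \<open>M\<close>, so a functional on the free
  space that kills \<open>S\<close> descends to \<open>M\<close>. The free space sits in a vector
  space on a whole type, where independent sets carry functionals with prescribed values, and
  \<open>basis_elt x\<close> is independent of a basis of \<open>S\<close> because
  \<open>x \<notin> N\<close>.\<close>

theorem functional_separation:
  assumes "cvspace M" "csub N M" "x \<in> carrier M" "x \<notin> N"
  shows "\<exists>l. lin_functional M l \<and> (\<forall>n\<in>N. l n = 0) \<and> l x = 1"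
proof -
  define S where "S = {p. Poly_Mapping.keys p \<subseteq> carrier M \<and> lext M id p \<in> N}"
  have id: "id \<in> carrier M \<rightarrow> carrier M" by auto
  note lx = lext_add[OF assms(1) id] lext_scale[OF assms(1) id] lext_single[OF assms(1) id] lext_diff[OF assms(1) id]
  have sub: "pm.subspace S"
    using subspace_free_space[of "carrier M"] csubD[OF assms(2)]
    by (auto simp: S_def pm.subspace_def lx abelian_monoid.finsum_empty abelian_group.axioms(1) cv_abelian_group assms(1) lext_def[of M id 0])
  obtain C where C: "C \<subseteq> S" "pm.independent C" "S \<subseteq> pm.span C"
    by (rule pm.basis_exists[of S])
  have "lext M id (basis_elt x) = x" by (subst lx(3)) (use assms in simp_all)
  then have "basis_elt x \<notin> S" using assms(3,4) by (simp add: S_def)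
  moreover have "pm.span C \<subseteq> S" by (rule pm.span_minimal[OF C(1) sub])
  ultimately have "basis_elt x \<notin> pm.span C" by blast
  with C have ind: "pm.independent (insert (basis_elt x) C)"
    by (intro pm.independent_insertI) auto
  interpret cc: vector_space "(*) :: complex \<Rightarrow> _" by standard (auto simp: algebra_simps)
  interpret pc: vector_space_pair "pm_scale :: complex \<Rightarrow> ('a \<Rightarrow>\<^sub>0 complex) \<Rightarrow> _" "(*) :: complex \<Rightarrow> _" ..
  obtain f where f: "Vector_Spaces.linear pm_scale (*) f"
    "\<And>y. y \<in> insert (basis_elt x) C \<Longrightarrow> f y = (if y = basis_elt x then 1 else 0)"
    using pc.linear_independent_extend[OF ind, of "\<lambda>y. if y = basis_elt x then 1 else 0"] by blast
  interpret f: Vector_Spaces.linear pm_scale "(*)" f by fact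
  have fS: "f p = 0" if "p \<in> S" for p
  proof -
    have "p \<in> pm.span C" using that C by auto
    moreover have "f y = 0" if "y \<in> C" for y
      using that f(2)[of y] C \<open>basis_elt x \<notin> S\<close> by auto
    ultimately show ?thesis
      by (induction rule: pm.span_induct_alt) (auto simp: f.add f.scale f.zero)
  qed
  have single: "basis_elt y \<in> carrier (free_space (carrier M))" if "y \<in> carrier M" for y using that by auto
  let ?l = "\<lambda>y. f (basis_elt y)"
  have "?l (y \<oplus>\<^bsub>M\<^esub> z) = ?l y + ?l z" if yz: "y \<in> carrier M" "z \<in> carrier M" for y z
  proof -
    have "basis_elt (y \<oplus>\<^bsub>M\<^esub> z) - (basis_elt y + basis_elt z) \<in> S"
    proof -
      have k: "Poly_Mapping.keys (basis_elt y + basis_elt z) \<subseteq> carrier M"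
        using yz keys_add[of "basis_elt y" "basis_elt z"] by auto
      have "Poly_Mapping.keys (basis_elt (y \<oplus>\<^bsub>M\<^esub> z) - (basis_elt y + basis_elt z)) \<subseteq> carrier M"
        using yz assms(1) k keys_diff[of "basis_elt (y \<oplus>\<^bsub>M\<^esub> z)" "basis_elt y + basis_elt z"] by auto
      moreover have "lext M id (basis_elt (y \<oplus>\<^bsub>M\<^esub> z) - (basis_elt y + basis_elt z)) = \<zero>\<^bsub>M\<^esub>"
        using yz assms(1) k by (simp add: lx abelian_group.minus_eq abelian_group.r_neg cv_abelian_group)
      ultimately show ?thesis using csubD[OF assms(2)] by (auto simp: S_def)
    qed
    then show ?thesis using fS[of "basis_elt (y \<oplus>\<^bsub>M\<^esub> z) - (basis_elt y + basis_elt z)"] by (simp add: f.diff f.add)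
  qed
  moreover have "?l (c \<odot>\<^bsub>M\<^esub> y) = c * ?l y" if y: "y \<in> carrier M" for c y
  proof -
    have k: "Poly_Mapping.keys (pm_scale c (basis_elt y)) \<subseteq> carrier M"
      using y keys_pm_scale[of c "basis_elt y"] by auto
    have "basis_elt (c \<odot>\<^bsub>M\<^esub> y) - pm_scale c (basis_elt y) \<in> S"
    proof -
      have "Poly_Mapping.keys (basis_elt (c \<odot>\<^bsub>M\<^esub> y) - pm_scale c (basis_elt y)) \<subseteq> carrier M"
        using y assms(1) k keys_diff[of "basis_elt (c \<odot>\<^bsub>M\<^esub> y)" "pm_scale c (basis_elt y)"] by auto
      moreover have "lext M id (basis_elt (c \<odot>\<^bsub>M\<^esub> y) - pm_scale c (basis_elt y)) = \<zero>\<^bsub>M\<^esub>"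
        using y assms(1) k by (simp add: lx abelian_group.minus_eq abelian_group.r_neg cv_abelian_group)
      ultimately show ?thesis using csubD[OF assms(2)] by (auto simp: S_def)
    qed
    then show ?thesis using fS[of "basis_elt (c \<odot>\<^bsub>M\<^esub> y) - pm_scale c (basis_elt y)"] by (simp add: f.diff f.scale)
  qed
  moreover have "?l n = 0" if "n \<in> N" for n
    using that csubD[OF assms(2)] assms(1) by (intro fS) (auto simp: S_def lx subset_iff)
  moreover have "?l x = 1" using f(2) by simp
  ultimately show ?thesis by (intro exI[of _ ?l]) (auto simp: lin_functional_def)
qed

text \<open>Separation applied to the zero subspace and the vector \<open>x \<ominus> y\<close>.
  This is the extensionality principle of the whole development: after it, linear identities in any
  carrier are proved by arithmetic on the complex values \<open>l x\<close>.\<close>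

lemma functional_eqI:
  assumes "cvspace M" "x \<in> carrier M" "y \<in> carrier M" "\<And>l. lin_functional M l \<Longrightarrow> l x = l y"
  shows "x = y"
proof (rule ccontr)
  assume "x \<noteq> y"
  have "csub {\<zero>\<^bsub>M\<^esub>} M" using assms by (intro csubI) auto
  moreover have "x \<ominus>\<^bsub>M\<^esub> y \<noteq> \<zero>\<^bsub>M\<^esub>"
  proof
    assume *: "x \<ominus>\<^bsub>M\<^esub> y = \<zero>\<^bsub>M\<^esub>"
    interpret abelian_group M by (rule cv_abelian_group[OF assms(1)])
    have "x = x \<oplus>\<^bsub>M\<^esub> (\<ominus>\<^bsub>M\<^esub> y \<oplus>\<^bsub>M\<^esub> y)" using assms by (simp add: l_neg)
    also have "\<dots> = (x \<ominus>\<^bsub>M\<^esub> y) \<oplus>\<^bsub>M\<^esub> y" using assms by (simp add: minus_eq a_assoc)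
    also have "\<dots> = y" using * assms by simp
    finally show False using \<open>x \<noteq> y\<close> by simp
  qed
  ultimately obtain l where "lin_functional M l" "l (x \<ominus>\<^bsub>M\<^esub> y) = 1"
    using functional_separation[of M "{\<zero>\<^bsub>M\<^esub>}" "x \<ominus>\<^bsub>M\<^esub> y"] assms by auto
  then show False using assms(4)[of l] assms lf_diff[of M l x y] by simp
qed

lemma lin_mapI:
  assumes "cvspace M" "cvspace N" "\<And>x. x \<in> carrier M \<Longrightarrow> f x \<in> carrier N"
    and "\<And>l x y. lin_functional N l \<Longrightarrow> x \<in> carrier M \<Longrightarrow> y \<in> carrier M \<Longrightarrow> l (f (x \<oplus>\<^bsub>M\<^esub> y)) = l (f x) + l (f y)"
    and "\<And>l c x. lin_functional N l \<Longrightarrow> x \<in> carrier M \<Longrightarrow> l (f (c \<odot>\<^bsub>M\<^esub> x)) = c * l (f x)"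
  shows "lin_map M N f"
  unfolding lin_map_def
  by (intro conjI ballI allI funcsetI functional_eqI[OF assms(2)]) (simp_all add: assms lf_add lf_smult)

section \<open>Quotients and tensor products\<close>

lemma keys_add_closed [simp]: "Poly_Mapping.keys p \<subseteq> X \<Longrightarrow> Poly_Mapping.keys q \<subseteq> X \<Longrightarrow> Poly_Mapping.keys (p + q) \<subseteq> X"
  and keys_diff_closed [simp]: "Poly_Mapping.keys p' \<subseteq> X \<Longrightarrow> Poly_Mapping.keys q' \<subseteq> X \<Longrightarrow> Poly_Mapping.keys (p' - q') \<subseteq> X"
  and keys_pm_scale_closed [simp]: "Poly_Mapping.keys r \<subseteq> X \<Longrightarrow> Poly_Mapping.keys (pm_scale c r) \<subseteq> X"
  using keys_add[of p q] keys_diff[of p' q'] keys_pm_scale[of c r] by auto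

context
  fixes M :: "(complex, 'a) module" and N
  assumes M: "cvspace M" and N: "csub N M"
begin

interpretation abelian_group M by (rule cv_abelian_group[OF M])

lemma csub_abelian_subgroup: "abelian_subgroup N M"
  using submodule.axioms(1)[OF N] abelian_group_axioms
  by (intro abelian_subgroupI3 additive_subgroup.intro)

interpretation abelian_subgroup N M by (rule csub_abelian_subgroup)

lemma coset_iff: "x \<in> carrier M \<Longrightarrow> z \<in> N +>\<^bsub>M\<^esub> x \<longleftrightarrow> (\<exists>n\<in>N. z = n \<oplus>\<^bsub>M\<^esub> x)"
  by (auto simp: a_r_coset_def')

lemma coset_self: "x \<in> carrier M \<Longrightarrow> x \<in> N +>\<^bsub>M\<^esub> x"
  by (rule a_rcos_self)

lemma coset_closed: "x \<in> carrier M \<Longrightarrow> z \<in> N +>\<^bsub>M\<^esub> x \<Longrightarrow> z \<in> carrier M"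
  using csubD(1)[OF N] by (auto simp: coset_iff)

lemma coset_repr: "x \<in> carrier M \<Longrightarrow> z \<in> N +>\<^bsub>M\<^esub> x \<Longrightarrow> N +>\<^bsub>M\<^esub> z = N +>\<^bsub>M\<^esub> x"
  using a_repr_independence' by simp

lemma coset_eq_iff:
  assumes "x \<in> carrier M" "y \<in> carrier M"
  shows "N +>\<^bsub>M\<^esub> x = N +>\<^bsub>M\<^esub> y \<longleftrightarrow> x \<ominus>\<^bsub>M\<^esub> y \<in> N"
proof
  assume "N +>\<^bsub>M\<^esub> x = N +>\<^bsub>M\<^esub> y"
  then obtain n where "n \<in> N" "x = n \<oplus>\<^bsub>M\<^esub> y" using coset_self assms coset_iff by blast
  moreover then have "x \<ominus>\<^bsub>M\<^esub> y = n"
    using assms csubD(1)[OF N] by (auto simp: minus_eq a_assoc r_neg subset_iff)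
  ultimately show "x \<ominus>\<^bsub>M\<^esub> y \<in> N" by simp
next
  assume *: "x \<ominus>\<^bsub>M\<^esub> y \<in> N"
  have "x = (x \<ominus>\<^bsub>M\<^esub> y) \<oplus>\<^bsub>M\<^esub> y" using assms by (simp add: minus_eq a_assoc l_neg)
  then have "x \<in> N +>\<^bsub>M\<^esub> y" using * assms by (auto simp: coset_iff)
  then show "N +>\<^bsub>M\<^esub> x = N +>\<^bsub>M\<^esub> y" using coset_repr assms by blast
qed

lemma carrier_quot_space: "carrier (quot_space M N) = (\<lambda>x. N +>\<^bsub>M\<^esub> x) ` carrier M"
  by (auto simp: quot_space_def A_RCOSETS_def')

lemma zero_quot_space: "\<zero>\<^bsub>quot_space M N\<^esub> = N +>\<^bsub>M\<^esub> \<zero>\<^bsub>M\<^esub>"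
  using csubD(1)[OF N] by (auto simp: quot_space_def a_r_coset_def' subset_iff)

lemma add_quot_space: "x \<in> carrier M \<Longrightarrow> y \<in> carrier M \<Longrightarrow>
    (N +>\<^bsub>M\<^esub> x) \<oplus>\<^bsub>quot_space M N\<^esub> (N +>\<^bsub>M\<^esub> y) = N +>\<^bsub>M\<^esub> (x \<oplus>\<^bsub>M\<^esub> y)"
  by (simp add: quot_space_def a_rcos_sum)

text \<open>The union that defines scalar multiplication runs over all representatives of a nonempty
  coset, and each of them contributes the same coset.\<close>

lemma smult_quot_space:
  assumes "x \<in> carrier M"
  shows "c \<odot>\<^bsub>quot_space M N\<^esub> (N +>\<^bsub>M\<^esub> x) = N +>\<^bsub>M\<^esub> (c \<odot>\<^bsub>M\<^esub> x)"
proof -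
  have eq: "N +>\<^bsub>M\<^esub> (c \<odot>\<^bsub>M\<^esub> z) = N +>\<^bsub>M\<^esub> (c \<odot>\<^bsub>M\<^esub> x)" if z: "z \<in> N +>\<^bsub>M\<^esub> x" for z
  proof -
    obtain n where n: "n \<in> N" "z = n \<oplus>\<^bsub>M\<^esub> x" using z assms by (auto simp: coset_iff)
    then have "c \<odot>\<^bsub>M\<^esub> z = c \<odot>\<^bsub>M\<^esub> n \<oplus>\<^bsub>M\<^esub> c \<odot>\<^bsub>M\<^esub> x" using assms M csubD(1)[OF N] by (simp add: cv_add_smult subset_iff)
    then have "c \<odot>\<^bsub>M\<^esub> z \<in> N +>\<^bsub>M\<^esub> (c \<odot>\<^bsub>M\<^esub> x)" using n csubD(3)[OF N] M assms by (auto simp: coset_iff)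
    then show ?thesis using M assms by (intro coset_repr) auto
  qed
  have "(\<Union>z\<in>N +>\<^bsub>M\<^esub> x. N +>\<^bsub>M\<^esub> (c \<odot>\<^bsub>M\<^esub> z)) = (\<Union>z\<in>N +>\<^bsub>M\<^esub> x. N +>\<^bsub>M\<^esub> (c \<odot>\<^bsub>M\<^esub> x))"
    by (rule SUP_cong[OF refl eq])
  also have "\<dots> = N +>\<^bsub>M\<^esub> (c \<odot>\<^bsub>M\<^esub> x)"
    using coset_self[OF assms] by blast
  finally show ?thesis by (simp add: quot_space_def)
qed

lemma cvspace_quot_space: "cvspace (quot_space M N)"
proof -
  note q = zero_quot_space add_quot_space smult_quot_space M
  have c: "x \<in> carrier M \<Longrightarrow> N +>\<^bsub>M\<^esub> x \<in> carrier (quot_space M N)" for x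
    by (auto simp: carrier_quot_space)
  show ?thesis
  proof (rule cvspaceI)
    fix t u v a b
    assume t: "t \<in> carrier (quot_space M N)" 
    then obtain x where x: "x \<in> carrier M" "t = N +>\<^bsub>M\<^esub> x" by (auto simp: carrier_quot_space)
    show "\<zero>\<^bsub>quot_space M N\<^esub> \<oplus>\<^bsub>quot_space M N\<^esub> t = t" using x by (simp add: q)
    show "a \<odot>\<^bsub>quot_space M N\<^esub> t \<in> carrier (quot_space M N)" using x c by (simp add: q)
    show "(a + b) \<odot>\<^bsub>quot_space M N\<^esub> t = a \<odot>\<^bsub>quot_space M N\<^esub> t \<oplus>\<^bsub>quot_space M N\<^esub> b \<odot>\<^bsub>quot_space M N\<^esub> t"
      using x by (simp add: q cv_smult_add[OF M])
    show "(a * b) \<odot>\<^bsub>quot_space M N\<^esub> t = a \<odot>\<^bsub>quot_space M N\<^esub> (b \<odot>\<^bsub>quot_space M N\<^esub> t)"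
      using x by (simp add: q cv_smult_smult[OF M])
    show "1 \<odot>\<^bsub>quot_space M N\<^esub> t = t" "0 \<odot>\<^bsub>quot_space M N\<^esub> t = \<zero>\<^bsub>quot_space M N\<^esub>" using x by (simp_all add: q)
    assume "u \<in> carrier (quot_space M N)"
    then obtain y where y: "y \<in> carrier M" "u = N +>\<^bsub>M\<^esub> y" by (auto simp: carrier_quot_space)
    show "t \<oplus>\<^bsub>quot_space M N\<^esub> u \<in> carrier (quot_space M N)" using x y c by (simp add: q)
    show "t \<oplus>\<^bsub>quot_space M N\<^esub> u = u \<oplus>\<^bsub>quot_space M N\<^esub> t" using x y by (simp add: q cv_add_commute[OF M, of x y])
    show "a \<odot>\<^bsub>quot_space M N\<^esub> (t \<oplus>\<^bsub>quot_space M N\<^esub> u) = a \<odot>\<^bsub>quot_space M N\<^esub> t \<oplus>\<^bsub>quot_space M N\<^esub> a \<odot>\<^bsub>quot_space M N\<^esub> u"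
      using x y by (simp add: q cv_add_smult[OF M])
    assume "v \<in> carrier (quot_space M N)"
    then obtain z where z: "z \<in> carrier M" "v = N +>\<^bsub>M\<^esub> z" by (auto simp: carrier_quot_space)
    show "t \<oplus>\<^bsub>quot_space M N\<^esub> u \<oplus>\<^bsub>quot_space M N\<^esub> v = t \<oplus>\<^bsub>quot_space M N\<^esub> (u \<oplus>\<^bsub>quot_space M N\<^esub> v)"
      using x y z by (simp add: q cv_add_assoc[OF M])
  qed (simp add: c q)
qed

lemma coset_linear: "lin_map M (quot_space M N) (\<lambda>x. N +>\<^bsub>M\<^esub> x)"
  by (auto simp: lin_map_def carrier_quot_space add_quot_space smult_quot_space)

end

lemma finsum_free_space: "f \<in> I \<rightarrow> carrier (free_space X) \<Longrightarrow> finsum (free_space X) f I = sum f I"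
proof (induction I rule: infinite_finite_induct)
  case (insert x F)
  then have "f \<in> F \<rightarrow> carrier (free_space X)" "f x \<in> carrier (free_space X)" by auto
  with insert show ?case
    by (simp add: abelian_monoid.finsum_insert abelian_group.axioms(1) cv_abelian_group cvspace_free_space)
qed (auto simp: abelian_monoid.finsum_infinite abelian_monoid.finsum_empty abelian_group.axioms(1)
    cv_abelian_group cvspace_free_space)

lemma free_space_induct:
  assumes "csub Q (free_space X)" "\<And>x. x \<in> X \<Longrightarrow> basis_elt x \<in> Q" "Poly_Mapping.keys p \<subseteq> X"
  shows "p \<in> Q"
proof -
  have "p = (\<Sum>x\<in>Poly_Mapping.keys p. pm_scale (Poly_Mapping.lookup p x) (basis_elt x))"
    by (rule poly_mapping_eqI)
      (auto simp: lookup_sum lookup_single when_def if_distrib[of "(*) _"] sum.delta in_keys_iff cong: if_cong)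
  moreover have "(\<Sum>x\<in>Y. pm_scale (Poly_Mapping.lookup p x) (basis_elt x)) \<in> Q" if "Y \<subseteq> X" for Y
    using that csubD[OF assms(1)] assms(2)
    by (induction Y rule: infinite_finite_induct) auto
  ultimately show ?thesis using assms(3) by metis
qed

lemma free_space_ext:
  assumes "cvspace P" "lin_map (free_space X) P f" "lin_map (free_space X) P g"
    and "\<And>x. x \<in> X \<Longrightarrow> f (basis_elt x) = g (basis_elt x)" "Poly_Mapping.keys p \<subseteq> X"
  shows "f p = g p"
proof -
  have "csub {p. Poly_Mapping.keys p \<subseteq> X \<and> f p = g p} (free_space X)"
    using lin_map_add[OF assms(2)] lin_map_add[OF assms(3)] lin_map_smult[OF assms(2)] lin_map_smult[OF assms(3)]
      lin_map_zero[OF cvspace_free_space assms(1,2)] lin_map_zero[OF cvspace_free_space assms(1,3)]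
    by (intro csubI cvspace_free_space) auto
  from free_space_induct[OF this _ assms(5)] assms(4) show ?thesis by simp
qed

lemma csub_span: "R \<subseteq> carrier (free_space X) \<Longrightarrow> csub (pm.span R) (free_space X)"
  using pm.span_minimal[OF _ subspace_free_space[of X], of R]
  by (intro csubI cvspace_free_space) (auto intro: pm.span_add pm.span_scale pm.span_zero)

context
  fixes X :: "'x set" and R :: "('x \<Rightarrow>\<^sub>0 complex) set" and N and P :: "(complex, 'a) module" and g
  assumes P: "cvspace P" and g: "g \<in> X \<rightarrow> carrier P"
    and R: "R \<subseteq> carrier (free_space X)" and N: "N = pm.span R"
    and zero: "\<And>r. r \<in> R \<Longrightarrow> lext P g r = \<zero>\<^bsub>P\<^esub>"
begin

lemma lext_coset_rep:
  assumes "Poly_Mapping.keys p \<subseteq> X" "q \<in> N +>\<^bsub>free_space X\<^esub> p"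
  shows "Poly_Mapping.keys q \<subseteq> X \<and> lext P g q = lext P g p"
proof -
  obtain n where n: "n \<in> N" "q = n + p"
    using assms coset_iff[OF cvspace_free_space csub_span[OF R], folded N, of p q] by auto
  then have "Poly_Mapping.keys n \<subseteq> X \<and> lext P g n = \<zero>\<^bsub>P\<^esub>"
    using lext_span_zero[OF P g _ R zero] N by auto
  with n assms P keys_add[of n p] show ?thesis
    by (auto simp: lext_add[OF P g] lext_closed[OF P g])
qed

text \<open>A linear extension that vanishes on the relations takes a single value on each coset, so
  evaluation at the representative picked by \<open>SOME\<close> is the induced map on the quotient.
  The definitions by \<open>SOME\<close> of algebra actions and tensor actions are unfolded through
  it.\<close>

lemma lext_some:
  assumes "Poly_Mapping.keys p \<subseteq> X"
  shows "lext P g (SOME q. q \<in> N +>\<^bsub>free_space X\<^esub> p) = lext P g p"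
proof -
  have "p \<in> N +>\<^bsub>free_space X\<^esub> p"
    using coset_self[OF cvspace_free_space csub_span[OF R], folded N, of p] assms by simp
  then have "(SOME q. q \<in> N +>\<^bsub>free_space X\<^esub> p) \<in> N +>\<^bsub>free_space X\<^esub> p" by (rule someI)
  with lext_coset_rep assms show ?thesis by blast
qed

lemma lext_some_linear:
  "lin_map (quot_space (free_space X) N) P (\<lambda>C. lext P g (SOME q. q \<in> C))"
proof -
  note c = cvspace_free_space csub_span[OF R, folded N]
  have *: "Poly_Mapping.keys p \<subseteq> X \<Longrightarrow> Poly_Mapping.keys q \<subseteq> X \<Longrightarrow> Poly_Mapping.keys (p + q) \<subseteq> X"
    "Poly_Mapping.keys p \<subseteq> X \<Longrightarrow> Poly_Mapping.keys (pm_scale a p) \<subseteq> X" for p q :: "'x \<Rightarrow>\<^sub>0 complex" and a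
    using keys_add[of p q] keys_pm_scale[of a p] by auto
  show ?thesis
    using add_quot_space[OF c] smult_quot_space[OF c] *
    by (auto simp: lin_map_def carrier_quot_space[OF c] lext_some lext_closed[OF P g] lext_add[OF P g] lext_scale[OF P g])
qed

end

section \<open>Universal property of the tensor product\<close>

definition bilin :: "(complex, 'a) module \<Rightarrow> (complex, 'b) module \<Rightarrow> (complex, 'c) module \<Rightarrow> ('a \<Rightarrow> 'b \<Rightarrow> 'c) \<Rightarrow> bool" where
  "bilin M N P f \<longleftrightarrow> (\<forall>y\<in>carrier N. lin_map M P (\<lambda>x. f x y)) \<and> (\<forall>x\<in>carrier M. lin_map N P (f x))"

lemma bilinD:
  assumes "bilin M N P f"
  shows "x \<in> carrier M \<Longrightarrow> y \<in> carrier N \<Longrightarrow> f x y \<in> carrier P"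
    and "x \<in> carrier M \<Longrightarrow> x' \<in> carrier M \<Longrightarrow> y \<in> carrier N \<Longrightarrow> f (x \<oplus>\<^bsub>M\<^esub> x') y = f x y \<oplus>\<^bsub>P\<^esub> f x' y"
    and "x \<in> carrier M \<Longrightarrow> y \<in> carrier N \<Longrightarrow> y' \<in> carrier N \<Longrightarrow> f x (y \<oplus>\<^bsub>N\<^esub> y') = f x y \<oplus>\<^bsub>P\<^esub> f x y'"
    and "x \<in> carrier M \<Longrightarrow> y \<in> carrier N \<Longrightarrow> f (c \<odot>\<^bsub>M\<^esub> x) y = c \<odot>\<^bsub>P\<^esub> f x y"
    and "x \<in> carrier M \<Longrightarrow> y \<in> carrier N \<Longrightarrow> f x (c \<odot>\<^bsub>N\<^esub> y) = c \<odot>\<^bsub>P\<^esub> f x y"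
  using assms by (auto simp: bilin_def lin_map_def)

text \<open>The linear map on a tensor product induced by a bilinear \<open>f\<close>. The two
  factors need not be mentioned, since a representative carries its own finite support.\<close>

definition tlift :: "(complex, 'c) module \<Rightarrow> ('a \<Rightarrow> 'b \<Rightarrow> 'c) \<Rightarrow> ('a \<times> 'b \<Rightarrow>\<^sub>0 complex) set \<Rightarrow> 'c" where
  "tlift P f t = lext P (\<lambda>(x, y). f x y) (SOME p. p \<in> t)"

text \<open>The generators of \<open>bilinear_relations\<close>, named separately because a map on
  the quotient is well defined once it kills generators of the relation space.\<close>

definition bilin_gens :: "(complex, 'a) module \<Rightarrow> (complex, 'b) module \<Rightarrow> ('a \<times> 'b \<Rightarrow>\<^sub>0 complex) set" where
  "bilin_gens M N =
     {basis_elt (x \<oplus>\<^bsub>M\<^esub> x', y) - basis_elt (x, y) - basis_elt (x', y) | x x' y.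
         x \<in> carrier M \<and> x' \<in> carrier M \<and> y \<in> carrier N} \<union>
      {basis_elt (x, y \<oplus>\<^bsub>N\<^esub> y') - basis_elt (x, y) - basis_elt (x, y') | x y y'.
         x \<in> carrier M \<and> y \<in> carrier N \<and> y' \<in> carrier N} \<union>
      {basis_elt (c \<odot>\<^bsub>M\<^esub> x, y) - pm_scale c (basis_elt (x, y)) | c x y.
         x \<in> carrier M \<and> y \<in> carrier N} \<union>
      {basis_elt (x, c \<odot>\<^bsub>N\<^esub> y) - pm_scale c (basis_elt (x, y)) | c x y.
         x \<in> carrier M \<and> y \<in> carrier N}"

lemma bilinear_relations_span: "bilinear_relations M N = pm.span (bilin_gens M N)"
  by (simp add: bilinear_relations_def bilin_gens_def)

context
  fixes M :: "(complex, 'a) module" and N :: "(complex, 'b) module"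
  assumes M: "cvspace M" and N: "cvspace N"
begin

lemma bilin_gens_closed: "bilin_gens M N \<subseteq> carrier (free_space (carrier M \<times> carrier N))"
  unfolding bilin_gens_def by (intro subsetI, elim UnE CollectE exE conjE) (simp_all add: M N)

private lemmas fs = cvspace_free_space csub_span[OF bilin_gens_closed, folded bilinear_relations_span]

lemma cvspace_tensor: "cvspace (tensor M N)"
  unfolding tensor_def by (rule cvspace_quot_space[OF fs])

lemma tens_closed: "x \<in> carrier M \<Longrightarrow> y \<in> carrier N \<Longrightarrow> tens M N x y \<in> carrier (tensor M N)"
  by (auto simp: tens_def tensor_def carrier_quot_space[OF fs])

lemma tens_lext:
  assumes "Poly_Mapping.keys p \<subseteq> carrier M \<times> carrier N"
  shows "bilinear_relations M N +>\<^bsub>free_space (carrier M \<times> carrier N)\<^esub> p = lext (tensor M N) (\<lambda>(x, y). tens M N x y) p"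
proof -
  have 1: "(\<lambda>(x, y). tens M N x y) \<in> carrier M \<times> carrier N \<rightarrow> carrier (tensor M N)"
    by (auto simp: tens_closed)
  show ?thesis
    by (rule free_space_ext[OF cvspace_tensor coset_linear[OF fs, folded tensor_def] lext_linear[OF cvspace_tensor 1] _ assms])
      (auto simp: lext_single[OF cvspace_tensor 1] tens_def[symmetric] cvspace_tensor tens_closed)
qed

lemma tensor_induct:
  assumes "csub Q (tensor M N)" "\<And>x y. x \<in> carrier M \<Longrightarrow> y \<in> carrier N \<Longrightarrow> tens M N x y \<in> Q" "t \<in> carrier (tensor M N)"
  shows "t \<in> Q"
proof -
  obtain p where p: "Poly_Mapping.keys p \<subseteq> carrier M \<times> carrier N"
    "t = bilinear_relations M N +>\<^bsub>free_space (carrier M \<times> carrier N)\<^esub> p"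
    using assms(3) by (auto simp: tensor_def carrier_quot_space[OF fs])
  show ?thesis unfolding p(2) tens_lext[OF p(1)] lext_def using p(1)
    by (intro csub_finsum[OF cvspace_tensor assms(1)]) (auto intro!: csubD[OF assms(1)] assms(2))
qed

lemma tensor_ext:
  assumes "cvspace P" "lin_map (tensor M N) P f" "lin_map (tensor M N) P g"
    and "\<And>x y. x \<in> carrier M \<Longrightarrow> y \<in> carrier N \<Longrightarrow> f (tens M N x y) = g (tens M N x y)" "t \<in> carrier (tensor M N)"
  shows "f t = g t"
proof -
  have "csub {t \<in> carrier (tensor M N). f t = g t} (tensor M N)"
    using assms cvspace_tensor
    by (intro csubI cvspace_tensor) (auto simp: lin_map_add lin_map_smult lin_map_zero)
  from tensor_induct[OF this _ assms(5)] assms(4) show ?thesis by (simp add: tens_closed)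
qed

text \<open>Scalar form of extensionality. In its uses \<open>f\<close> and \<open>g\<close> are
  built from functionals composed with operators, so that an operator identity on a tensor product
  is checked on pure tensors and as an equation of numbers.\<close>

lemma tensor_lf_ext:
  assumes "lin_functional (tensor M N) f" "lin_functional (tensor M N) g"
    and "\<And>x y. x \<in> carrier M \<Longrightarrow> y \<in> carrier N \<Longrightarrow> f (tens M N x y) = g (tens M N x y)" "t \<in> carrier (tensor M N)"
  shows "f t = g t"
proof -
  have "csub {t \<in> carrier (tensor M N). f t = g t} (tensor M N)"
    using assms cvspace_tensor
    by (intro csubI cvspace_tensor) (auto simp: lf_simps)
  from tensor_induct[OF this _ assms(4)] assms(3) show ?thesis by (simp add: tens_closed)
qed

lemma bilin_tens: "bilin M N (tensor M N) (tens M N)"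
proof -
  let ?F = "free_space (carrier M \<times> carrier N)" and ?R = "bilinear_relations M N"
  have minus: "p \<ominus>\<^bsub>?F\<^esub> q = p - q" if "p \<in> carrier ?F" "q \<in> carrier ?F" for p q
    using that by (simp add: cv_diff_eq[OF cvspace_free_space] poly_mapping_eqI lookup_add lookup_minus)
  have eq: "?R +>\<^bsub>?F\<^esub> p = ?R +>\<^bsub>?F\<^esub> q" if "p - q \<in> bilin_gens M N" "Poly_Mapping.keys p \<subseteq> carrier M \<times> carrier N"
    "Poly_Mapping.keys q \<subseteq> carrier M \<times> carrier N" for p q
    using that by (subst coset_eq_iff[OF fs]) (auto simp: minus bilinear_relations_span intro: pm.span_base)
  have 1: "tens M N (x \<oplus>\<^bsub>M\<^esub> x') y = tens M N x y \<oplus>\<^bsub>tensor M N\<^esub> tens M N x' y"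
    if "x \<in> carrier M" "x' \<in> carrier M" "y \<in> carrier N" for x x' y
  proof -
    have "basis_elt (x \<oplus>\<^bsub>M\<^esub> x', y) - (basis_elt (x, y) + basis_elt (x', y)) \<in> bilin_gens M N"
      unfolding bilin_gens_def diff_diff_add[symmetric] using that by blast
    from eq[OF this] add_quot_space[OF fs, of "basis_elt (x, y)" "basis_elt (x', y)"] that M N show ?thesis by (simp add: tens_def tensor_def)
  qed
  have 2: "tens M N x (y \<oplus>\<^bsub>N\<^esub> y') = tens M N x y \<oplus>\<^bsub>tensor M N\<^esub> tens M N x y'"
    if "x \<in> carrier M" "y \<in> carrier N" "y' \<in> carrier N" for x y y'
  proof -
    have "basis_elt (x, y \<oplus>\<^bsub>N\<^esub> y') - (basis_elt (x, y) + basis_elt (x, y')) \<in> bilin_gens M N"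
      unfolding bilin_gens_def diff_diff_add[symmetric] using that by blast
    from eq[OF this] add_quot_space[OF fs, of "basis_elt (x, y)" "basis_elt (x, y')"] that M N show ?thesis by (simp add: tens_def tensor_def)
  qed
  have 3: "tens M N (c \<odot>\<^bsub>M\<^esub> x) y = c \<odot>\<^bsub>tensor M N\<^esub> tens M N x y"
    if "x \<in> carrier M" "y \<in> carrier N" for c x y
  proof -
    have "basis_elt (c \<odot>\<^bsub>M\<^esub> x, y) - (pm_scale c (basis_elt (x, y))) \<in> bilin_gens M N"
      unfolding bilin_gens_def diff_diff_add[symmetric] using that by blast
    from eq[OF this] smult_quot_space[OF fs, of "basis_elt (x, y)" c] that M N show ?thesis by (simp add: tens_def tensor_def)
  qed
  have 4: "tens M N x (c \<odot>\<^bsub>N\<^esub> y) = c \<odot>\<^bsub>tensor M N\<^esub> tens M N x y"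
    if "x \<in> carrier M" "y \<in> carrier N" for c x y
  proof -
    have "basis_elt (x, c \<odot>\<^bsub>N\<^esub> y) - (pm_scale c (basis_elt (x, y))) \<in> bilin_gens M N"
      unfolding bilin_gens_def diff_diff_add[symmetric] using that by blast
    from eq[OF this] smult_quot_space[OF fs, of "basis_elt (x, y)" c] that M N show ?thesis by (simp add: tens_def tensor_def)
  qed
  show ?thesis using 1 2 3 4 by (simp add: bilin_def lin_map_def tens_closed)
qed

context
  fixes P :: "(complex, 'c) module" and f
  assumes P: "cvspace P" and f: "bilin M N P f"
begin

private lemma fP: "(\<lambda>(x, y). f x y) \<in> carrier M \<times> carrier N \<rightarrow> carrier P"
  using f by (auto simp: bilin_def lin_map_def)

lemma bilin_gens_lext: "r \<in> bilin_gens M N \<Longrightarrow> lext P (\<lambda>(x, y). f x y) r = \<zero>\<^bsub>P\<^esub>"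
proof -
  have fin: "(case k of (x, y) \<Rightarrow> f x y) \<in> carrier P" if "k \<in> carrier M \<times> carrier N" for k
    using that fP by (auto simp: Pi_iff)
  have a: "lext P (\<lambda>(x, y). f x y) (basis_elt a - basis_elt b - basis_elt c) =
      (case a of (x, y) \<Rightarrow> f x y) \<ominus>\<^bsub>P\<^esub> (case b of (x, y) \<Rightarrow> f x y) \<ominus>\<^bsub>P\<^esub> (case c of (x, y) \<Rightarrow> f x y)"
    if "a \<in> carrier M \<times> carrier N" "b \<in> carrier M \<times> carrier N" "c \<in> carrier M \<times> carrier N" for a b c
    using that by (simp add: lext_diff[OF P fP] lext_single[OF P fP] fin P del: mem_Times_iff split_paired_All)
  have b: "lext P (\<lambda>(x, y). f x y) (basis_elt a - pm_scale c (basis_elt b)) =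
      (case a of (x, y) \<Rightarrow> f x y) \<ominus>\<^bsub>P\<^esub> c \<odot>\<^bsub>P\<^esub> (case b of (x, y) \<Rightarrow> f x y)"
    if "a \<in> carrier M \<times> carrier N" "b \<in> carrier M \<times> carrier N" for a b c
    using that by (simp add: lext_diff[OF P fP] lext_single[OF P fP] lext_scale[OF P fP] fin P)
  have z: "u = v \<Longrightarrow> v \<in> carrier P \<Longrightarrow> u \<ominus>\<^bsub>P\<^esub> v = \<zero>\<^bsub>P\<^esub>" for u v
    by (rule functional_eqI[OF P]) (auto simp: P lf_simps)
  have z2: "u \<in> carrier P \<Longrightarrow> v \<in> carrier P \<Longrightarrow> (u \<oplus>\<^bsub>P\<^esub> v) \<ominus>\<^bsub>P\<^esub> u \<ominus>\<^bsub>P\<^esub> v = \<zero>\<^bsub>P\<^esub>" for u v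
    by (rule functional_eqI[OF P]) (auto simp: P lf_simps)
  show "r \<in> bilin_gens M N \<Longrightarrow> lext P (\<lambda>(x, y). f x y) r = \<zero>\<^bsub>P\<^esub>"
    using M N P unfolding bilin_gens_def
    by (elim UnE CollectE exE conjE) (simp_all add: a b bilinD[OF f] z z2)
qed

lemma tlift_linear: "lin_map (tensor M N) P (tlift P f)"
  using lext_some_linear[OF P fP bilin_gens_closed bilinear_relations_span bilin_gens_lext]
  by (simp add: tlift_def[abs_def] tensor_def)

lemma tlift_coset: "Poly_Mapping.keys p \<subseteq> carrier M \<times> carrier N \<Longrightarrow>
   tlift P f (bilinear_relations M N +>\<^bsub>free_space (carrier M \<times> carrier N)\<^esub> p) = lext P (\<lambda>(x, y). f x y) p"
  using lext_some[OF P fP bilin_gens_closed bilinear_relations_span bilin_gens_lext]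
  by (simp add: tlift_def)

lemma tlift_tens: "x \<in> carrier M \<Longrightarrow> y \<in> carrier N \<Longrightarrow> tlift P f (tens M N x y) = f x y"
  using lext_single[OF P fP, of "(x, y)" 1] fP P
  by (simp add: tens_def tlift_coset Pi_iff)

end

end

lemma bilinI:
  assumes "cvspace M" "cvspace N" "cvspace P" "\<And>x y. x \<in> carrier M \<Longrightarrow> y \<in> carrier N \<Longrightarrow> f x y \<in> carrier P"
    and "\<And>l x x' y. lin_functional P l \<Longrightarrow> x \<in> carrier M \<Longrightarrow> x' \<in> carrier M \<Longrightarrow> y \<in> carrier N \<Longrightarrow>
       l (f (x \<oplus>\<^bsub>M\<^esub> x') y) = l (f x y) + l (f x' y)"
    and "\<And>l x y y'. lin_functional P l \<Longrightarrow> x \<in> carrier M \<Longrightarrow> y \<in> carrier N \<Longrightarrow> y' \<in> carrier N \<Longrightarrow>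
       l (f x (y \<oplus>\<^bsub>N\<^esub> y')) = l (f x y) + l (f x y')"
    and "\<And>l c x y. lin_functional P l \<Longrightarrow> x \<in> carrier M \<Longrightarrow> y \<in> carrier N \<Longrightarrow> l (f (c \<odot>\<^bsub>M\<^esub> x) y) = c * l (f x y)"
    and "\<And>l c x y. lin_functional P l \<Longrightarrow> x \<in> carrier M \<Longrightarrow> y \<in> carrier N \<Longrightarrow> l (f x (c \<odot>\<^bsub>N\<^esub> y)) = c * l (f x y)"
  shows "bilin M N P f"
  unfolding bilin_def using assms by (intro conjI ballI lin_mapI) auto

text \<open>\<open>tensor_map\<close> is a union over all representatives of its argument; each of
  them yields the coset computed by \<open>tlift\<close>, so functoriality reduces to the universal
  property.\<close>

lemma tensor_map_tlift:
  assumes "cvspace M" "cvspace N" "cvspace M'" "cvspace N'" "lin_map M M' f" "lin_map N N' h"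
  shows "bilin M N (tensor M' N') (\<lambda>x y. tens M' N' (f x) (h y))"
    and "t \<in> carrier (tensor M N) \<Longrightarrow>
      tensor_map M N M' N' f h t = tlift (tensor M' N') (\<lambda>x y. tens M' N' (f x) (h y)) t"
proof -
  show b: "bilin M N (tensor M' N') (\<lambda>x y. tens M' N' (f x) (h y))"
    using bilin_tens[OF assms(3,4)] assms unfolding bilin_def
    by (auto intro: lin_map_comp[of M M' f] lin_map_comp[of N N' h] simp: lin_map_closed)
  assume "t \<in> carrier (tensor M N)"
  note fs = cvspace_free_space csub_span[OF bilin_gens_closed[OF assms(1,2)], folded bilinear_relations_span]
  note fs' = cvspace_free_space csub_span[OF bilin_gens_closed[OF assms(3,4)], folded bilinear_relations_span]
  let ?X = "carrier M \<times> carrier N" and ?X' = "carrier M' \<times> carrier N'"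
  let ?c = "\<lambda>q. bilinear_relations M' N' +>\<^bsub>free_space ?X'\<^esub>
        (\<Sum>(x, y)\<in>Poly_Mapping.keys q. pm_scale (Poly_Mapping.lookup q (x, y)) (basis_elt (f x, h y)))"
  obtain p where p: "Poly_Mapping.keys p \<subseteq> ?X" "t = bilinear_relations M N +>\<^bsub>free_space ?X\<^esub> p"
    using \<open>t \<in> _\<close> by (auto simp: tensor_def carrier_quot_space[OF fs])
  note P = cvspace_tensor[OF assms(3,4)]
  have g: "(\<lambda>(x, y). tens M' N' (f x) (h y)) \<in> ?X \<rightarrow> carrier (tensor M' N')"
    using assms by (auto simp: tens_closed lin_map_closed)
  have "?c q = lext (tensor M' N') (\<lambda>(x, y). tens M' N' (f x) (h y)) q" if q: "Poly_Mapping.keys q \<subseteq> ?X" for q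
  proof -
    let ?f = "\<lambda>(x, y). pm_scale (Poly_Mapping.lookup q (x, y)) (basis_elt (f x, h y))"
    have f: "?f \<in> Poly_Mapping.keys q \<rightarrow> carrier (free_space ?X')"
    proof safe
      fix x y assume "(x, y) \<in> Poly_Mapping.keys q"
      then have "(f x, h y) \<in> ?X'" using q assms by (auto simp: lin_map_closed)
      then show "pm_scale (Poly_Mapping.lookup q (x, y)) (basis_elt (f x, h y)) \<in> carrier (free_space ?X')"
        using keys_pm_scale[of "Poly_Mapping.lookup q (x, y)" "basis_elt (f x, h y)"] by auto
    qed
    have "?c q = finsum (tensor M' N') (\<lambda>k. bilinear_relations M' N' +>\<^bsub>free_space ?X'\<^esub> ?f k) (Poly_Mapping.keys q)"
      using lin_map_finsum[OF cvspace_free_space P coset_linear[OF fs', folded tensor_def] f]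
      by (simp add: finsum_free_space[OF f])
    also have "\<dots> = lext (tensor M' N') (\<lambda>(x, y). tens M' N' (f x) (h y)) q"
      unfolding lext_def
    proof (rule abelian_monoid.finsum_cong'[OF abelian_group.axioms(1)[OF cv_abelian_group[OF P]]])
      show "(\<lambda>x. Poly_Mapping.lookup q x \<odot>\<^bsub>tensor M' N'\<^esub> (case x of (x, y) \<Rightarrow> tens M' N' (f x) (h y))) \<in> Poly_Mapping.keys q \<rightarrow> carrier (tensor M' N')"
        using q P assms by (auto simp: tens_closed lin_map_closed)
      fix k assume "k \<in> Poly_Mapping.keys q"
      then obtain x y where k: "k = (x, y)" "x \<in> carrier M" "y \<in> carrier N" using q by (cases k) auto
      then have "basis_elt (f x, h y) \<in> carrier (free_space ?X')" using assms by (auto simp: lin_map_closed)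
      from smult_quot_space[OF fs' this] k
      show "bilinear_relations M' N' +>\<^bsub>free_space ?X'\<^esub> ?f k = Poly_Mapping.lookup q k \<odot>\<^bsub>tensor M' N'\<^esub> (case k of (x, y) \<Rightarrow> tens M' N' (f x) (h y))"
        by (simp add: tens_def tensor_def)
    qed simp
    finally show ?thesis .
  qed
  moreover have "Poly_Mapping.keys q \<subseteq> ?X \<and> lext (tensor M' N') (\<lambda>(x, y). tens M' N' (f x) (h y)) q = tlift (tensor M' N') (\<lambda>x y. tens M' N' (f x) (h y)) t"
    if "q \<in> t" for q
    using lext_coset_rep[OF P g bilin_gens_closed[OF assms(1,2)] bilinear_relations_span bilin_gens_lext[OF assms(1,2) P b] p(1)] that p
      tlift_coset[OF assms(1,2) P b p(1)] by simp
  moreover have "p \<in> t" using coset_self[OF fs] p by simp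
  ultimately show "tensor_map M N M' N' f h t = tlift (tensor M' N') (\<lambda>x y. tens M' N' (f x) (h y)) t"
    unfolding tensor_map_def by auto
qed

lemma lin_map_cong: "(\<And>x. x \<in> carrier M \<Longrightarrow> f x = g x) \<Longrightarrow> cvspace M \<Longrightarrow> lin_map M N f \<longleftrightarrow> lin_map M N g"
  by (auto simp: lin_map_def Pi_iff)

lemma tensor_map_linear:
  assumes "cvspace M" "cvspace N" "cvspace M'" "cvspace N'" "lin_map M M' f" "lin_map N N' h"
  shows "lin_map (tensor M N) (tensor M' N') (tensor_map M N M' N' f h)"
  using tlift_linear[OF assms(1,2) cvspace_tensor[OF assms(3,4)] tensor_map_tlift(1)[OF assms]]
  by (subst lin_map_cong[OF tensor_map_tlift(2)[OF assms]]) (auto simp: cvspace_tensor assms)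

lemma tensor_map_tens:
  assumes "cvspace M" "cvspace N" "cvspace M'" "cvspace N'" "lin_map M M' f" "lin_map N N' h" "x \<in> carrier M" "y \<in> carrier N"
  shows "tensor_map M N M' N' f h (tens M N x y) = tens M' N' (f x) (h y)"
  using tensor_map_tlift[OF assms(1-6)] assms by (simp add: tlift_tens cvspace_tensor tens_closed)

section \<open>Actions of presented algebras\<close>

lemma letters_plus [simp]: "letters (u + v) = letters u @ letters v" "letters 0 = []"
  by (simp_all add: plus_word_def zero_word_def)

lemma words_plus: "u \<in> words X \<Longrightarrow> v \<in> words X \<Longrightarrow> u + v \<in> words X"
  by (simp add: words_def)

lemma pm_scale_conv_mult: "pm_scale c p = Poly_Mapping.single 0 c * (p :: 'x word \<Rightarrow>\<^sub>0 complex)"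
  by (simp add: pm_scale_def mult_map_scale_conv_mult)

lemma pm_scale_mult: "pm_scale c (p * q) = pm_scale c p * (q :: 'x word \<Rightarrow>\<^sub>0 complex)"
  by (simp add: pm_scale_conv_mult mult.assoc)

lemma basis_elt_mult_pm_scale: "basis_elt u * pm_scale c q = pm_scale c (basis_elt u * (q :: 'x word \<Rightarrow>\<^sub>0 complex))"
  by (simp add: pm_scale_conv_mult mult.assoc[symmetric] mult_single)

lemma keys_mult_words:
  assumes "Poly_Mapping.keys p \<subseteq> words X" "Poly_Mapping.keys q \<subseteq> words X"
  shows "Poly_Mapping.keys (p * q) \<subseteq> words X"
proof
  fix w assume "w \<in> Poly_Mapping.keys (p * q)"
  then obtain u v where "u \<in> Poly_Mapping.keys p" "v \<in> Poly_Mapping.keys q" "w = u + v"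
    using subsetD[OF keys_mult[of p q]] by blast
  then show "w \<in> words X" using assms by (simp add: words_plus subset_iff)
qed

lemma lin_map_foldr:
  assumes "\<And>x. x \<in> X \<Longrightarrow> lin_map M M (\<rho> x)" "set w \<subseteq> X"
  shows "lin_map M M (foldr \<rho> w)"
  using assms(2)
proof (induction w)
  case Nil
  show ?case using lin_map_id(1)[of M] by (simp only: foldr.simps)
next
  case (Cons x w)
  then have "x \<in> X" "lin_map M M (foldr \<rho> w)" by simp_all
  from lin_map_comp[OF this(2) assms(1)[OF this(1)]] show ?case by (simp only: foldr.simps o_def)
qed

context
  fixes X :: "'x set" and M :: "(complex, 'm) module" and \<rho>
  assumes M: "cvspace M" and \<rho>: "\<And>x. x \<in> X \<Longrightarrow> lin_map M M (\<rho> x)"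
begin

private abbreviation "act m \<equiv> lext M (\<lambda>w. foldr \<rho> (letters w) m)"

lemma foldr_closed: "set w \<subseteq> X \<Longrightarrow> m \<in> carrier M \<Longrightarrow> foldr \<rho> w m \<in> carrier M"
  using lin_map_closed[OF lin_map_foldr[of X M \<rho> w]] \<rho> by blast

private lemma fM: "m \<in> carrier M \<Longrightarrow> (\<lambda>w. foldr \<rho> (letters w) m) \<in> words X \<rightarrow> carrier M"
  by (auto simp: words_def foldr_closed)

text \<open>Compatibility of the action with multiplication in the free algebra. It lets the
  vanishing of the relations pass to products \<open>p * r * q\<close>, hence to the two-sided
  ideal. The right factor is reduced to words first, for a single word on the left; then the left
  factor is extended linearly.\<close>

lemma act_mult:
  assumes m: "m \<in> carrier M" and p: "Poly_Mapping.keys p \<subseteq> words X" and q: "Poly_Mapping.keys q \<subseteq> words X"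
  shows "act m (p * q) = act (act m q) p"
proof -
  have lin: "lin_map (free_space (words X)) M (act m)" if "m \<in> carrier M" for m
    using lext_linear[OF M fM[OF that]] .
  have 1: "act m (basis_elt u * q) = foldr \<rho> (letters u) (act m q)"
    if u: "u \<in> words X" and q: "Poly_Mapping.keys q \<subseteq> words X" for u q
  proof (rule free_space_ext[OF M _ _ _ q])
    have "lin_map (free_space (words X)) (free_space (words X)) (\<lambda>q. basis_elt u * q)"
      using u by (simp add: lin_map_def distrib_left basis_elt_mult_pm_scale keys_mult_words)
    from lin_map_comp[OF this lin[OF m]]
    show "lin_map (free_space (words X)) M (\<lambda>q. act m (basis_elt u * q))" .
    show "lin_map (free_space (words X)) M (\<lambda>q. foldr \<rho> (letters u) (act m q))"
      using u by (intro lin_map_comp[OF lin[OF m]] lin_map_foldr[of X] \<rho>) (auto simp: words_def)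
    fix v assume v: "v \<in> words X"
    then show "act m (basis_elt u * basis_elt v) = foldr \<rho> (letters u) (act m (basis_elt v))"
      using u M m by (simp add: mult_single lext_single[OF M fM[OF m]] words_plus foldr_closed words_def)
  qed
  show ?thesis
  proof (rule free_space_ext[OF M _ _ _ p])
    have "lin_map (free_space (words X)) (free_space (words X)) (\<lambda>p. p * q)"
      using q by (simp add: lin_map_def distrib_right pm_scale_mult keys_mult_words)
    from lin_map_comp[OF this lin[OF m]] show "lin_map (free_space (words X)) M (\<lambda>p. act m (p * q))" .
    have am: "act m q \<in> carrier M" using lext_closed[OF M fM[OF m] q] .
    show "lin_map (free_space (words X)) M (act (act m q))" using lin[OF am] .
    fix u assume u: "u \<in> words X"
    then show "act m (basis_elt u * q) = act (act m q) (basis_elt u)"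
      using 1[OF u q] M am by (simp add: lext_single[OF M fM[OF am]] foldr_closed words_def)
  qed
qed

context
  fixes R :: "('x word \<Rightarrow>\<^sub>0 complex) set"
  assumes R: "R \<subseteq> carrier (free_space (words X))" and zero: "\<And>r m. r \<in> R \<Longrightarrow> m \<in> carrier M \<Longrightarrow> act m r = \<zero>\<^bsub>M\<^esub>"
begin

private abbreviation "gens \<equiv> {p * r * q | p r q. r \<in> R \<and> p \<in> carrier (free_space (words X)) \<and> q \<in> carrier (free_space (words X))}"

private lemma gens: "gens \<subseteq> carrier (free_space (words X))"
proof -
  have "Poly_Mapping.keys r \<subseteq> words X" if "r \<in> R" for r using that R by auto
  then show ?thesis by (intro subsetI, elim CollectE exE conjE) (simp add: keys_mult_words)
qed

private lemma ideal: "two_sided_ideal X R = pm.span gens"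
  by (simp add: two_sided_ideal_def)

private lemmas fsw = cvspace_free_space csub_span[OF gens, folded ideal]

text \<open>In \<open>p * s * q\<close> the factor \<open>q\<close> acts first, the relation
  \<open>s\<close> kills whatever vector results, and \<open>p\<close> then acts on zero. This is
  why vanishing of relations is assumed on all vectors at once.\<close>

private lemma zero_gens: "m \<in> carrier M \<Longrightarrow> r \<in> gens \<Longrightarrow> act m r = \<zero>\<^bsub>M\<^esub>"
proof -
  assume m: "m \<in> carrier M" and "r \<in> gens"
  then obtain p s q where r: "r = p * s * q" "s \<in> R" "Poly_Mapping.keys p \<subseteq> words X" "Poly_Mapping.keys q \<subseteq> words X"
    by auto
  then have s: "Poly_Mapping.keys s \<subseteq> words X" using R by auto
  have am: "act m q \<in> carrier M" using lext_closed[OF M fM[OF m]] r by blast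
  have "act m (p * s * q) = act (act m q) (p * s)" using r s m by (intro act_mult keys_mult_words)
  also have "\<dots> = act (act (act m q) s) p" using r s am by (intro act_mult)
  also have "\<dots> = act \<zero>\<^bsub>M\<^esub> p" using zero[OF r(2) am] by simp
  also have "\<dots> = \<zero>\<^bsub>M\<^esub>"
  proof -
    have "foldr \<rho> (letters w) \<zero>\<^bsub>M\<^esub> = \<zero>\<^bsub>M\<^esub>" if "w \<in> words X" for w
      using lin_map_zero[OF M M lin_map_foldr[of X M \<rho> "letters w"]] that \<rho> by (simp add: words_def)
    then show ?thesis unfolding lext_def using r(3) M
      by (subst abelian_monoid.finsum_cong'[OF abelian_group.axioms(1)[OF cv_abelian_group[OF M]] refl, of "\<lambda>_. \<zero>\<^bsub>M\<^esub>"])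
        (auto simp: subset_iff abelian_monoid.finsum_zero abelian_group.axioms(1) cv_abelian_group)
  qed
  finally show ?thesis using r by simp
qed

lemma cvspace_presented_algebra: "cvspace (presented_algebra X R)"
  unfolding presented_algebra_def by (rule cvspace_quot_space[OF fsw])

lemma gen_prod_closed: "set w \<subseteq> X \<Longrightarrow> gen_prod X R w \<in> carrier (presented_algebra X R)"
  unfolding gen_prod_def presented_algebra_def carrier_quot_space[OF fsw]
  by (intro imageI) (simp add: words_def)

lemma alg_act_lext: "alg_act M \<rho> u m = act m (SOME p. p \<in> u)"
  by (simp add: alg_act_def lext_def Let_def)

lemma alg_act_linear_left: "m \<in> carrier M \<Longrightarrow> lin_map (presented_algebra X R) M (\<lambda>u. alg_act M \<rho> u m)"
  unfolding alg_act_lext presented_algebra_def by (rule lext_some_linear[OF M fM gens ideal zero_gens])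

lemma alg_act_gen_prod:
  assumes "set w \<subseteq> X" and m: "m \<in> carrier M"
  shows "alg_act M \<rho> (gen_prod X R w) m = foldr \<rho> w m"
proof -
  have w: "Word w \<in> words X" using assms by (simp add: words_def)
  have "alg_act M \<rho> (gen_prod X R w) m = act m (basis_elt (Word w))"
    unfolding alg_act_lext gen_prod_def
    by (rule lext_some[OF M fM[OF m] gens ideal zero_gens[OF m]]) (use w in simp_all)
  also have "\<dots> = foldr \<rho> w m"
    using assms by (simp add: lext_single[OF M fM[OF m] w] M foldr_closed)
  finally show ?thesis .
qed

text \<open>The representative in the definition is chosen for the algebra element alone. With one
  representative \<open>p\<close> fixed for all vectors, linearity is inherited from the
  words.\<close>

lemma alg_act_linear:
  assumes "u \<in> carrier (presented_algebra X R)"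
  shows "lin_map M M (alg_act M \<rho> u)"
proof -
  obtain p where p: "Poly_Mapping.keys p \<subseteq> words X" "u = two_sided_ideal X R +>\<^bsub>free_space (words X)\<^esub> p"
    using assms by (auto simp: presented_algebra_def carrier_quot_space[OF fsw])
  have eq: "alg_act M \<rho> u m = act m p" if "m \<in> carrier M" for m
    unfolding alg_act_lext p(2) by (rule lext_some[OF M fM[OF that] gens ideal zero_gens[OF that] p(1)])
  have l: "l (act m p) = (\<Sum>w\<in>Poly_Mapping.keys p. Poly_Mapping.lookup p w * l (foldr \<rho> (letters w) m))"
    if l: "lin_functional M l" and m: "m \<in> carrier M" for l m
  proof -
    have c: "foldr \<rho> (letters w) m \<in> carrier M" if "w \<in> Poly_Mapping.keys p" for w
      using that p(1) m by (auto simp: words_def foldr_closed)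
    then have "(\<lambda>w. Poly_Mapping.lookup p w \<odot>\<^bsub>M\<^esub> foldr \<rho> (letters w) m) \<in> Poly_Mapping.keys p \<rightarrow> carrier M" using M by auto
    from lf_finsum[OF M l this] c show ?thesis unfolding lext_def by (auto simp: lf_smult[OF l])
  qed
  have lin: "lin_map M M (foldr \<rho> (letters w))" if "w \<in> Poly_Mapping.keys p" for w
    using that p(1) \<rho> by (intro lin_map_foldr[of X]) (auto simp: words_def)
  show ?thesis
  proof (rule lin_mapI[OF M M])
    fix x assume "x \<in> carrier M" then show "alg_act M \<rho> u x \<in> carrier M"
      using lext_closed[OF M fM p(1)] eq by simp
  next
    fix l x y assume *: "lin_functional M l" "x \<in> carrier M" "y \<in> carrier M"
    then show "l (alg_act M \<rho> u (x \<oplus>\<^bsub>M\<^esub> y)) = l (alg_act M \<rho> u x) + l (alg_act M \<rho> u y)"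
      using M lf_add[OF lf_comp[OF lin *(1)]]
      by (simp add: eq l[OF *(1)] distrib_left sum.distrib)
  next
    fix l c x assume *: "lin_functional M l" "x \<in> carrier M"
    then show "l (alg_act M \<rho> u (c \<odot>\<^bsub>M\<^esub> x)) = c * l (alg_act M \<rho> u x)"
      using M lf_smult[OF lf_comp[OF lin *(1)]]
      by (simp add: eq l[OF *(1)] sum_distrib_left algebra_simps)
  qed
qed

end

end

section \<open>Enveloping and Clifford algebra actions\<close>

interpretation cs: vector_space "cscale :: complex \<Rightarrow> 'l::real_vector \<times> 'l \<Rightarrow> 'l \<times> 'l"
  by standard (simp_all add: cscale_def algebra_simps prod_eq_iff)

lemma gen_mult: "gen x * gen y = basis_elt (Word [x, y])"
  by (simp add: mult_single plus_word_def)

lemma one_basis_elt: "(1 :: 'x word \<Rightarrow>\<^sub>0 complex) = basis_elt (Word [])"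
  by (metis single_one zero_word_def)

lemma generators_actD:
  assumes "generators_act X M \<rho>"
  shows "cvspace M" "x \<in> X \<Longrightarrow> lin_map M M (\<rho> x)" "x \<in> X \<Longrightarrow> m \<in> carrier M \<Longrightarrow> \<rho> x m \<in> carrier M"
    "x \<in> X \<Longrightarrow> y \<in> X \<Longrightarrow> m \<in> carrier M \<Longrightarrow> \<rho> (x + y) m = \<rho> x m \<oplus>\<^bsub>M\<^esub> \<rho> y m"
    "x \<in> X \<Longrightarrow> m \<in> carrier M \<Longrightarrow> \<rho> (cscale c x) m = c \<odot>\<^bsub>M\<^esub> \<rho> x m"
  using assms by (auto simp: generators_act_def lin_map_def)

context
  fixes br :: "'l::euclidean_space \<Rightarrow> 'l \<Rightarrow> 'l" and X :: "('l \<times> 'l) set" and M \<rho>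
  assumes X: "csubspace X" and act: "generators_act X M \<rho>"
begin

private lemma f1: "m \<in> carrier M \<Longrightarrow> (\<lambda>w. foldr \<rho> (letters w) m) \<in> words X \<rightarrow> carrier M"
  using foldr_closed[OF generators_actD(1,2)[OF act]] by (auto simp: words_def)

private lemma ws_in: "Word w \<in> words X \<longleftrightarrow> set w \<subseteq> X"
  by (simp add: words_def)

private lemmas lx = lext_diff[OF generators_actD(1)[OF act] f1] lext_add[OF generators_actD(1)[OF act] f1] lext_scale[OF generators_actD(1)[OF act] f1]
  lext_single[OF generators_actD(1)[OF act] f1]

private lemma z1: "u = v \<Longrightarrow> v \<in> carrier M \<Longrightarrow> u \<ominus>\<^bsub>M\<^esub> v = \<zero>\<^bsub>M\<^esub>"
  by (rule functional_eqI[OF generators_actD(1)[OF act]]) (auto simp: generators_actD(1)[OF act] lf_simps)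

private lemma z2: "u \<in> carrier M \<Longrightarrow> v \<in> carrier M \<Longrightarrow> (u \<oplus>\<^bsub>M\<^esub> v) \<ominus>\<^bsub>M\<^esub> u \<ominus>\<^bsub>M\<^esub> v = \<zero>\<^bsub>M\<^esub>"
  by (rule functional_eqI[OF generators_actD(1)[OF act]]) (auto simp: generators_actD(1)[OF act] lf_simps)

lemma linearity_relations_closed: "linearity_relations X \<subseteq> carrier (free_space (words X))"
  unfolding linearity_relations_def using X
  by (intro subsetI, elim UnE CollectE exE conjE) (simp_all add: ws_in cs.subspace_add cs.subspace_scale)

lemma linearity_relations_zero:
  "r \<in> linearity_relations X \<Longrightarrow> m \<in> carrier M \<Longrightarrow> lext M (\<lambda>w. foldr \<rho> (letters w) m) r = \<zero>\<^bsub>M\<^esub>"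
  unfolding linearity_relations_def using X
  by (elim UnE CollectE exE conjE)
    (simp_all add: ws_in cs.subspace_add cs.subspace_scale lx generators_actD[OF act] z1 z2)

lemma U_relations_closed: "subalgebra br X \<Longrightarrow> U_relations br X \<subseteq> carrier (free_space (words X))"
  unfolding U_relations_def gen_mult subalgebra_def
  by (intro Un_least linearity_relations_closed subsetI, elim CollectE exE conjE) (simp add: ws_in)

lemma Cl_relations_closed: "Cl_relations br X \<subseteq> carrier (free_space (words X))"
  unfolding Cl_relations_def gen_mult one_basis_elt
  by (intro Un_least linearity_relations_closed subsetI, elim CollectE exE conjE) (simp add: ws_in)

lemma U_relations_zero:
  assumes "lie_module br X M \<rho>" "subalgebra br X" "r \<in> U_relations br X" "m \<in> carrier M"
  shows "lext M (\<lambda>w. foldr \<rho> (letters w) m) r = \<zero>\<^bsub>M\<^esub>"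
proof -
  have *: "lext M (\<lambda>w. foldr \<rho> (letters w) m) (gen x * gen y - gen y * gen x - gen (cbr br x y)) = \<zero>\<^bsub>M\<^esub>"
    if xy: "x \<in> X" "y \<in> X" for x y
  proof -
    have c: "cbr br x y \<in> X" using assms(2) xy by (simp add: subalgebra_def)
    have "\<rho> (cbr br x y) m = \<rho> x (\<rho> y m) \<ominus>\<^bsub>M\<^esub> \<rho> y (\<rho> x m)"
      using assms xy by (simp add: lie_module_def)
    then show ?thesis using xy c assms(4)
      by (simp add: gen_mult lx ws_in generators_actD[OF act] z1)
  qed
  from assms(3) show ?thesis unfolding U_relations_def
    by (elim UnE CollectE exE conjE) (simp_all only: * linearity_relations_zero assms(4))
qed

lemma Cl_relations_zero:
  assumes "clifford_module br X M \<rho>" "r \<in> Cl_relations br X" "m \<in> carrier M"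
  shows "lext M (\<lambda>w. foldr \<rho> (letters w) m) r = \<zero>\<^bsub>M\<^esub>"
proof -
  have *: "lext M (\<lambda>w. foldr \<rho> (letters w) m) (gen x * gen y + gen y * gen x - pm_scale (2 * killing br x y) 1) = \<zero>\<^bsub>M\<^esub>"
    if xy: "x \<in> X" "y \<in> X" for x y
  proof -
    have "\<rho> x (\<rho> y m) \<oplus>\<^bsub>M\<^esub> \<rho> y (\<rho> x m) = (2 * killing br x y) \<odot>\<^bsub>M\<^esub> m"
      using assms xy by (simp add: clifford_module_def)
    then show ?thesis using xy assms(3)
      by (simp add: gen_mult one_basis_elt lx ws_in generators_actD[OF act] z1)
  qed
  from assms(2) show ?thesis unfolding Cl_relations_def
    by (elim UnE CollectE exE conjE) (simp_all only: * linearity_relations_zero assms(3))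
qed

end

context
  fixes br :: "'l::euclidean_space \<Rightarrow> 'l \<Rightarrow> 'l" and \<aa> \<bb> M \<rho> S \<gamma> W
  assumes sub: "subalgebra br \<aa>" and M: "lie_module br \<aa> M \<rho>" and W: "W = orth br \<aa> \<bb>" "csubspace W"
    and S: "clifford_module br W S \<gamma>"
begin

private lemma aS: "csubspace \<aa>" "generators_act \<aa> M \<rho>" "generators_act W S \<gamma>"
  using sub M S by (simp_all add: subalgebra_def lie_module_def clifford_module_def)

private lemma cv: "cvspace M" "cvspace S"
  using generators_actD(1) aS by auto

private lemmas U = cv(1) generators_actD(2)[OF aS(2)] U_relations_closed[OF aS(1,2) sub] U_relations_zero[OF aS(1,2) M sub]
private lemmas Cl = cv(2) generators_actD(2)[OF aS(3)] Cl_relations_closed[OF W(2) aS(3)] Cl_relations_zero[OF W(2) aS(3) S]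

private lemma UCv: "cvspace (U_alg br \<aa>)" "cvspace (Cl_alg br W)"
  using cvspace_presented_algebra[OF U] cvspace_presented_algebra[OF Cl] by auto

private abbreviation "UCW \<equiv> tensor (U_alg br \<aa>) (Cl_alg br W)"

lemma tensor_act_bilin:
  assumes z: "z \<in> carrier (tensor M S)"
  shows "bilin (U_alg br \<aa>) (Cl_alg br W) (tensor M S)
    (\<lambda>u c. tensor_map M S M S (alg_act M \<rho> u) (alg_act S \<gamma> c) z)"
proof -
  have lin: "lin_map (tensor M S) (tensor M S) (tensor_map M S M S (alg_act M \<rho> u) (alg_act S \<gamma> c))"
    if "u \<in> carrier (U_alg br \<aa>)" "c \<in> carrier (Cl_alg br W)" for u c
    using that by (intro tensor_map_linear cv alg_act_linear[OF U] alg_act_linear[OF Cl])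
  have val: "tensor_map M S M S (alg_act M \<rho> u) (alg_act S \<gamma> c) (tens M S m s) = tens M S (alg_act M \<rho> u m) (alg_act S \<gamma> c s)"
    if "u \<in> carrier (U_alg br \<aa>)" "c \<in> carrier (Cl_alg br W)" "m \<in> carrier M" "s \<in> carrier S" for u c m s
    using that by (intro tensor_map_tens cv alg_act_linear[OF U] alg_act_linear[OF Cl])
  have cl: "alg_act M \<rho> u m \<in> carrier M" "alg_act S \<gamma> c s \<in> carrier S"
    if "u \<in> carrier (U_alg br \<aa>)" "c \<in> carrier (Cl_alg br W)" "m \<in> carrier M" "s \<in> carrier S" for u c m s
    using that lin_map_closed[OF alg_act_linear[OF U]] lin_map_closed[OF alg_act_linear[OF Cl]] by auto
  \<comment> \<open>The combination with two coefficients serves all four bilinearity clauses below: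
    coefficients \<open>1, 1\<close> for sums and \<open>a, 0\<close> for scalar multiples.\<close>
  have lfc: "lin_functional (tensor M S) (\<lambda>z. a * l (f z) + b * l (g z))"
    if "lin_functional (tensor M S) l" "lin_map (tensor M S) (tensor M S) f" "lin_map (tensor M S) (tensor M S) g" for l f g a b
    using lf_comp[OF that(2,1)] lf_comp[OF that(3,1)] by (simp add: lin_functional_def algebra_simps)
  note bt = bilinD[OF bilin_tens[OF cv]]
  note al = lin_map_add[OF alg_act_linear_left[OF U]] lin_map_smult[OF alg_act_linear_left[OF U]]
    lin_map_add[OF alg_act_linear_left[OF Cl]] lin_map_smult[OF alg_act_linear_left[OF Cl]]
  show ?thesis
  proof (rule bilinI[OF UCv cvspace_tensor[OF cv]])
    fix u c assume uc: "u \<in> carrier (U_alg br \<aa>)" "c \<in> carrier (Cl_alg br W)"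
    show "tensor_map M S M S (alg_act M \<rho> u) (alg_act S \<gamma> c) z \<in> carrier (tensor M S)"
      using lin_map_closed[OF lin[OF uc] z] .
    fix l assume l: "lin_functional (tensor M S) l"
    { fix u' assume u': "u' \<in> carrier (U_alg br \<aa>)"
      have "l (tensor_map M S M S (alg_act M \<rho> (u \<oplus>\<^bsub>U_alg br \<aa>\<^esub> u')) (alg_act S \<gamma> c) z) =
         1 * l (tensor_map M S M S (alg_act M \<rho> u) (alg_act S \<gamma> c) z) + 1 * l (tensor_map M S M S (alg_act M \<rho> u') (alg_act S \<gamma> c) z)"
        using uc u' by (intro tensor_lf_ext[OF cv lf_comp[OF lin l] lfc[OF l lin lin] _ z])
          (simp_all add: UCv val al cl bt lf_add[OF l] tens_closed[OF cv])
      then show "l (tensor_map M S M S (alg_act M \<rho> (u \<oplus>\<^bsub>U_alg br \<aa>\<^esub> u')) (alg_act S \<gamma> c) z) =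
         l (tensor_map M S M S (alg_act M \<rho> u) (alg_act S \<gamma> c) z) + l (tensor_map M S M S (alg_act M \<rho> u') (alg_act S \<gamma> c) z)" by simp }
    { fix c' assume c': "c' \<in> carrier (Cl_alg br W)"
      have "l (tensor_map M S M S (alg_act M \<rho> u) (alg_act S \<gamma> (c \<oplus>\<^bsub>Cl_alg br W\<^esub> c')) z) =
         1 * l (tensor_map M S M S (alg_act M \<rho> u) (alg_act S \<gamma> c) z) + 1 * l (tensor_map M S M S (alg_act M \<rho> u) (alg_act S \<gamma> c') z)"
        using uc c' by (intro tensor_lf_ext[OF cv lf_comp[OF lin l] lfc[OF l lin lin] _ z])
          (simp_all add: UCv val al cl bt lf_add[OF l] tens_closed[OF cv])
      then show "l (tensor_map M S M S (alg_act M \<rho> u) (alg_act S \<gamma> (c \<oplus>\<^bsub>Cl_alg br W\<^esub> c')) z) =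
         l (tensor_map M S M S (alg_act M \<rho> u) (alg_act S \<gamma> c) z) + l (tensor_map M S M S (alg_act M \<rho> u) (alg_act S \<gamma> c') z)" by simp }
    fix a
    have "l (tensor_map M S M S (alg_act M \<rho> (a \<odot>\<^bsub>U_alg br \<aa>\<^esub> u)) (alg_act S \<gamma> c) z) =
         a * l (tensor_map M S M S (alg_act M \<rho> u) (alg_act S \<gamma> c) z) + 0 * l (tensor_map M S M S (alg_act M \<rho> u) (alg_act S \<gamma> c) z)"
      using uc by (intro tensor_lf_ext[OF cv lf_comp[OF lin l] lfc[OF l lin lin] _ z])
          (simp_all add: UCv val al cl bt lf_smult[OF l] tens_closed[OF cv])
    then show "l (tensor_map M S M S (alg_act M \<rho> (a \<odot>\<^bsub>U_alg br \<aa>\<^esub> u)) (alg_act S \<gamma> c) z) =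
         a * l (tensor_map M S M S (alg_act M \<rho> u) (alg_act S \<gamma> c) z)" by simp
    have "l (tensor_map M S M S (alg_act M \<rho> u) (alg_act S \<gamma> (a \<odot>\<^bsub>Cl_alg br W\<^esub> c)) z) =
         a * l (tensor_map M S M S (alg_act M \<rho> u) (alg_act S \<gamma> c) z) + 0 * l (tensor_map M S M S (alg_act M \<rho> u) (alg_act S \<gamma> c) z)"
      using uc by (intro tensor_lf_ext[OF cv lf_comp[OF lin l] lfc[OF l lin lin] _ z])
          (simp_all add: UCv val al cl bt lf_smult[OF l] tens_closed[OF cv])
    then show "l (tensor_map M S M S (alg_act M \<rho> u) (alg_act S \<gamma> (a \<odot>\<^bsub>Cl_alg br W\<^esub> c)) z) =
         a * l (tensor_map M S M S (alg_act M \<rho> u) (alg_act S \<gamma> c) z)" by simp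
  qed
qed

lemma tensor_act_tlift:
  "tensor_act M \<rho> S \<gamma> t z = tlift (tensor M S) (\<lambda>u c. tensor_map M S M S (alg_act M \<rho> u) (alg_act S \<gamma> c) z) t"
  unfolding tensor_act_def tlift_def lext_def Let_def by (simp add: case_prod_unfold)

lemma tensor_act_linear_left:
  "z \<in> carrier (tensor M S) \<Longrightarrow> lin_map UCW (tensor M S) (\<lambda>t. tensor_act M \<rho> S \<gamma> t z)"
  using tlift_linear[OF UCv cvspace_tensor[OF cv] tensor_act_bilin] by (simp add: tensor_act_tlift)

lemma tensor_act_tens:
  assumes "u \<in> carrier (U_alg br \<aa>)" "c \<in> carrier (Cl_alg br W)" "m \<in> carrier M" "s \<in> carrier S"
  shows "tensor_act M \<rho> S \<gamma> (tens (U_alg br \<aa>) (Cl_alg br W) u c) (tens M S m s) = tens M S (alg_act M \<rho> u m) (alg_act S \<gamma> c s)"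
  using tlift_tens[OF UCv cvspace_tensor[OF cv] tensor_act_bilin[OF tens_closed[OF cv assms(3,4)]] assms(1,2)]
    tensor_map_tens[OF cv cv alg_act_linear[OF U assms(1)] alg_act_linear[OF Cl assms(2)] assms(3,4)]
  by (simp add: tensor_act_tlift)

text \<open>Induction on \<open>t\<close> in the tensor product of the algebras: the elements that
  act linearly form a subspace, and a pure tensor acts by \<open>tensor_map\<close>.\<close>

lemma tensor_act_linear:
  assumes t: "t \<in> carrier UCW"
  shows "lin_map (tensor M S) (tensor M S) (tensor_act M \<rho> S \<gamma> t)"
proof -
  let ?Q = "{t \<in> carrier UCW. lin_map (tensor M S) (tensor M S) (tensor_act M \<rho> S \<gamma> t)}"
  note T = cvspace_tensor[OF cv] and UT = cvspace_tensor[OF UCv]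
  have cl: "tensor_act M \<rho> S \<gamma> t z \<in> carrier (tensor M S)" if "t \<in> carrier UCW" "z \<in> carrier (tensor M S)" for t z
    using lin_map_closed[OF tensor_act_linear_left[OF that(2)] that(1)] .
  have "csub ?Q UCW"
  proof (rule csubI[OF UT])
    have "lin_map (tensor M S) (tensor M S) (tensor_act M \<rho> S \<gamma> \<zero>\<^bsub>UCW\<^esub>)"
      using lin_map_zero[OF UT T tensor_act_linear_left] T by (simp add: lin_map_def)
    then show "\<zero>\<^bsub>UCW\<^esub> \<in> ?Q" using UT by simp
  next
    fix t u assume "t \<in> ?Q" "u \<in> ?Q"
    then have *: "t \<in> carrier UCW" "u \<in> carrier UCW" and l: "lin_map (tensor M S) (tensor M S) (tensor_act M \<rho> S \<gamma> t)"
      "lin_map (tensor M S) (tensor M S) (tensor_act M \<rho> S \<gamma> u)" by auto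
    have eq: "tensor_act M \<rho> S \<gamma> (t \<oplus>\<^bsub>UCW\<^esub> u) z = tensor_act M \<rho> S \<gamma> t z \<oplus>\<^bsub>tensor M S\<^esub> tensor_act M \<rho> S \<gamma> u z"
      if "z \<in> carrier (tensor M S)" for z
      using lin_map_add[OF tensor_act_linear_left[OF that] *] .
    have "lin_map (tensor M S) (tensor M S) (tensor_act M \<rho> S \<gamma> (t \<oplus>\<^bsub>UCW\<^esub> u))"
      using lin_map_add[OF l(1)] lin_map_add[OF l(2)] lin_map_smult[OF l(1)] lin_map_smult[OF l(2)]
      by (intro lin_mapI[OF T T]) (simp_all add: T eq cl * lf_add[where M = "tensor M S"] lf_smult[where M = "tensor M S"] algebra_simps)
    then show "t \<oplus>\<^bsub>UCW\<^esub> u \<in> ?Q" using * UT by simp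
  next
    fix a t assume "t \<in> ?Q"
    then have *: "t \<in> carrier UCW" and l: "lin_map (tensor M S) (tensor M S) (tensor_act M \<rho> S \<gamma> t)" by auto
    have eq: "tensor_act M \<rho> S \<gamma> (a \<odot>\<^bsub>UCW\<^esub> t) z = a \<odot>\<^bsub>tensor M S\<^esub> tensor_act M \<rho> S \<gamma> t z"
      if "z \<in> carrier (tensor M S)" for z
      using lin_map_smult[OF tensor_act_linear_left[OF that] *] .
    have "lin_map (tensor M S) (tensor M S) (tensor_act M \<rho> S \<gamma> (a \<odot>\<^bsub>UCW\<^esub> t))"
      using lin_map_add[OF l(1)] lin_map_smult[OF l(1)]
      by (intro lin_mapI[OF T T]) (simp_all add: T eq cl * lf_add[where M = "tensor M S"] lf_smult[where M = "tensor M S"] algebra_simps)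
    then show "a \<odot>\<^bsub>UCW\<^esub> t \<in> ?Q" using * UT by simp
  qed auto
  moreover have "tens (U_alg br \<aa>) (Cl_alg br W) u c \<in> ?Q" if uc: "u \<in> carrier (U_alg br \<aa>)" "c \<in> carrier (Cl_alg br W)" for u c
  proof -
    have "lin_map (tensor M S) (tensor M S) (tensor_map M S M S (alg_act M \<rho> u) (alg_act S \<gamma> c))"
      using uc by (intro tensor_map_linear cv alg_act_linear[OF U] alg_act_linear[OF Cl])
    moreover have "tensor_act M \<rho> S \<gamma> (tens (U_alg br \<aa>) (Cl_alg br W) u c) z = tensor_map M S M S (alg_act M \<rho> u) (alg_act S \<gamma> c) z"
      if "z \<in> carrier (tensor M S)" for z
      using tlift_tens[OF UCv T tensor_act_bilin[OF that] uc] by (simp add: tensor_act_tlift)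
    ultimately show ?thesis using uc T tens_closed[OF UCv]
      by (subst mem_Collect_eq, subst lin_map_cong[where g = "tensor_map M S M S (alg_act M \<rho> u) (alg_act S \<gamma> c)"]) auto
  qed
  ultimately show ?thesis using tensor_induct[OF UCv _ _ t, of ?Q] by auto
qed

lemma uc_closed: "set u \<subseteq> \<aa> \<Longrightarrow> set c \<subseteq> W \<Longrightarrow> uc br \<aa> \<bb> u c \<in> carrier UCW"
  using gen_prod_closed[OF U] gen_prod_closed[OF Cl] by (auto simp: W(1)[symmetric] intro!: tens_closed[OF UCv])

lemma uc_act:
  assumes "set u \<subseteq> \<aa>" "set c \<subseteq> W" "m \<in> carrier M" "s \<in> carrier S"
  shows "tensor_act M \<rho> S \<gamma> (uc br \<aa> \<bb> u c) (tens M S m s) = tens M S (foldr \<rho> u m) (foldr \<gamma> c s)"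
  using tensor_act_tens[OF gen_prod_closed[OF U assms(1)] gen_prod_closed[OF Cl assms(2)] assms(3,4)]
    alg_act_gen_prod[OF U assms(1,3)] alg_act_gen_prod[OF Cl assms(2,4)] by (simp add: W(1)[symmetric])

context
  fixes ws :: "('l \<times> 'l) list"
  assumes ws: "set ws \<subseteq> W"
begin

private lemma ws_nth:
  assumes "i < length ws"
  shows "ws ! i \<in> W" "ws ! i \<in> \<aa>"
proof -
  show "ws ! i \<in> W" using ws nth_mem[OF assms] by blast
  then show "ws ! i \<in> \<aa>" by (simp add: W(1) orth_def)
qed

private lemma dirac_summands:
  "(\<lambda>k. uc br \<aa> \<bb> [ws ! k] [ws ! k]) \<in> {..<length ws} \<rightarrow> carrier UCW"
  "(\<lambda>(i, j, k). killing br (cbr br (ws ! i) (ws ! j)) (ws ! k)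
            \<odot>\<^bsub>UCW\<^esub> uc br \<aa> \<bb> [] [ws ! i, ws ! j, ws ! k]) \<in> {(i, j, k). i < j \<and> j < k \<and> k < length ws} \<rightarrow> carrier UCW"
  by (auto intro!: uc_closed cv_smult_closed cvspace_tensor UCv ws_nth)

lemma dirac_closed: "dirac br \<aa> \<bb> ws \<in> carrier UCW"
  unfolding dirac_def W(1)[symmetric] using dirac_summands cvspace_tensor[OF UCv] by (simp add: W(1))

text \<open>With this formula and \<open>diagonal_act\<close> the elements of \<open>UC\<close>
  disappear: Dirac operators and diagonal actions become explicit scalar sums over an orthonormal
  basis.\<close>

lemma dirac_act:
  assumes l: "lin_functional (tensor M S) l" and ms: "m \<in> carrier M" "s \<in> carrier S"
  shows "l (tensor_act M \<rho> S \<gamma> (dirac br \<aa> \<bb> ws) (tens M S m s)) =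
    (\<Sum>k<length ws. l (tens M S (\<rho> (ws ! k) m) (\<gamma> (ws ! k) s))) -
    1/2 * (\<Sum>(i, j, k)\<in>{(i, j, k). i < j \<and> j < k \<and> k < length ws}.
      killing br (cbr br (ws ! i) (ws ! j)) (ws ! k) * l (tens M S m (\<gamma> (ws ! i) (\<gamma> (ws ! j) (\<gamma> (ws ! k) s)))))"
proof -
  note UT = cvspace_tensor[OF UCv]
  have lf: "lin_functional UCW (\<lambda>t. l (tensor_act M \<rho> S \<gamma> t (tens M S m s)))"
    using lf_comp[OF tensor_act_linear_left[OF tens_closed[OF cv ms]] l] .
  note ds = dirac_summands[unfolded W(1)]
  show ?thesis
    unfolding dirac_def using ds UT[unfolded W(1)] ws_nth ms
    by (simp add: lf_diff[OF UT lf, unfolded W(1)] lf_smult[OF lf, unfolded W(1)] lf_finsum[OF UT lf, unfolded W(1)]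
        uc_closed[unfolded W(1)] uc_act[unfolded W(1)] W(1) case_prod_unfold)
qed

private lemma so_summands:
  "(\<lambda>(i, j). (A i j * (1/2)) \<odot>\<^bsub>Cl_alg br W\<^esub> Cl_prod br W [ws ! i, ws ! j]) \<in> {(i, j). i < j \<and> j < length ws} \<rightarrow> carrier (Cl_alg br W)"
proof safe
  fix i j assume "i < j" "j < length ws"
  then have "Cl_prod br W [ws ! i, ws ! j] \<in> carrier (Cl_alg br W)"
    using ws_nth[of i] ws_nth[of j] by (intro gen_prod_closed[OF Cl]) auto
  then show "(A i j * (1/2)) \<odot>\<^bsub>Cl_alg br W\<^esub> Cl_prod br W [ws ! i, ws ! j] \<in> carrier (Cl_alg br W)"
    by (rule cv_smult_closed[OF UCv(2)])
qed

private lemma so_closed: "so_inclusion br W ws A \<in> carrier (Cl_alg br W)"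
  unfolding so_inclusion_def by (rule cv_finsum_closed[OF UCv(2) so_summands])

private lemma so_act:
  assumes l: "lin_functional S l" and s: "s \<in> carrier S"
  shows "l (alg_act S \<gamma> (so_inclusion br W ws A) s) =
    (\<Sum>(i, j)\<in>{(i, j). i < j \<and> j < length ws}. A i j * (1/2) * l (\<gamma> (ws ! i) (\<gamma> (ws ! j) s)))"
proof -
  have lf: "lin_functional (Cl_alg br W) (\<lambda>c. l (alg_act S \<gamma> c s))"
    using lf_comp[OF alg_act_linear_left[OF Cl s] l] .
  have "l (alg_act S \<gamma> (a \<odot>\<^bsub>Cl_alg br W\<^esub> Cl_prod br W [ws ! i, ws ! j]) s) = a * l (\<gamma> (ws ! i) (\<gamma> (ws ! j) s))"
    if "i < j" "j < length ws" for i j a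
  proof -
    have w: "set [ws ! i, ws ! j] \<subseteq> W" using ws_nth[of i] ws_nth[of j] that by auto
    show ?thesis using lf_smult[OF lf gen_prod_closed[OF Cl w]] alg_act_gen_prod[OF Cl w s] by simp
  qed
  then show ?thesis
    unfolding so_inclusion_def lf_finsum[OF UCv(2) lf so_summands]
    by (intro sum.cong) auto
qed

lemma diagonal_closed:
  assumes "x \<in> \<aa>"
  shows "diagonal br \<aa> \<bb> ws x \<in> carrier UCW"
  unfolding diagonal_def W(1)[symmetric]
  by (intro cv_add_closed[OF cvspace_tensor[OF UCv]] tens_closed[OF UCv] gen_prod_closed[OF U] gen_prod_closed[OF Cl] so_closed)
    (use assms in auto)

lemma diagonal_act:
  assumes l: "lin_functional (tensor M S) l" and ms: "m \<in> carrier M" "s \<in> carrier S" and x: "x \<in> \<aa>"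
  shows "l (tensor_act M \<rho> S \<gamma> (diagonal br \<aa> \<bb> ws x) (tens M S m s)) = l (tens M S (\<rho> x m) s) +
    (\<Sum>(i, j)\<in>{(i, j). i < j \<and> j < length ws}. ad_matrix br ws x i j * (1/2) * l (tens M S m (\<gamma> (ws ! i) (\<gamma> (ws ! j) s))))"
proof -
  note UT = cvspace_tensor[OF UCv]
  have lf: "lin_functional UCW (\<lambda>t. l (tensor_act M \<rho> S \<gamma> t (tens M S m s)))"
    using lf_comp[OF tensor_act_linear_left[OF tens_closed[OF cv ms]] l] .
  have lS: "lin_functional S (\<lambda>s. l (tens M S m s))"
    using bilin_tens[OF cv] ms by (intro lf_comp[OF _ l]) (auto simp: bilin_def)
  have u0: "U_prod br \<aa> [] \<in> carrier (U_alg br \<aa>)" by (rule gen_prod_closed[OF U]) simp_all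
  have c1: "tens (U_alg br \<aa>) (Cl_alg br W) (U_prod br \<aa> [x]) (Cl_prod br W []) \<in> carrier UCW"
    using uc_closed[of "[x]" "[]"] x by (simp add: W(1)[symmetric])
  have c2: "tens (U_alg br \<aa>) (Cl_alg br W) (U_prod br \<aa> []) (so_inclusion br W ws (ad_matrix br ws x)) \<in> carrier UCW"
    by (intro tens_closed[OF UCv] u0 so_closed)
  have a1: "tensor_act M \<rho> S \<gamma> (tens (U_alg br \<aa>) (Cl_alg br W) (U_prod br \<aa> [x]) (Cl_prod br W [])) (tens M S m s) = tens M S (\<rho> x m) s"
    using uc_act[of "[x]" "[]" m s] x ms by (simp add: W(1)[symmetric])
  have a2: "alg_act M \<rho> (U_prod br \<aa> []) m = m"
    using alg_act_gen_prod[OF U, of "[]" m] ms by simp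
  show ?thesis
    unfolding diagonal_def W(1)[symmetric] lf_add[OF lf c1 c2] a1
    by (simp add: tensor_act_tens[OF u0 so_closed ms] a2 so_act[OF lS ms(2)])
qed

end

end

section \<open>Killing form and Cartan decomposition\<close>

definition tr :: "('l::euclidean_space \<Rightarrow> 'l) \<Rightarrow> real" where
  "tr f = (\<Sum>b\<in>Basis. f b \<bullet> b)"

lemma tr_comp_commute:
  fixes f g :: "'l::euclidean_space \<Rightarrow> 'l"
  assumes "linear f" "linear g"
  shows "tr (\<lambda>x. f (g x)) = tr (\<lambda>x. g (f x))"
proof -
  have *: "f (g b) \<bullet> b = (\<Sum>c\<in>Basis. (g b \<bullet> c) * (f c \<bullet> b))" if "linear f" for f g :: "'l \<Rightarrow> 'l" and b
  proof -
    have "f (g b) = f (\<Sum>c\<in>Basis. (g b \<bullet> c) *\<^sub>R c)" by (simp add: euclidean_representation)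
    also have "\<dots> = (\<Sum>c\<in>Basis. (g b \<bullet> c) *\<^sub>R f c)" by (simp add: linear_sum[OF that] linear_cmul[OF that])
    finally show ?thesis by (simp add: inner_sum_left)
  qed
  have "tr (\<lambda>x. f (g x)) = (\<Sum>b\<in>Basis. \<Sum>c\<in>Basis. (g b \<bullet> c) * (f c \<bullet> b))"
    unfolding tr_def by (intro sum.cong refl *[OF assms(1)])
  also have "\<dots> = (\<Sum>b\<in>Basis. \<Sum>c\<in>Basis. (f b \<bullet> c) * (g c \<bullet> b))"
    by (subst sum.swap) (simp add: mult.commute)
  also have "\<dots> = tr (\<lambda>x. g (f x))"
    unfolding tr_def by (intro sum.cong refl *[OF assms(2), symmetric])
  finally show ?thesis .
qed

locale real_lie =
  fixes br :: "'l::euclidean_space \<Rightarrow> 'l \<Rightarrow> 'l"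
  assumes real_lie: "real_lie_algebra br"
begin

abbreviation "K \<equiv> killing_real br"
abbreviation "B \<equiv> killing br"
abbreviation "cb \<equiv> cbr br"

lemma linear_br: "linear (br X)" "linear (\<lambda>X. br X Y)"
  using real_lie by (auto simp: real_lie_algebra_def)

lemma br_simps [simp]:
  "br (x + y) z = br x z + br y z" "br x (y + z) = br x y + br x z"
  "br (x - y) z = br x z - br y z" "br x (y - z) = br x y - br x z"
  "br (c *\<^sub>R x) z = c *\<^sub>R br x z" "br x (c *\<^sub>R z) = c *\<^sub>R br x z"
  "br (- x) z = - br x z" "br x (- z) = - br x z" "br 0 z = 0" "br x 0 = 0"
  by (simp_all add: linear_add[OF linear_br(1)] linear_add[OF linear_br(2)] linear_diff[OF linear_br(1)] linear_diff[OF linear_br(2)]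
      linear_cmul[OF linear_br(1)] linear_cmul[OF linear_br(2)] linear_neg[OF linear_br(1)] linear_neg[OF linear_br(2)]
      linear_0[OF linear_br(1)] linear_0[OF linear_br(2)])

lemma br_self [simp]: "br x x = 0"
  using real_lie by (auto simp: real_lie_algebra_def)

lemma br_anti: "br x y = - br y x"
proof -
  have "br (x + y) (x + y) = br x y + br y x" by (simp only: br_simps) simp
  then show ?thesis by (simp add: eq_neg_iff_add_eq_0)
qed

lemma br_jacobi: "br (br x y) z = br x (br y z) - br y (br x z)"
proof -
  have "br x (br y z) + br y (br z x) + br z (br x y) = 0"
    using real_lie by (auto simp: real_lie_algebra_def)
  moreover have "br z (br x y) = - br (br x y) z" "br y (br z x) = - br y (br x z)"
    by (rule br_anti) (subst br_anti[of z x], simp)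
  ultimately show ?thesis by (simp add: algebra_simps)
qed

lemma K_tr: "K x y = tr (\<lambda>z. br x (br y z))"
  by (simp add: killing_real_def tr_def)

lemma K_simps [simp]:
  "K (x + y) z = K x z + K y z" "K x (y + z) = K x y + K x z"
  "K (x - y) z = K x z - K y z" "K x (y - z) = K x y - K x z"
  "K (c *\<^sub>R x) z = c * K x z" "K x (c *\<^sub>R z) = c * K x z"
  "K (- x) z = - K x z" "K x (- z) = - K x z" "K 0 z = 0" "K x 0 = 0"
  by (simp_all add: killing_real_def inner_add_left inner_diff_left sum.distrib sum_subtractf sum_distrib_left sum_negf)

lemma K_sym: "K x y = K y x"
  unfolding K_tr by (rule tr_comp_commute) (rule linear_br)+

text \<open>With \<open>ad [x, y]\<close> expanded as a commutator, the claim is the cyclic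
  invariance of the trace.\<close>

lemma K_inv: "K (br x y) z = K x (br y z)"
proof -
  have "tr (\<lambda>u. br y (br x (br z u))) = tr (\<lambda>u. br x (br z (br y u)))"
    using tr_comp_commute[OF linear_br(1)[of y] linear_compose[OF linear_br(1)[of z] linear_br(1)[of x]]] by (simp add: o_def)
  then show ?thesis
    unfolding K_tr br_jacobi by (simp add: tr_def inner_diff_left sum_subtractf)
qed

text \<open>\<open>ad (L x)\<close> is \<open>L (ad x) L'\<close>, so both values are traces of
  conjugate operators. It is applied to \<theta> and later to \<open>Ad\<close>.\<close>

lemma K_automorphism:
  assumes "linear L" "\<And>x y. L (br x y) = br (L x) (L y)" "linear L'" "\<And>x. L (L' x) = x" "\<And>x. L' (L x) = x"
  shows "K (L x) (L y) = K x y"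
proof -
  have "K (L x) (L y) = tr (\<lambda>z. L (br x (br y (L' z))))"
    by (simp add: K_tr assms)
  also have "\<dots> = tr (\<lambda>z. br x (br y (L' (L z))))"
    using tr_comp_commute[OF assms(1), of "\<lambda>z. br x (br y (L' z))"]
      linear_compose[OF linear_compose[OF assms(3) linear_br(1)[of y]] linear_br(1)[of x]] by (simp add: o_def)
  finally show ?thesis by (simp add: assms K_tr)
qed

lemma B_K: "B x y = Complex (K (fst x) (fst y) - K (snd x) (snd y)) (K (fst x) (snd y) + K (snd x) (fst y))"
  unfolding killing_def ctrace_def killing_real_def cbr_def
  by (simp add: inner_add_left inner_diff_left sum.distrib sum_subtractf complex_eq_iff)

lemma B_simps [simp]:
  "B (x + y) z = B x z + B y z" "B x (y + z) = B x y + B x z"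
  "B (x - y) z = B x z - B y z" "B x (y - z) = B x y - B x z"
  "B (cscale c x) z = c * B x z" "B x (cscale c z) = c * B x z"
  "B (- x) z = - B x z" "B x (- z) = - B x z" "B 0 z = 0" "B x 0 = 0"
  by (simp_all add: B_K complex_eq_iff cscale_def algebra_simps)

lemma B_sym: "B x y = B y x"
  by (simp add: B_K K_sym[of "fst x"] K_sym[of "snd x"] add.commute)

lemma cb_simps [simp]:
  "cb (x + y) z = cb x z + cb y z" "cb x (y + z) = cb x y + cb x z"
  "cb (x - y) z = cb x z - cb y z" "cb x (y - z) = cb x y - cb x z"
  "cb (cscale c x) z = cscale c (cb x z)" "cb x (cscale c z) = cscale c (cb x z)"
  "cb (- x) z = - cb x z" "cb x (- z) = - cb x z" "cb 0 z = 0" "cb x 0 = 0"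
  by (simp_all add: cbr_def prod_eq_iff cscale_def algebra_simps)

lemma cb_anti: "cb x y = - cb y x"
  unfolding cbr_def using br_anti[of "fst x" "fst y"] br_anti[of "snd x" "snd y"] br_anti[of "fst x" "snd y"] br_anti[of "snd x" "fst y"]
  by (simp add: prod_eq_iff)

lemma cb_jacobi: "cb (cb x y) z = cb x (cb y z) - cb y (cb x z)"
  by (simp add: cbr_def prod_eq_iff br_jacobi algebra_simps)

lemma B_inv: "B (cb x y) z = B x (cb y z)"
  by (simp add: B_K cbr_def K_inv complex_eq_iff)

lemma B_skew: "B (cb x y) z = - B y (cb x z)"
  by (subst cb_anti[of x y]) (simp add: B_inv)

text \<open>The two swaps together make \<open>B [x, y] z\<close> an alternating trilinear form,
  which is the structure behind the cubic term.\<close>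

lemma B_cb_rotate: "B (cb x y) z = - B (cb y x) z" "B (cb x y) z = - B (cb x z) y"
  using B_skew[of x y z] B_sym[of y "cb x z"] cb_anti[of x y] B_simps(7)[of "cb y x" z] by simp_all

text \<open>Complex linearity relative to a subspace \<open>W\<close> only: a Clifford action is
  meaningful just for vectors of \<open>W\<close>, so linearity cannot be demanded on the whole
  type.\<close>

definition clin :: "('l \<times> 'l) set \<Rightarrow> ('l \<times> 'l \<Rightarrow> complex) \<Rightarrow> bool" where
  "clin W \<phi> \<longleftrightarrow> (\<forall>x\<in>W. \<forall>y\<in>W. \<phi> (x + y) = \<phi> x + \<phi> y) \<and> (\<forall>c. \<forall>x\<in>W. \<phi> (cscale c x) = c * \<phi> x)"

definition cbil :: "('l \<times> 'l) set \<Rightarrow> ('l \<times> 'l \<Rightarrow> 'l \<times> 'l \<Rightarrow> complex) \<Rightarrow> bool" where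
  "cbil W F \<longleftrightarrow> (\<forall>y\<in>W. clin W (\<lambda>x. F x y)) \<and> (\<forall>x\<in>W. clin W (F x))"

lemma clin_sum:
  assumes "csubspace W" "clin W \<phi>" "\<And>i. i \<in> I \<Longrightarrow> x i \<in> W"
  shows "\<phi> (\<Sum>i\<in>I. cscale (c i) (x i)) = (\<Sum>i\<in>I. c i * \<phi> (x i))"
proof -
  have "\<phi> 0 = 0"
  proof -
    have "\<phi> (cscale 0 0) = 0 * \<phi> 0" using assms(1,2) cs.subspace_0 unfolding clin_def by blast
    then show ?thesis by simp
  qed
  have "(\<forall>i\<in>I. x i \<in> W) \<longrightarrow> (\<Sum>i\<in>I. cscale (c i) (x i)) \<in> W \<and> \<phi> (\<Sum>i\<in>I. cscale (c i) (x i)) = (\<Sum>i\<in>I. c i * \<phi> (x i))"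
  proof (induction I rule: infinite_finite_induct)
    case (insert i F)
    then show ?case using assms(1,2) cs.subspace_add[OF assms(1)] cs.subspace_scale[OF assms(1)]
      by (simp add: clin_def)
  qed (use \<open>\<phi> 0 = 0\<close> cs.subspace_0[OF assms(1)] in auto)
  then show ?thesis using assms(3) by blast
qed

context
  fixes W ws assumes W: "orthonormal_basis br W ws"
begin

lemma onb_subspace: "csubspace W"
  using W cs.subspace_span[of "set ws"] by (auto simp: orthonormal_basis_def)

lemma onb_in: "set ws \<subseteq> W" "i < length ws \<Longrightarrow> ws ! i \<in> W"
  using W cs.span_superset[of "set ws"] nth_mem[of i ws] by (auto simp: orthonormal_basis_def)

lemma onb_B: "i < length ws \<Longrightarrow> j < length ws \<Longrightarrow> B (ws ! i) (ws ! j) = (if i = j then 1 else 0)"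
  using W by (auto simp: orthonormal_basis_def)

lemma onb_expand: "x \<in> W \<Longrightarrow> x = (\<Sum>i<length ws. cscale (B x (ws ! i)) (ws ! i))"
proof -
  assume "x \<in> W"
  then have "x \<in> cs.span (set ws)" using W by (simp add: orthonormal_basis_def)
  then show ?thesis
  proof (induction rule: cs.span_induct_alt)
    case (step c w y)
    then obtain j where j: "j < length ws" "w = ws ! j" by (auto simp: in_set_conv_nth)
    have "(\<Sum>i<length ws. cscale (B w (ws ! i)) (ws ! i)) = (\<Sum>i<length ws. if i = j then w else 0)"
      using j by (intro sum.cong) (auto simp: onb_B)
    then have w: "(\<Sum>i<length ws. cscale (B w (ws ! i)) (ws ! i)) = w" using j by simp
    have "(\<Sum>i<length ws. cscale (B (cscale c w + y) (ws ! i)) (ws ! i)) =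
      cscale c (\<Sum>i<length ws. cscale (B w (ws ! i)) (ws ! i)) + (\<Sum>i<length ws. cscale (B y (ws ! i)) (ws ! i))"
      by (simp add: cs.scale_left_distrib sum.distrib cs.scale_sum_right)
    then show ?case using w step by simp
  qed simp
qed

lemma clin_expand: "clin W \<phi> \<Longrightarrow> x \<in> W \<Longrightarrow> \<phi> x = (\<Sum>i<length ws. B x (ws ! i) * \<phi> (ws ! i))"
  by (subst onb_expand[of x]) (auto intro!: clin_sum[OF onb_subspace] onb_in)

text \<open>The sum of \<open>w \<otimes> w\<close> over an orthonormal basis is the canonical
  element of \<open>W \<otimes> W\<close> dual to \<open>B\<close>. Consequently Dirac operators and
  Casimir elements may be evaluated in whichever basis suits: one adapted to \<pp> and \<kk>, a real
  one, or one moved by \<open>Ad\<close>.\<close>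

lemma contraction_independent:
  assumes es: "orthonormal_basis br W es" and F: "cbil W F"
  shows "(\<Sum>i<length es. F (es ! i) (es ! i)) = (\<Sum>j<length ws. F (ws ! j) (ws ! j))"
proof -
  have e: "i < length es \<Longrightarrow> es ! i \<in> W" for i
    using es cs.span_superset[of "set es"] nth_mem[of i es] by (auto simp: orthonormal_basis_def)
  have "(\<Sum>i<length es. F (es ! i) (es ! i)) = (\<Sum>i<length es. \<Sum>j<length ws. B (es ! i) (ws ! j) * F (ws ! j) (es ! i))"
    using F e by (intro sum.cong refl clin_expand) (auto simp: cbil_def)
  also have "\<dots> = (\<Sum>j<length ws. \<Sum>i<length es. B (ws ! j) (es ! i) * F (ws ! j) (es ! i))"
    by (subst sum.swap) (simp add: B_sym)
  also have "\<dots> = (\<Sum>j<length ws. F (ws ! j) (ws ! j))"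
  proof (intro sum.cong refl)
    fix j assume "j \<in> {..<length ws}"
    then have w: "ws ! j \<in> W" using onb_in by auto
    have "(\<Sum>i<length es. cscale (B (ws ! j) (es ! i)) (es ! i)) = ws ! j"
      using real_lie.onb_expand[OF real_lie_axioms es w] by simp
    moreover have "clin W (F (ws ! j))" using F w by (simp add: cbil_def)
    ultimately show "(\<Sum>i<length es. B (ws ! j) (es ! i) * F (ws ! j) (es ! i)) = F (ws ! j) (ws ! j)"
      using clin_sum[OF onb_subspace, of "F (ws ! j)" "{..<length es}" "\<lambda>i. es ! i" "\<lambda>i. B (ws ! j) (es ! i)"] e by auto
  qed
  finally show ?thesis .
qed

text \<open>\<open>ad x\<close> is skew for \<open>B\<close>, so it annihilates the canonical
  element of \<open>W \<otimes> W\<close>. This is the invariance behind the commutation of Dirac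
  and Casimir operators with Lie algebra actions.\<close>

lemma contraction_invariant:
  assumes F: "cbil W F" and X: "\<And>w. w \<in> W \<Longrightarrow> cb x w \<in> W"
  shows "(\<Sum>i<length ws. F (cb x (ws ! i)) (ws ! i)) = - (\<Sum>i<length ws. F (ws ! i) (cb x (ws ! i)))"
proof -
  have "(\<Sum>i<length ws. F (cb x (ws ! i)) (ws ! i)) =
     (\<Sum>i<length ws. \<Sum>j<length ws. B (cb x (ws ! i)) (ws ! j) * F (ws ! j) (ws ! i))"
    using F X onb_in by (intro sum.cong refl clin_expand[of "\<lambda>y. F y _"]) (auto simp: cbil_def)
  also have "\<dots> = (\<Sum>j<length ws. \<Sum>i<length ws. - (B (cb x (ws ! j)) (ws ! i) * F (ws ! j) (ws ! i)))"
  proof -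
    have sk: "B (cb x a) b = - B (cb x b) a" for a b using B_skew[of x a b] B_sym[of a "cb x b"] by simp
    show ?thesis by (subst sum.swap, intro sum.cong refl, subst sk) simp
  qed
  also have "\<dots> = - (\<Sum>j<length ws. \<Sum>i<length ws. B (cb x (ws ! j)) (ws ! i) * F (ws ! j) (ws ! i))"
    by (simp add: sum_negf)
  also have "(\<Sum>j<length ws. \<Sum>i<length ws. B (cb x (ws ! j)) (ws ! i) * F (ws ! j) (ws ! i)) = (\<Sum>i<length ws. F (ws ! i) (cb x (ws ! i)))"
    using F X onb_in by (intro sum.cong refl clin_expand[symmetric]) (auto simp: cbil_def)
  finally show ?thesis .
qed

end

end

text \<open>Gram-Schmidt for a form positive on \<open>U\<close> alone: on the
  \<open>(-1)\<close>-eigenspace of \<theta> it is applied to the Killing form, on the fixed space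
  to its negative. The list grows up to length \<open>dim U\<close>, so that independence gives
  spanning.\<close>

lemma exists_real_onb:
  fixes Q :: "'l::euclidean_space \<Rightarrow> 'l \<Rightarrow> real"
  assumes "subspace U" and lin: "\<And>y. linear (\<lambda>x. Q x y)" and sym: "\<And>x y. Q x y = Q y x"
    and pos: "\<And>x. x \<in> U \<Longrightarrow> x \<noteq> 0 \<Longrightarrow> Q x x > 0"
  shows "\<exists>us. set us \<subseteq> U \<and> span (set us) = U \<and>
    (\<forall>i<length us. \<forall>j<length us. Q (us ! i) (us ! j) = (if i = j then 1 else 0))"
proof -
  note lin2 = linear_add[OF lin] linear_diff[OF lin] linear_cmul[OF lin] linear_sum[OF lin]
  have "\<exists>us. length us = n \<and> distinct us \<and> set us \<subseteq> U \<and> independent (set us) \<and>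
    (\<forall>i<length us. \<forall>j<length us. Q (us ! i) (us ! j) = (if i = j then 1 else 0))" if "n \<le> dim U" for n
    using that
  proof (induction n)
    case 0
    show ?case by (rule exI[of _ "[]"]) (simp add: independent_empty)
  next
    case (Suc n)
    then obtain us where us: "length us = n" "distinct us" "set us \<subseteq> U" "independent (set us)"
      and Qus: "\<And>i j. i < length us \<Longrightarrow> j < length us \<Longrightarrow> Q (us ! i) (us ! j) = (if i = j then 1 else 0)" by auto
    have "\<not> U \<subseteq> span (set us)"
      using dim_le_card[of U "set us"] us Suc.prems by (auto simp: distinct_card)
    then obtain x where x: "x \<in> U" "x \<notin> span (set us)" by blast
    define y where "y = x - (\<Sum>i<n. Q x (us ! i) *\<^sub>R us ! i)"
    have s: "(\<Sum>i<n. Q x (us ! i) *\<^sub>R us ! i) \<in> span (set us)"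
      using us by (intro span_sum span_scale span_base) auto
    have ysp: "y \<notin> span (set us)" using x s span_add[of y "set us" "\<Sum>i<n. Q x (us ! i) *\<^sub>R us ! i"] by (auto simp: y_def)
    then have "y \<noteq> 0" using span_zero by metis
    have "y \<in> U" unfolding y_def using us x
      by (intro subspace_diff[OF assms(1)] subspace_sum[OF assms(1)] subspace_scale[OF assms(1)]) (auto simp: subset_iff)
    have Qy: "Q y (us ! j) = 0" if "j < n" for j
    proof -
      have "Q y (us ! j) = Q x (us ! j) - (\<Sum>i<n. Q x (us ! i) * (if i = j then 1 else 0))"
        using that us Qus by (simp add: y_def lin2)
      then show ?thesis using that by (simp add: if_distrib[of "(*) _"] cong: if_cong)
    qed
    define z where "z = (1 / sqrt (Q y y)) *\<^sub>R y"
    have p: "Q y y > 0" using pos \<open>y \<in> U\<close> \<open>y \<noteq> 0\<close> by blast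
    have Qz: "Q z (us ! j) = 0" if "j < n" for j using Qy[OF that] by (simp add: z_def lin2)
    have "Q z z = (1 / sqrt (Q y y)) * ((1 / sqrt (Q y y)) * Q y y)"
      unfolding z_def by (subst lin2(3), subst sym, subst lin2(3)) simp
    then have Qzz: "Q z z = 1" using p by (simp add: field_simps real_sqrt_mult_self)
    have zsp: "z \<notin> span (set us)"
    proof
      assume "z \<in> span (set us)"
      then have "sqrt (Q y y) *\<^sub>R z \<in> span (set us)" by (rule span_scale)
      then show False using ysp p by (simp add: z_def)
    qed
    have "z \<in> U" using \<open>y \<in> U\<close> subspace_scale[OF assms(1)] by (simp add: z_def)
    let ?us = "us @ [z]"
    have "Q (?us ! i) (?us ! j) = (if i = j then 1 else 0)" if "i < Suc n" "j < Suc n" for i j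
      using that us Qus Qz Qzz sym[of "us ! i" z] by (auto simp: nth_append less_Suc_eq)
    moreover have "z \<notin> set us" using zsp span_base by blast
    moreover have "independent (insert z (set us))" using us(4) zsp independent_insertI by blast
    ultimately show ?case using us \<open>z \<in> U\<close> by (intro exI[of _ ?us]) auto
  qed
  from this[OF order_refl] obtain us where us: "length us = dim U" "distinct us" "set us \<subseteq> U" "independent (set us)"
      "\<forall>i<length us. \<forall>j<length us. Q (us ! i) (us ! j) = (if i = j then 1 else 0)" by auto
  have "U \<subseteq> span (set us)" using card_eq_dim[of "set us" U] us by (auto simp: distinct_card)
  moreover have "span (set us) \<subseteq> U" using us(3) assms(1) by (rule span_minimal)
  ultimately show ?thesis using us by blast
qed

text \<open>A nonzero scalar \<open>c\<close> does not change the complex span; it will be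
  \<open>\<i>\<close> on the compact part, where the Killing form is negative.\<close>

lemma cspan_complexify:
  assumes "span (set us) = U" "c \<noteq> 0"
  shows "cs.span (set (map (\<lambda>u. cscale c (u, 0)) us)) = {x. fst x \<in> U \<and> snd x \<in> U}"
proof -
  let ?S = "set (map (\<lambda>u. cscale c (u, 0)) us)"
  have U: "subspace U" using assms(1) subspace_span by blast
  have 1: "(u, 0) \<in> cs.span ?S" if "u \<in> U" for u
  proof -
    have "u \<in> span (set us)" using that assms by simp
    then show ?thesis
    proof (induction rule: span_induct_alt)
      case base
      then show ?case using cs.span_zero[of ?S] by (simp add: zero_prod_def)
    next
      case (step a v y)
      have v: "cscale c (v, 0) \<in> cs.span ?S" using step by (intro cs.span_base) auto
      have y: "(y, 0) \<in> cs.span ?S" using step by blast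
      have "cscale (of_real a / c) (cscale c (v, 0)) + (y, 0) \<in> cs.span ?S"
        by (rule cs.span_add[OF cs.span_scale[OF v] y])
      moreover have "cscale (of_real a / c) (cscale c (v, 0)) + (y, 0) = (a *\<^sub>R v + y, 0)"
        using assms(2) by (simp only: cs.scale_scale) (simp add: cscale_def)
      ultimately show ?case by simp
    qed
  qed
  have "x \<in> cs.span ?S" if "fst x \<in> U" "snd x \<in> U" for x
  proof -
    have "(fst x, 0) + cscale \<i> (snd x, 0) \<in> cs.span ?S" using that 1 by (intro cs.span_add cs.span_scale) auto
    then show ?thesis by (simp add: cscale_def)
  qed
  moreover have "cs.span ?S \<subseteq> {x. fst x \<in> U \<and> snd x \<in> U}"
  proof (rule cs.span_minimal)
    show "?S \<subseteq> {x. fst x \<in> U \<and> snd x \<in> U}"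
      using assms(1) span_superset[of "set us"] U by (auto simp: cscale_def subset_iff intro: subspace_scale)
    show "csubspace {x. fst x \<in> U \<and> snd x \<in> U}"
      using U by (auto simp: cs.subspace_def cscale_def subspace_0 subspace_add subspace_scale subspace_diff)
  qed
  ultimately show ?thesis by blast
qed

locale cartan = real_lie +
  fixes \<theta> assumes cartan: "cartan_involution br \<theta>"
begin

lemma \<theta>_linear: "linear \<theta>" and \<theta>_invol [simp]: "\<theta> (\<theta> X) = X" and \<theta>_br: "\<theta> (br X Y) = br (\<theta> X) (\<theta> Y)"
  and \<theta>_pos: "X \<noteq> 0 \<Longrightarrow> - K X (\<theta> X) > 0"
  using cartan by (auto simp: cartan_involution_def)

lemma \<theta>_simps [simp]: "\<theta> (x + y) = \<theta> x + \<theta> y" "\<theta> (x - y) = \<theta> x - \<theta> y" "\<theta> (c *\<^sub>R x) = c *\<^sub>R \<theta> x" "\<theta> (- x) = - \<theta> x" "\<theta> 0 = 0"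
  using \<theta>_linear by (auto simp: linear_add linear_diff linear_cmul linear_neg linear_0)

abbreviation "kk \<equiv> k_part \<theta>"
abbreviation "pp \<equiv> p_part \<theta>"

lemma kk_iff: "x \<in> kk \<longleftrightarrow> \<theta> (fst x) = fst x \<and> \<theta> (snd x) = snd x"
  by (auto simp: k_part_def cmap_def prod_eq_iff)

lemma pp_iff: "x \<in> pp \<longleftrightarrow> \<theta> (fst x) = - fst x \<and> \<theta> (snd x) = - snd x"
  by (auto simp: p_part_def cmap_def prod_eq_iff)

lemma kk_subspace: "csubspace kk" and pp_subspace: "csubspace pp"
  by (auto simp: cs.subspace_def kk_iff pp_iff cscale_def)

lemma cb_kk: "x \<in> kk \<Longrightarrow> y \<in> kk \<Longrightarrow> cb x y \<in> kk"
  and cb_kp: "x \<in> kk \<Longrightarrow> y \<in> pp \<Longrightarrow> cb x y \<in> pp"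
  and cb_pk: "x \<in> pp \<Longrightarrow> y \<in> kk \<Longrightarrow> cb x y \<in> pp"
  and cb_pp: "x \<in> pp \<Longrightarrow> y \<in> pp \<Longrightarrow> cb x y \<in> kk"
  by (auto simp: kk_iff pp_iff cbr_def \<theta>_br)

lemma kk_subalgebra: "subalgebra br kk"
  by (simp add: subalgebra_def kk_subspace cb_kk)

lemma K_\<theta>: "K (\<theta> x) (\<theta> y) = K x y"
  by (rule K_automorphism[of \<theta> \<theta>]) (auto simp: \<theta>_linear \<theta>_br)

lemma B_kp: "x \<in> kk \<Longrightarrow> y \<in> pp \<Longrightarrow> B x y = 0"
proof -
  have *: "K a b = 0" if "\<theta> a = a" "\<theta> b = - b" for a b
    using K_\<theta>[of a b] that by simp
  show "x \<in> kk \<Longrightarrow> y \<in> pp \<Longrightarrow> B x y = 0" by (auto simp: B_K kk_iff pp_iff * complex_eq_iff)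
qed

lemma B_pk: "x \<in> pp \<Longrightarrow> y \<in> kk \<Longrightarrow> B x y = 0"
  using B_kp B_sym by metis

abbreviation "kpart x \<equiv> (1/2) *\<^sub>R (x + cmap \<theta> x)"
abbreviation "ppart x \<equiv> (1/2) *\<^sub>R (x - cmap \<theta> x)"

lemma kpart_in: "kpart x \<in> kk" and ppart_in: "ppart x \<in> pp"
  by (auto simp: kk_iff pp_iff cmap_def algebra_simps)

lemma decompose: "x = ppart x + kpart x"
proof -
  have "ppart x + kpart x = (1/2) *\<^sub>R (x + x)"
    unfolding scaleR_right_distrib[symmetric] by simp
  then show ?thesis by (simp add: scaleR_half_double)
qed

lemma kpart_kk: "x \<in> kk \<Longrightarrow> kpart x = x" "x \<in> kk \<Longrightarrow> ppart x = 0"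
  and ppart_pp: "x \<in> pp \<Longrightarrow> kpart x = 0" "x \<in> pp \<Longrightarrow> ppart x = x"
  by (simp_all add: k_part_def p_part_def scaleR_half_double del: scaleR_add_right)

text \<open>Pairing \<open>x\<close> with its complex conjugate \<open>(fst x, - snd x)\<close>
  gives the sum of the Killing norms of the two real components, and the Killing form is negative
  definite on the fixed space of \<theta>.\<close>

lemma kk_nondegenerate: "x \<in> kk \<Longrightarrow> (\<And>y. y \<in> kk \<Longrightarrow> B x y = 0) \<Longrightarrow> x = 0"
proof -
  assume x: "x \<in> kk" and *: "\<And>y. y \<in> kk \<Longrightarrow> B x y = 0"
  have "(fst x, - snd x) \<in> kk" using x by (auto simp: kk_iff)
  from *[OF this] have "K (fst x) (fst x) + K (snd x) (snd x) = 0"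
    by (simp add: B_K complex_eq_iff)
  moreover have "K (fst x) (fst x) \<le> 0 \<and> (fst x \<noteq> 0 \<longrightarrow> K (fst x) (fst x) < 0)"
    using \<theta>_pos[of "fst x"] x by (cases "fst x = 0") (auto simp: kk_iff)
  moreover have "K (snd x) (snd x) \<le> 0 \<and> (snd x \<noteq> 0 \<longrightarrow> K (snd x) (snd x) < 0)"
    using \<theta>_pos[of "snd x"] x by (cases "snd x = 0") (auto simp: kk_iff)
  ultimately have "fst x = 0 \<and> snd x = 0" by linarith
  then show "x = 0" by (simp add: prod_eq_iff)
qed

lemma orth_kk: "orth br UNIV kk = pp"
proof
  show "pp \<subseteq> orth br UNIV kk" by (auto simp: orth_def B_pk)
  show "orth br UNIV kk \<subseteq> pp"
  proof
    fix x assume "x \<in> orth br UNIV kk"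
    then have x: "y \<in> kk \<Longrightarrow> B x y = 0" for y by (simp add: orth_def)
    have "B (kpart x) y = 0" if "y \<in> kk" for y
    proof -
      have "B x y = B (ppart x) y + B (kpart x) y" by (subst decompose[of x]) (simp only: B_simps)
      then show ?thesis using x[OF that] B_pk[OF ppart_in that] by simp
    qed
    then have "kpart x = 0" by (rule kk_nondegenerate[OF kpart_in])
    then show "x \<in> pp" using decompose[of x] ppart_in[of x] by simp
  qed
qed

lemma exists_pp_basis: "\<exists>us. (\<forall>u\<in>set us. \<theta> u = - u) \<and> orthonormal_basis br pp (map (\<lambda>u. cscale 1 (u, 0)) us)"
proof -
  have 1: "subspace {u. \<theta> u = - u}" by (auto simp: subspace_def)
  have 2: "linear (\<lambda>x. K x y)" for y by (rule linearI) auto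
  have 3: "K x x > 0" if "x \<in> {u. \<theta> u = - u}" "x \<noteq> 0" for x using \<theta>_pos[of x] that by simp
  from exists_real_onb[OF 1 2 K_sym 3] obtain us where us: "set us \<subseteq> {u. \<theta> u = - u}" "span (set us) = {u. \<theta> u = - u}"
    "\<forall>i<length us. \<forall>j<length us. K (us ! i) (us ! j) = (if i = j then 1 else 0)" by auto
  then have "orthonormal_basis br pp (map (\<lambda>u. cscale 1 (u, 0)) us)"
    unfolding orthonormal_basis_def
    by (subst cspan_complexify[OF us(2)]) (auto simp: pp_iff B_K complex_eq_iff)
  with us show ?thesis by blast
qed

text \<open>A real basis orthonormal for \<open>- K\<close> becomes orthonormal for \<open>B\<close>
  after multiplication by \<open>\<i>\<close>, whose square absorbs the sign.\<close>

lemma exists_kk_basis: "\<exists>us. (\<forall>u\<in>set us. \<theta> u = u) \<and> orthonormal_basis br kk (map (\<lambda>u. cscale \<i> (u, 0)) us)"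
proof -
  have 1: "subspace {u. \<theta> u = u}" by (auto simp: subspace_def)
  have 2: "linear (\<lambda>x. - K x y)" for y by (rule linearI) auto
  have 3: "- K x x > 0" if "x \<in> {u. \<theta> u = u}" "x \<noteq> 0" for x using \<theta>_pos[of x] that by simp
  have 4: "- K x y = - K y x" for x y using K_sym[of x y] by simp
  from exists_real_onb[OF 1 2 4 3] obtain us where us: "set us \<subseteq> {u. \<theta> u = u}" "span (set us) = {u. \<theta> u = u}"
    "\<forall>i<length us. \<forall>j<length us. - K (us ! i) (us ! j) = (if i = j then 1 else 0)" by auto
  then have "orthonormal_basis br kk (map (\<lambda>u. cscale \<i> (u, 0)) us)"
    unfolding orthonormal_basis_def
    by (subst cspan_complexify[OF us(2)]) (auto simp: kk_iff B_K cscale_def complex_eq_iff)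
  with us show ?thesis by blast
qed

lemma onb_append:
  assumes "orthonormal_basis br P ps" "orthonormal_basis br Q qs" "P \<subseteq> pp" "Q \<subseteq> kk"
  shows "orthonormal_basis br {x + y | x y. x \<in> P \<and> y \<in> Q} (ps @ qs)"
proof -
  have "B (ps ! i) (qs ! j) = 0" "B (qs ! j) (ps ! i) = 0" if "i < length ps" "j < length qs" for i j
    using onb_in(2)[OF assms(1) that(1)] onb_in(2)[OF assms(2) that(2)] assms(3,4) B_pk B_kp by blast+
  then show ?thesis
    using assms unfolding orthonormal_basis_def
    by (auto simp: cs.span_Un nth_append)
qed

end

section \<open>Clifford modules\<close>

lemma sum_pairs:
  fixes f :: "nat \<Rightarrow> nat \<Rightarrow> complex"
  assumes "\<And>i j. i < n \<Longrightarrow> j < n \<Longrightarrow> f i j = f j i" "\<And>i. i < n \<Longrightarrow> f i i = 0"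
  shows "(\<Sum>i<n. \<Sum>j<n. f i j) = 2 * (\<Sum>(i, j)\<in>{(i, j). i < j \<and> j < n}. f i j)"
  using assms
proof (induction n)
  case (Suc n)
  have fin: "finite {(i, j). i < j \<and> j < n}" by (rule finite_subset[of _ "{..<n} \<times> {..<n}"]) auto
  have "{(i, j). i < j \<and> j < Suc n} = {(i, j). i < j \<and> j < n} \<union> (\<lambda>i. (i, n)) ` {..<n}"
    by (auto simp: less_Suc_eq)
  then have "(\<Sum>(i, j)\<in>{(i, j). i < j \<and> j < Suc n}. f i j) = (\<Sum>(i, j)\<in>{(i, j). i < j \<and> j < n}. f i j) + (\<Sum>i<n. f i n)"
    using fin by (simp, subst sum.union_disjoint) (auto simp: sum.reindex inj_on_def)
  moreover have "(\<Sum>i<n. f n i) = (\<Sum>i<n. f i n)" using Suc.prems(1) by (intro sum.cong) auto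
  ultimately show ?case using Suc by (simp add: sum.distrib)
qed simp

text \<open>The summand is symmetric and vanishes when two indices agree, so each ordered triple is
  counted once for each of its \<open>3! = 6\<close> arrangements.\<close>

lemma sum_triples:
  fixes f :: "nat \<Rightarrow> nat \<Rightarrow> nat \<Rightarrow> complex"
  assumes "\<And>i j k. i < n \<Longrightarrow> j < n \<Longrightarrow> k < n \<Longrightarrow> f i j k = f j i k" "\<And>i j k. i < n \<Longrightarrow> j < n \<Longrightarrow> k < n \<Longrightarrow> f i j k = f i k j"
    and "\<And>i k. i < n \<Longrightarrow> k < n \<Longrightarrow> f i i k = 0"
  shows "(\<Sum>i<n. \<Sum>j<n. \<Sum>k<n. f i j k) = 6 * (\<Sum>(i, j, k)\<in>{(i, j, k). i < j \<and> j < k \<and> k < n}. f i j k)"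
  using assms
proof (induction n)
  case (Suc n)
  have fin: "finite {(i, j). i < j \<and> j < n}" by (rule finite_subset[of _ "{..<n} \<times> {..<n}"]) auto
  have fin3: "finite {(i, j, k). i < j \<and> j < k \<and> k < n}" by (rule finite_subset[of _ "{..<n} \<times> {..<n} \<times> {..<n}"]) auto
  have "{(i, j, k). i < j \<and> j < k \<and> k < Suc n} = {(i, j, k). i < j \<and> j < k \<and> k < n} \<union> (\<lambda>(i, j). (i, j, n)) ` {(i, j). i < j \<and> j < n}"
    by (auto simp: less_Suc_eq)
  then have "(\<Sum>(i, j, k)\<in>{(i, j, k). i < j \<and> j < k \<and> k < Suc n}. f i j k) =
      (\<Sum>(i, j, k)\<in>{(i, j, k). i < j \<and> j < k \<and> k < n}. f i j k) + (\<Sum>(i, j)\<in>{(i, j). i < j \<and> j < n}. f i j n)"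
    using fin fin3 by (simp, subst sum.union_disjoint) (auto simp: sum.reindex inj_on_def case_prod_unfold)
  moreover have "(\<Sum>i<n. \<Sum>j<n. f i j n) = 2 * (\<Sum>(i, j)\<in>{(i, j). i < j \<and> j < n}. f i j n)"
    using Suc.prems by (intro sum_pairs) auto
  moreover have "(\<Sum>i<n. \<Sum>k<n. f i n k) = (\<Sum>i<n. \<Sum>j<n. f i j n)" "(\<Sum>j<n. \<Sum>k<n. f n j k) = (\<Sum>i<n. \<Sum>j<n. f i j n)"
    using Suc.prems(1,2) by (auto intro!: sum.cong)
  moreover have z: "f i i k = 0" "f k i i = 0" "f i k i = 0" if "i < Suc n" "k < Suc n" for i k
    using Suc.prems that by metis+
  then have "(\<Sum>i<n. f i n n) = 0" "(\<Sum>i<n. f n i n) = 0" "(\<Sum>i<n. f n n i) = 0" "f n n n = 0" by (auto intro!: sum.neutral)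
  moreover have "(\<Sum>i<n. \<Sum>j<n. \<Sum>k<n. f i j k) = 6 * (\<Sum>(i, j, k)\<in>{(i, j, k). i < j \<and> j < k \<and> k < n}. f i j k)"
    using Suc.prems by (intro Suc.IH) auto
  ultimately show ?case by (simp add: sum.distrib)
qed (simp add: case_prod_unfold)

lemma sum_append: "(\<Sum>i<length (xs @ ys). f ((xs @ ys) ! i)) = (\<Sum>i<length xs. f (xs ! i)) + (\<Sum>i<length ys. (f (ys ! i) :: 'a::comm_monoid_add))"
  using sum_list_sum_nth[of "map f xs"] sum_list_sum_nth[of "map f ys"] sum_list_sum_nth[of "map f (xs @ ys)"]
  by (simp add: atLeast0LessThan del: map_append) (simp add: atLeast0LessThan)

context real_lie
begin

lemma clinI: "(\<And>x y. x \<in> W \<Longrightarrow> y \<in> W \<Longrightarrow> \<phi> (x + y) = \<phi> x + \<phi> y) \<Longrightarrow> (\<And>c x. x \<in> W \<Longrightarrow> \<phi> (cscale c x) = c * \<phi> x) \<Longrightarrow> clin W \<phi>"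
  by (simp add: clin_def)

lemma clin_generators: "generators_act W S \<gamma> \<Longrightarrow> lin_functional S l \<Longrightarrow> s \<in> carrier S \<Longrightarrow> clin W (\<lambda>x. l (\<gamma> x s))"
  by (rule clinI) (auto simp: generators_actD lf_add lf_smult)

lemma clin_mult: "clin W \<phi> \<Longrightarrow> clin W (\<lambda>x. \<phi> x * c)" "clin W \<phi> \<Longrightarrow> clin W (\<lambda>x. c * \<phi> x)"
  by (auto simp: clin_def algebra_simps)

lemma clin_B: "clin W (\<lambda>x. B x y)" "clin W (\<lambda>x. B y x)" "clin W (\<lambda>x. B (cb x y) z)" "clin W (\<lambda>x. B (cb y x) z)"
  by (auto simp: clin_def)

lemma clin_cb: "clin W \<phi> \<Longrightarrow> (\<And>w. w \<in> W' \<Longrightarrow> cb x w \<in> W) \<Longrightarrow> clin W' (\<lambda>w. \<phi> (cb x w))"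
  by (auto simp: clin_def)

text \<open>The cubic element is a contraction in three slots. The basis is exchanged in one slot at
  a time, by \<open>contraction_independent\<close> with the other two arguments frozen, and the
  sums are swapped to bring that slot innermost.\<close>

lemma triple_sum_independent:
  assumes es: "orthonormal_basis br W es" and ws: "orthonormal_basis br W ws"
    and U1: "\<And>b c. b \<in> W \<Longrightarrow> c \<in> W \<Longrightarrow> clin W (\<lambda>a. U a b c)" and U2: "\<And>a c. a \<in> W \<Longrightarrow> c \<in> W \<Longrightarrow> clin W (\<lambda>b. U a b c)"
    and U3: "\<And>a b. a \<in> W \<Longrightarrow> b \<in> W \<Longrightarrow> clin W (\<lambda>c. U a b c)"
  shows "(\<Sum>i<length es. \<Sum>j<length es. \<Sum>k<length es. B (cb (es ! i) (es ! j)) (es ! k) * U (es ! i) (es ! j) (es ! k)) =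
    (\<Sum>i<length ws. \<Sum>j<length ws. \<Sum>k<length ws. B (cb (ws ! i) (ws ! j)) (ws ! k) * U (ws ! i) (ws ! j) (ws ! k))"
    (is "?L = ?R")
proof -
  note e = onb_in(2)[OF es] and w = onb_in(2)[OF ws]
  let ?G = "\<lambda>a b c. B (cb a b) c * U a b c"
  have 1: "(\<Sum>i<length es. ?G (es ! i) b c) = (\<Sum>i<length ws. ?G (ws ! i) b c)" if "b \<in> W" "c \<in> W" for b c
    by (rule contraction_independent[OF ws es, of "\<lambda>x y. B (cb x b) c * U y b c"])
      (unfold cbil_def, intro conjI ballI clin_mult clin_B U1 that)
  have 2: "(\<Sum>i<length es. ?G a (es ! i) c) = (\<Sum>i<length ws. ?G a (ws ! i) c)" if "a \<in> W" "c \<in> W" for a c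
    by (rule contraction_independent[OF ws es, of "\<lambda>x y. B (cb a x) c * U a y c"])
      (unfold cbil_def, intro conjI ballI clin_mult clin_B U2 that)
  have 3: "(\<Sum>i<length es. ?G a b (es ! i)) = (\<Sum>i<length ws. ?G a b (ws ! i))" if "a \<in> W" "b \<in> W" for a b
    by (rule contraction_independent[OF ws es, of "\<lambda>x y. B (cb a b) x * U a b y"])
      (unfold cbil_def, intro conjI ballI clin_mult clin_B U3 that)
  have "?L = (\<Sum>i<length es. \<Sum>j<length es. \<Sum>k<length ws. ?G (es ! i) (es ! j) (ws ! k))"
    using e by (intro sum.cong refl 3) auto
  also have "\<dots> = (\<Sum>i<length es. \<Sum>k<length ws. \<Sum>j<length es. ?G (es ! i) (es ! j) (ws ! k))"
    by (intro sum.cong refl sum.swap)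
  also have "\<dots> = (\<Sum>i<length es. \<Sum>k<length ws. \<Sum>j<length ws. ?G (es ! i) (ws ! j) (ws ! k))"
    using e w by (intro sum.cong refl 2) auto
  also have "\<dots> = (\<Sum>k<length ws. \<Sum>i<length es. \<Sum>j<length ws. ?G (es ! i) (ws ! j) (ws ! k))"
    by (rule sum.swap)
  also have "\<dots> = (\<Sum>k<length ws. \<Sum>j<length ws. \<Sum>i<length es. ?G (es ! i) (ws ! j) (ws ! k))"
    by (intro sum.cong refl sum.swap)
  also have "\<dots> = (\<Sum>k<length ws. \<Sum>j<length ws. \<Sum>i<length ws. ?G (ws ! i) (ws ! j) (ws ! k))"
    using w by (intro sum.cong refl 1) auto
  also have "\<dots> = (\<Sum>k<length ws. \<Sum>i<length ws. \<Sum>j<length ws. ?G (ws ! i) (ws ! j) (ws ! k))"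
    by (intro sum.cong refl sum.swap)
  also have "\<dots> = (\<Sum>i<length ws. \<Sum>k<length ws. \<Sum>j<length ws. ?G (ws ! i) (ws ! j) (ws ! k))"
    by (rule sum.swap)
  also have "\<dots> = ?R"
    by (intro sum.cong refl sum.swap)
  finally show ?thesis .
qed

end

locale clifford = real_lie +
  fixes W S \<gamma> ws
  assumes cliff: "clifford_module br W S \<gamma>" and onb: "orthonormal_basis br W ws"
begin

lemma gen_act: "generators_act W S \<gamma>"
  using cliff by (simp add: clifford_module_def)

lemmas cvS = generators_actD(1)[OF gen_act] and \<gamma>_lin = generators_actD(2)[OF gen_act] and \<gamma>_closed = generators_actD(3)[OF gen_act]
lemmas lf_\<gamma> = lf_comp[OF \<gamma>_lin]
lemmas clin_\<gamma> = clin_generators[OF gen_act]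
lemmas ws_in = onb_in(2)[OF onb]

lemma anticommute:
  assumes "lin_functional S l" "x \<in> W" "y \<in> W" "s \<in> carrier S"
  shows "l (\<gamma> x (\<gamma> y s)) = 2 * B x y * l s - l (\<gamma> y (\<gamma> x s))"
proof -
  have "\<gamma> x (\<gamma> y s) \<oplus>\<^bsub>S\<^esub> \<gamma> y (\<gamma> x s) = (2 * killing br x y) \<odot>\<^bsub>S\<^esub> s"
    using cliff assms by (simp add: clifford_module_def)
  then have "l (\<gamma> x (\<gamma> y s) \<oplus>\<^bsub>S\<^esub> \<gamma> y (\<gamma> x s)) = l ((2 * killing br x y) \<odot>\<^bsub>S\<^esub> s)" by simp
  then show ?thesis using assms by (simp add: lf_add[OF assms(1)] lf_smult[OF assms(1)] \<gamma>_closed eq_diff_eq)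
qed

text \<open>For distinct indices the Clifford product and the coefficient both change sign under an
  adjacent swap, so their product is symmetric; for repeated indices the coefficient vanishes. The
  sum over all triples, unlike the ordered one, can be moved to another basis.\<close>

lemma cubic_full:
  assumes l: "lin_functional S l" and s: "s \<in> carrier S"
  shows "(\<Sum>(i, j, k)\<in>{(i, j, k). i < j \<and> j < k \<and> k < length ws}.
      B (cb (ws ! i) (ws ! j)) (ws ! k) * l (\<gamma> (ws ! i) (\<gamma> (ws ! j) (\<gamma> (ws ! k) s)))) =
    1/6 * (\<Sum>i<length ws. \<Sum>j<length ws. \<Sum>k<length ws. B (cb (ws ! i) (ws ! j)) (ws ! k) * l (\<gamma> (ws ! i) (\<gamma> (ws ! j) (\<gamma> (ws ! k) s))))"
proof -
  let ?f = "\<lambda>i j k. B (cb (ws ! i) (ws ! j)) (ws ! k) * l (\<gamma> (ws ! i) (\<gamma> (ws ! j) (\<gamma> (ws ! k) s)))"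
  have z: "B (cb a a) c = 0" "B (cb a c) c = 0" for a c
    using B_cb_rotate(1)[of a a c] B_cb_rotate(2)[of a c c] by (simp_all add: eq_neg_iff_add_eq_0 flip: mult_2)
  have "(\<Sum>i<length ws. \<Sum>j<length ws. \<Sum>k<length ws. ?f i j k) =
    6 * (\<Sum>(i, j, k)\<in>{(i, j, k). i < j \<and> j < k \<and> k < length ws}. ?f i j k)"
  proof (rule sum_triples)
    fix i j k assume ijk: "i < length ws" "j < length ws" "k < length ws"
    show "?f i j k = ?f j i k"
    proof (cases "i = j")
      case False
      then have "l (\<gamma> (ws ! i) (\<gamma> (ws ! j) (\<gamma> (ws ! k) s))) = - l (\<gamma> (ws ! j) (\<gamma> (ws ! i) (\<gamma> (ws ! k) s)))"
        using ijk s ws_in by (subst anticommute[OF l]) (auto simp: onb_B[OF onb] \<gamma>_closed)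
      then show ?thesis using B_cb_rotate(1)[of "ws ! i" "ws ! j" "ws ! k"] by simp
    qed simp
    show "?f i j k = ?f i k j"
    proof (cases "j = k")
      case False
      then have "l (\<gamma> (ws ! i) (\<gamma> (ws ! j) (\<gamma> (ws ! k) s))) = - l (\<gamma> (ws ! i) (\<gamma> (ws ! k) (\<gamma> (ws ! j) s)))"
        using ijk s ws_in by (subst anticommute[OF lf_\<gamma>[OF _ l]]) (auto simp: onb_B[OF onb] \<gamma>_closed)
      then show ?thesis using B_cb_rotate(2)[of "ws ! i" "ws ! j" "ws ! k"] by simp
    qed simp
  qed (simp add: z)
  then show ?thesis by simp
qed

lemma cubic_independent:
  assumes l: "lin_functional S l" and s: "s \<in> carrier S" and es: "orthonormal_basis br W es"
  shows "(\<Sum>i<length ws. \<Sum>j<length ws. \<Sum>k<length ws. B (cb (ws ! i) (ws ! j)) (ws ! k) * l (\<gamma> (ws ! i) (\<gamma> (ws ! j) (\<gamma> (ws ! k) s)))) =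
    (\<Sum>i<length es. \<Sum>j<length es. \<Sum>k<length es. B (cb (es ! i) (es ! j)) (es ! k) * l (\<gamma> (es ! i) (\<gamma> (es ! j) (\<gamma> (es ! k) s))))"
  by (rule triple_sum_independent[OF onb es, of "\<lambda>a b c. l (\<gamma> a (\<gamma> b (\<gamma> c s)))"])
    (auto intro!: clin_\<gamma>[OF l] clin_\<gamma>[OF lf_\<gamma>[OF _ l]] clin_\<gamma>[OF lf_\<gamma>[OF _ lf_\<gamma>[OF _ l]]] \<gamma>_closed s)

text \<open>The spin representation in the form \<open>1/4 \<Sum> [x, w] w\<close>. Unlike
  \<open>so_inclusion\<close> it involves no ordering of the indices, so the contraction lemmas
  apply to it.\<close>

definition alpha where
  "alpha x s = finsum S (\<lambda>j. (1/4) \<odot>\<^bsub>S\<^esub> \<gamma> (cb x (ws ! j)) (\<gamma> (ws ! j) s)) {..<length ws}"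

context
  fixes x assumes x: "\<And>w. w \<in> W \<Longrightarrow> cb x w \<in> W"
begin

lemma alpha_closed: "s \<in> carrier S \<Longrightarrow> alpha x s \<in> carrier S"
  unfolding alpha_def using cvS ws_in x \<gamma>_closed by (intro cv_finsum_closed) auto

lemma lf_alpha:
  assumes "lin_functional S l" "s \<in> carrier S"
  shows "l (alpha x s) = 1/4 * (\<Sum>j<length ws. l (\<gamma> (cb x (ws ! j)) (\<gamma> (ws ! j) s)))"
proof -
  have "(\<lambda>j. (1/4) \<odot>\<^bsub>S\<^esub> \<gamma> (cb x (ws ! j)) (\<gamma> (ws ! j) s)) \<in> {..<length ws} \<rightarrow> carrier S"
    using assms cvS ws_in x \<gamma>_closed by auto
  from lf_finsum[OF cvS assms(1) this] show ?thesis
    unfolding alpha_def using assms ws_in x \<gamma>_closed by (simp add: lf_smult[OF assms(1)] sum_distrib_left)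
qed

lemma alpha_lin: "lin_map S S (alpha x)"
proof (rule lin_mapI[OF cvS cvS])
  fix l s t assume "lin_functional S l" "s \<in> carrier S" "t \<in> carrier S"
  then show "l (alpha x (s \<oplus>\<^bsub>S\<^esub> t)) = l (alpha x s) + l (alpha x t)"
    using cvS ws_in x \<gamma>_closed
    by (simp add: lf_alpha lin_map_add[OF \<gamma>_lin] lf_add[of S l] sum.distrib distrib_left)
next
  fix l c s assume "lin_functional S l" "s \<in> carrier S"
  then show "l (alpha x (c \<odot>\<^bsub>S\<^esub> s)) = c * l (alpha x s)"
    using cvS ws_in x \<gamma>_closed
    by (simp add: lf_alpha lin_map_smult[OF \<gamma>_lin] lf_smult[of S l] sum_distrib_left algebra_simps)
qed (rule alpha_closed)

text \<open>The summand is symmetric in \<open>i\<close> and \<open>j\<close>, so the ordered sum is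
  half of the full one; summing over \<open>i\<close> reassembles \<open>[x, w_j]\<close>, and the
  factors \<open>1/2 * 1/2\<close> give the \<open>1/4\<close> of \<open>alpha\<close>.\<close>

lemma so_inclusion_alpha:
  assumes l: "lin_functional S l" and s: "s \<in> carrier S"
  shows "(\<Sum>(i, j)\<in>{(i, j). i < j \<and> j < length ws}. ad_matrix br ws x i j * (1/2) * l (\<gamma> (ws ! i) (\<gamma> (ws ! j) s))) = l (alpha x s)"
proof -
  let ?f = "\<lambda>i j. B (cb x (ws ! j)) (ws ! i) * (1/2) * l (\<gamma> (ws ! i) (\<gamma> (ws ! j) s))"
  have z: "B (cb a c) c = 0" for a c
    using B_cb_rotate(2)[of a c c] by (simp add: eq_neg_iff_add_eq_0 flip: mult_2)
  have "(\<Sum>i<length ws. \<Sum>j<length ws. ?f i j) = 2 * (\<Sum>(i, j)\<in>{(i, j). i < j \<and> j < length ws}. ?f i j)"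
  proof (rule sum_pairs)
    fix i j assume ij: "i < length ws" "j < length ws"
    show "?f i j = ?f j i"
    proof (cases "i = j")
      case False
      then have "l (\<gamma> (ws ! i) (\<gamma> (ws ! j) s)) = - l (\<gamma> (ws ! j) (\<gamma> (ws ! i) s))"
        using ij s ws_in by (subst anticommute[OF l]) (auto simp: onb_B[OF onb])
      then show ?thesis using B_cb_rotate(2)[of x "ws ! j" "ws ! i"] by simp
    qed simp
  qed (simp add: z)
  moreover have "(\<Sum>i<length ws. ?f i j) = 1/2 * l (\<gamma> (cb x (ws ! j)) (\<gamma> (ws ! j) s))" if "j < length ws" for j
    using clin_expand[OF onb clin_\<gamma>[OF l \<gamma>_closed[OF ws_in[OF that] s]] x[OF ws_in[OF that]]]
    by (simp add: sum_distrib_left algebra_simps)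
  then have "(\<Sum>j<length ws. \<Sum>i<length ws. ?f i j) = (\<Sum>j<length ws. 1/2 * l (\<gamma> (cb x (ws ! j)) (\<gamma> (ws ! j) s)))"
    by (intro sum.cong) auto
  then have "(\<Sum>j<length ws. \<Sum>i<length ws. ?f i j) = 2 * l (alpha x s)"
    by (simp add: lf_alpha[OF l s] sum_distrib_left)
  ultimately show ?thesis by (subst (asm) sum.swap) (simp add: ad_matrix_def)
qed

text \<open>Moving \<open>\<gamma> z\<close> to the left through a product of two generators
  produces two correction terms by the Clifford relation. After summation over the basis each of
  them contributes one half of \<open>\<gamma> [x, z]\<close>.\<close>

lemma alpha_commutator:
  assumes l: "lin_functional S l" and s: "s \<in> carrier S" and z: "z \<in> W"
  shows "l (alpha x (\<gamma> z s)) = l (\<gamma> z (alpha x s)) + l (\<gamma> (cb x z) s)"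
proof -
  have *: "l (\<gamma> a (\<gamma> b (\<gamma> z s))) = l (\<gamma> z (\<gamma> a (\<gamma> b s))) + 2 * B b z * l (\<gamma> a s) - 2 * B a z * l (\<gamma> b s)"
    if "a \<in> W" "b \<in> W" for a b
    using that z s anticommute[OF lf_\<gamma>[OF that(1) l] that(2) z s] anticommute[OF l that(1) z \<gamma>_closed[OF that(2) s]]
    by simp
  have "l (alpha x (\<gamma> z s)) = 1/4 * (\<Sum>j<length ws. l (\<gamma> z (\<gamma> (cb x (ws ! j)) (\<gamma> (ws ! j) s)))) +
     1/2 * (\<Sum>j<length ws. B z (ws ! j) * l (\<gamma> (cb x (ws ! j)) s)) + 1/2 * (\<Sum>j<length ws. B (cb x z) (ws ! j) * l (\<gamma> (ws ! j) s))"
    using x ws_in z s B_sym[of z] B_skew[of x _ z] B_sym[of "cb x z"]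
    by (simp add: lf_alpha[OF l] \<gamma>_closed * sum.distrib sum_subtractf sum_negf sum_distrib_left algebra_simps)
  also have "(\<Sum>j<length ws. B z (ws ! j) * l (\<gamma> (cb x (ws ! j)) s)) = l (\<gamma> (cb x z) s)"
    by (rule clin_expand[OF onb clin_cb[OF clin_\<gamma>[OF l s] x] z, symmetric])
  also have "(\<Sum>j<length ws. B (cb x z) (ws ! j) * l (\<gamma> (ws ! j) s)) = l (\<gamma> (cb x z) s)"
    by (rule clin_expand[OF onb clin_\<gamma>[OF l s] x[OF z], symmetric])
  also have "1/4 * (\<Sum>j<length ws. l (\<gamma> z (\<gamma> (cb x (ws ! j)) (\<gamma> (ws ! j) s)))) = l (\<gamma> z (alpha x s))"
    using lf_alpha[OF lf_\<gamma>[OF z l] s] by simp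
  finally show ?thesis by simp
qed

end

text \<open>The commutator formula for \<open>alpha x\<close> is applied to both generators in
  \<open>alpha y\<close>. The resulting term \<open>[y, w] [x, w]\<close> is turned by
  \<open>contraction_invariant\<close> into \<open>- [y, [x, w]] w\<close>, and the Jacobi identity
  combines it with \<open>[x, [y, w]] w\<close>.\<close>

lemma alpha_bracket:
  assumes x: "\<And>w. w \<in> W \<Longrightarrow> cb x w \<in> W" and y: "\<And>w. w \<in> W \<Longrightarrow> cb y w \<in> W"
    and l: "lin_functional S l" and s: "s \<in> carrier S"
  shows "l (alpha (cb x y) s) = l (alpha x (alpha y s)) - l (alpha y (alpha x s))"
proof -
  have xy: "cb (cb x y) w \<in> W" if "w \<in> W" for w
    using that x y cs.subspace_diff[OF onb_subspace[OF onb]] by (simp add: cb_jacobi)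
  have lx: "lin_functional S (\<lambda>s. l (alpha x s))" by (rule lf_comp[OF alpha_lin[OF x] l])
  have ax: "alpha x s \<in> carrier S" by (rule alpha_closed[OF x s])
  have 1: "l (alpha x (\<gamma> a (\<gamma> b s))) = l (\<gamma> a (\<gamma> b (alpha x s))) + l (\<gamma> (cb x a) (\<gamma> b s)) + l (\<gamma> a (\<gamma> (cb x b) s))"
    if "a \<in> W" "b \<in> W" for a b
    using that s by (simp add: alpha_commutator[OF x l] alpha_commutator[OF x lf_\<gamma>[OF _ l]] \<gamma>_closed)
  have "4 * (l (alpha x (alpha y s)) - l (alpha y (alpha x s))) =
      (\<Sum>j<length ws. l (\<gamma> (cb x (cb y (ws ! j))) (\<gamma> (ws ! j) s))) + (\<Sum>j<length ws. l (\<gamma> (cb y (ws ! j)) (\<gamma> (cb x (ws ! j)) s)))"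
    using ws_in x y s by (simp add: lf_alpha[OF y lx s] lf_alpha[OF y l ax] 1 sum.distrib add_divide_distrib)
  also have "(\<Sum>j<length ws. l (\<gamma> (cb y (ws ! j)) (\<gamma> (cb x (ws ! j)) s))) = - (\<Sum>j<length ws. l (\<gamma> (cb y (cb x (ws ! j))) (\<gamma> (ws ! j) s)))"
  proof -
    have "cbil W (\<lambda>a b. l (\<gamma> (cb y a) (\<gamma> b s)))"
      using y s by (auto simp: cbil_def intro!: clin_cb[OF clin_\<gamma>[OF l]] clin_\<gamma>[OF lf_\<gamma>[OF _ l]] \<gamma>_closed)
    from contraction_invariant[OF onb this x] show ?thesis by simp
  qed
  also have "(\<Sum>j<length ws. l (\<gamma> (cb x (cb y (ws ! j))) (\<gamma> (ws ! j) s))) + - (\<Sum>j<length ws. l (\<gamma> (cb y (cb x (ws ! j))) (\<gamma> (ws ! j) s)))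
     = (\<Sum>j<length ws. l (\<gamma> (cb (cb x y) (ws ! j)) (\<gamma> (ws ! j) s)))"
    unfolding sum_negf[symmetric] sum.distrib[symmetric]
  proof (intro sum.cong refl)
    fix j assume "j \<in> {..<length ws}"
    then have j: "ws ! j \<in> W" using ws_in by auto
    have "clin W (\<lambda>a. l (\<gamma> a (\<gamma> (ws ! j) s)))" by (rule clin_\<gamma>[OF l \<gamma>_closed[OF j s]])
    then have d: "l (\<gamma> (a - b) (\<gamma> (ws ! j) s)) = l (\<gamma> a (\<gamma> (ws ! j) s)) + - l (\<gamma> b (\<gamma> (ws ! j) s))" if "a \<in> W" "b \<in> W" for a b
      using that cs.subspace_scale[OF onb_subspace[OF onb], of b "- 1"] cs.scale_minus_left[of 1 b] unfolding clin_def
      by (metis add_uminus_conv_diff cs.scale_one mult_minus1)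
    show "l (\<gamma> (cb x (cb y (ws ! j))) (\<gamma> (ws ! j) s)) + - l (\<gamma> (cb y (cb x (ws ! j))) (\<gamma> (ws ! j) s)) = l (\<gamma> (cb (cb x y) (ws ! j)) (\<gamma> (ws ! j) s))"
      unfolding cb_jacobi using x y j by (simp add: d)
  qed
  also have "\<dots> = 4 * l (alpha (cb x y) s)" by (simp add: lf_alpha[OF xy l s])
  finally have "4 * (l (alpha x (alpha y s)) - l (alpha y (alpha x s))) = 4 * l (alpha (cb x y) s)" .
  then show ?thesis by (subst (asm) mult_cancel_left) simp
qed

lemma alpha_clin:
  assumes "\<And>x w. x \<in> kk \<Longrightarrow> w \<in> W \<Longrightarrow> cb x w \<in> W" "csubspace kk" "lin_functional S l" "s \<in> carrier S"
  shows "clin kk (\<lambda>x. l (alpha x s))"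
proof (rule clinI)
  note c = clin_\<gamma>[OF assms(3)]
  fix x y assume xy: "x \<in> kk" "y \<in> kk"
  then have "x + y \<in> kk" using assms(2) cs.subspace_add by blast
  then show "l (alpha (x + y) s) = l (alpha x s) + l (alpha y s)"
    using xy assms(1) ws_in c \<gamma>_closed[OF _ assms(4)]
    by (simp add: lf_alpha[OF assms(1) assms(3,4)] clin_def sum.distrib)
next
  note c = clin_\<gamma>[OF assms(3)]
  fix a x assume x: "x \<in> kk"
  then have "cscale a x \<in> kk" using assms(2) cs.subspace_scale by blast
  then show "l (alpha (cscale a x) s) = a * l (alpha x s)"
    using x assms(1) ws_in c \<gamma>_closed[OF _ assms(4)]
    by (simp add: lf_alpha[OF assms(1) assms(3,4)] clin_def sum_distrib_left algebra_simps)
qed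

end

section \<open>Projections for a Hodge decomposition\<close>

lemma cv_add_eq_iff:
  assumes "cvspace M" "u \<in> carrier M" "x \<in> carrier M" "u' \<in> carrier M" "x' \<in> carrier M" "u \<oplus>\<^bsub>M\<^esub> x = u' \<oplus>\<^bsub>M\<^esub> x'"
  shows "u \<ominus>\<^bsub>M\<^esub> u' = x' \<ominus>\<^bsub>M\<^esub> x"
proof (rule functional_eqI[OF assms(1)])
  fix l assume l: "lin_functional M l"
  have "l u + l x = l u' + l x'" using arg_cong[OF assms(6), of l] assms(2-5) by (simp only: lf_add[OF l])
  then show "l (u \<ominus>\<^bsub>M\<^esub> u') = l (x' \<ominus>\<^bsub>M\<^esub> x)"
    using assms(2-5) by (simp add: lf_diff[OF assms(1) l] algebra_simps)
qed (use assms in auto)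

lemma cv_diff_zero: "cvspace M \<Longrightarrow> u \<in> carrier M \<Longrightarrow> v \<in> carrier M \<Longrightarrow> u \<ominus>\<^bsub>M\<^esub> v = \<zero>\<^bsub>M\<^esub> \<Longrightarrow> u = v"
proof (rule functional_eqI)
  fix l assume *: "cvspace M" "u \<in> carrier M" "v \<in> carrier M" "u \<ominus>\<^bsub>M\<^esub> v = \<zero>\<^bsub>M\<^esub>" and l: "lin_functional M l"
  have "l u - l v = 0" using lf_diff[OF *(1) l *(2,3)] *(4) lf_zero[OF *(1) l] by simp
  then show "l u = l v" by simp
qed auto

lemma cv_zero_diff: "cvspace M \<Longrightarrow> \<zero>\<^bsub>M\<^esub> \<ominus>\<^bsub>M\<^esub> \<zero>\<^bsub>M\<^esub> = \<zero>\<^bsub>M\<^esub>"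
  by (simp add: cv_diff_eq)

text \<open>Algebraic Hodge decomposition: \<open>decomp\<close> says that kernel and image span the
  space, \<open>disjoint\<close> that they meet in zero. The space may be
  infinite-dimensional.\<close>

locale hodge =
  fixes T :: "(complex, 'a) module" and D
  assumes T: "cvspace T" and D: "lin_map T T D"
    and decomp: "\<And>t. t \<in> carrier T \<Longrightarrow> \<exists>u\<in>carrier T. \<exists>w\<in>carrier T. D u = \<zero>\<^bsub>T\<^esub> \<and> t = u \<oplus>\<^bsub>T\<^esub> D w"
    and disjoint: "\<And>w. w \<in> carrier T \<Longrightarrow> D (D w) = \<zero>\<^bsub>T\<^esub> \<Longrightarrow> D w = \<zero>\<^bsub>T\<^esub>"
begin

lemmas Dc = lin_map_closed[OF D]
lemmas Dadd = lin_map_add[OF D] and Dsmult = lin_map_smult[OF D] and Ddiff = lin_map_diff[OF T T D] and Dzero = lin_map_zero[OF T T D]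

definition proj where "proj t = (SOME u. u \<in> carrier T \<and> D u = \<zero>\<^bsub>T\<^esub> \<and> (\<exists>w\<in>carrier T. t = u \<oplus>\<^bsub>T\<^esub> D w))"

lemma proj_props: "t \<in> carrier T \<Longrightarrow> proj t \<in> carrier T \<and> D (proj t) = \<zero>\<^bsub>T\<^esub> \<and> (\<exists>w\<in>carrier T. t = proj t \<oplus>\<^bsub>T\<^esub> D w)"
  unfolding proj_def by (rule someI_ex) (use decomp in blast)

text \<open>The kernel parts of two decompositions of one vector differ by an element that lies in
  kernel and image at once, and \<open>disjoint\<close> makes it zero.\<close>

lemma proj_unique:
  assumes "u \<in> carrier T" "D u = \<zero>\<^bsub>T\<^esub>" "w \<in> carrier T"
  shows "proj (u \<oplus>\<^bsub>T\<^esub> D w) = u"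
proof -
  let ?t = "u \<oplus>\<^bsub>T\<^esub> D w"
  have "?t \<in> carrier T" using assms T Dc by simp
  from proj_props[OF this] obtain w' where p: "proj ?t \<in> carrier T" "D (proj ?t) = \<zero>\<^bsub>T\<^esub>" "w' \<in> carrier T" "?t = proj ?t \<oplus>\<^bsub>T\<^esub> D w'" by blast
  have "u \<ominus>\<^bsub>T\<^esub> proj ?t = D w' \<ominus>\<^bsub>T\<^esub> D w" using assms p T Dc by (intro cv_add_eq_iff) auto
  also have "\<dots> = D (w' \<ominus>\<^bsub>T\<^esub> w)" using assms p by (simp add: Ddiff)
  finally have *: "u \<ominus>\<^bsub>T\<^esub> proj ?t = D (w' \<ominus>\<^bsub>T\<^esub> w)" .
  have "D (u \<ominus>\<^bsub>T\<^esub> proj ?t) = \<zero>\<^bsub>T\<^esub>" using assms p(1,2) by (simp add: Ddiff cv_zero_diff[OF T])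
  then have "u \<ominus>\<^bsub>T\<^esub> proj ?t = \<zero>\<^bsub>T\<^esub>" using * disjoint[of "w' \<ominus>\<^bsub>T\<^esub> w"] assms p T by simp
  then show ?thesis using cv_diff_zero[OF T] assms p by metis
qed

lemma proj_closed: "t \<in> carrier T \<Longrightarrow> proj t \<in> carrier T"
  and D_proj: "t \<in> carrier T \<Longrightarrow> D (proj t) = \<zero>\<^bsub>T\<^esub>"
  using proj_props by auto

lemma proj_ker: "u \<in> carrier T \<Longrightarrow> D u = \<zero>\<^bsub>T\<^esub> \<Longrightarrow> proj u = u"
  using proj_unique[of u "\<zero>\<^bsub>T\<^esub>"] T Dzero by simp

lemma proj_lin: "lin_map T T proj"
  unfolding lin_map_def
proof (intro conjI funcsetI ballI allI proj_closed)
  fix x y assume xy: "x \<in> carrier T" "y \<in> carrier T"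
  obtain w where w: "w \<in> carrier T" "x = proj x \<oplus>\<^bsub>T\<^esub> D w" using proj_props[OF xy(1)] by blast
  obtain v where v: "v \<in> carrier T" "y = proj y \<oplus>\<^bsub>T\<^esub> D v" using proj_props[OF xy(2)] by blast
  have "x \<oplus>\<^bsub>T\<^esub> y = (proj x \<oplus>\<^bsub>T\<^esub> D w) \<oplus>\<^bsub>T\<^esub> (proj y \<oplus>\<^bsub>T\<^esub> D v)" using w v by metis
  also have "\<dots> = (proj x \<oplus>\<^bsub>T\<^esub> proj y) \<oplus>\<^bsub>T\<^esub> D (w \<oplus>\<^bsub>T\<^esub> v)"
    using w(1) v(1) xy T by (intro functional_eqI[OF T]) (auto simp: proj_closed Dc Dadd lf_add[where M = T])
  finally show "proj (x \<oplus>\<^bsub>T\<^esub> y) = proj x \<oplus>\<^bsub>T\<^esub> proj y"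
    using proj_unique[of "proj x \<oplus>\<^bsub>T\<^esub> proj y" "w \<oplus>\<^bsub>T\<^esub> v"] w v xy T by (simp add: proj_closed Dadd D_proj)
next
  fix c x assume x: "x \<in> carrier T"
  obtain w where w: "w \<in> carrier T" "x = proj x \<oplus>\<^bsub>T\<^esub> D w" using proj_props[OF x(1)] by blast
  have "c \<odot>\<^bsub>T\<^esub> x = c \<odot>\<^bsub>T\<^esub> (proj x \<oplus>\<^bsub>T\<^esub> D w)" using w by metis
  also have "\<dots> = c \<odot>\<^bsub>T\<^esub> proj x \<oplus>\<^bsub>T\<^esub> D (c \<odot>\<^bsub>T\<^esub> w)"
    using w(1) x T by (simp add: cv_add_smult proj_closed Dc Dsmult)
  finally show "proj (c \<odot>\<^bsub>T\<^esub> x) = c \<odot>\<^bsub>T\<^esub> proj x"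
    using proj_unique[of "c \<odot>\<^bsub>T\<^esub> proj x" "c \<odot>\<^bsub>T\<^esub> w"] w x T by (simp add: proj_closed Dsmult D_proj)
qed

lemma proj_D: "t \<in> carrier T \<Longrightarrow> proj (D t) = \<zero>\<^bsub>T\<^esub>"
  using proj_unique[of "\<zero>\<^bsub>T\<^esub>" t] T Dzero Dc by simp

text \<open>The generalized inverse (Green operator) of \<open>D\<close>: zero on the kernel and
  inverse to \<open>D\<close> on the image. The condition \<open>proj w = 0\<close> selects the
  preimage that lies in the image.\<close>

definition inv_D where "inv_D t = (SOME w. w \<in> carrier T \<and> proj w = \<zero>\<^bsub>T\<^esub> \<and> D w = t \<ominus>\<^bsub>T\<^esub> proj t)"

lemma inv_D_props: assumes t: "t \<in> carrier T" shows "inv_D t \<in> carrier T \<and> proj (inv_D t) = \<zero>\<^bsub>T\<^esub> \<and> D (inv_D t) = t \<ominus>\<^bsub>T\<^esub> proj t"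
  unfolding inv_D_def
proof (rule someI_ex)
  obtain w where w: "w \<in> carrier T" "t = proj t \<oplus>\<^bsub>T\<^esub> D w" using proj_props[OF t(1)] by blast
  let ?w = "w \<ominus>\<^bsub>T\<^esub> proj w"
  have "t \<ominus>\<^bsub>T\<^esub> proj t = (proj t \<oplus>\<^bsub>T\<^esub> D w) \<ominus>\<^bsub>T\<^esub> proj t" using w by simp
  also have "\<dots> = D ?w" using w(1) t T
    by (intro functional_eqI[OF T]) (auto simp: proj_closed Dc Ddiff D_proj lf_add[where M = T] lf_diff[where M = T] lf_zero)
  finally have "D ?w = t \<ominus>\<^bsub>T\<^esub> proj t" by simp
  moreover have "proj ?w = \<zero>\<^bsub>T\<^esub>"
    using w T by (intro functional_eqI[OF T]) (auto simp: lin_map_diff[OF T T proj_lin] proj_closed proj_ker D_proj lf_diff[where M = T] lf_zero)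
  ultimately show "\<exists>w. w \<in> carrier T \<and> proj w = \<zero>\<^bsub>T\<^esub> \<and> D w = t \<ominus>\<^bsub>T\<^esub> proj t"
    using w T by (intro exI[of _ ?w]) (simp add: proj_closed)
qed

lemma inv_D_unique:
  assumes "t \<in> carrier T" "w \<in> carrier T" "proj w = \<zero>\<^bsub>T\<^esub>" "D w = t \<ominus>\<^bsub>T\<^esub> proj t"
  shows "inv_D t = w"
proof -
  note i = inv_D_props[OF assms(1)]
  let ?d = "inv_D t \<ominus>\<^bsub>T\<^esub> w"
  have d: "?d \<in> carrier T" using i assms T by simp
  have "D ?d = \<zero>\<^bsub>T\<^esub>" using i assms T
    by (intro functional_eqI[OF T]) (auto simp: proj_closed Ddiff lf_diff[where M = T] lf_zero)
  then have "proj ?d = ?d" using d by (rule proj_ker[rotated])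
  moreover have "proj ?d = \<zero>\<^bsub>T\<^esub>"
    using i assms T by (intro functional_eqI[OF T]) (auto simp: lin_map_diff[OF T T proj_lin] lf_diff[where M = T] lf_zero)
  ultimately show ?thesis using cv_diff_zero[OF T, of "inv_D t" w] i assms by simp
qed

lemma inv_D_closed: "t \<in> carrier T \<Longrightarrow> inv_D t \<in> carrier T"
  and D_inv_D: "t \<in> carrier T \<Longrightarrow> D (inv_D t) = t \<ominus>\<^bsub>T\<^esub> proj t"
  using inv_D_props by auto

text \<open>From \<open>A D = c D A\<close> with a sign \<open>c\<close>, the operator
  \<open>A\<close> preserves kernel and image, hence commutes with the projection; the sign
  reappears in front of the generalized inverse. The sign is \<open>sg\<close> for the parity
  operator, and \<open>1\<close> for the diagonal action of \<kk> and for \<open>D\<close>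
  itself.\<close>

lemma commute_transfer:
  assumes A: "lin_map T T A" and AD: "\<And>t. t \<in> carrier T \<Longrightarrow> A (D t) = c \<odot>\<^bsub>T\<^esub> D (A t)" and c: "c * c = 1" and t: "t \<in> carrier T"
  shows "proj (A t) = A (proj t)" "inv_D (A t) = c \<odot>\<^bsub>T\<^esub> A (inv_D t)"
proof -
  note Ac = lin_map_closed[OF A] and Aadd = lin_map_add[OF A] and Azero = lin_map_zero[OF T T A]
  have AK: "D (A u) = \<zero>\<^bsub>T\<^esub>" if "u \<in> carrier T" "D u = \<zero>\<^bsub>T\<^esub>" for u
  proof -
    have "c \<odot>\<^bsub>T\<^esub> (c \<odot>\<^bsub>T\<^esub> D (A u)) = c \<odot>\<^bsub>T\<^esub> A (D u)" using AD[OF that(1)] by simp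
    also have "\<dots> = \<zero>\<^bsub>T\<^esub>" using that Azero T by simp
    finally show ?thesis using c that T Ac Dc by (simp add: cv_smult_smult)
  qed
  have proj: "proj (A t) = A (proj t)" if t: "t \<in> carrier T" for t
  proof -
    obtain w where w: "w \<in> carrier T" "t = proj t \<oplus>\<^bsub>T\<^esub> D w" using proj_props[OF t] by blast
    have "A t = A (proj t \<oplus>\<^bsub>T\<^esub> D w)" using w by simp
    also have "\<dots> = A (proj t) \<oplus>\<^bsub>T\<^esub> D (c \<odot>\<^bsub>T\<^esub> A w)"
      using w(1) t Ac T by (simp add: Aadd proj_closed Dc AD Dsmult)
    finally show ?thesis
      using proj_unique[of "A (proj t)" "c \<odot>\<^bsub>T\<^esub> A w"] w t Ac T AK proj_closed D_proj by simp
  qed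
  show "proj (A t) = A (proj t)" by (rule proj[OF t])
  show "inv_D (A t) = c \<odot>\<^bsub>T\<^esub> A (inv_D t)"
  proof (rule inv_D_unique)
    note i = inv_D_props[OF t]
    show "A t \<in> carrier T" "c \<odot>\<^bsub>T\<^esub> A (inv_D t) \<in> carrier T" using t Ac T i by auto
    show "proj (c \<odot>\<^bsub>T\<^esub> A (inv_D t)) = \<zero>\<^bsub>T\<^esub>"
      using i Ac T by (simp add: lin_map_smult[OF proj_lin] proj Azero)
    have "D (c \<odot>\<^bsub>T\<^esub> A (inv_D t)) = A (D (inv_D t))" using inv_D_closed[OF t] Ac by (simp add: Dsmult AD)
    then show "D (c \<odot>\<^bsub>T\<^esub> A (inv_D t)) = A t \<ominus>\<^bsub>T\<^esub> proj (A t)"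
      using t i by (simp add: lin_map_diff[OF T T A] proj_closed proj)
  qed
qed

lemma inv_D_lin: "lin_map T T inv_D"
  unfolding lin_map_def
proof (intro conjI funcsetI ballI allI inv_D_closed)
  note i = inv_D_props
  fix x y assume xy: "x \<in> carrier T" "y \<in> carrier T"
  show "inv_D (x \<oplus>\<^bsub>T\<^esub> y) = inv_D x \<oplus>\<^bsub>T\<^esub> inv_D y"
  proof (rule inv_D_unique)
    show "D (inv_D x \<oplus>\<^bsub>T\<^esub> inv_D y) = x \<oplus>\<^bsub>T\<^esub> y \<ominus>\<^bsub>T\<^esub> proj (x \<oplus>\<^bsub>T\<^esub> y)"
      using xy T i by (intro functional_eqI[OF T])
        (auto simp: inv_D_closed proj_closed Dadd lin_map_add[OF proj_lin] lf_add[where M = T] lf_diff[where M = T] Dc)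
  qed (use xy T i in \<open>auto simp: lin_map_add[OF proj_lin]\<close>)
next
  note i = inv_D_props
  fix c x assume x: "x \<in> carrier T"
  show "inv_D (c \<odot>\<^bsub>T\<^esub> x) = c \<odot>\<^bsub>T\<^esub> inv_D x"
  proof (rule inv_D_unique)
    show "D (c \<odot>\<^bsub>T\<^esub> inv_D x) = c \<odot>\<^bsub>T\<^esub> x \<ominus>\<^bsub>T\<^esub> proj (c \<odot>\<^bsub>T\<^esub> x)"
      using x T i by (intro functional_eqI[OF T])
        (auto simp: inv_D_closed proj_closed Dsmult lin_map_smult[OF proj_lin] lf_smult[where M = T] lf_diff[where M = T] Dc right_diff_distrib)
  qed (use x T i in \<open>auto simp: lin_map_smult[OF proj_lin]\<close>)
qed

lemma inv_D_D: "t \<in> carrier T \<Longrightarrow> inv_D (D t) = t \<ominus>\<^bsub>T\<^esub> proj t"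
proof -
  assume t: "t \<in> carrier T"
  \<comment> \<open>The transfer lemma with \<open>A = D\<close>: as \<open>D\<close> commutes with
    itself, its generalized inverse is also a left inverse up to the projection.\<close>
  have "inv_D (D t) = 1 \<odot>\<^bsub>T\<^esub> D (inv_D t)"
    using t T Dc by (intro commute_transfer(2)[OF D]) auto
  then show ?thesis using t T by (simp add: D_inv_D proj_closed)
qed

end

section \<open>The Dirac operator of the symmetric pair\<close>

lemma tens_lf:
  assumes "cvspace M" "cvspace N" "lin_functional (tensor M N) l"
  shows "n \<in> carrier N \<Longrightarrow> lin_functional M (\<lambda>m. l (tens M N m n))" "m \<in> carrier M \<Longrightarrow> lin_functional N (\<lambda>n. l (tens M N m n))"
  using bilin_tens[OF assms(1,2)] lf_comp[OF _ assms(3)] by (auto simp: bilin_def)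

locale symmetric_pair = cartan +
  fixes V \<pi> S \<gamma> ws
  assumes V: "lie_module br UNIV V \<pi>" and clp: "clifford_module br pp S \<gamma>" and onbp: "orthonormal_basis br pp ws"
begin

sublocale clifford br pp S \<gamma> ws
  by unfold_locales (fact clp onbp)+

lemma V_act: "generators_act UNIV V \<pi>"
  using V by (simp add: lie_module_def)

lemmas cvV = generators_actD(1)[OF V_act]
lemma \<pi>_lin: "lin_map V V (\<pi> x)" by (rule generators_actD(2)[OF V_act]) simp
lemma \<pi>_closed: "v \<in> carrier V \<Longrightarrow> \<pi> x v \<in> carrier V" by (rule generators_actD(3)[OF V_act]) simp_all

lemma \<pi>_bracket: "v \<in> carrier V \<Longrightarrow> \<pi> (cb x y) v = \<pi> x (\<pi> y v) \<ominus>\<^bsub>V\<^esub> \<pi> y (\<pi> x v)"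
  using V unfolding lie_module_def by blast

lemma lf_\<pi>_bracket: "lin_functional V l \<Longrightarrow> v \<in> carrier V \<Longrightarrow> l (\<pi> (cb x y) v) = l (\<pi> x (\<pi> y v)) - l (\<pi> y (\<pi> x v))"
  by (simp add: \<pi>_bracket lf_diff[OF cvV] \<pi>_closed)

lemma clin_\<pi>: "lin_functional V l \<Longrightarrow> v \<in> carrier V \<Longrightarrow> clin W (\<lambda>x. l (\<pi> x v))"
  using clin_generators[OF V_act] by (auto simp: clin_def)

abbreviation "T1 \<equiv> tensor V S"
abbreviation "D1 \<equiv> tensor_act V \<pi> S \<gamma> (dirac br UNIV kk ws)"
abbreviation "dg x \<equiv> tensor_act V \<pi> S \<gamma> (diagonal br UNIV kk ws x)"
abbreviation "tn \<equiv> tens V S"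

lemma UNIV_sub: "subalgebra br UNIV"
  by (simp add: subalgebra_def)

lemmas T1 = cvspace_tensor[OF cvV cvS]
lemmas tnc = tens_closed[OF cvV cvS]
lemmas act_data = UNIV_sub V orth_kk[symmetric] pp_subspace clp onb_in(1)[OF onbp]
lemmas D1_lin = tensor_act_linear[OF act_data(1-5) dirac_closed[OF act_data]]
lemma dg_lin: "lin_map T1 T1 (dg x)"
  by (rule tensor_act_linear[OF act_data(1-5) diagonal_closed[OF act_data]]) simp

lemmas tlf = tens_lf[OF cvV cvS]

text \<open>For a symmetric pair the cubic term is zero, since \<open>[\<pp>, \<pp>]\<close> lies in
  \<kk>, which is orthogonal to \<pp>. The formula is stated for an arbitrary orthonormal basis
  because the adjointness argument needs a real one.\<close>

lemma D1_tens:
  assumes l: "lin_functional T1 l" and vs: "v \<in> carrier V" "s \<in> carrier S" and es: "orthonormal_basis br pp es"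
  shows "l (D1 (tn v s)) = (\<Sum>i<length es. l (tn (\<pi> (es ! i) v) (\<gamma> (es ! i) s)))"
proof -
  have "l (D1 (tn v s)) = (\<Sum>i<length ws. l (tn (\<pi> (ws ! i) v) (\<gamma> (ws ! i) s)))"
  proof -
    have "B (cb (ws ! i) (ws ! j)) (ws ! k) = 0" if "i < j" "j < k" "k < length ws" for i j k
      using that ws_in B_kp[OF cb_pp] by simp
    then have "(\<Sum>(i, j, k)\<in>{(i, j, k). i < j \<and> j < k \<and> k < length ws}.
      B (cb (ws ! i) (ws ! j)) (ws ! k) * l (tn v (\<gamma> (ws ! i) (\<gamma> (ws ! j) (\<gamma> (ws ! k) s))))) = 0"
      by (intro sum.neutral) auto
    then show ?thesis using dirac_act[OF act_data l vs] by simp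
  qed
  also have "\<dots> = (\<Sum>i<length es. l (tn (\<pi> (es ! i) v) (\<gamma> (es ! i) s)))"
    by (rule contraction_independent[OF es onbp, of "\<lambda>x y. l (tn (\<pi> x v) (\<gamma> y s))"])
      (unfold cbil_def, intro conjI ballI clin_\<gamma> clin_\<pi>[OF tlf(1)[OF l]] tlf(2)[OF l] \<pi>_closed vs \<gamma>_closed)
  finally show ?thesis .
qed

lemma dg_tens:
  assumes l: "lin_functional T1 l" and vs: "v \<in> carrier V" "s \<in> carrier S" and x: "x \<in> kk"
  shows "l (dg x (tn v s)) = l (tn (\<pi> x v) s) + l (tn v (alpha x s))"
  using diagonal_act[OF act_data l vs, of x] so_inclusion_alpha[OF cb_kp[OF x] tlf(2)[OF l vs(1)] vs(2)] by simp

lemmas alpha_kk = alpha_closed[OF cb_kp]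

text \<open>Moving \<open>x\<close> past a summand costs
  \<open>\<pi> [x, w] \<otimes> \<gamma> w\<close> on the module side and
  \<open>\<pi> w \<otimes> \<gamma> [x, w]\<close> on the spin side; the two totals cancel by
  invariance of the contraction.\<close>

lemma D1_dg:
  assumes x: "x \<in> kk" and t: "t \<in> carrier T1"
  shows "D1 (dg x t) = dg x (D1 t)"
proof (rule functional_eqI[OF T1])
  fix l assume l: "lin_functional T1 l"
  have lD: "lin_functional T1 (\<lambda>t. l (D1 t))" and lg: "lin_functional T1 (\<lambda>t. l (dg x t))"
    by (rule lf_comp[OF D1_lin l] lf_comp[OF dg_lin l])+
  show "l (D1 (dg x t)) = l (dg x (D1 t))"
  proof (rule tensor_lf_ext[OF cvV cvS lf_comp[OF dg_lin lD] lf_comp[OF D1_lin lg] _ t])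
    fix v s assume v: "v \<in> carrier V" and s: "s \<in> carrier S"
    have inv: "(\<Sum>i<length ws. l (tn (\<pi> (cb x (ws ! i)) v) (\<gamma> (ws ! i) s))) = - (\<Sum>i<length ws. l (tn (\<pi> (ws ! i) v) (\<gamma> (cb x (ws ! i)) s)))"
      by (rule contraction_invariant[OF onbp _ cb_kp[OF x], of "\<lambda>a b. l (tn (\<pi> a v) (\<gamma> b s))"])
       (unfold cbil_def, intro conjI ballI clin_\<gamma> clin_\<pi>[OF tlf(1)[OF l]] tlf(2)[OF l] \<pi>_closed v s \<gamma>_closed)
    have "l (D1 (dg x (tn v s))) = (\<Sum>i<length ws. l (tn (\<pi> (ws ! i) (\<pi> x v)) (\<gamma> (ws ! i) s))) +
        (\<Sum>i<length ws. l (tn (\<pi> (ws ! i) v) (\<gamma> (ws ! i) (alpha x s))))"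
      using v s x by (simp add: dg_tens[OF lD] D1_tens[OF l _ _ onbp] \<pi>_closed alpha_kk)
    also have "\<dots> = (\<Sum>i<length ws. l (tn (\<pi> x (\<pi> (ws ! i) v)) (\<gamma> (ws ! i) s))) + (\<Sum>i<length ws. l (tn (\<pi> (ws ! i) v) (alpha x (\<gamma> (ws ! i) s))))"
    proof -
      have 1: "l (tn (\<pi> x (\<pi> (ws ! i) v)) (\<gamma> (ws ! i) s)) = l (tn (\<pi> (ws ! i) (\<pi> x v)) (\<gamma> (ws ! i) s)) + l (tn (\<pi> (cb x (ws ! i)) v) (\<gamma> (ws ! i) s))"
        if "i < length ws" for i
        using lf_\<pi>_bracket[OF tlf(1)[OF l \<gamma>_closed[OF ws_in[OF that] s]] v] by simp
      have 2: "l (tn (\<pi> (ws ! i) v) (alpha x (\<gamma> (ws ! i) s))) = l (tn (\<pi> (ws ! i) v) (\<gamma> (ws ! i) (alpha x s))) + l (tn (\<pi> (ws ! i) v) (\<gamma> (cb x (ws ! i)) s))"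
        if "i < length ws" for i
        by (rule alpha_commutator[OF cb_kp[OF x] tlf(2)[OF l \<pi>_closed[OF v]] s ws_in[OF that]])
      show ?thesis using inv by (simp add: 1 2 sum.distrib)
    qed
    also have "\<dots> = l (dg x (D1 (tn v s)))"
      using v s x by (simp add: D1_tens[OF lg _ _ onbp] dg_tens[OF l] \<pi>_closed \<gamma>_closed ws_in sum.distrib)
    finally show "l (D1 (dg x (tn v s))) = l (dg x (D1 (tn v s)))" .
  qed
qed (use t T1 lin_map_closed[OF D1_lin] lin_map_closed[OF dg_lin] in auto)

lemma dg_bracket:
  assumes x: "x \<in> kk" and y: "y \<in> kk" and t: "t \<in> carrier T1"
  shows "dg (cb x y) t = dg x (dg y t) \<ominus>\<^bsub>T1\<^esub> dg y (dg x t)"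
proof (rule functional_eqI[OF T1])
  fix l assume l: "lin_functional T1 l"
  have lx: "lin_functional T1 (\<lambda>t. l (dg x t))" and ly: "lin_functional T1 (\<lambda>t. l (dg y t))"
    by (rule lf_comp[OF dg_lin l])+
  have ld: "lin_functional T1 (\<lambda>t. l (dg x (dg y t)) - l (dg y (dg x t)))"
    using lf_comp[OF dg_lin lx, of y] lf_comp[OF dg_lin ly, of x] by (simp add: lin_functional_def algebra_simps)
  have "l (dg (cb x y) t) = l (dg x (dg y t)) - l (dg y (dg x t))"
  proof (rule tensor_lf_ext[OF cvV cvS lf_comp[OF dg_lin l] ld _ t])
    fix v s assume v: "v \<in> carrier V" and s: "s \<in> carrier S"
    note a = alpha_bracket[OF cb_kp[OF x] cb_kp[OF y] tlf(2)[OF l v] s]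
    show "l (dg (cb x y) (tn v s)) = l (dg x (dg y (tn v s))) - l (dg y (dg x (tn v s)))"
      using v s x y cb_kk[OF x y] a lf_\<pi>_bracket[OF tlf(1)[OF l s] v]
      by (simp add: dg_tens[OF l] dg_tens[OF lx] dg_tens[OF ly] \<pi>_closed alpha_kk)
  qed
  then show "l (dg (cb x y) t) = l (dg x (dg y t) \<ominus>\<^bsub>T1\<^esub> dg y (dg x t))"
    using t by (simp add: lf_diff[OF T1 l] lin_map_closed[OF dg_lin])
qed (use t T1 lin_map_closed[OF dg_lin] in auto)

lemma dg_clin:
  assumes l: "lin_functional T1 l" and t: "t \<in> carrier T1"
  shows "clin kk (\<lambda>x. l (dg x t))"
proof (rule clinI)
  fix x y assume xy: "x \<in> kk" "y \<in> kk"
  have ld: "lin_functional T1 (\<lambda>t. l (dg x t) + l (dg y t))"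
    using lf_comp[OF dg_lin l, of x] lf_comp[OF dg_lin l, of y] by (simp add: lin_functional_def algebra_simps)
  show "l (dg (x + y) t) = l (dg x t) + l (dg y t)"
  proof (rule tensor_lf_ext[OF cvV cvS lf_comp[OF dg_lin l] ld _ t])
    fix v s assume v: "v \<in> carrier V" and s: "s \<in> carrier S"
    show "l (dg (x + y) (tn v s)) = l (dg x (tn v s)) + l (dg y (tn v s))"
      using xy cs.subspace_add[OF kk_subspace xy] clin_\<pi>[OF tlf(1)[OF l s] v, of kk] alpha_clin[OF cb_kp kk_subspace tlf(2)[OF l v] s]
      by (simp add: dg_tens[OF l v s] clin_def)
  qed
next
  fix c x assume x: "x \<in> kk"
  have ld: "lin_functional T1 (\<lambda>t. c * l (dg x t))"
    using lf_comp[OF dg_lin l, of x] by (simp add: lin_functional_def algebra_simps)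
  show "l (dg (cscale c x) t) = c * l (dg x t)"
  proof (rule tensor_lf_ext[OF cvV cvS lf_comp[OF dg_lin l] ld _ t])
    fix v s assume v: "v \<in> carrier V" and s: "s \<in> carrier S"
    show "l (dg (cscale c x) (tn v s)) = c * l (dg x (tn v s))"
      using x cs.subspace_scale[OF kk_subspace x] clin_\<pi>[OF tlf(1)[OF l s] v, of kk] alpha_clin[OF cb_kp kk_subspace tlf(2)[OF l v] s]
      by (simp add: dg_tens[OF l v s] clin_def algebra_simps)
  qed
qed

end

section \<open>Decomposition of the Dirac operator of the pair\<close>

text \<open>Both gradings at once: \<open>(\<epsilon>l, \<epsilon>r, sg)\<close> is \<open>(\<epsilon>, id, -1)\<close> for \<open>graded_left\<close> and \<open>(id, \<epsilon>, 1)\<close> for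
  \<open>graded_right\<close>.\<close>

locale two_stage = symmetric_pair br \<theta> V \<pi> Sp \<gamma>p ws_p
  for br :: "'l::euclidean_space \<Rightarrow> 'l \<Rightarrow> 'l" and \<theta> and V :: "(complex, 'v) module" and \<pi>
    and Sp :: "(complex, 's) module" and \<gamma>p ws_p +
  fixes \<rr> \<ss> :: "('l \<times> 'l) set" and Sk :: "(complex, 't) module" and \<gamma>k ws_k ws_s \<gamma> \<epsilon>l \<epsilon>r and sg :: complex
  assumes rr: "\<rr> \<subseteq> kk" "subalgebra br \<rr>" and ss: "\<ss> = orth br UNIV \<rr>"
    and clk: "clifford_module br (\<ss> \<inter> kk) Sk \<gamma>k" and onbk: "orthonormal_basis br (\<ss> \<inter> kk) ws_k"
    and onbs: "orthonormal_basis br \<ss> ws_s"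
    and \<epsilon>l: "lin_map Sp Sp \<epsilon>l" "\<And>s. s \<in> carrier Sp \<Longrightarrow> \<epsilon>l (\<epsilon>l s) = s"
      "\<And>x s. x \<in> pp \<Longrightarrow> s \<in> carrier Sp \<Longrightarrow> \<epsilon>l (\<gamma>p x s) = sg \<odot>\<^bsub>Sp\<^esub> \<gamma>p x (\<epsilon>l s)"
    and \<epsilon>r: "lin_map Sk Sk \<epsilon>r" "\<And>s. s \<in> carrier Sk \<Longrightarrow> \<epsilon>r (\<epsilon>r s) = s"
      "\<And>x s. x \<in> \<ss> \<inter> kk \<Longrightarrow> s \<in> carrier Sk \<Longrightarrow> \<epsilon>r (\<gamma>k x s) = (- sg) \<odot>\<^bsub>Sk\<^esub> \<gamma>k x (\<epsilon>r s)"
    and sg: "sg * sg = 1"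
    and \<gamma>: "\<And>x z. \<gamma> x z = tensor_map Sp Sk Sp Sk (\<gamma>p (ppart x)) \<epsilon>r z \<oplus>\<^bsub>tensor Sp Sk\<^esub> tensor_map Sp Sk Sp Sk \<epsilon>l (\<gamma>k (kpart x)) z"
begin

abbreviation "Q \<equiv> \<ss> \<inter> kk"

sublocale k: clifford br Q Sk \<gamma>k ws_k
  by unfold_locales (fact clk onbk)+

abbreviation "SS \<equiv> tensor Sp Sk"
abbreviation "TT \<equiv> tensor V SS"
abbreviation "ts \<equiv> tens Sp Sk"
abbreviation "tt \<equiv> tens V SS"
abbreviation "asc \<equiv> tens_assoc V Sp Sk"

lemmas cvp = cvS and cvk = k.cvS
lemmas SS = cvspace_tensor[OF cvp cvk]
lemmas TT = cvspace_tensor[OF cvV SS]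
lemmas tsc = tens_closed[OF cvp cvk]
lemmas \<epsilon>lc = lin_map_closed[OF \<epsilon>l(1)] and \<epsilon>rc = lin_map_closed[OF \<epsilon>r(1)]
lemmas slf = tens_lf[OF cvp cvk]
lemmas ttlf = tens_lf[OF cvV SS]

lemma pp_ss: "pp \<subseteq> \<ss>"
  using rr(1) B_pk by (auto simp: ss orth_def)

lemma ss_subspace: "csubspace \<ss>"
  by (rule onb_subspace[OF onbs])

text \<open>\<ss> contains \<pp>, so it is stable under the projections of the Cartan
  decomposition.\<close>

lemma kpart_Q: "x \<in> \<ss> \<Longrightarrow> kpart x \<in> Q"
proof -
  assume x: "x \<in> \<ss>"
  have "kpart x = x - ppart x" using decompose[of x] by (simp add: eq_diff_eq add.commute)
  then have "kpart x \<in> \<ss>" using x pp_ss ppart_in cs.subspace_diff[OF ss_subspace] by (metis subsetD)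
  then show ?thesis using kpart_in by blast
qed

lemma \<gamma>p_lin: "x \<in> pp \<Longrightarrow> lin_map Sp Sp (\<gamma>p x)" and \<gamma>k_lin: "x \<in> Q \<Longrightarrow> lin_map Sk Sk (\<gamma>k x)"
  by (fact \<gamma>_lin k.\<gamma>_lin)+

lemma \<gamma>_linear: "x \<in> \<ss> \<Longrightarrow> lin_map SS SS (\<gamma> x)"
proof -
  assume x: "x \<in> \<ss>"
  have 1: "lin_map SS SS (tensor_map Sp Sk Sp Sk (\<gamma>p (ppart x)) \<epsilon>r)"
    by (intro tensor_map_linear cvp cvk \<gamma>p_lin ppart_in \<epsilon>r)
  have 2: "lin_map SS SS (tensor_map Sp Sk Sp Sk \<epsilon>l (\<gamma>k (kpart x)))"
    by (intro tensor_map_linear cvp cvk \<gamma>k_lin kpart_Q x \<epsilon>l)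
  show ?thesis
  proof (rule lin_mapI[OF SS SS])
    fix l s t assume l: "lin_functional SS l" and st: "s \<in> carrier SS" "t \<in> carrier SS"
    then show "l (\<gamma> x (s \<oplus>\<^bsub>SS\<^esub> t)) = l (\<gamma> x s) + l (\<gamma> x t)"
      by (simp add: \<gamma> lin_map_add[OF 1] lin_map_add[OF 2] lf_add[OF l] lin_map_closed[OF 1] lin_map_closed[OF 2] SS)
  next
    fix l c s assume l: "lin_functional SS l" and st: "s \<in> carrier SS"
    then show "l (\<gamma> x (c \<odot>\<^bsub>SS\<^esub> s)) = c * l (\<gamma> x s)"
      by (simp add: \<gamma> lin_map_smult[OF 1] lin_map_smult[OF 2] lf_add[OF l] lf_smult[OF l] lin_map_closed[OF 1] lin_map_closed[OF 2] SS distrib_left)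
  qed (simp add: \<gamma> lin_map_closed[OF 1] lin_map_closed[OF 2] SS)
qed

lemma lf_\<gamma>_ts:
  assumes "x \<in> \<ss>" "p \<in> carrier Sp" "q \<in> carrier Sk" "lin_functional SS l"
  shows "l (\<gamma> x (ts p q)) = l (ts (\<gamma>p (ppart x) p) (\<epsilon>r q)) + l (ts (\<epsilon>l p) (\<gamma>k (kpart x) q))"
  unfolding \<gamma>
  using assms kpart_Q[OF assms(1)]
  by (simp add: tensor_map_tens[OF cvp cvk cvp cvk \<gamma>p_lin[OF ppart_in] \<epsilon>r(1)] tensor_map_tens[OF cvp cvk cvp cvk \<epsilon>l(1) \<gamma>k_lin[OF kpart_Q[OF assms(1)]]]
      lf_add[OF assms(4)] tsc \<gamma>_closed ppart_in \<epsilon>rc \<epsilon>lc k.\<gamma>_closed)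

lemma gen_zero: "generators_act W M \<rho> \<Longrightarrow> 0 \<in> W \<Longrightarrow> m \<in> carrier M \<Longrightarrow> \<rho> 0 m = \<zero>\<^bsub>M\<^esub>"
  using generators_actD(5)[of W M \<rho> 0 m 0] generators_actD(1,3)[of W M \<rho>] by (metis cs.scale_zero_left cv_zero_smult)

lemma tens_zero:
  assumes "cvspace M" "cvspace N" "m \<in> carrier M" "n \<in> carrier N"
  shows "tens M N \<zero>\<^bsub>M\<^esub> n = \<zero>\<^bsub>tensor M N\<^esub>" "tens M N m \<zero>\<^bsub>N\<^esub> = \<zero>\<^bsub>tensor M N\<^esub>"
  using bilinD(4)[OF bilin_tens[OF assms(1,2)] assms(3,4), of 0] bilinD(5)[OF bilin_tens[OF assms(1,2)] assms(3,4), of 0]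
    assms tens_closed[OF assms] cvspace_tensor[OF assms(1,2)] by simp_all

lemma \<gamma>_pp:
  assumes *: "x \<in> pp" "p \<in> carrier Sp" "q \<in> carrier Sk"
  shows "\<gamma> x (ts p q) = ts (\<gamma>p x p) (\<epsilon>r q)"
proof (rule functional_eqI[OF SS])
  fix l assume l: "lin_functional SS l"
  have z: "\<gamma>k 0 q = \<zero>\<^bsub>Sk\<^esub>" using gen_zero[OF k.gen_act] * cs.subspace_0[OF onb_subspace[OF onbk]] by blast
  show "l (\<gamma> x (ts p q)) = l (ts (\<gamma>p x p) (\<epsilon>r q))"
    using * lf_\<gamma>_ts[OF subsetD[OF pp_ss *(1)] *(2,3) l] ppart_pp[OF *(1)] z
      tens_zero(2)[OF cvp cvk \<epsilon>lc[OF *(2)] *(3)] lf_zero[OF SS l] by simp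
next
  show "\<gamma> x (ts p q) \<in> carrier SS" by (rule lin_map_closed[OF \<gamma>_linear[OF subsetD[OF pp_ss *(1)]] tsc[OF *(2,3)]])
qed (simp_all add: tsc \<gamma>_closed \<epsilon>rc *)

lemma \<gamma>_Q:
  assumes *: "x \<in> Q" "p \<in> carrier Sp" "q \<in> carrier Sk"
  shows "\<gamma> x (ts p q) = ts (\<epsilon>l p) (\<gamma>k x q)"
proof (rule functional_eqI[OF SS])
  fix l assume l: "lin_functional SS l"
  have z: "\<gamma>p 0 p = \<zero>\<^bsub>Sp\<^esub>" using gen_zero[OF gen_act] * cs.subspace_0[OF pp_subspace] by blast
  show "l (\<gamma> x (ts p q)) = l (ts (\<epsilon>l p) (\<gamma>k x q))"
    using * lf_\<gamma>_ts[OF _ *(2,3) l, of x] kpart_kk[of x] z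
      tens_zero(1)[OF cvp cvk *(2) \<epsilon>rc[OF *(3)]] lf_zero[OF SS l] by simp
next
  show "\<gamma> x (ts p q) \<in> carrier SS" by (rule lin_map_closed[OF \<gamma>_linear tsc[OF *(2,3)]]) (use * in blast)
qed (use * in \<open>simp_all add: tsc k.\<gamma>_closed \<epsilon>lc\<close>)

lemma \<gamma>_clifford: "clifford_module br \<ss> SS \<gamma>"
proof -
  have ppart_lin: "ppart (x + y) = ppart x + ppart y" "kpart (x + y) = kpart x + kpart y" 
      "ppart (cscale c x) = cscale c (ppart x)" "kpart (cscale c x) = cscale c (kpart x)" for x y c
    by (simp_all add: prod_eq_iff cmap_def cscale_def algebra_simps)
  have c1: "\<gamma> x z \<in> carrier SS" if "x \<in> \<ss>" "z \<in> carrier SS" for x z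
    using lin_map_closed[OF \<gamma>_linear] that by blast
  have lfsum: "lin_functional SS (\<lambda>z. a * f z + b * g z)"
    if "lin_functional SS f" "lin_functional SS g" for a b f g
    using that by (simp add: lin_functional_def algebra_simps)
  have add: "\<gamma> (x + y) z = \<gamma> x z \<oplus>\<^bsub>SS\<^esub> \<gamma> y z" if xy: "x \<in> \<ss>" "y \<in> \<ss>" and z: "z \<in> carrier SS" for x y z
  proof (rule functional_eqI[OF SS])
    fix l assume l: "lin_functional SS l"
    have s: "x + y \<in> \<ss>" using xy cs.subspace_add[OF ss_subspace] by blast
    have "l (\<gamma> (x + y) z) = 1 * l (\<gamma> x z) + 1 * l (\<gamma> y z)"
    proof (rule tensor_lf_ext[OF cvp cvk lf_comp[OF \<gamma>_linear[OF s] l] lfsum[OF lf_comp[OF \<gamma>_linear[OF xy(1)] l] lf_comp[OF \<gamma>_linear[OF xy(2)] l]] _ z])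
      fix p q assume pq: "p \<in> carrier Sp" "q \<in> carrier Sk"
      show "l (\<gamma> (x + y) (ts p q)) = 1 * l (\<gamma> x (ts p q)) + 1 * l (\<gamma> y (ts p q))"
        using clin_\<gamma>[OF slf(1)[OF l \<epsilon>rc[OF pq(2)]] pq(1)] k.clin_\<gamma>[OF slf(2)[OF l \<epsilon>lc[OF pq(1)]] pq(2)] ppart_in kpart_Q[OF xy(1)] kpart_Q[OF xy(2)]
        unfolding lf_\<gamma>_ts[OF s pq l] lf_\<gamma>_ts[OF xy(1) pq l] lf_\<gamma>_ts[OF xy(2) pq l] ppart_lin clin_def by simp
    qed
    then show "l (\<gamma> (x + y) z) = l (\<gamma> x z \<oplus>\<^bsub>SS\<^esub> \<gamma> y z)" using xy z by (simp add: lf_add[OF l] c1)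
  qed (use xy z c1 SS cs.subspace_add[OF ss_subspace] in auto)
  have scale: "\<gamma> (cscale c x) z = c \<odot>\<^bsub>SS\<^esub> \<gamma> x z" if x: "x \<in> \<ss>" and z: "z \<in> carrier SS" for c x z
  proof (rule functional_eqI[OF SS])
    fix l assume l: "lin_functional SS l"
    have s: "cscale c x \<in> \<ss>" using x cs.subspace_scale[OF ss_subspace] by blast
    have "l (\<gamma> (cscale c x) z) = c * l (\<gamma> x z) + 0 * l (\<gamma> x z)"
    proof (rule tensor_lf_ext[OF cvp cvk lf_comp[OF \<gamma>_linear[OF s] l] lfsum[OF lf_comp[OF \<gamma>_linear[OF x] l] lf_comp[OF \<gamma>_linear[OF x] l]] _ z])
      fix p q assume pq: "p \<in> carrier Sp" "q \<in> carrier Sk"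
      show "l (\<gamma> (cscale c x) (ts p q)) = c * l (\<gamma> x (ts p q)) + 0 * l (\<gamma> x (ts p q))"
        using clin_\<gamma>[OF slf(1)[OF l \<epsilon>rc[OF pq(2)]] pq(1)] k.clin_\<gamma>[OF slf(2)[OF l \<epsilon>lc[OF pq(1)]] pq(2)] ppart_in kpart_Q[OF x]
        unfolding lf_\<gamma>_ts[OF s pq l] lf_\<gamma>_ts[OF x pq l] ppart_lin clin_def by (simp add: distrib_left)
    qed
    then show "l (\<gamma> (cscale c x) z) = l (c \<odot>\<^bsub>SS\<^esub> \<gamma> x z)" using x z by (simp add: lf_smult[OF l] c1)
  qed (use x z c1 SS cs.subspace_scale[OF ss_subspace] in auto)
  have anti: "\<gamma> x (\<gamma> y z) \<oplus>\<^bsub>SS\<^esub> \<gamma> y (\<gamma> x z) = (2 * B x y) \<odot>\<^bsub>SS\<^esub> z" if xy: "x \<in> \<ss>" "y \<in> \<ss>" and z: "z \<in> carrier SS" for x y z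
  proof (rule functional_eqI[OF SS])
    fix l assume l: "lin_functional SS l"
    note lx = lf_comp[OF \<gamma>_linear[OF xy(1)] l] and ly = lf_comp[OF \<gamma>_linear[OF xy(2)] l]
    have "1 * l (\<gamma> x (\<gamma> y z)) + 1 * l (\<gamma> y (\<gamma> x z)) = (2 * B x y) * l z + 0 * l z"
    proof (rule tensor_lf_ext[OF cvp cvk lfsum[OF lf_comp[OF \<gamma>_linear[OF xy(2)] lx] lf_comp[OF \<gamma>_linear[OF xy(1)] ly]] lfsum[OF l l] _ z])
      fix p q assume pq: "p \<in> carrier Sp" "q \<in> carrier Sk"
      note P = ppart_in and K = kpart_Q[OF xy(1)] kpart_Q[OF xy(2)]
      have s1: "l (ts (\<epsilon>l (\<gamma>p a p)) q') = sg * l (ts (\<gamma>p a (\<epsilon>l p)) q')" if "a \<in> pp" "q' \<in> carrier Sk" for a q'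
        using that pq by (simp add: \<epsilon>l(3) lf_smult[OF slf(1)[OF l]] \<gamma>_closed \<epsilon>lc)
      have s2: "l (ts p' (\<epsilon>r (\<gamma>k a q))) = - sg * l (ts p' (\<gamma>k a (\<epsilon>r q)))" if "a \<in> Q" "p' \<in> carrier Sp" for a p'
        using that pq by (simp add: \<epsilon>r(3) lf_smult[OF slf(2)[OF l]] k.\<gamma>_closed \<epsilon>rc)
      have a1: "l (ts (\<gamma>p a (\<gamma>p b p)) q) = 2 * B a b * l (ts p q) - l (ts (\<gamma>p b (\<gamma>p a p)) q)" if "a \<in> pp" "b \<in> pp" for a b
        using anticommute[OF slf(1)[OF l pq(2)] that pq(1)] .
      have a2: "l (ts p (\<gamma>k a (\<gamma>k b q))) = 2 * B a b * l (ts p q) - l (ts p (\<gamma>k b (\<gamma>k a q)))" if "a \<in> Q" "b \<in> Q" for a b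
        using k.anticommute[OF slf(2)[OF l pq(1)] that pq(2)] .
      have BB: "B x y = B (ppart x) (ppart y) + B (kpart x) (kpart y)"
      proof -
        have "B (ppart x + kpart x) (ppart y + kpart y) = B (ppart x) (ppart y) + B (kpart x) (kpart y)"
          using B_kp[OF kpart_in ppart_in] B_pk[OF ppart_in kpart_in] by (simp only: B_simps(1,2)) simp
        then show ?thesis by (simp only: decompose[symmetric])
      qed
      \<comment> \<open>The mixed terms come with the signs \<open>sg\<close> and
        \<open>- sg\<close>, one from each parity operator. They are antisymmetric under exchange of
        \<open>a\<close> and \<open>b\<close> and so cancel in the anticommutator; this is what the
        opposite signs of \<open>\<epsilon>l\<close> and \<open>\<epsilon>r\<close> are for.\<close>
      have e: "l (\<gamma> a (\<gamma> b (ts p q))) = l (ts (\<gamma>p (ppart a) (\<gamma>p (ppart b) p)) q) + sg * l (ts (\<gamma>p (ppart b) (\<epsilon>l p)) (\<gamma>k (kpart a) (\<epsilon>r q)))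
          - sg * l (ts (\<gamma>p (ppart a) (\<epsilon>l p)) (\<gamma>k (kpart b) (\<epsilon>r q))) + l (ts p (\<gamma>k (kpart a) (\<gamma>k (kpart b) q)))"
        if ab: "a \<in> \<ss>" "b \<in> \<ss>" for a b
        using pq P kpart_Q[OF ab(1)] kpart_Q[OF ab(2)]
        by (simp add: lf_\<gamma>_ts[OF ab(2) _ _ lf_comp[OF \<gamma>_linear[OF ab(1)] l]] lf_\<gamma>_ts[OF ab(1) _ _ l] \<gamma>_closed k.\<gamma>_closed \<epsilon>lc \<epsilon>rc s1 s2 \<epsilon>l(2) \<epsilon>r(2))
      show "1 * l (\<gamma> x (\<gamma> y (ts p q))) + 1 * l (\<gamma> y (\<gamma> x (ts p q))) = (2 * B x y) * l (ts p q) + 0 * l (ts p q)"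
        unfolding e[OF xy] e[OF xy(2,1)] BB
        by (subst a1[OF P P], subst a2[OF K]) (simp add: algebra_simps)
    qed
    then show "l (\<gamma> x (\<gamma> y z) \<oplus>\<^bsub>SS\<^esub> \<gamma> y (\<gamma> x z)) = l ((2 * B x y) \<odot>\<^bsub>SS\<^esub> z)" using xy z by (simp add: lf_add[OF l] lf_smult[OF l] c1)
  qed (use xy z c1 SS in auto)
  show ?thesis
    unfolding clifford_module_def generators_act_def
    by (intro conjI ballI allI SS \<gamma>_linear add scale anti)
qed

sublocale s: clifford br \<ss> SS \<gamma> ws_s
  by unfold_locales (fact \<gamma>_clifford onbs)+

lemma onb_ss: "orthonormal_basis br \<ss> (ws_p @ ws_k)"
proof -
  have "\<ss> = {x + y | x y. x \<in> pp \<and> y \<in> Q}"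
    using pp_ss cs.subspace_add[OF ss_subspace] decompose ppart_in kpart_Q by blast
  then show ?thesis using onb_append[OF onbp onbk] by simp
qed

definition DD where "DD = tensor_act V \<pi> SS \<gamma> (dirac br UNIV \<rr> ws_s)"

lemmas DD_data = UNIV_sub V ss ss_subspace \<gamma>_clifford onb_in(1)[OF onbs]
lemma DD_lin: "lin_map TT TT DD"
  unfolding DD_def by (rule tensor_act_linear[OF DD_data(1-5) dirac_closed[OF DD_data]])

lemma asc_tens: "v \<in> carrier V \<Longrightarrow> p \<in> carrier Sp \<Longrightarrow> q \<in> carrier Sk \<Longrightarrow> asc (tn v p) q = tt v (ts p q)"
  unfolding tens_assoc_def using bilin_tens[OF cvp cvk]
  by (subst tensor_map_tens[OF cvV cvp cvV SS lin_map_id(1)]) (auto simp: bilin_def)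

lemma asc_lin1: "q \<in> carrier Sk \<Longrightarrow> lin_map T1 TT (\<lambda>t. asc t q)"
  unfolding tens_assoc_def using bilin_tens[OF cvp cvk]
  by (intro tensor_map_linear[OF cvV cvp cvV SS lin_map_id(1)]) (auto simp: bilin_def)

lemma asc_bilin: "bilin T1 Sk TT asc"
proof (rule bilinI[OF T1 cvk TT])
  fix t q assume tq: "t \<in> carrier T1" "q \<in> carrier Sk"
  show "asc t q \<in> carrier TT" using lin_map_closed[OF asc_lin1] tq by blast
  fix l assume l: "lin_functional TT l"
  show "l (asc (t \<oplus>\<^bsub>T1\<^esub> t') q) = l (asc t q) + l (asc t' q)" if "t' \<in> carrier T1" for t'
    using lf_add[OF lf_comp[OF asc_lin1[OF tq(2)] l] tq(1) that] .
  show "l (asc (c \<odot>\<^bsub>T1\<^esub> t) q) = c * l (asc t q)" for c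
    using lf_smult[OF lf_comp[OF asc_lin1[OF tq(2)] l] tq(1)] .
  have lfsum: "lin_functional T1 (\<lambda>z. l (asc z q) + l (asc z q'))" if "q' \<in> carrier Sk" for q'
    using lf_comp[OF asc_lin1[OF tq(2)] l] lf_comp[OF asc_lin1[OF that] l] by (simp add: lin_functional_def algebra_simps)
  have lfs: "lin_functional T1 (\<lambda>z. c * l (asc z q))" for c
    using lf_comp[OF asc_lin1[OF tq(2)] l] by (simp add: lin_functional_def algebra_simps)
  have z: "lin_functional Sk (\<lambda>q. l (tt v (ts p q)))" if "v \<in> carrier V" "p \<in> carrier Sp" for v p
    by (rule slf(2)[OF ttlf(2)[OF l that(1)] that(2)])
  show "l (asc t (q \<oplus>\<^bsub>Sk\<^esub> q')) = l (asc t q) + l (asc t q')" if q': "q' \<in> carrier Sk" for q'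
  proof (rule tensor_lf_ext[OF cvV cvp lf_comp[OF asc_lin1 l] lfsum[OF q'] _ tq(1)])
    show "q \<oplus>\<^bsub>Sk\<^esub> q' \<in> carrier Sk" using cvk tq q' by simp
    show "l (asc (tn v p) (q \<oplus>\<^bsub>Sk\<^esub> q')) = l (asc (tn v p) q) + l (asc (tn v p) q')" if "v \<in> carrier V" "p \<in> carrier Sp" for v p
      using that tq q' cvk by (simp add: asc_tens lf_add[OF z])
  qed
  show "l (asc t (c \<odot>\<^bsub>Sk\<^esub> q)) = c * l (asc t q)" for c
  proof (rule tensor_lf_ext[OF cvV cvp lf_comp[OF asc_lin1 l] lfs _ tq(1)])
    show "c \<odot>\<^bsub>Sk\<^esub> q \<in> carrier Sk" using cvk tq by simp
    show "l (asc (tn v p) (c \<odot>\<^bsub>Sk\<^esub> q)) = c * l (asc (tn v p) q)" if "v \<in> carrier V" "p \<in> carrier Sp" for v p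
      using that tq cvk by (simp add: asc_tens lf_smult[OF z])
  qed
qed

definition EE where "EE = tensor_map V Sp V Sp id \<epsilon>l"

lemma EE_lin: "lin_map T1 T1 EE"
  unfolding EE_def by (rule tensor_map_linear[OF cvV cvp cvV cvp lin_map_id(1) \<epsilon>l(1)])

lemma EE_tens: "v \<in> carrier V \<Longrightarrow> p \<in> carrier Sp \<Longrightarrow> EE (tn v p) = tn v (\<epsilon>l p)"
  unfolding EE_def by (subst tensor_map_tens[OF cvV cvp cvV cvp lin_map_id(1) \<epsilon>l(1)]) auto

text \<open>\<open>alpha\<close> is quadratic in the Clifford generators, so the two signs multiply
  to \<open>sg * sg = 1\<close>.\<close>

lemma alpha_\<epsilon>l:
  assumes c: "c \<in> kk" and p: "p \<in> carrier Sp" and l: "lin_functional Sp l"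
  shows "l (\<epsilon>l (alpha c p)) = l (alpha c (\<epsilon>l p))"
proof -
  have "l (\<epsilon>l (\<gamma>p a (\<gamma>p b p))) = l (\<gamma>p a (\<gamma>p b (\<epsilon>l p)))" if "a \<in> pp" "b \<in> pp" for a b
    using that p sg cvp by (simp add: \<epsilon>l(3) \<gamma>_closed \<epsilon>lc lin_map_smult[OF \<gamma>p_lin] cv_smult_smult)
  then show ?thesis
    using cb_kp[OF c] ws_in by (simp add: lf_alpha[OF cb_kp[OF c] lf_comp[OF \<epsilon>l(1) l] p] lf_alpha[OF cb_kp[OF c] l \<epsilon>lc[OF p]])
qed

end

lemma lf_sum_intro: "(\<And>i. i \<in> I \<Longrightarrow> lin_functional M (f i)) \<Longrightarrow> lin_functional M (\<lambda>z. \<Sum>i\<in>I. f i z)"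
  by (simp add: lin_functional_def sum.distrib sum_distrib_left)

lemma lf_plus_intro: "lin_functional M f \<Longrightarrow> lin_functional M g \<Longrightarrow> lin_functional M (\<lambda>z. f z + g z)"
  and lf_minus_intro: "lin_functional M f \<Longrightarrow> lin_functional M g \<Longrightarrow> lin_functional M (\<lambda>z. f z - g z)"
  and lf_cmult_intro: "lin_functional M f \<Longrightarrow> lin_functional M (\<lambda>z. c * f z)"
  by (simp_all add: lin_functional_def algebra_simps)

lemmas lf_intros = lf_sum_intro lf_plus_intro lf_minus_intro lf_cmult_intro

lemma triple_sum_append:
  fixes f :: "'a \<Rightarrow> 'a \<Rightarrow> 'a \<Rightarrow> complex" and xs ys :: "'a list"
  defines "s \<equiv> \<lambda>us vs ws. \<Sum>i<length us. \<Sum>j<length vs. \<Sum>k<length ws. f (us ! i) (vs ! j) (ws ! k)"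
  shows "s (xs @ ys) (xs @ ys) (xs @ ys) =
    s xs xs xs + s xs xs ys + s xs ys xs + s xs ys ys + s ys xs xs + s ys xs ys + s ys ys xs + s ys ys ys"
proof -
  let ?es = "xs @ ys"
  note 1 = sum_append[of "f a b" xs ys for a b]
  note 2 = sum_append[of "\<lambda>b. \<Sum>k<length ?es. f a b (?es ! k)" xs ys for a]
  note 3 = sum_append[of "\<lambda>a. \<Sum>j<length ?es. \<Sum>k<length ?es. f a (?es ! j) (?es ! k)" xs ys]
  show ?thesis unfolding s_def 3 unfolding 2 unfolding 1 sum.distrib by (simp only: ac_simps)
qed

section \<open>The operator \<open>D(g, r)\<close> in terms of the two stages\<close>

context two_stage
begin

text \<open>The cubic sum over all triples rather than ordered ones, tested by a function
  \<open>l\<close>. The missing factor \<open>1/6\<close> joins the \<open>1/2\<close> of the Dirac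
  operator; hence the \<open>1/12\<close> below.\<close>

definition cubic_k where
  "cubic_k l q = (\<Sum>i<length ws_k. \<Sum>j<length ws_k. \<Sum>k<length ws_k.
     B (cb (ws_k ! i) (ws_k ! j)) (ws_k ! k) * l (\<gamma>k (ws_k ! i) (\<gamma>k (ws_k ! j) (\<gamma>k (ws_k ! k) q))))"

text \<open>The basis of \<ss> is replaced by one adapted to \<pp> and
  \<open>\<ss> \<inter> \<kk>\<close>. The linear terms from \<pp> give \<open>D(g, k)\<close>.
  Those from \<kk> let \<kk> act on \<open>V\<close> only; the mixed cubic terms supply its action
  on \<open>Sp\<close>, so that together they form the diagonal action that occurs in
  \<open>D(k, r)\<close>. \<open>EE\<close> and \<open>\<epsilon>r\<close> are the parity signs of
  the graded tensor product.\<close>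

lemma DD_asc_tens:
  assumes l: "lin_functional TT l" and v: "v \<in> carrier V" and p: "p \<in> carrier Sp" and q: "q \<in> carrier Sk"
  shows "l (DD (asc (tn v p) q)) = l (asc (D1 (tn v p)) (\<epsilon>r q)) +
    (\<Sum>i<length ws_k. l (asc (EE (dg (ws_k ! i) (tn v p))) (\<gamma>k (ws_k ! i) q))) - 1/12 * cubic_k (\<lambda>q. l (asc (EE (tn v p)) q)) q"
proof -
  let ?z = "ts p q" and ?L = "\<lambda>z. l (tt v z)" and ?s = "\<lambda>f us vs ws. \<Sum>i<length us. \<Sum>j<length vs. \<Sum>k<length ws. (f (us ! i) (vs ! j) (ws ! k) :: complex)"
  have L: "lin_functional SS ?L" by (rule ttlf(2)[OF l v])
  have z: "?z \<in> carrier SS" by (rule tsc[OF p q])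
  define F where "F a b c = B (cb a b) c * ?L (\<gamma> a (\<gamma> b (\<gamma> c ?z)))" for a b c
  note pin = ws_in and kin = k.ws_in
  have kkk: "ws_k ! i \<in> kk" "ws_k ! i \<in> \<ss>" if "i < length ws_k" for i using kin[OF that] by auto
  have pss: "ws_p ! i \<in> \<ss>" if "i < length ws_p" for i using pin[OF that] pp_ss by auto
  have "l (DD (tt v ?z)) = (\<Sum>i<length ws_s. l (tt (\<pi> (ws_s ! i) v) (\<gamma> (ws_s ! i) ?z))) - 1/12 * ?s F ws_s ws_s ws_s"
    unfolding DD_def dirac_act[OF DD_data l v z] s.cubic_full[OF L z] F_def by simp
  also have "?s F ws_s ws_s ws_s = ?s F (ws_p @ ws_k) (ws_p @ ws_k) (ws_p @ ws_k)"
    unfolding F_def by (rule s.cubic_independent[OF L z onb_ss])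
  also have "(\<Sum>i<length ws_s. l (tt (\<pi> (ws_s ! i) v) (\<gamma> (ws_s ! i) ?z))) =
      (\<Sum>i<length (ws_p @ ws_k). l (tt (\<pi> ((ws_p @ ws_k) ! i) v) (\<gamma> ((ws_p @ ws_k) ! i) ?z)))"
    by (rule contraction_independent[OF onb_ss onbs, of "\<lambda>x y. l (tt (\<pi> x v) (\<gamma> y ?z))"])
      (unfold cbil_def, intro conjI ballI s.clin_\<gamma> clin_\<pi>[OF ttlf(1)[OF l]] ttlf(2)[OF l] \<pi>_closed v z s.\<gamma>_closed)
  also have "\<dots> = (\<Sum>i<length ws_p. l (tt (\<pi> (ws_p ! i) v) (ts (\<gamma>p (ws_p ! i) p) (\<epsilon>r q)))) +
      (\<Sum>i<length ws_k. l (tt (\<pi> (ws_k ! i) v) (ts (\<epsilon>l p) (\<gamma>k (ws_k ! i) q))))"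
    using p q pin kin unfolding sum_append[of "\<lambda>x. l (tt (\<pi> x v) (\<gamma> x ?z))"] by (simp add: \<gamma>_pp \<gamma>_Q)
  also have "(\<Sum>i<length ws_p. l (tt (\<pi> (ws_p ! i) v) (ts (\<gamma>p (ws_p ! i) p) (\<epsilon>r q)))) = l (asc (D1 (tn v p)) (\<epsilon>r q))"
    using v p q by (simp add: D1_tens[OF lf_comp[OF asc_lin1 l] _ _ onbp] \<epsilon>rc asc_tens \<pi>_closed \<gamma>_closed pin)
  \<comment> \<open>Of the eight blocks, those with three indices or exactly one index in \<pp>
    vanish, by the bracket relations and the orthogonality of \<pp> and \<kk>. The three
    arrangements of two \<pp>-indices and one \<kk>-index agree, because coefficient and Clifford
    product change sign together.\<close>
  also have "?s F (ws_p @ ws_k) (ws_p @ ws_k) (ws_p @ ws_k) = 3 * ?s F ws_p ws_p ws_k + ?s F ws_k ws_k ws_k"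
  proof -
    have B0: "B (cb a b) c = 0" if "a \<in> pp" "b \<in> pp" "c \<in> pp" for a b c by (rule B_kp[OF cb_pp[OF that(1,2)] that(3)])
    have B1: "B (cb a b) c = 0" "B (cb b a) c = 0" "B (cb b c) a = 0" if "a \<in> pp" "b \<in> kk" "c \<in> kk" for a b c
      by (rule B_pk[OF cb_pk[OF that(1,2)] that(3)] B_pk[OF cb_kp[OF that(2,1)] that(3)] B_kp[OF cb_kk[OF that(2,3)] that(1)])+
    have F2: "F a c b = F a b c" "F c a b = F a b c" if "a \<in> pp" "b \<in> pp" "c \<in> Q" for a b c
    proof -
      have s: "a \<in> \<ss>" "b \<in> \<ss>" "c \<in> \<ss>" "B c b = 0" "B c a = 0" using that pp_ss B_kp by auto
      have 1: "?L (\<gamma> a (\<gamma> c (\<gamma> b ?z))) = - ?L (\<gamma> a (\<gamma> b (\<gamma> c ?z)))"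
        using s.anticommute[OF s.lf_\<gamma>[OF s(1) L] s(3,2) z] s by simp
      have 2: "?L (\<gamma> c (\<gamma> a (\<gamma> b ?z))) = - ?L (\<gamma> a (\<gamma> c (\<gamma> b ?z)))"
        using s.anticommute[OF L s(3,1) s.\<gamma>_closed[OF s(2) z]] s by simp
      show "F a c b = F a b c" unfolding F_def 1 using B_cb_rotate(2)[of a c b] by simp
      then show "F c a b = F a b c" unfolding F_def 2 using B_cb_rotate(1)[of c a b] by simp
    qed
    have t0: "?s F ws_p ws_p ws_p = 0" unfolding F_def by (intro sum.neutral ballI) (simp add: B0 pin)
    have t1: "?s F ws_p ws_k ws_k = 0" unfolding F_def by (intro sum.neutral ballI) (simp add: B1 pin kkk)
    have t2: "?s F ws_k ws_p ws_k = 0" unfolding F_def by (intro sum.neutral ballI) (simp add: B1 pin kkk)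
    have t3: "?s F ws_k ws_k ws_p = 0" unfolding F_def by (intro sum.neutral ballI) (simp add: B1 pin kkk)
    have t4: "?s F ws_p ws_k ws_p = ?s F ws_p ws_p ws_k"
      by (rule sum.cong[OF refl], subst sum.swap) (intro sum.cong refl F2 pin kin; simp)
    have "?s F ws_k ws_p ws_p = (\<Sum>i<length ws_k. \<Sum>j<length ws_p. \<Sum>k<length ws_p. F (ws_p ! j) (ws_p ! k) (ws_k ! i))"
      by (intro sum.cong refl F2 pin kin; simp)
    also have "\<dots> = (\<Sum>j<length ws_p. \<Sum>i<length ws_k. \<Sum>k<length ws_p. F (ws_p ! j) (ws_p ! k) (ws_k ! i))"
      by (rule sum.swap)
    also have "\<dots> = ?s F ws_p ws_p ws_k" by (intro sum.cong refl sum.swap)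
    finally have t5: "?s F ws_k ws_p ws_p = ?s F ws_p ws_p ws_k" .
    show ?thesis unfolding triple_sum_append t0 t1 t2 t3 t4 t5 by simp
  qed
  also have "?s F ws_k ws_k ws_k = cubic_k (\<lambda>q. l (asc (EE (tn v p)) q)) q"
    unfolding cubic_k_def F_def
  proof (intro sum.cong refl)
    fix i j k assume *: "i \<in> {..<length ws_k}" "j \<in> {..<length ws_k}" "k \<in> {..<length ws_k}"
    then have w: "ws_k ! i \<in> Q" "ws_k ! j \<in> Q" "ws_k ! k \<in> Q" using kin by auto
    have "?L (\<gamma> (ws_k ! i) (\<gamma> (ws_k ! j) (\<gamma> (ws_k ! k) ?z))) = l (asc (EE (tn v p)) (\<gamma>k (ws_k ! i) (\<gamma>k (ws_k ! j) (\<gamma>k (ws_k ! k) q))))"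
      using w v p q k.\<gamma>_closed by (simp only: \<gamma>_Q \<epsilon>lc EE_tens asc_tens \<epsilon>l(2))
    then show "B (cb (ws_k ! i) (ws_k ! j)) (ws_k ! k) * ?L (\<gamma> (ws_k ! i) (\<gamma> (ws_k ! j) (\<gamma> (ws_k ! k) ?z))) =
        B (cb (ws_k ! i) (ws_k ! j)) (ws_k ! k) * l (asc (EE (tn v p)) (\<gamma>k (ws_k ! i) (\<gamma>k (ws_k ! j) (\<gamma>k (ws_k ! k) q))))" by simp
  qed
  \<comment> \<open>The double sum over \<pp> is four times \<open>alpha\<close>, with a minus sign
    from rotating \<open>B [w_i, w_j] c\<close> into \<open>B [c, w_j] w_i\<close>. With the factors
    \<open>- 1/12\<close> and \<open>3\<close> in front, \<open>alpha\<close> ends up with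
    coefficient exactly \<open>1\<close>, which is what the diagonal action requires.\<close>
  also have "?s F ws_p ws_p ws_k = - 4 * (\<Sum>i<length ws_k. l (asc (tn v (\<epsilon>l (alpha (ws_k ! i) p))) (\<gamma>k (ws_k ! i) q)))"
  proof -
    have val: "4 * l (asc (tn v (\<epsilon>l (alpha c p))) (\<gamma>k c q)) = - (\<Sum>i<length ws_p. \<Sum>j<length ws_p. F (ws_p ! i) (ws_p ! j) c)" if c: "c \<in> Q" for c
    proof -
      have ck: "c \<in> kk" using c by blast
      note gc = k.\<gamma>_closed[OF c q]
      let ?m = "\<lambda>p. l (tt v (ts p (\<gamma>k c q)))"
      have m: "lin_functional Sp ?m" by (rule slf(1)[OF L gc])
      have "4 * l (asc (tn v (\<epsilon>l (alpha c p))) (\<gamma>k c q)) = 4 * ?m (alpha c (\<epsilon>l p))"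
        using v gc p ck by (simp add: asc_tens \<epsilon>lc alpha_kk alpha_\<epsilon>l[OF ck p m])
      also have "\<dots> = (\<Sum>j<length ws_p. ?m (\<gamma>p (cb c (ws_p ! j)) (\<gamma>p (ws_p ! j) (\<epsilon>l p))))"
        by (simp add: lf_alpha[OF cb_kp[OF ck] m \<epsilon>lc[OF p]])
      also have "\<dots> = (\<Sum>j<length ws_p. \<Sum>i<length ws_p. B (cb c (ws_p ! j)) (ws_p ! i) * ?m (\<gamma>p (ws_p ! i) (\<gamma>p (ws_p ! j) (\<epsilon>l p))))"
        using pin p ck by (intro sum.cong refl clin_expand[OF onbp] clin_\<gamma>[OF m] \<gamma>_closed \<epsilon>lc cb_kp) auto
      also have "\<dots> = (\<Sum>j<length ws_p. \<Sum>i<length ws_p. - F (ws_p ! i) (ws_p ! j) c)"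
      proof (intro sum.cong refl)
        fix i j assume "i \<in> {..<length ws_p}" "j \<in> {..<length ws_p}"
        then have w: "ws_p ! i \<in> pp" "ws_p ! j \<in> pp" using pin by auto
        have "?L (\<gamma> (ws_p ! i) (\<gamma> (ws_p ! j) (\<gamma> c ?z))) = ?m (\<gamma>p (ws_p ! i) (\<gamma>p (ws_p ! j) (\<epsilon>l p)))"
          using w c p q gc by (simp only: \<gamma>_Q \<gamma>_pp \<epsilon>lc \<epsilon>rc \<gamma>_closed \<epsilon>r(2))
        moreover have "B (cb c (ws_p ! j)) (ws_p ! i) = - B (cb (ws_p ! i) (ws_p ! j)) c"
          using B_cb_rotate(2)[of c "ws_p ! j" "ws_p ! i"] B_cb_rotate(1)[of c "ws_p ! i" "ws_p ! j"] B_cb_rotate(2)[of "ws_p ! i" c "ws_p ! j"] by simp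
        ultimately show "B (cb c (ws_p ! j)) (ws_p ! i) * ?m (\<gamma>p (ws_p ! i) (\<gamma>p (ws_p ! j) (\<epsilon>l p))) = - F (ws_p ! i) (ws_p ! j) c"
          unfolding F_def by simp
      qed
      also have "\<dots> = (\<Sum>i<length ws_p. \<Sum>j<length ws_p. - F (ws_p ! i) (ws_p ! j) c)" by (rule sum.swap)
      finally show ?thesis by (simp only: sum_negf)
    qed
    have "?s F ws_p ws_p ws_k = (\<Sum>i<length ws_p. \<Sum>k<length ws_k. \<Sum>j<length ws_p. F (ws_p ! i) (ws_p ! j) (ws_k ! k))"
      by (intro sum.cong refl sum.swap)
    also have "\<dots> = (\<Sum>k<length ws_k. \<Sum>i<length ws_p. \<Sum>j<length ws_p. F (ws_p ! i) (ws_p ! j) (ws_k ! k))"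
      by (rule sum.swap)
    also have "\<dots> = (\<Sum>k<length ws_k. - (4 * l (asc (tn v (\<epsilon>l (alpha (ws_k ! k) p))) (\<gamma>k (ws_k ! k) q))))"
      by (intro sum.cong refl, subst val) (use kin in auto)
    finally show ?thesis by (simp add: sum_negf sum_distrib_left)
  qed
  also have "(\<Sum>i<length ws_k. l (tt (\<pi> (ws_k ! i) v) (ts (\<epsilon>l p) (\<gamma>k (ws_k ! i) q)))) =
     (\<Sum>i<length ws_k. l (asc (EE (dg (ws_k ! i) (tn v p))) (\<gamma>k (ws_k ! i) q))) -
     (\<Sum>i<length ws_k. l (asc (tn v (\<epsilon>l (alpha (ws_k ! i) p))) (\<gamma>k (ws_k ! i) q)))"
    unfolding sum_subtractf[symmetric]
  proof (intro sum.cong refl)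
    fix i assume "i \<in> {..<length ws_k}"
    then have i: "ws_k ! i \<in> Q" "ws_k ! i \<in> kk" using kin by auto
    show "l (tt (\<pi> (ws_k ! i) v) (ts (\<epsilon>l p) (\<gamma>k (ws_k ! i) q))) = l (asc (EE (dg (ws_k ! i) (tn v p))) (\<gamma>k (ws_k ! i) q)) -
        l (asc (tn v (\<epsilon>l (alpha (ws_k ! i) p))) (\<gamma>k (ws_k ! i) q))"
      using v p q i k.\<gamma>_closed[OF i(1) q]
      by (simp add: dg_tens[OF lf_comp[OF EE_lin lf_comp[OF asc_lin1 l]]] EE_tens asc_tens \<pi>_closed alpha_kk \<epsilon>lc)
  qed
  finally show ?thesis using v p q by (simp add: asc_tens algebra_simps)
qed

lemma DD_asc:
  assumes l: "lin_functional TT l" and t: "t \<in> carrier T1" and q: "q \<in> carrier Sk"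
  shows "l (DD (asc t q)) = l (asc (D1 t) (\<epsilon>r q)) +
    (\<Sum>i<length ws_k. l (asc (EE (dg (ws_k ! i) t)) (\<gamma>k (ws_k ! i) q))) - 1/12 * cubic_k (\<lambda>q. l (asc (EE t) q)) q"
proof -
  have a: "lin_functional T1 (\<lambda>t. l (asc t q))" if "q \<in> carrier Sk" for q by (rule lf_comp[OF asc_lin1[OF that] l])
  have 1: "lin_functional T1 (\<lambda>t. l (DD (asc t q)))" by (rule lf_comp[OF asc_lin1[OF q] lf_comp[OF DD_lin l]])
  have 2: "lin_functional T1 (\<lambda>t. l (asc (D1 t) (\<epsilon>r q)) +
    (\<Sum>i<length ws_k. l (asc (EE (dg (ws_k ! i) t)) (\<gamma>k (ws_k ! i) q))) - 1/12 * cubic_k (\<lambda>q. l (asc (EE t) q)) q)"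
    unfolding cubic_k_def
    by (intro lf_intros lf_comp[OF D1_lin a] lf_comp[OF EE_lin a] lf_comp[OF dg_lin lf_comp[OF EE_lin a]] k.\<gamma>_closed q \<epsilon>rc k.ws_in) simp_all
  show ?thesis by (rule tensor_lf_ext[OF cvV cvp 1 2 DD_asc_tens[OF l _ _ q] t])
qed

lemma asc_ext:
  assumes "lin_functional TT f" "lin_functional TT g" "\<And>t q. t \<in> carrier T1 \<Longrightarrow> q \<in> carrier Sk \<Longrightarrow> f (asc t q) = g (asc t q)" "x \<in> carrier TT"
  shows "f x = g x"
proof (rule tensor_lf_ext[OF cvV SS assms(1,2) _ assms(4)])
  fix v \<sigma> assume v: "v \<in> carrier V" and \<sigma>: "\<sigma> \<in> carrier SS"
  show "f (tt v \<sigma>) = g (tt v \<sigma>)"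
  proof (rule tensor_lf_ext[OF cvp cvk ttlf(2)[OF assms(1) v] ttlf(2)[OF assms(2) v] _ \<sigma>])
    fix p q assume "p \<in> carrier Sp" "q \<in> carrier Sk"
    then show "f (tt v (ts p q)) = g (tt v (ts p q))" using assms(3)[of "tn v p" q] v by (simp add: asc_tens tnc)
  qed
qed

text \<open>Reassociation in the other direction: a bilinear map on
  \<open>(V \<otimes> Sp) \<times> Sk\<close> becomes a linear map on
  \<open>V \<otimes> (Sp \<otimes> Sk)\<close> by lifting twice, so that no inverse of the
  associativity map has to be constructed.\<close>

definition alift where "alift P f = tlift P (\<lambda>v. tlift P (\<lambda>p. f (tn v p)))"

context
  fixes P :: "(complex, 'z) module" and f
  assumes P: "cvspace P" and f: "bilin T1 Sk P f"
begin

lemma alift_inner: "v \<in> carrier V \<Longrightarrow> bilin Sp Sk P (\<lambda>p. f (tn v p))"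
proof -
  assume v: "v \<in> carrier V"
  have "lin_map Sp T1 (tn v)" using bilin_tens[OF cvV cvp] v by (simp add: bilin_def)
  then show ?thesis
    using f v unfolding bilin_def by (auto intro: lin_map_comp simp: tnc)
qed

lemma alift_outer: "bilin V SS P (\<lambda>v. tlift P (\<lambda>p. f (tn v p)))"
proof (rule bilinI[OF cvV SS P])
  note lin = tlift_linear[OF cvp cvk P alift_inner]
  note val = tlift_tens[OF cvp cvk P alift_inner]
  fix v \<sigma> assume v: "v \<in> carrier V" and \<sigma>: "\<sigma> \<in> carrier SS"
  show "tlift P (\<lambda>p. f (tn v p)) \<sigma> \<in> carrier P" by (rule lin_map_closed[OF lin[OF v] \<sigma>])
  fix l assume l: "lin_functional P l"
  note bt = bilinD[OF bilin_tens[OF cvV cvp]] and bf = bilinD[OF f]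
  show "l (tlift P (\<lambda>p. f (tn (v \<oplus>\<^bsub>V\<^esub> v') p)) \<sigma>) = l (tlift P (\<lambda>p. f (tn v p)) \<sigma>) + l (tlift P (\<lambda>p. f (tn v' p)) \<sigma>)" if v': "v' \<in> carrier V" for v'
  proof (rule tensor_lf_ext[OF cvp cvk lf_comp[OF lin l] lf_plus_intro[OF lf_comp[OF lin[OF v] l] lf_comp[OF lin[OF v'] l]] _ \<sigma>])
    show v2: "v \<oplus>\<^bsub>V\<^esub> v' \<in> carrier V" using v v' cvV by simp
    fix p q assume "p \<in> carrier Sp" "q \<in> carrier Sk"
    then show "l (tlift P (\<lambda>p. f (tn (v \<oplus>\<^bsub>V\<^esub> v') p)) (ts p q)) = l (tlift P (\<lambda>p. f (tn v p)) (ts p q)) + l (tlift P (\<lambda>p. f (tn v' p)) (ts p q))"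
      using v v' by (simp add: val[OF v2] val[OF v] val[OF v'] bt bf tnc lf_add[OF l])
  qed
  show "l (tlift P (\<lambda>p. f (tn (c \<odot>\<^bsub>V\<^esub> v) p)) \<sigma>) = c * l (tlift P (\<lambda>p. f (tn v p)) \<sigma>)" for c
  proof (rule tensor_lf_ext[OF cvp cvk lf_comp[OF lin l] lf_cmult_intro[OF lf_comp[OF lin[OF v] l]] _ \<sigma>])
    show v2: "c \<odot>\<^bsub>V\<^esub> v \<in> carrier V" using v cvV by simp
    fix p q assume "p \<in> carrier Sp" "q \<in> carrier Sk"
    then show "l (tlift P (\<lambda>p. f (tn (c \<odot>\<^bsub>V\<^esub> v) p)) (ts p q)) = c * l (tlift P (\<lambda>p. f (tn v p)) (ts p q))"
      using v by (simp add: val[OF v2] val[OF v] bt bf tnc lf_smult[OF l])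
  qed
  show "l (tlift P (\<lambda>p. f (tn v p)) (\<sigma> \<oplus>\<^bsub>SS\<^esub> \<sigma>')) = l (tlift P (\<lambda>p. f (tn v p)) \<sigma>) + l (tlift P (\<lambda>p. f (tn v p)) \<sigma>')" if "\<sigma>' \<in> carrier SS" for \<sigma>'
    by (rule lf_add[OF lf_comp[OF lin[OF v] l] \<sigma> that])
  show "l (tlift P (\<lambda>p. f (tn v p)) (c \<odot>\<^bsub>SS\<^esub> \<sigma>)) = c * l (tlift P (\<lambda>p. f (tn v p)) \<sigma>)" for c
    by (rule lf_smult[OF lf_comp[OF lin[OF v] l] \<sigma>])
qed

lemma alift_lin: "lin_map TT P (alift P f)"
  unfolding alift_def by (rule tlift_linear[OF cvV SS P alift_outer])

lemma alift_asc:
  assumes t: "t \<in> carrier T1" and q: "q \<in> carrier Sk"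
  shows "alift P f (asc t q) = f t q"
proof (rule functional_eqI[OF P])
  fix l assume l: "lin_functional P l"
  have fq: "lin_map T1 P (\<lambda>t. f t q)" using f q by (simp add: bilin_def)
  show "l (alift P f (asc t q)) = l (f t q)"
  proof (rule tensor_lf_ext[OF cvV cvp lf_comp[OF asc_lin1[OF q] lf_comp[OF alift_lin l]] lf_comp[OF fq l] _ t])
    fix v p assume "v \<in> carrier V" "p \<in> carrier Sp"
    then show "l (alift P f (asc (tn v p) q)) = l (f (tn v p) q)"
      using q by (simp add: asc_tens alift_def tlift_tens[OF cvV SS P alift_outer] tlift_tens[OF cvp cvk P alift_inner] tsc)
  qed
qed (use t q bilinD(1)[OF f] lin_map_closed[OF alift_lin] bilinD(1)[OF asc_bilin] in auto)

end

end

section \<open>Cohomology in stages\<close>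

definition ker_of where "ker_of T D = {z \<in> carrier T. D z = \<zero>\<^bsub>T\<^esub>}"
definition coh where "coh T D = quot_space (T\<lparr>carrier := ker_of T D\<rparr>) (D ` carrier T \<inter> ker_of T D)"
definition coh_class where "coh_class T D z = (D ` carrier T \<inter> ker_of T D) +>\<^bsub>T\<^esub> z"

context
  fixes T :: "(complex, 'a) module" and D
  assumes T: "cvspace T" and D: "lin_map T T D"
begin

lemma ker_sub: "csub (ker_of T D) T"
  unfolding ker_of_def by (rule csub_kernel[OF T T D])

lemma im_sub: "csub (D ` carrier T \<inter> ker_of T D) T"
  by (rule csub_Int[OF T csub_range[OF T T D] ker_sub])

lemma kerM: "cvspace (T\<lparr>carrier := ker_of T D\<rparr>)"
  by (rule csub_cvspace[OF T ker_sub])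

lemma im_subM: "csub (D ` carrier T \<inter> ker_of T D) (T\<lparr>carrier := ker_of T D\<rparr>)"
  using csubD[OF im_sub] by (intro csubI[OF kerM]) auto

lemma a_r_coset_restrict: "N +>\<^bsub>T\<lparr>carrier := X\<rparr>\<^esub> z = N +>\<^bsub>T\<^esub> z"
  by (simp add: a_r_coset_def')

lemma cvspace_coh: "cvspace (coh T D)"
  unfolding coh_def by (rule cvspace_quot_space[OF kerM im_subM])

lemma carrier_coh: "carrier (coh T D) = coh_class T D ` ker_of T D"
  unfolding coh_def coh_class_def carrier_quot_space[OF kerM im_subM] by (simp add: a_r_coset_restrict)

lemma coh_class_lin: "lin_map (T\<lparr>carrier := ker_of T D\<rparr>) (coh T D) (coh_class T D)"
  using coset_linear[OF kerM im_subM] unfolding coh_def coh_class_def[abs_def] by (simp add: a_r_coset_restrict)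

lemma coh_class_eq_iff:
  assumes "x \<in> ker_of T D" "y \<in> ker_of T D"
  shows "coh_class T D x = coh_class T D y \<longleftrightarrow> x \<ominus>\<^bsub>T\<^esub> y \<in> D ` carrier T \<inter> ker_of T D"
  unfolding coh_class_def using assms csubD(1)[OF ker_sub]
  by (intro coset_eq_iff[OF T im_sub]) auto

end

text \<open>\<open>J R\<close> is a projection commuting with \<open>D\<close>, and \<open>D\<close> is acyclic on its kernel. The parity operator
  \<open>\<sigma>\<close> is an involution, so it affects neither kernels nor images.\<close>

lemma coh_iso:
  fixes T :: "(complex, 'a) module" and U :: "(complex, 'b) module"
  assumes T: "cvspace T" and D: "lin_map T T D" and U: "cvspace U" and D': "lin_map U U D'"
    and J: "lin_map U T J" and R: "lin_map T U R" and RJ: "\<And>x. x \<in> carrier U \<Longrightarrow> R (J x) = x"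
    and \<sigma>: "lin_map T T \<sigma>" "\<And>t. t \<in> carrier T \<Longrightarrow> \<sigma> (\<sigma> t) = t" "\<And>t. t \<in> carrier T \<Longrightarrow> \<sigma> (J (R t)) = J (R (\<sigma> t))"
    and DJ: "\<And>x. x \<in> carrier U \<Longrightarrow> D (J x) = \<sigma> (J (D' x))"
    and DP: "\<And>t. t \<in> carrier T \<Longrightarrow> D (J (R t)) = J (R (D t))"
    and D\<sigma>: "\<And>x. x \<in> carrier U \<Longrightarrow> D (\<sigma> (J x)) = \<sigma> (D (J x))"
    and acyclic: "\<And>y. y \<in> carrier T \<Longrightarrow> D y = \<zero>\<^bsub>T\<^esub> \<Longrightarrow> R y = \<zero>\<^bsub>U\<^esub> \<Longrightarrow> y \<in> D ` carrier T"
  shows "\<exists>\<Phi>. lin_map (coh U D') (coh T D) \<Phi> \<and> bij_betw \<Phi> (carrier (coh U D')) (carrier (coh T D)) \<and>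
    (\<forall>z\<in>ker_of U D'. J z \<in> ker_of T D \<and> \<Phi> (coh_class U D' z) = coh_class T D (J z))"
proof -
  note c = lin_map_closed[OF D] lin_map_closed[OF D'] lin_map_closed[OF J] lin_map_closed[OF R] lin_map_closed[OF \<sigma>(1)]
  note z = lin_map_zero[OF T T D] lin_map_zero[OF U U D'] lin_map_zero[OF U T J] lin_map_zero[OF T U R] lin_map_zero[OF T T \<sigma>(1)]
  have JR\<sigma>: "R (\<sigma> (J x)) \<in> carrier U" "J (R (\<sigma> (J x))) = \<sigma> (J x)" if "x \<in> carrier U" for x
    using \<sigma>(3)[of "J x"] that RJ c by auto
  have ker: "J x \<in> ker_of T D" if "x \<in> ker_of U D'" for x
    using that DJ c z by (auto simp: ker_of_def)
  have ker': "R t \<in> ker_of U D'" if t: "t \<in> ker_of T D" for t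
  proof -
    have t': "t \<in> carrier T" "D t = \<zero>\<^bsub>T\<^esub>" using t by (auto simp: ker_of_def)
    have "\<sigma> (J (D' (R t))) = \<zero>\<^bsub>T\<^esub>" using DJ[of "R t"] DP[OF t'(1)] t' c z by simp
    then have "\<sigma> (\<sigma> (J (D' (R t)))) = \<zero>\<^bsub>T\<^esub>" using z by simp
    then have "J (D' (R t)) = \<zero>\<^bsub>T\<^esub>" using \<sigma>(2) t' c by simp
    then have "D' (R t) = \<zero>\<^bsub>U\<^esub>" using RJ[of "D' (R t)"] t' c z by simp
    then show ?thesis using t' c by (simp add: ker_of_def)
  qed
  \<comment> \<open>On the range of \<open>J\<close> the involution \<open>\<sigma>\<close> commutes
    with \<open>D\<close>, so it can be absorbed into the preimage. Conversely \<open>J R\<close>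
    carries any preimage \<open>w\<close> of \<open>J x\<close> back into the range of
    \<open>J\<close>.\<close>
  have im: "J x \<in> D ` carrier T \<longleftrightarrow> x \<in> D' ` carrier U" if x: "x \<in> carrier U" for x
  proof
    assume "x \<in> D' ` carrier U"
    then obtain y where y: "y \<in> carrier U" "x = D' y" by auto
    have "J x = \<sigma> (\<sigma> (J (D' y)))" using y c \<sigma>(2) by simp
    also have "\<dots> = D (\<sigma> (J y))" using y by (simp add: DJ D\<sigma>)
    finally show "J x \<in> D ` carrier T" using y c by simp
  next
    assume "J x \<in> D ` carrier T"
    then obtain w where w: "w \<in> carrier T" "J x = D w" by auto
    have "J x = J (R (D w))" using w RJ[OF x] by simp
    also have "\<dots> = \<sigma> (D (\<sigma> (J (R w))))" using w c by (simp add: DP[symmetric] D\<sigma> \<sigma>(2))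
    also have "\<sigma> (J (R w)) = J (R (\<sigma> w))" using w \<sigma>(3) by simp
    also have "\<sigma> (D (J (R (\<sigma> w)))) = J (D' (R (\<sigma> w)))" using w c by (simp add: DJ \<sigma>(2))
    finally have "R (J x) = R (J (D' (R (\<sigma> w))))" by simp
    then have "x = D' (R (\<sigma> w))" by (simp only: RJ[OF x] RJ[OF c(2)[OF c(4)[OF c(5)[OF w(1)]]]])
    then show "x \<in> D' ` carrier U" using c(4)[OF c(5)[OF w(1)]] by blast
  qed
  note cl = coh_class_eq_iff[OF U D'] coh_class_eq_iff[OF T D]
  have kc: "x \<in> carrier U" if "x \<in> ker_of U D'" for x using that by (simp add: ker_of_def)
  have key: "coh_class U D' x = coh_class U D' y \<longleftrightarrow> coh_class T D (J x) = coh_class T D (J y)"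
    if "x \<in> ker_of U D'" "y \<in> ker_of U D'" for x y
  proof -
    have d: "x \<ominus>\<^bsub>U\<^esub> y \<in> ker_of U D'" by (rule csub_diff[OF U ker_sub[OF U D'] that])
    have "J x \<ominus>\<^bsub>T\<^esub> J y = J (x \<ominus>\<^bsub>U\<^esub> y)" using that kc by (simp add: lin_map_diff[OF U T J])
    then show ?thesis using cl(1)[OF that] cl(2)[OF ker ker, OF that] im[OF kc[OF d]] d ker[OF d] by simp
  qed
  define \<Phi> where "\<Phi> C = coh_class T D (J (SOME x. x \<in> ker_of U D' \<and> C = coh_class U D' x))" for C
  have \<Phi>: "\<Phi> (coh_class U D' x) = coh_class T D (J x)" if "x \<in> ker_of U D'" for x
  proof -
    define y where "y = (SOME y. y \<in> ker_of U D' \<and> coh_class U D' x = coh_class U D' y)"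
    have y: "y \<in> ker_of U D' \<and> coh_class U D' x = coh_class U D' y"
      unfolding y_def by (rule someI[of _ x]) (use that in simp)
    have "\<Phi> (coh_class U D' x) = coh_class T D (J y)" by (simp only: \<Phi>_def y_def)
    also have "\<dots> = coh_class T D (J x)" using key[OF that, of y] y by simp
    finally show ?thesis .
  qed
  have cU: "C \<in> carrier (coh U D') \<longleftrightarrow> (\<exists>x\<in>ker_of U D'. C = coh_class U D' x)" for C
    unfolding carrier_coh[OF U D'] by auto
  have lU: "coh_class U D' x \<oplus>\<^bsub>coh U D'\<^esub> coh_class U D' y = coh_class U D' (x \<oplus>\<^bsub>U\<^esub> y)" "a \<odot>\<^bsub>coh U D'\<^esub> coh_class U D' x = coh_class U D' (a \<odot>\<^bsub>U\<^esub> x)"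
    if "x \<in> ker_of U D'" "y \<in> ker_of U D'" for x y a
    using lin_map_add[OF coh_class_lin[OF U D'], of x y] lin_map_smult[OF coh_class_lin[OF U D'], of x a] that by simp_all
  have lT: "coh_class T D x \<oplus>\<^bsub>coh T D\<^esub> coh_class T D y = coh_class T D (x \<oplus>\<^bsub>T\<^esub> y)" "a \<odot>\<^bsub>coh T D\<^esub> coh_class T D x = coh_class T D (a \<odot>\<^bsub>T\<^esub> x)"
    if "x \<in> ker_of T D" "y \<in> ker_of T D" for x y a
    using lin_map_add[OF coh_class_lin[OF T D], of x y] lin_map_smult[OF coh_class_lin[OF T D], of x a] that by simp_all
  note kU = csubD[OF ker_sub[OF U D']]
  have "lin_map (coh U D') (coh T D) \<Phi>"
    unfolding lin_map_def
  proof (intro conjI funcsetI ballI allI)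
    fix C assume "C \<in> carrier (coh U D')"
    then obtain x where x: "x \<in> ker_of U D'" "C = coh_class U D' x" using cU by blast
    then show "\<Phi> C \<in> carrier (coh T D)" using \<Phi> ker carrier_coh[OF T D] by auto
    show "\<Phi> (a \<odot>\<^bsub>coh U D'\<^esub> C) = a \<odot>\<^bsub>coh T D\<^esub> \<Phi> C" for a
      using x kU(3)[OF x(1)] lU(2)[OF x(1) x(1)] lT(2)[OF ker[OF x(1)] ker[OF x(1)]] \<Phi> lin_map_smult[OF J kc[OF x(1)]] by simp
    fix C' assume "C' \<in> carrier (coh U D')"
    then obtain y where y: "y \<in> ker_of U D'" "C' = coh_class U D' y" using cU by blast
    show "\<Phi> (C \<oplus>\<^bsub>coh U D'\<^esub> C') = \<Phi> C \<oplus>\<^bsub>coh T D\<^esub> \<Phi> C'"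
      using x y kU(2)[OF x(1) y(1)] lU(1)[OF x(1) y(1)] lT(1)[OF ker[OF x(1)] ker[OF y(1)]] \<Phi> lin_map_add[OF J kc[OF x(1)] kc[OF y(1)]] by simp
  qed
  moreover have "bij_betw \<Phi> (carrier (coh U D')) (carrier (coh T D))"
    unfolding bij_betw_def
  proof
    show "inj_on \<Phi> (carrier (coh U D'))"
    proof (rule inj_onI)
      fix C C' assume *: "C \<in> carrier (coh U D')" "C' \<in> carrier (coh U D')" "\<Phi> C = \<Phi> C'"
      obtain x where x: "x \<in> ker_of U D'" "C = coh_class U D' x" using cU * by blast
      obtain y where y: "y \<in> ker_of U D'" "C' = coh_class U D' y" using cU * by blast
      show "C = C'" using *(3) x y key[OF x(1) y(1)] by (simp only: \<Phi>)
    qed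
    show "\<Phi> ` carrier (coh U D') = carrier (coh T D)"
    proof (intro equalityI subsetI)
      fix C assume "C \<in> \<Phi> ` carrier (coh U D')"
      then show "C \<in> carrier (coh T D)" using cU \<Phi> ker carrier_coh[OF T D] by auto
    next
      fix C assume "C \<in> carrier (coh T D)"
      then obtain t where t: "t \<in> ker_of T D" "C = coh_class T D t" using carrier_coh[OF T D] by auto
      have t': "t \<in> carrier T" "D t = \<zero>\<^bsub>T\<^esub>" using t by (auto simp: ker_of_def)
      \<comment> \<open>The component of the cocycle in the kernel of the projection
        \<open>J R\<close>. It is a cocycle killed by \<open>R\<close>, hence exact by
        \<open>acyclic\<close>, so every class has a representative in the range of
        \<open>J\<close>.\<close>
      let ?y = "t \<ominus>\<^bsub>T\<^esub> J (R t)"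
      have k: "J (R t) \<in> ker_of T D" using ker ker' t by blast
      have y: "?y \<in> ker_of T D" by (rule csub_diff[OF T ker_sub[OF T D] t(1) k])
      have "R ?y = \<zero>\<^bsub>U\<^esub>"
        using t' c RJ U by (intro functional_eqI[OF U]) (auto simp: lin_map_diff[OF T U R] T lf_diff[OF U] lf_zero)
      then have "?y \<in> D ` carrier T" using y by (intro acyclic) (auto simp: ker_of_def)
      then have "coh_class T D t = coh_class T D (J (R t))" using cl(2)[OF t(1) k] y by simp
      then show "C \<in> \<Phi> ` carrier (coh U D')" using t \<Phi>[OF ker'[OF t(1)]] ker'[OF t(1)] cU by (metis image_eqI)
    qed
  qed
  ultimately show ?thesis using \<Phi> ker by blast
qed

lemma dirac_cohomology_coh:
  "dirac_cohomology br \<aa> \<bb> ws M \<rho> S \<gamma> = coh (tensor M S) (tensor_act M \<rho> S \<gamma> (dirac br \<aa> \<bb> ws))"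
  "dirac_class br \<aa> \<bb> ws M \<rho> S \<gamma> z = coh_class (tensor M S) (tensor_act M \<rho> S \<gamma> (dirac br \<aa> \<bb> ws)) z"
  "dirac_ker br \<aa> \<bb> ws M \<rho> S \<gamma> = ker_of (tensor M S) (tensor_act M \<rho> S \<gamma> (dirac br \<aa> \<bb> ws))"
  by (simp_all add: dirac_cohomology_def dirac_class_def coh_def coh_class_def dirac_ker_def dirac_im_def ker_of_def)

locale two_stage_hodge = two_stage +
  assumes hodge: "hodge T1 D1"
begin

sublocale h: hodge T1 D1 by (rule hodge)

abbreviation "H \<equiv> dirac_cohomology br UNIV kk ws_p V \<pi> Sp \<gamma>p"
abbreviation "\<rho> \<equiv> cohomology_action br UNIV kk ws_p V \<pi> Sp \<gamma>p"
abbreviation "KD \<equiv> ker_of T1 D1"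
abbreviation "cls \<equiv> dirac_class br UNIV kk ws_p V \<pi> Sp \<gamma>p"

lemma KD_iff: "z \<in> KD \<longleftrightarrow> z \<in> carrier T1 \<and> D1 z = \<zero>\<^bsub>T1\<^esub>"
  by (simp add: ker_of_def)

lemma im_ker: "D1 ` carrier T1 \<inter> KD = {\<zero>\<^bsub>T1\<^esub>}"
proof (intro equalityI subsetI)
  fix x assume "x \<in> D1 ` carrier T1 \<inter> KD"
  then have x: "x \<in> D1 ` carrier T1" "D1 x = \<zero>\<^bsub>T1\<^esub>" by (simp_all only: Int_iff KD_iff)
  from x(1) obtain w where w: "x = D1 w" "w \<in> carrier T1" by (elim imageE)
  from h.disjoint[OF w(2)] x(2) show "x \<in> {\<zero>\<^bsub>T1\<^esub>}" by (simp only: w(1) singleton_iff)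
next
  fix x assume "x \<in> {\<zero>\<^bsub>T1\<^esub>}"
  then show "x \<in> D1 ` carrier T1 \<inter> KD" using csubD(4)[OF im_sub[OF T1 D1_lin]] by (simp only: singleton_iff)
qed

text \<open>Kernel and image of \<open>D(g, k)\<close> meet in zero, so each class is a singleton:
  the first-stage cohomology is the kernel itself with every vector wrapped in a set.\<close>

lemma cls_eq: "z \<in> carrier T1 \<Longrightarrow> cls z = {z}"
  unfolding dirac_cohomology_coh(2) coh_class_def im_ker using T1 by (simp add: a_r_coset_def')

lemma H_carrier: "carrier H = (\<lambda>z. {z}) ` KD"
  unfolding dirac_cohomology_coh(1) carrier_coh[OF T1 D1_lin] dirac_cohomology_coh(2)[symmetric]
  by (rule image_cong) (auto simp: cls_eq KD_iff)

lemma H_cv: "cvspace H"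
  unfolding dirac_cohomology_coh(1) by (rule cvspace_coh[OF T1 D1_lin])

lemma H_add: "x \<in> KD \<Longrightarrow> y \<in> KD \<Longrightarrow> {x} \<oplus>\<^bsub>H\<^esub> {y} = {x \<oplus>\<^bsub>T1\<^esub> y}"
  and H_smult: "x \<in> KD \<Longrightarrow> c \<odot>\<^bsub>H\<^esub> {x} = {c \<odot>\<^bsub>T1\<^esub> x}"
  using lin_map_add[OF coh_class_lin[OF T1 D1_lin], of x y] lin_map_smult[OF coh_class_lin[OF T1 D1_lin], of x c] T1
  by (auto simp: dirac_cohomology_coh(1) dirac_cohomology_coh(2)[symmetric] cls_eq KD_iff)

lemmas KDs = csubD[OF ker_sub[OF T1 D1_lin]]

lemma dg_KD: "x \<in> kk \<Longrightarrow> z \<in> KD \<Longrightarrow> dg x z \<in> KD"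
  using D1_dg lin_map_zero[OF T1 T1 dg_lin] lin_map_closed[OF dg_lin] by (simp add: KD_iff)

lemma \<rho>_eq: "x \<in> kk \<Longrightarrow> z \<in> KD \<Longrightarrow> \<rho> x {z} = {dg x z}"
  using lin_map_closed[OF dg_lin] by (simp add: cohomology_action_def cls_eq KD_iff)

lemma H_module: "lie_module br kk H \<rho>"
proof -
  have 1: "lin_map H H (\<rho> x)" if x: "x \<in> kk" for x
  proof -
    have "\<rho> x h \<in> carrier H" if "h \<in> carrier H" for h
      using that x by (auto simp: H_carrier \<rho>_eq dg_KD)
    moreover have "\<rho> x (h \<oplus>\<^bsub>H\<^esub> h') = \<rho> x h \<oplus>\<^bsub>H\<^esub> \<rho> x h'" if "h \<in> carrier H" "h' \<in> carrier H" for h h'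
    proof -
      from that obtain z z' where "z \<in> KD" "z' \<in> KD" "h = {z}" "h' = {z'}" by (auto simp: H_carrier)
      then show ?thesis using x lin_map_add[OF dg_lin, of z z'] by (simp add: H_add \<rho>_eq dg_KD KDs KD_iff[THEN iffD1])
    qed
    moreover have "\<rho> x (c \<odot>\<^bsub>H\<^esub> h) = c \<odot>\<^bsub>H\<^esub> \<rho> x h" if "h \<in> carrier H" for h c
    proof -
      from that obtain z where "z \<in> KD" "h = {z}" by (auto simp: H_carrier)
      then show ?thesis using x lin_map_smult[OF dg_lin, of z] by (simp add: H_smult \<rho>_eq dg_KD KDs KD_iff[THEN iffD1])
    qed
    ultimately show ?thesis by (auto simp: lin_map_def)
  qed
  have 2: "dg (x + y) z = dg x z \<oplus>\<^bsub>T1\<^esub> dg y z" if "x \<in> kk" "y \<in> kk" "z \<in> carrier T1" for x y z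
    using that T1 dg_clin lin_map_closed[OF dg_lin]
    by (intro functional_eqI[OF T1]) (auto simp: clin_def lf_add[where M = T1])
  have 3: "dg (cscale c x) z = c \<odot>\<^bsub>T1\<^esub> dg x z" if "x \<in> kk" "z \<in> carrier T1" for x c z
    using that T1 dg_clin lin_map_closed[OF dg_lin]
    by (intro functional_eqI[OF T1]) (auto simp: clin_def lf_smult[where M = T1])
  have diff: "{x} \<ominus>\<^bsub>H\<^esub> {y} = {x \<ominus>\<^bsub>T1\<^esub> y}" if "x \<in> KD" "y \<in> KD" for x y
    using that T1 H_cv by (simp add: cv_diff_eq H_carrier H_smult H_add KDs KD_iff[THEN iffD1])
  show ?thesis
    unfolding lie_module_def generators_act_def
  proof (intro conjI ballI allI H_cv 1)
    fix x h assume x: "x \<in> kk" and "h \<in> carrier H"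
    then obtain z where z: "z \<in> KD" "z \<in> carrier T1" "h = {z}" by (auto simp: H_carrier KD_iff)
    show "\<rho> (cscale c x) h = c \<odot>\<^bsub>H\<^esub> \<rho> x h" for c
      using x z cs.subspace_scale[OF kk_subspace x] by (simp add: \<rho>_eq 3 H_smult dg_KD)
    fix y assume y: "y \<in> kk"
    show "\<rho> (x + y) h = \<rho> x h \<oplus>\<^bsub>H\<^esub> \<rho> y h"
      using x y z cs.subspace_add[OF kk_subspace x y] by (simp add: \<rho>_eq 2 H_add dg_KD)
    show "\<rho> (cb x y) h = \<rho> x (\<rho> y h) \<ominus>\<^bsub>H\<^esub> \<rho> y (\<rho> x h)"
      using x y z cb_kk[OF x y] by (simp add: \<rho>_eq dg_bracket diff dg_KD)
  qed
qed

lemma orth_kk_rr: "Q = orth br kk \<rr>"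
  by (auto simp: ss orth_def)

lemmas DK_data = kk_subalgebra H_module orth_kk_rr onb_subspace[OF onbk] clk onb_in(1)[OF onbk]

definition DK where "DK = tensor_act H \<rho> Sk \<gamma>k (dirac br kk \<rr> ws_k)"
abbreviation "HS \<equiv> tensor H Sk"
abbreviation "hs \<equiv> tens H Sk"

lemma DK_lin: "lin_map HS HS DK"
  unfolding DK_def by (rule tensor_act_linear[OF DK_data(1-5) dirac_closed[OF DK_data]])

lemmas HS = cvspace_tensor[OF H_cv cvk]
lemma inH: "z \<in> KD \<Longrightarrow> {z} \<in> carrier H" by (simp add: H_carrier)
lemmas hsc = tens_closed[OF H_cv cvk]
lemmas hlf = tens_lf[OF H_cv cvk]

lemma DK_tens:
  assumes l: "lin_functional HS l" and z: "z \<in> KD" and q: "q \<in> carrier Sk"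
  shows "l (DK (hs {z} q)) = (\<Sum>i<length ws_k. l (hs {dg (ws_k ! i) z} (\<gamma>k (ws_k ! i) q))) - 1/12 * cubic_k (\<lambda>q. l (hs {z} q)) q"
  using z q k.ws_in dirac_act[OF DK_data l inH[OF z] q] k.cubic_full[OF hlf(2)[OF l inH[OF z]] q]
  by (simp add: DK_def cubic_k_def \<rho>_eq)

text \<open>\<open>the_elem\<close> unwraps the singleton class. \<open>J\<close> includes
  \<open>Ker \<otimes> Sk\<close> into the triple tensor product, and \<open>R\<close> below is the
  projection along \<open>Im \<otimes> Sk\<close>.\<close>

definition J where "J = tlift TT (\<lambda>h. asc (the_elem h))"
definition R where "R = alift HS (\<lambda>t. hs {h.proj t})"

lemma proj_KD: "t \<in> carrier T1 \<Longrightarrow> h.proj t \<in> KD"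
  using h.proj_closed h.D_proj by (simp add: KD_iff)

lemma J_bilin: "bilin H Sk TT (\<lambda>h. asc (the_elem h))"
  using bilinD[OF asc_bilin] unfolding bilin_def lin_map_def
  by (auto simp: H_carrier H_add H_smult KD_iff[THEN iffD1])

lemma R_bilin: "bilin T1 Sk HS (\<lambda>t. hs {h.proj t})"
  using bilinD[OF bilin_tens[OF H_cv cvk]] lin_map_add[OF h.proj_lin] lin_map_smult[OF h.proj_lin] unfolding bilin_def lin_map_def
  by (auto simp: inH proj_KD H_add[symmetric] H_smult[symmetric])

lemmas J_lin = tlift_linear[OF H_cv cvk TT J_bilin, folded J_def]
lemma J_tens: "z \<in> KD \<Longrightarrow> q \<in> carrier Sk \<Longrightarrow> J (hs {z} q) = asc z q"
  unfolding J_def by (simp add: tlift_tens[OF H_cv cvk TT J_bilin] inH)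
lemmas R_lin = alift_lin[OF HS R_bilin, folded R_def]
lemmas R_asc = alift_asc[OF HS R_bilin, folded R_def]

lemma HS_ext:
  assumes "lin_functional HS f" "lin_functional HS g" "\<And>z q. z \<in> KD \<Longrightarrow> q \<in> carrier Sk \<Longrightarrow> f (hs {z} q) = g (hs {z} q)" "x \<in> carrier HS"
  shows "f x = g x"
  by (rule tensor_lf_ext[OF H_cv cvk assms(1,2) _ assms(4)]) (auto simp: H_carrier assms(3))

text \<open>The operator \<open>A \<otimes> C\<close> for the bracketing
  \<open>(V \<otimes> Sp) \<otimes> Sk\<close>, transported to
  \<open>V \<otimes> (Sp \<otimes> Sk)\<close>.\<close>

definition op where "op A C = alift TT (\<lambda>t q. asc (A t) (C q))"

context
  fixes A C assumes A: "lin_map T1 T1 A" and C: "lin_map Sk Sk C"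
begin
lemma op_bilin: "bilin T1 Sk TT (\<lambda>t q. asc (A t) (C q))"
  using bilinD[OF asc_bilin] lin_map_add[OF A] lin_map_smult[OF A] lin_map_closed[OF A] lin_map_add[OF C] lin_map_smult[OF C] lin_map_closed[OF C]
  unfolding bilin_def lin_map_def by auto
lemmas op_lin = alift_lin[OF TT op_bilin, folded op_def]
lemmas op_asc = alift_asc[OF TT op_bilin, folded op_def]
end

end

section \<open>Intertwining relations and the contracting homotopy\<close>

context two_stage_hodge
begin

lemmas EEc = lin_map_closed[OF EE_lin] and dgc = lin_map_closed[OF dg_lin] and D1c = lin_map_closed[OF D1_lin]
lemmas ascc = bilinD(1)[OF asc_bilin]

lemma EE_EE: "t \<in> carrier T1 \<Longrightarrow> EE (EE t) = t"
proof (rule tensor_ext[OF cvV cvp T1 lin_map_comp[OF EE_lin EE_lin] lin_map_id(2)])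
  show "EE (EE (tn v p)) = tn v p" if "v \<in> carrier V" "p \<in> carrier Sp" for v p
    using that by (simp add: EE_tens \<epsilon>lc \<epsilon>l(2))
qed

text \<open>Each summand of \<open>D(g, k)\<close> contains one Clifford generator of \<pp>, hence
  yields one factor \<open>sg\<close>.\<close>

lemma EE_D1: assumes t: "t \<in> carrier T1" shows "EE (D1 t) = sg \<odot>\<^bsub>T1\<^esub> D1 (EE t)"
proof (rule functional_eqI[OF T1])
  fix l assume l: "lin_functional T1 l"
  have "l (EE (D1 t)) = sg * l (D1 (EE t))"
  proof (rule tensor_lf_ext[OF cvV cvp lf_comp[OF D1_lin lf_comp[OF EE_lin l]] lf_cmult_intro[OF lf_comp[OF EE_lin lf_comp[OF D1_lin l]]] _ t])
    fix v p assume v: "v \<in> carrier V" and p: "p \<in> carrier Sp"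
    show "l (EE (D1 (tn v p))) = sg * l (D1 (EE (tn v p)))"
      using v p ws_in
      by (simp add: D1_tens[OF lf_comp[OF EE_lin l] v p onbp] D1_tens[OF l v _ onbp] EE_tens \<pi>_closed \<gamma>_closed \<epsilon>lc \<epsilon>l(3)
          lf_smult[OF tlf(2)[OF l]] sum_distrib_left)
  qed
  then show "l (EE (D1 t)) = l (sg \<odot>\<^bsub>T1\<^esub> D1 (EE t))" using t by (simp add: lf_smult[OF l] D1c EEc)
qed (use t T1 in \<open>simp_all add: D1c EEc\<close>)

lemma EE_dg: assumes x: "x \<in> kk" and t: "t \<in> carrier T1" shows "EE (dg x t) = dg x (EE t)"
proof (rule functional_eqI[OF T1])
  fix l assume l: "lin_functional T1 l"
  show "l (EE (dg x t)) = l (dg x (EE t))"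
  proof (rule tensor_lf_ext[OF cvV cvp lf_comp[OF dg_lin lf_comp[OF EE_lin l]] lf_comp[OF EE_lin lf_comp[OF dg_lin l]] _ t])
    fix v p assume v: "v \<in> carrier V" and p: "p \<in> carrier Sp"
    show "l (EE (dg x (tn v p))) = l (dg x (EE (tn v p)))"
      using v p x by (simp add: dg_tens[OF lf_comp[OF EE_lin l]] dg_tens[OF l] EE_tens \<pi>_closed \<epsilon>lc alpha_kk alpha_\<epsilon>l[OF x p tlf(2)[OF l v]])
  qed
qed (use t in \<open>simp_all add: dgc EEc\<close>)

lemma EE_transfer:
  assumes "t \<in> carrier T1"
  shows "h.proj (EE t) = EE (h.proj t)" "h.inv_D (EE t) = sg \<odot>\<^bsub>T1\<^esub> EE (h.inv_D t)"
  by (rule h.commute_transfer[OF EE_lin EE_D1 sg assms], assumption)+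

lemma dg_transfer:
  assumes "x \<in> kk" "t \<in> carrier T1"
  shows "h.proj (dg x t) = dg x (h.proj t)" "h.inv_D (dg x t) = dg x (h.inv_D t)"
  using h.commute_transfer[OF dg_lin, of x 1 t] assms D1_dg T1 by (simp_all add: D1c dgc h.inv_D_closed)

lemma cubic_k_cong: "(\<And>q. q \<in> carrier Sk \<Longrightarrow> f q = g q) \<Longrightarrow> q \<in> carrier Sk \<Longrightarrow> cubic_k f q = cubic_k g q"
  unfolding cubic_k_def using k.ws_in k.\<gamma>_closed by (intro sum.cong refl arg_cong2[of _ _ _ _ "(*)"]) auto

lemma kws: "i < length ws_k \<Longrightarrow> ws_k ! i \<in> kk"
  using k.ws_in by blast

lemma asc_zero: "q \<in> carrier Sk \<Longrightarrow> asc \<zero>\<^bsub>T1\<^esub> q = \<zero>\<^bsub>TT\<^esub>"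
  using lin_map_zero[OF T1 TT asc_lin1] by simp

text \<open>On the kernel of \<open>D(g, k)\<close> the first summand of \<open>D(g, r)\<close>
  vanishes, and only the \<kk>-terms remain.\<close>

lemma DD_KD:
  assumes l: "lin_functional TT l" and z: "z \<in> KD" and q: "q \<in> carrier Sk"
  shows "l (DD (asc z q)) = (\<Sum>i<length ws_k. l (asc (EE (dg (ws_k ! i) z)) (\<gamma>k (ws_k ! i) q))) - 1/12 * cubic_k (\<lambda>q. l (asc (EE z) q)) q"
  using DD_asc[OF l _ q, of z] z q lf_zero[OF TT l] by (simp add: KD_iff asc_zero \<epsilon>rc)

lemma EE_KD: "z \<in> KD \<Longrightarrow> EE z \<in> KD"
  using EE_transfer(1)[of z] h.D_proj[of "EE z"] h.proj_ker[of z] by (simp add: KD_iff EEc)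

text \<open>Each generator of \<open>\<ss> \<inter> \<kk>\<close> brings one factor
  \<open>\<epsilon>l\<close>. Linear terms contain one such factor and purely cubic \<kk>-terms
  three, which is the same; so on the kernel \<open>D(g, r)\<close> is \<open>D(k, r)\<close>
  followed by this single involution.\<close>

definition \<sigma> where "\<sigma> = op EE (\<lambda>q. q)"
lemmas \<sigma>_lin = op_lin[OF EE_lin lin_map_id(2), folded \<sigma>_def]
lemmas \<sigma>_asc = op_asc[OF EE_lin lin_map_id(2), folded \<sigma>_def]

lemma JR_asc: "t \<in> carrier T1 \<Longrightarrow> q \<in> carrier Sk \<Longrightarrow> J (R (asc t q)) = asc (h.proj t) q"
  by (simp add: R_asc J_tens proj_KD)

lemmas Jc = lin_map_closed[OF J_lin] and Rc = lin_map_closed[OF R_lin] and DDc = lin_map_closed[OF DD_lin]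
  and DKc = lin_map_closed[OF DK_lin] and \<sigma>c = lin_map_closed[OF \<sigma>_lin]

lemma RJ: assumes x: "x \<in> carrier HS" shows "R (J x) = x"
proof (rule functional_eqI[OF HS])
  fix l assume l: "lin_functional HS l"
  show "l (R (J x)) = l x"
    by (rule HS_ext[OF lf_comp[OF J_lin lf_comp[OF R_lin l]] l _ x])
      (simp add: J_tens R_asc KD_iff[THEN iffD1] h.proj_ker)
qed (use x in \<open>simp_all add: Jc Rc\<close>)

lemma \<sigma>_\<sigma>: assumes t: "t \<in> carrier TT" shows "\<sigma> (\<sigma> t) = t"
proof (rule functional_eqI[OF TT])
  fix l assume l: "lin_functional TT l"
  show "l (\<sigma> (\<sigma> t)) = l t"
    by (rule asc_ext[OF lf_comp[OF \<sigma>_lin lf_comp[OF \<sigma>_lin l]] l _ t]) (simp add: \<sigma>_asc EEc EE_EE)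
qed (use t in \<open>simp_all add: \<sigma>c\<close>)

lemma \<sigma>_JR: assumes t: "t \<in> carrier TT" shows "\<sigma> (J (R t)) = J (R (\<sigma> t))"
proof (rule functional_eqI[OF TT])
  fix l assume l: "lin_functional TT l"
  show "l (\<sigma> (J (R t))) = l (J (R (\<sigma> t)))"
    by (rule asc_ext[OF lf_comp[OF R_lin lf_comp[OF J_lin lf_comp[OF \<sigma>_lin l]]] lf_comp[OF \<sigma>_lin lf_comp[OF R_lin lf_comp[OF J_lin l]]] _ t])
      (simp add: JR_asc \<sigma>_asc EEc h.proj_closed EE_transfer)
qed (use t in \<open>simp_all add: \<sigma>c Jc Rc\<close>)

lemma DD_J: assumes x: "x \<in> carrier HS" shows "DD (J x) = \<sigma> (J (DK x))"
proof (rule functional_eqI[OF TT])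
  fix l assume l: "lin_functional TT l"
  note lJ = lf_comp[OF J_lin lf_comp[OF \<sigma>_lin l]]
  show "l (DD (J x)) = l (\<sigma> (J (DK x)))"
  proof (rule HS_ext[OF lf_comp[OF J_lin lf_comp[OF DD_lin l]] lf_comp[OF DK_lin lJ] _ x])
    fix z q assume z: "z \<in> KD" and q: "q \<in> carrier Sk"
    have "cubic_k (\<lambda>q. l (\<sigma> (J (hs {z} q)))) q = cubic_k (\<lambda>q. l (asc (EE z) q)) q"
      using z q by (intro cubic_k_cong) (simp_all add: J_tens \<sigma>_asc KD_iff[THEN iffD1])
    then show "l (DD (J (hs {z} q))) = l (\<sigma> (J (DK (hs {z} q))))"
      using z q kws k.ws_in by (simp add: J_tens DD_KD[OF l] DK_tens[OF lJ] dg_KD \<sigma>_asc k.\<gamma>_closed KD_iff[THEN iffD1] dgc)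
  qed
qed (use x in \<open>simp_all add: \<sigma>c Jc DDc DKc\<close>)

text \<open>Every ingredient of \<open>D(g, r)\<close> is compatible with the projection onto the
  kernel of \<open>D(g, k)\<close>: parity and diagonal action by the transfer lemma, while the
  summand \<open>D(g, k)\<close> itself is annihilated from either side.\<close>

lemma DD_JR: assumes t: "t \<in> carrier TT" shows "DD (J (R t)) = J (R (DD t))"
proof (rule functional_eqI[OF TT])
  fix l assume l: "lin_functional TT l"
  note lJ = lf_comp[OF R_lin lf_comp[OF J_lin l]]
  show "l (DD (J (R t))) = l (J (R (DD t)))"
  proof (rule asc_ext[OF lf_comp[OF R_lin lf_comp[OF J_lin lf_comp[OF DD_lin l]]] lf_comp[OF DD_lin lJ] _ t])
    fix t q assume t: "t \<in> carrier T1" and q: "q \<in> carrier Sk"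
    have "cubic_k (\<lambda>q. l (J (R (asc (EE t) q)))) q = cubic_k (\<lambda>q. l (asc (EE (h.proj t)) q)) q"
      using t q by (intro cubic_k_cong) (simp_all add: JR_asc EEc EE_transfer)
    then show "l (DD (J (R (asc t q)))) = l (J (R (DD (asc t q))))"
      using t q kws k.ws_in lf_zero[OF TT l]
      by (simp add: JR_asc DD_KD[OF l proj_KD] DD_asc[OF lJ] dgc EEc D1c \<epsilon>rc k.\<gamma>_closed h.proj_D asc_zero EE_transfer dg_transfer)
  qed
qed (use t in \<open>simp_all add: \<sigma>c Jc Rc DDc DKc\<close>)

lemma DD_\<sigma>: assumes x: "x \<in> carrier HS" shows "DD (\<sigma> (J x)) = \<sigma> (DD (J x))"
proof (rule functional_eqI[OF TT])
  fix l assume l: "lin_functional TT l"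
  note lS = lf_comp[OF \<sigma>_lin l]
  show "l (DD (\<sigma> (J x))) = l (\<sigma> (DD (J x)))"
  proof (rule HS_ext[OF lf_comp[OF J_lin lf_comp[OF \<sigma>_lin lf_comp[OF DD_lin l]]] lf_comp[OF J_lin lf_comp[OF DD_lin lS]] _ x])
    fix z q assume z: "z \<in> KD" and q: "q \<in> carrier Sk"
    have z1: "z \<in> carrier T1" using z by (simp add: KD_iff)
    have "cubic_k (\<lambda>q. l (\<sigma> (asc (EE z) q))) q = cubic_k (\<lambda>q. l (asc (EE (EE z)) q)) q"
      using z1 q by (intro cubic_k_cong) (simp_all add: \<sigma>_asc EEc)
    then show "l (DD (\<sigma> (J (hs {z} q)))) = l (\<sigma> (DD (J (hs {z} q))))"
      using z z1 q kws k.ws_in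
      by (simp add: J_tens \<sigma>_asc DD_KD[OF l EE_KD] DD_KD[OF lS] dgc EEc k.\<gamma>_closed EE_dg)
  qed
qed (use x in \<open>simp_all add: \<sigma>c Jc DDc DKc\<close>)

text \<open>Three anticommutations give \<open>(- sg)^3 = - sg\<close>, the same sign as for a
  single generator, so linear and cubic terms behave alike in the homotopy argument.\<close>

lemma \<epsilon>r_cubic:
  assumes m: "lin_functional Sk m" and abc: "a \<in> Q" "b \<in> Q" "c \<in> Q" and q: "q \<in> carrier Sk"
  shows "m (\<epsilon>r (\<gamma>k a (\<gamma>k b (\<gamma>k c q)))) = - sg * m (\<gamma>k a (\<gamma>k b (\<gamma>k c (\<epsilon>r q))))"
proof -
  have "(- sg) * ((- sg) * (- sg)) = - sg" using sg by simp
  moreover have "\<epsilon>r (\<gamma>k a (\<gamma>k b (\<gamma>k c q))) = ((- sg) * ((- sg) * (- sg))) \<odot>\<^bsub>Sk\<^esub> \<gamma>k a (\<gamma>k b (\<gamma>k c (\<epsilon>r q)))"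
    using abc q cvk by (simp add: \<epsilon>r(3) k.\<gamma>_closed \<epsilon>rc lin_map_smult[OF \<gamma>k_lin] cv_smult_smult)
  ultimately show ?thesis using abc q by (simp add: lf_smult[OF m] k.\<gamma>_closed \<epsilon>rc)
qed

text \<open>\<open>GG\<close> is the generalized inverse of \<open>D(g, k)\<close> tensored with
  parity. It anticommutes with the second summand of \<open>D(g, r)\<close>, and composed with the
  first summand in either order it is \<open>1 - J R\<close>. For \<open>y\<close> closed and killed
  by \<open>R\<close> this gives \<open>D(g, r) (GG y) = 2 y\<close>, so half of \<open>GG y\<close>
  is a preimage of \<open>y\<close>.\<close>

lemma acyclic:
  assumes y: "y \<in> carrier TT" "DD y = \<zero>\<^bsub>TT\<^esub>" "R y = \<zero>\<^bsub>HS\<^esub>"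
  shows "y \<in> DD ` carrier TT"
proof -
  define EH where "EH = op D1 \<epsilon>r"
  define GG where "GG = op h.inv_D \<epsilon>r"
  note EHl = op_lin[OF D1_lin \<epsilon>r(1), folded EH_def] and EHa = op_asc[OF D1_lin \<epsilon>r(1), folded EH_def]
  note Gl = op_lin[OF h.inv_D_lin \<epsilon>r(1), folded GG_def] and Ga = op_asc[OF h.inv_D_lin \<epsilon>r(1), folded GG_def]
  note EHc = lin_map_closed[OF EHl] and Gc = lin_map_closed[OF Gl]
  have JR0: "J (R y) = \<zero>\<^bsub>TT\<^esub>" using y lin_map_zero[OF HS TT J_lin] by simp
  have l2: "l (DD (GG y)) = 2 * l y" if l: "lin_functional TT l" for l
  proof -
    note lJR = lf_comp[OF R_lin lf_comp[OF J_lin l]] and lG = lf_comp[OF Gl l] and lEH = lf_comp[OF EHl l]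
    have lasc: "lin_functional T1 (\<lambda>t. l (asc t q))" if "q \<in> carrier Sk" for q by (rule lf_comp[OF asc_lin1[OF that] l])
    have lasc2: "lin_functional Sk (\<lambda>q. l (asc t q))" if "t \<in> carrier T1" for t
      using asc_bilin that by (intro lf_comp[OF _ l]) (simp add: bilin_def)
    have e1: "l (EH (GG y)) = l y - l (J (R y))"
      by (rule asc_ext[OF lf_comp[OF Gl lEH] lf_minus_intro[OF l lJR] _ y(1)])
        (simp add: Ga EHa JR_asc h.inv_D_closed \<epsilon>rc \<epsilon>r(2) h.D_inv_D lf_diff[OF T1 lasc] h.proj_closed)
    have e2: "l (GG (EH y)) = l y - l (J (R y))"
      by (rule asc_ext[OF lf_comp[OF EHl lG] lf_minus_intro[OF l lJR] _ y(1)])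
        (simp add: Ga EHa JR_asc D1c \<epsilon>rc \<epsilon>r(2) h.inv_D_D lf_diff[OF T1 lasc] h.proj_closed)
    \<comment> \<open>The rest \<open>DD - EH\<close> anticommutes with \<open>GG\<close>: moving
      \<open>h.inv_D\<close> past \<open>EE\<close> gives \<open>sg\<close>, moving
      \<open>\<epsilon>r\<close> past one or three Clifford generators gives \<open>- sg\<close>,
      and the product of the two is \<open>- 1\<close>.\<close>
    have e3: "l (DD (GG y)) - l (EH (GG y)) = l (GG (EH y)) - l (GG (DD y))"
    proof (rule asc_ext[OF lf_minus_intro[OF lf_comp[OF Gl lf_comp[OF DD_lin l]] lf_comp[OF Gl lEH]]
          lf_minus_intro[OF lf_comp[OF EHl lG] lf_comp[OF DD_lin lG]] _ y(1)])
      fix t q assume t: "t \<in> carrier T1" and q: "q \<in> carrier Sk"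
      let ?i = "h.inv_D t"
      have i: "?i \<in> carrier T1" using h.inv_D_closed[OF t] .
      have e: "EE ?i \<in> carrier T1" by (rule EEc[OF i])
      have iEE: "h.inv_D (EE u) = sg \<odot>\<^bsub>T1\<^esub> EE (h.inv_D u)" if "u \<in> carrier T1" for u by (rule EE_transfer(2)[OF that])
      have "l (GG (asc (EE t) (\<gamma>k a (\<gamma>k b (\<gamma>k c q))))) = - l (asc (EE ?i) (\<gamma>k a (\<gamma>k b (\<gamma>k c (\<epsilon>r q)))))"
        if "a \<in> Q" "b \<in> Q" "c \<in> Q" for a b c
        using that t q i e sg \<epsilon>r_cubic[OF lasc2[OF e] that q] 
        by (simp add: Ga EEc iEE k.\<gamma>_closed \<epsilon>rc lf_smult[OF lasc] flip: mult.assoc)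
      then have cub: "cubic_k (\<lambda>q. l (GG (asc (EE t) q))) q = - cubic_k (\<lambda>q. l (asc (EE ?i) q)) (\<epsilon>r q)"
        unfolding cubic_k_def using k.ws_in by (simp add: sum_negf)
      have tm: "l (GG (asc (EE (dg (ws_k ! j) t)) (\<gamma>k (ws_k ! j) q))) = - l (asc (EE (dg (ws_k ! j) ?i)) (\<gamma>k (ws_k ! j) (\<epsilon>r q)))"
        if j: "j < length ws_k" for j
        using j t q i sg k.ws_in[OF j] kws[OF j]
        by (simp add: Ga EEc iEE dgc dg_transfer k.\<gamma>_closed \<epsilon>rc \<epsilon>r(3) lf_smult[OF lasc] lf_smult[OF lasc2] cvk flip: mult.assoc)
      show "l (DD (GG (asc t q))) - l (EH (GG (asc t q))) = l (GG (EH (asc t q))) - l (GG (DD (asc t q)))"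
        using t q i by (simp add: Ga EHa DD_asc[OF l] DD_asc[OF lG] \<epsilon>rc D1c cub tm sum_negf)
    qed
    show ?thesis using e1 e2 e3 JR0 y(2) lin_map_zero[OF TT TT Gl] lf_zero[OF TT l] by simp
  qed
  have "y = (1/2) \<odot>\<^bsub>TT\<^esub> DD (GG y)"
  proof (rule functional_eqI[OF TT y(1)])
    show "(1/2) \<odot>\<^bsub>TT\<^esub> DD (GG y) \<in> carrier TT" by (rule cv_smult_closed[OF TT DDc[OF Gc[OF y(1)]]])
    fix l assume l: "lin_functional TT l"
    show "l y = l ((1/2) \<odot>\<^bsub>TT\<^esub> DD (GG y))"
      unfolding lf_smult[OF l DDc[OF Gc[OF y(1)]]] l2[OF l] by simp
  qed
  then have "y = DD ((1/2) \<odot>\<^bsub>TT\<^esub> GG y)" by (simp only: lin_map_smult[OF DD_lin Gc[OF y(1)]])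
  moreover have "(1/2) \<odot>\<^bsub>TT\<^esub> GG y \<in> carrier TT" using y(1) TT by (simp add: Gc)
  ultimately show ?thesis by (rule image_eqI)
qed

theorem cohomology_in_stages:
  "\<exists>\<Phi>. lin_map (dirac_cohomology br kk \<rr> ws_k H \<rho> Sk \<gamma>k) (dirac_cohomology br UNIV \<rr> ws_s V \<pi> SS \<gamma>) \<Phi> \<and>
     bij_betw \<Phi> (carrier (dirac_cohomology br kk \<rr> ws_k H \<rho> Sk \<gamma>k)) (carrier (dirac_cohomology br UNIV \<rr> ws_s V \<pi> SS \<gamma>)) \<and>
     (\<forall>(n::nat) x y.
        let z = finsum HS (\<lambda>i. hs (cls (x i)) (y i)) {..<n}; z' = finsum TT (\<lambda>i. asc (x i) (y i)) {..<n}
        in (\<forall>i<n. x i \<in> dirac_ker br UNIV kk ws_p V \<pi> Sp \<gamma>p \<and> y i \<in> carrier Sk) \<and> z \<in> dirac_ker br kk \<rr> ws_k H \<rho> Sk \<gamma>k \<longrightarrow>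
           z' \<in> dirac_ker br UNIV \<rr> ws_s V \<pi> SS \<gamma> \<and>
           \<Phi> (dirac_class br kk \<rr> ws_k H \<rho> Sk \<gamma>k z) = dirac_class br UNIV \<rr> ws_s V \<pi> SS \<gamma> z')"
proof -
  have "\<exists>\<Phi>. lin_map (coh HS DK) (coh TT DD) \<Phi> \<and> bij_betw \<Phi> (carrier (coh HS DK)) (carrier (coh TT DD)) \<and>
      (\<forall>z\<in>ker_of HS DK. J z \<in> ker_of TT DD \<and> \<Phi> (coh_class HS DK z) = coh_class TT DD (J z))"
    by (rule coh_iso[where T = TT and D = DD and U = HS and D' = DK and J = J and R = R and \<sigma> = \<sigma>])
      (fact TT DD_lin HS DK_lin J_lin R_lin RJ \<sigma>_lin \<sigma>_\<sigma> \<sigma>_JR DD_J DD_JR DD_\<sigma> acyclic)+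
  then obtain \<Phi> where \<Phi>: "lin_map (coh HS DK) (coh TT DD) \<Phi>" "bij_betw \<Phi> (carrier (coh HS DK)) (carrier (coh TT DD))"
    "\<forall>z\<in>ker_of HS DK. J z \<in> ker_of TT DD \<and> \<Phi> (coh_class HS DK z) = coh_class TT DD (J z)"
    by (elim exE conjE) (rule that)
  \<comment> \<open>\<open>J\<close> sends a sum of pure tensors of classes to the corresponding sum
    of representatives, which makes \<open>\<Phi>\<close> the natural identification and not merely
    some isomorphism.\<close>
  have Jz: "J (finsum HS (\<lambda>i. hs (cls (x i)) (y i)) {..<n}) = finsum TT (\<lambda>i. asc (x i) (y i)) {..<n}"
    if "\<forall>i<n. x i \<in> KD \<and> y i \<in> carrier Sk" for n x y
  proof -
    have x: "x i \<in> carrier T1" "cls (x i) = {x i}" "x i \<in> KD" "y i \<in> carrier Sk" if "i < n" for i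
      using \<open>\<forall>i<n. _\<close> that cls_eq by (auto simp: KD_iff)
    have "J (finsum HS (\<lambda>i. hs (cls (x i)) (y i)) {..<n}) = finsum TT (\<lambda>i. J (hs (cls (x i)) (y i))) {..<n}"
      using x by (intro lin_map_finsum[OF HS TT J_lin]) (simp add: hsc inH)
    also have "\<dots> = finsum TT (\<lambda>i. asc (x i) (y i)) {..<n}"
      using x by (intro abelian_monoid.finsum_cong'[OF abelian_group.axioms(1)[OF cv_abelian_group[OF TT]]])
        (simp_all add: J_tens ascc)
    finally show ?thesis .
  qed
  show ?thesis
    unfolding dirac_cohomology_coh(1,3)[of br kk \<rr>] dirac_cohomology_coh(2)[of br kk \<rr>] dirac_cohomology_coh(1,3)[of br UNIV \<rr>] dirac_cohomology_coh(2)[of br UNIV \<rr>]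
      dirac_cohomology_coh(3)[of br UNIV kk] DK_def[symmetric] DD_def[symmetric] Let_def
  proof (intro exI[of _ \<Phi>] conjI allI impI \<Phi>(1,2); elim conjE)
    fix n :: nat and x y
    assume a: "\<forall>i<n. x i \<in> KD \<and> y i \<in> carrier Sk" and b: "finsum HS (\<lambda>i. hs (cls (x i)) (y i)) {..<n} \<in> ker_of HS DK"
    show "finsum TT (\<lambda>i. asc (x i) (y i)) {..<n} \<in> ker_of TT DD"
      "\<Phi> (coh_class HS DK (finsum HS (\<lambda>i. hs (cls (x i)) (y i)) {..<n})) = coh_class TT DD (finsum TT (\<lambda>i. asc (x i) (y i)) {..<n})"
      using \<Phi>(3)[rule_format, OF b] unfolding Jz[OF a] by blast+
  qed
qed

end

section \<open>Spans and linear dependence\<close>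

text \<open>Span inside a carrier, taken as the range of evaluation on the free space;
  \<open>E\<close> may be infinite, as orbits of \<open>K\<close> will be.\<close>

definition spn :: "(complex, 'a) module \<Rightarrow> 'a set \<Rightarrow> 'a set" where
  "spn M E = lext M id ` carrier (free_space E)"

lemma csub_of_linear_free: "cvspace M \<Longrightarrow> E \<subseteq> carrier M \<Longrightarrow> lin_map (free_space E) M (lext M id)"
  by (rule lext_linear) auto

lemma spn_csub: "cvspace M \<Longrightarrow> E \<subseteq> carrier M \<Longrightarrow> csub (spn M E) M"
  unfolding spn_def by (rule csub_range[OF cvspace_free_space _ csub_of_linear_free])

lemma spn_base: "cvspace M \<Longrightarrow> E \<subseteq> carrier M \<Longrightarrow> e \<in> E \<Longrightarrow> e \<in> spn M E"
  unfolding spn_def by (rule image_eqI[of _ _ "basis_elt e"], subst lext_single[of M id E]) auto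

lemma spn_minimal: "cvspace M \<Longrightarrow> csub N M \<Longrightarrow> E \<subseteq> N \<Longrightarrow> spn M E \<subseteq> N"
  unfolding spn_def lext_def
proof (intro image_subsetI csub_finsum funcsetI; assumption?)
  fix p x
  assume "csub N M" "E \<subseteq> N" "p \<in> carrier (free_space E)" "x \<in> Poly_Mapping.keys p"
  then have "x \<in> N" by auto
  from csubD(3)[OF \<open>csub N M\<close> this] show "Poly_Mapping.lookup p x \<odot>\<^bsub>M\<^esub> id x \<in> N" by simp
qed

lemma spn_mono: "cvspace M \<Longrightarrow> E' \<subseteq> carrier M \<Longrightarrow> E \<subseteq> E' \<Longrightarrow> spn M E \<subseteq> spn M E'"
  by (rule spn_minimal[OF _ spn_csub]) (auto intro: spn_base)

lemma lf_vanish_spn: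
  assumes "cvspace M" "E \<subseteq> carrier M" "lin_functional M l" "\<And>e. e \<in> E \<Longrightarrow> l e = 0" "x \<in> spn M E"
  shows "l x = 0"
proof -
  have 1: "csub {x \<in> carrier M. l x = 0} M"
    by (rule csubI) (use assms(1) in \<open>auto simp: lf_add[OF assms(3)] lf_smult[OF assms(3)] lf_zero[OF assms(1,3)]\<close>)
  have "E \<subseteq> {x \<in> carrier M. l x = 0}" using assms(2,4) by auto
  from subsetD[OF spn_minimal[OF assms(1) 1 this] assms(5)] show ?thesis by simp
qed

text \<open>Membership in a subspace is tested by the functionals that vanish on it: the counterpart
  of \<open>functional_eqI\<close> for containments.\<close>

lemma csub_by_functionals:
  assumes "cvspace M" "csub N M" "x \<in> carrier M" "\<And>l. lin_functional M l \<Longrightarrow> (\<And>n. n \<in> N \<Longrightarrow> l n = 0) \<Longrightarrow> l x = 0"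
  shows "x \<in> N"
proof (rule ccontr)
  assume "x \<notin> N"
  then obtain l where "lin_functional M l" "\<forall>n\<in>N. l n = 0" "l x = 1"
    using functional_separation[OF assms(1-3)] by blast
  then show False using assms(4)[of l] by simp
qed

lemma spn_image:
  assumes "cvspace M" "cvspace N" "lin_map M N f" "E \<subseteq> carrier M" "csub Y N" "\<And>e. e \<in> E \<Longrightarrow> f e \<in> Y" "x \<in> spn M E"
  shows "f x \<in> Y"
proof -
  have 1: "csub {x \<in> carrier M. f x \<in> Y} M"
    by (rule csubI) (use assms(1) csubD[OF assms(5)] in \<open>auto simp: lin_map_add[OF assms(3)] lin_map_smult[OF assms(3)] lin_map_zero[OF assms(1-3)]\<close>)
  have "E \<subseteq> {x \<in> carrier M. f x \<in> Y}" using assms(4,6) by auto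
  from subsetD[OF spn_minimal[OF assms(1) 1 this] assms(7)] show ?thesis by simp
qed

text \<open>The vectors are pulled back to the free space on \<open>E\<close>, where
  \<open>card E\<close> vectors span and \<open>card E + 1\<close> independent ones cannot exist.
  Two pulled-back vectors may coincide; then their difference is the relation. Stating the relation
  through functionals lets it be used under any linear map.\<close>

lemma linear_dependence:
  assumes M: "cvspace M" and E: "finite E" "E \<subseteq> carrier M" and y: "\<And>k. k \<le> card E \<Longrightarrow> y k \<in> spn M E"
  shows "\<exists>c. (\<exists>k\<le>card E. c k \<noteq> 0) \<and> (\<forall>l. lin_functional M l \<longrightarrow> (\<Sum>k\<le>card E. c k * l (y k)) = 0)"
proof -
  define p where "p k = (SOME p. Poly_Mapping.keys p \<subseteq> E \<and> y k = lext M id p)" for k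
  have p: "Poly_Mapping.keys (p k) \<subseteq> E \<and> y k = lext M id (p k)" if "k \<le> card E" for k
    unfolding p_def by (rule someI_ex) (use y[OF that] in \<open>auto simp: spn_def\<close>)
  have "\<exists>c. (\<exists>k\<le>card E. c k \<noteq> 0) \<and> (\<Sum>k\<le>card E. pm_scale (c k) (p k)) = 0"
  proof (cases "inj_on p {..card E}")
    case False
    then obtain i j where ij: "i \<le> card E" "j \<le> card E" "i \<noteq> j" "p i = p j" by (auto simp: inj_on_def)
    let ?c = "\<lambda>k. if k = i then 1 else if k = j then - 1 else (0::complex)"
    have "(\<Sum>k\<le>card E. pm_scale (?c k) (p k)) = (\<Sum>k\<in>{i, j}. pm_scale (?c k) (p k))"
      using ij by (intro sum.mono_neutral_right) auto
    also have "\<dots> = 0" using ij by simp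
    finally show ?thesis using ij by (intro exI[of _ ?c]) auto
  next
    case True
    have sub: "p ` {..card E} \<subseteq> pm.span (basis_elt ` E)"
    proof safe
      fix k assume "k \<le> card E"
      then have k: "Poly_Mapping.keys (p k) \<subseteq> E" using p by blast
      have "basis_elt ` E \<subseteq> carrier (free_space E)" by auto
      from csub_span[OF this] show "p k \<in> pm.span (basis_elt ` E)"
        by (rule free_space_induct) (use k in \<open>auto intro: pm.span_base\<close>)
    qed
    have "card (p ` {..card E}) = Suc (card E)" using True by (simp add: card_image)
    moreover have "card (basis_elt ` E :: ('a \<Rightarrow>\<^sub>0 complex) set) \<le> card E" using E by (intro card_image_le)
    ultimately have "\<not> pm.independent (p ` {..card E})"
      using pm.independent_span_bound[OF finite_imageI[OF E(1)] _ sub] by fastforce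
    then obtain u where u: "\<exists>v\<in>p ` {..card E}. u v \<noteq> 0" "(\<Sum>v\<in>p ` {..card E}. pm_scale (u v) v) = 0"
      using pm.dependent_finite[of "p ` {..card E}"] by auto
    then show ?thesis using True by (intro exI[of _ "\<lambda>k. u (p k)"]) (auto simp: sum.reindex)
  qed
  then obtain c where c: "\<exists>k\<le>card E. c k \<noteq> 0" "(\<Sum>k\<le>card E. pm_scale (c k) (p k)) = 0" by blast
  have "(\<Sum>k\<le>card E. c k * l (y k)) = 0" if l: "lin_functional M l" for l
  proof -
    have lf: "lin_functional (free_space E) (\<lambda>p. l (lext M id p))"
      by (rule lf_comp[OF csub_of_linear_free[OF M E(2)] l])
    have "(\<Sum>k\<le>card E. c k * l (y k)) = (\<Sum>k\<le>card E. l (lext M id (pm_scale (c k) (p k))))"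
      using p lf_smult[OF lf] by (intro sum.cong) auto
    also have "\<dots> = l (lext M id (\<Sum>k\<le>card E. pm_scale (c k) (p k)))"
    proof -
      have f: "(\<lambda>k. pm_scale (c k) (p k)) \<in> {..card E} \<rightarrow> carrier (free_space E)" using p by auto
      show ?thesis using lf_finsum[OF cvspace_free_space lf f] unfolding finsum_free_space[OF f] by simp
    qed
    also have "\<dots> = 0" using c(2) lf_zero[OF cvspace_free_space lf] by simp
    finally show ?thesis .
  qed
  with c(1) show ?thesis by blast
qed

text \<open>In a spanning set of least cardinality no \<open>e\<close> lies in the span of the
  others, so separation provides a functional that is \<open>1\<close> at \<open>e\<close> and
  \<open>0\<close> on the rest.\<close>

lemma finite_dual_basis:
  assumes M: "cvspace M" and E: "finite E" "E \<subseteq> carrier M" "spn M E = carrier M"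
  shows "\<exists>E f. finite E \<and> E \<subseteq> carrier M \<and> (\<forall>e\<in>E. lin_functional M (f e)) \<and>
    (\<forall>s\<in>carrier M. \<forall>l. lin_functional M l \<longrightarrow> l s = (\<Sum>e\<in>E. f e s * l e))"
proof -
  let ?P = "\<lambda>E. finite E \<and> E \<subseteq> carrier M \<and> spn M E = carrier M"
  define F where "F = (ARG_MIN card E. ?P E)"
  have F: "?P F" and Fmin: "\<And>E. ?P E \<Longrightarrow> card F \<le> card E"
    using arg_min_natI[of ?P E card] arg_min_nat_le[of ?P _ card] E unfolding F_def by auto
  have "\<exists>f. lin_functional M f \<and> (\<forall>n\<in>spn M (F - {e}). f n = 0) \<and> f e = 1" if e: "e \<in> F" for e
  proof (rule functional_separation[OF M])
    have s: "F - {e} \<subseteq> carrier M" using F by blast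
    show "csub (spn M (F - {e})) M" by (rule spn_csub[OF M s])
    show "e \<in> carrier M" using F e by blast
    show "e \<notin> spn M (F - {e})"
    proof
      assume "e \<in> spn M (F - {e})"
      then have "F \<subseteq> spn M (F - {e})" using spn_base[OF M s] by blast
      then have "spn M F \<subseteq> spn M (F - {e})" by (rule spn_minimal[OF M spn_csub[OF M s]])
      then have "spn M (F - {e}) = carrier M" using F csubD(1)[OF spn_csub[OF M s]] by auto
      then have "card F \<le> card (F - {e})" using Fmin[of "F - {e}"] F s by blast
      then show False using F e card_Diff1_less[of F e] by linarith
    qed
  qed
  then obtain f where f: "\<And>e. e \<in> F \<Longrightarrow> lin_functional M (f e) \<and> (\<forall>n\<in>spn M (F - {e}). f e n = 0) \<and> f e e = 1" by metis
  have fe: "f e e' = (if e = e' then 1 else 0)" if "e \<in> F" "e' \<in> F" for e e'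
    using f[OF that(1)] that F spn_base[OF M, of "F - {e}" e'] by auto
  have "l s = (\<Sum>e\<in>F. f e s * l e)" if s: "s \<in> carrier M" and l: "lin_functional M l" for s l
  proof -
    have lf: "lin_functional M (\<lambda>s. l s - (\<Sum>e\<in>F. l e * f e s))"
      using f l by (intro lf_intros) auto
    have "l s - (\<Sum>e\<in>F. l e * f e s) = 0"
    proof (rule lf_vanish_spn[OF M _ lf])
      show "l e' - (\<Sum>e\<in>F. l e * f e e') = 0" if e: "e' \<in> F" for e'
      proof -
        have "(\<Sum>e\<in>F. l e * f e e') = (\<Sum>e\<in>F. if e = e' then l e' else 0)" using e by (intro sum.cong) (auto simp: fe)
        then show ?thesis using e F by simp
      qed
    qed (use F s in auto)
    then show ?thesis by (simp add: mult.commute)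
  qed
  with F f show ?thesis by (intro exI[of _ F] exI[of _ f]) blast
qed

section \<open>Hermitian forms\<close>

definition herm :: "(complex, 'a) module \<Rightarrow> ('a \<Rightarrow> 'a \<Rightarrow> complex) \<Rightarrow> bool" where
  "herm T H \<longleftrightarrow> (\<forall>v\<in>carrier T. lin_functional T (\<lambda>u. H u v)) \<and> (\<forall>u\<in>carrier T. \<forall>v\<in>carrier T. H u v = cnj (H v u)) \<and>
     (\<forall>v\<in>carrier T. v \<noteq> \<zero>\<^bsub>T\<^esub> \<longrightarrow> Re (H v v) > 0)"

lemma hermD:
  assumes "herm T H"
  shows "v \<in> carrier T \<Longrightarrow> lin_functional T (\<lambda>u. H u v)" "u \<in> carrier T \<Longrightarrow> v \<in> carrier T \<Longrightarrow> H u v = cnj (H v u)"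
    "v \<in> carrier T \<Longrightarrow> v \<noteq> \<zero>\<^bsub>T\<^esub> \<Longrightarrow> Re (H v v) > 0"
  using assms unfolding herm_def by blast+

lemma herm_zero: "cvspace T \<Longrightarrow> herm T H \<Longrightarrow> v \<in> carrier T \<Longrightarrow> H \<zero>\<^bsub>T\<^esub> v = 0"
  "cvspace T \<Longrightarrow> herm T H \<Longrightarrow> v \<in> carrier T \<Longrightarrow> H v \<zero>\<^bsub>T\<^esub> = 0"
  using lf_zero[OF _ hermD(1)[of T H v]] hermD(2)[of T H v "\<zero>\<^bsub>T\<^esub>"] by auto

lemma herm_nonneg: "cvspace T \<Longrightarrow> herm T H \<Longrightarrow> v \<in> carrier T \<Longrightarrow> Re (H v v) \<ge> 0"
  using hermD(3)[of T H v] herm_zero(1)[of T H v] by (cases "v = \<zero>\<^bsub>T\<^esub>") (auto intro: less_imp_le)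

lemma herm_average:
  assumes T: "cvspace T" and H: "herm T H" and A: "lin_map T T A"
  shows "herm T (\<lambda>u v. H u v + H (A u) (A v))"
  unfolding herm_def
proof (intro conjI ballI impI)
  note Ac = lin_map_closed[OF A]
  fix v assume v: "v \<in> carrier T"
  show "lin_functional T (\<lambda>u. H u v + H (A u) (A v))"
    by (intro lf_plus_intro hermD(1)[OF H v] lf_comp[OF A hermD(1)[OF H Ac[OF v]]])
  show "H u v + H (A u) (A v) = cnj (H v u + H (A v) (A u))" if "u \<in> carrier T" for u
    using hermD(2)[OF H that v] hermD(2)[OF H Ac[OF that] Ac[OF v]] by simp
  show "Re (H v v + H (A v) (A v)) > 0" if "v \<noteq> \<zero>\<^bsub>T\<^esub>"
    using hermD(3)[OF H v that] herm_nonneg[OF T H Ac[OF v]] by simp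
qed

text \<open>Skewness gives \<open>H (D w) (D w) = - H w (D (D w))\<close>, so \<open>D\<close> has
  no generalized kernel beyond its kernel. Local finiteness of \<open>D D\<close> yields a
  polynomial relation on \<open>z\<close>; once its lowest power of \<open>D D\<close> is removed,
  the constant term expresses \<open>z\<close> through a kernel vector and vectors in the
  image.\<close>

lemma skew_hodge:
  assumes T: "cvspace T" and D: "lin_map T T D" and H: "herm T H"
    and skew: "\<And>u v. u \<in> carrier T \<Longrightarrow> v \<in> carrier T \<Longrightarrow> H (D u) v = - H u (D v)"
    and fin: "\<And>z. z \<in> carrier T \<Longrightarrow> \<exists>E. finite E \<and> E \<subseteq> carrier T \<and> z \<in> spn T E \<and> (\<forall>y\<in>spn T E. D (D y) \<in> spn T E)"
  shows "hodge T D"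
proof (rule hodge.intro)
  note c = lin_map_closed[OF D]
  show disj: "D w = \<zero>\<^bsub>T\<^esub>" if w: "w \<in> carrier T" "D (D w) = \<zero>\<^bsub>T\<^esub>" for w
  proof (rule ccontr)
    assume "D w \<noteq> \<zero>\<^bsub>T\<^esub>"
    then have "Re (H (D w) (D w)) > 0" using hermD(3)[OF H c[OF w(1)]] by blast
    moreover have "H (D w) (D w) = 0" using skew[OF w(1) c[OF w(1)]] w herm_zero(2)[OF T H w(1)] by simp
    ultimately show False by simp
  qed
  fix z assume z: "z \<in> carrier T"
  define A where "A x = D (D x)" for x
  have A: "lin_map T T A" unfolding A_def by (rule lin_map_comp[OF D D])
  have Ak: "lin_map T T (\<lambda>x. (A ^^ k) x)" for k
    by (induction k) (simp_all add: lin_map_id lin_map_comp[OF _ A])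
  note Akc = lin_map_closed[OF Ak]
  \<comment> \<open>The power of \<open>A\<close> is lowered one step at a time:
    \<open>D (D x) = 0\<close> forces \<open>D x = 0\<close>, and this is used twice per
    step.\<close>
  have AkD: "D u = \<zero>\<^bsub>T\<^esub>" if "u \<in> carrier T" "(A ^^ k) u = \<zero>\<^bsub>T\<^esub>" for u k
    using that
  proof (induction k)
    case 0
    then show ?case using lin_map_zero[OF T T D] by simp
  next
    case (Suc k)
    have x: "(A ^^ k) u \<in> carrier T" using Akc Suc.prems by blast
    have "D (D ((A ^^ k) u)) = \<zero>\<^bsub>T\<^esub>" using Suc.prems(2) by (simp add: A_def[of "(A ^^ k) u"])
    then have *: "D ((A ^^ k) u) = \<zero>\<^bsub>T\<^esub>" by (rule disj[OF x])
    show ?case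
    proof (cases k)
      case 0
      then show ?thesis using * by simp
    next
      case (Suc j)
      have y: "(A ^^ j) u \<in> carrier T" using Akc Suc.prems by blast
      have "D (D (D ((A ^^ j) u))) = \<zero>\<^bsub>T\<^esub>" using * Suc by (simp add: A_def[of "(A ^^ j) u"])
      then have "D (D ((A ^^ j) u)) = \<zero>\<^bsub>T\<^esub>" by (rule disj[OF c[OF y]])
      then have "(A ^^ k) u = \<zero>\<^bsub>T\<^esub>" using Suc by (simp add: A_def[of "(A ^^ j) u"])
      then show ?thesis using Suc.IH Suc.prems by blast
    qed
  qed
  define N where "N = {x \<in> carrier T. \<exists>u\<in>carrier T. \<exists>w\<in>carrier T. D u = \<zero>\<^bsub>T\<^esub> \<and> x = u \<oplus>\<^bsub>T\<^esub> D w}"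
  have NI: "u \<oplus>\<^bsub>T\<^esub> D w \<in> N" if "u \<in> carrier T" "w \<in> carrier T" "D u = \<zero>\<^bsub>T\<^esub>" for u w
    using that T c unfolding N_def by auto
  have N: "csub N T"
  proof (rule csubI[OF T])
    show "N \<subseteq> carrier T" by (auto simp: N_def)
    show "\<zero>\<^bsub>T\<^esub> \<in> N" using NI[of "\<zero>\<^bsub>T\<^esub>" "\<zero>\<^bsub>T\<^esub>"] T lin_map_zero[OF T T D] by simp
  next
    fix x y assume "x \<in> N" "y \<in> N"
    then obtain u w u' w' where *: "u \<in> carrier T" "w \<in> carrier T" "D u = \<zero>\<^bsub>T\<^esub>" "x = u \<oplus>\<^bsub>T\<^esub> D w"
      "u' \<in> carrier T" "w' \<in> carrier T" "D u' = \<zero>\<^bsub>T\<^esub>" "y = u' \<oplus>\<^bsub>T\<^esub> D w'" by (auto simp: N_def)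
    have "x \<oplus>\<^bsub>T\<^esub> y = (u \<oplus>\<^bsub>T\<^esub> u') \<oplus>\<^bsub>T\<^esub> D (w \<oplus>\<^bsub>T\<^esub> w')"
    proof (rule functional_eqI[OF T])
      fix l assume l: "lin_functional T l"
      show "l (x \<oplus>\<^bsub>T\<^esub> y) = l ((u \<oplus>\<^bsub>T\<^esub> u') \<oplus>\<^bsub>T\<^esub> D (w \<oplus>\<^bsub>T\<^esub> w'))"
        using * T by (simp add: lf_add[OF l] c lin_map_add[OF D])
    qed (use * T c in simp_all)
    then show "x \<oplus>\<^bsub>T\<^esub> y \<in> N" using * T NI[of "u \<oplus>\<^bsub>T\<^esub> u'" "w \<oplus>\<^bsub>T\<^esub> w'"] by (simp add: lin_map_add[OF D])
  next
    fix a x assume "x \<in> N"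
    then obtain u w where *: "u \<in> carrier T" "w \<in> carrier T" "D u = \<zero>\<^bsub>T\<^esub>" "x = u \<oplus>\<^bsub>T\<^esub> D w" by (auto simp: N_def)
    then have "a \<odot>\<^bsub>T\<^esub> x = a \<odot>\<^bsub>T\<^esub> u \<oplus>\<^bsub>T\<^esub> D (a \<odot>\<^bsub>T\<^esub> w)" using T c by (simp add: lin_map_smult[OF D] cv_add_smult)
    then show "a \<odot>\<^bsub>T\<^esub> x \<in> N" using * T NI[of "a \<odot>\<^bsub>T\<^esub> u" "a \<odot>\<^bsub>T\<^esub> w"] by (simp add: lin_map_smult[OF D])
  qed
  have Nker: "u \<in> N" if "u \<in> carrier T" "D u = \<zero>\<^bsub>T\<^esub>" for u
    using NI[of u "\<zero>\<^bsub>T\<^esub>"] that T lin_map_zero[OF T T D] by simp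
  have Nim: "D w \<in> N" if "w \<in> carrier T" for w
    using NI[of "\<zero>\<^bsub>T\<^esub>" w] that T lin_map_zero[OF T T D] c by simp
  obtain E where E: "finite E" "E \<subseteq> carrier T" "z \<in> spn T E" "\<forall>y\<in>spn T E. D (D y) \<in> spn T E"
    using fin[OF z] by blast
  have "(A ^^ k) z \<in> spn T E" for k by (induction k) (use E A_def in \<open>auto simp only: funpow.simps o_apply id_apply\<close>)
  from linear_dependence[OF T E(1,2), of "\<lambda>k. (A ^^ k) z", OF this]
  obtain a where a: "\<exists>k\<le>card E. a k \<noteq> 0" "\<And>l. lin_functional T l \<Longrightarrow> (\<Sum>k\<le>card E. a k * l ((A ^^ k) z)) = 0" by blast
  define n where "n = card E"
  \<comment> \<open>The lowest power with nonzero coefficient. The combination \<open>u\<close>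
    below, with all exponents lowered by \<open>j\<close>, satisfies \<open>A^j u = 0\<close> and
    hence lies in the kernel of \<open>D\<close>, while its terms with \<open>k > j\<close> lie in
    the image.\<close>
  define j where "j = (LEAST k. a k \<noteq> 0)"
  have j: "a j \<noteq> 0" "j \<le> n" "\<And>k. k < j \<Longrightarrow> a k = 0"
  proof -
    obtain k where k: "k \<le> card E" "a k \<noteq> 0" using a by blast
    show "a j \<noteq> 0" unfolding j_def by (rule LeastI[of _ k]) (rule k)
    have "j \<le> k" unfolding j_def by (rule Least_le[of _ k]) (rule k)
    then show "j \<le> n" using k by (simp add: n_def)
    show "k < j \<Longrightarrow> a k = 0" for k unfolding j_def using not_less_Least by blast
  qed
  let ?t = "\<lambda>k. a k \<odot>\<^bsub>T\<^esub> (A ^^ (k - j)) z"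
  have tc: "?t \<in> I \<rightarrow> carrier T" for I using T z Akc by auto
  define u where "u = finsum T ?t {j..n}"
  have uc: "u \<in> carrier T" unfolding u_def using tc T by (rule cv_finsum_closed[rotated])
  have lu: "l u = (\<Sum>k\<in>{j..n}. a k * l ((A ^^ (k - j)) z))" if l: "lin_functional T l" for l
    unfolding u_def lf_finsum[OF T l tc] using z Akc by (simp add: lf_smult[OF l])
  have "(A ^^ j) u = \<zero>\<^bsub>T\<^esub>"
  proof (rule functional_eqI[OF T])
    fix l assume l: "lin_functional T l"
    have "l ((A ^^ j) u) = (\<Sum>k\<in>{j..n}. a k * l ((A ^^ j) ((A ^^ (k - j)) z)))"
      by (rule lu[OF lf_comp[OF Ak l]])
    also have "\<dots> = (\<Sum>k\<in>{j..n}. a k * l ((A ^^ k) z))"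
    proof (intro sum.cong refl)
      fix k assume "k \<in> {j..n}"
      then have "(A ^^ j) ((A ^^ (k - j)) z) = (A ^^ k) z" using funpow_add[of j "k - j" A] by (simp add: o_def)
      then show "a k * l ((A ^^ j) ((A ^^ (k - j)) z)) = a k * l ((A ^^ k) z)" by simp
    qed
    also have "\<dots> = (\<Sum>k\<le>n. a k * l ((A ^^ k) z))"
      using j by (intro sum.mono_neutral_left) auto
    also have "\<dots> = 0" using a(2)[OF l] by (simp add: n_def)
    finally show "l ((A ^^ j) u) = l \<zero>\<^bsub>T\<^esub>" using lf_zero[OF T l] by simp
  qed (use T uc Akc in auto)
  then have "u \<in> N" using AkD[OF uc] Nker[OF uc] by blast
  moreover have "finsum T ?t {Suc j..n} \<in> N"
  proof (rule csub_finsum[OF T N], rule funcsetI)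
    fix k assume "k \<in> {Suc j..n}"
    then obtain m where m: "k - j = Suc m" by (metis Suc_diff_le Suc_le_D atLeastAtMost_iff diff_Suc_Suc)
    have "(A ^^ (k - j)) z \<in> N" unfolding m using Nim[OF c[OF Akc[OF z, of m]]] by (simp add: A_def[of "(A ^^ m) z"])
    then show "?t k \<in> N" by (rule csubD(3)[OF N])
  qed
  ultimately have "u \<ominus>\<^bsub>T\<^esub> finsum T ?t {Suc j..n} \<in> N" by (rule csub_diff[OF T N])
  also have "u \<ominus>\<^bsub>T\<^esub> finsum T ?t {Suc j..n} = a j \<odot>\<^bsub>T\<^esub> z"
  proof (rule functional_eqI[OF T])
    fix l assume l: "lin_functional T l"
    have "l (finsum T ?t {Suc j..n}) = (\<Sum>k\<in>{Suc j..n}. a k * l ((A ^^ (k - j)) z))"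
      unfolding lf_finsum[OF T l tc] using z Akc by (simp add: lf_smult[OF l])
    then have "l (u \<ominus>\<^bsub>T\<^esub> finsum T ?t {Suc j..n}) = (\<Sum>k\<in>{j..n}. a k * l ((A ^^ (k - j)) z)) - (\<Sum>k\<in>{Suc j..n}. a k * l ((A ^^ (k - j)) z))"
      using lu[OF l] lf_diff[OF T l uc cv_finsum_closed[OF T tc]] by simp
    also have "\<dots> = a j * l z" using j(2) by (simp add: sum.atLeast_Suc_atMost)
    finally show "l (u \<ominus>\<^bsub>T\<^esub> finsum T ?t {Suc j..n}) = l (a j \<odot>\<^bsub>T\<^esub> z)" using z by (simp add: lf_smult[OF l])
  qed (use T uc z cv_finsum_closed[OF T tc] in auto)
  finally have "(1 / a j) \<odot>\<^bsub>T\<^esub> (a j \<odot>\<^bsub>T\<^esub> z) \<in> N" by (rule csubD(3)[OF N])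
  then have "z \<in> N" using j(1) z T by (simp add: cv_smult_smult)
  then show "\<exists>u\<in>carrier T. \<exists>w\<in>carrier T. D u = \<zero>\<^bsub>T\<^esub> \<and> z = u \<oplus>\<^bsub>T\<^esub> D w" by (auto simp: N_def)
qed (fact T D)+

lemma herm_minus:
  assumes "cvspace T" "herm T H" "u \<in> carrier T" "v \<in> carrier T"
  shows "H (\<ominus>\<^bsub>T\<^esub> u) (\<ominus>\<^bsub>T\<^esub> v) = H u v"
proof -
  have m: "H (\<ominus>\<^bsub>T\<^esub> a) b = - H a b" if "a \<in> carrier T" "b \<in> carrier T" for a b
    using lf_minus[OF assms(1) hermD(1)[OF assms(2) that(2)] that(1)] .
  have n: "H b (\<ominus>\<^bsub>T\<^esub> a) = - H b a" if "a \<in> carrier T" "b \<in> carrier T" for a b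
    using hermD(2)[OF assms(2), of b "\<ominus>\<^bsub>T\<^esub> a"] hermD(2)[OF assms(2), of b a] m that assms(1) by simp
  show ?thesis using m n assms by simp
qed

lemma two_sided_ideal_csub: "R \<subseteq> carrier (free_space (words X)) \<Longrightarrow> csub (two_sided_ideal X R) (free_space (words X))"
  unfolding two_sided_ideal_def
proof (rule csub_span)
  assume R: "R \<subseteq> carrier (free_space (words X))"
  have "Poly_Mapping.keys r \<subseteq> words X" if "r \<in> R" for r using that R by auto
  then show "{p * r * q |p r q. r \<in> R \<and> p \<in> carrier (free_space (words X)) \<and> q \<in> carrier (free_space (words X))} \<subseteq> carrier (free_space (words X))"
    by (intro subsetI, elim CollectE exE conjE) (simp add: keys_mult_words)
qed

text \<open>Turns stability under the generators into stability under the whole algebra, the form in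
  which \<open>spin_module\<close> expresses simplicity.\<close>

lemma alg_act_invariant:
  assumes R: "R \<subseteq> carrier (free_space (words X))" and M: "cvspace M" and N: "csub N M"
    and inv: "\<And>x n. x \<in> X \<Longrightarrow> n \<in> N \<Longrightarrow> \<rho> x n \<in> N"
    and c: "c \<in> carrier (presented_algebra X R)" and n: "n \<in> N"
  shows "alg_act M \<rho> c n \<in> N"
proof -
  note fs = cvspace_free_space two_sided_ideal_csub[OF R]
  obtain p where p: "p \<in> carrier (free_space (words X))" "c = two_sided_ideal X R +>\<^bsub>free_space (words X)\<^esub> p"
    using c unfolding presented_algebra_def carrier_quot_space[OF fs] by blast
  define q where "q = (SOME p. p \<in> c)"
  have "q \<in> c" unfolding q_def by (rule someI[of _ p]) (simp only: p(2) coset_self[OF fs p(1)])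
  then have q: "Poly_Mapping.keys q \<subseteq> words X"
    using coset_closed[OF fs p(1)] unfolding p(2) by fastforce
  have f: "foldr \<rho> w n \<in> N" if "set w \<subseteq> X" for w
    using that by (induction w) (simp_all add: n inv)
  show ?thesis
    unfolding alg_act_def Let_def q_def[symmetric]
  proof (rule csub_finsum[OF M N], rule funcsetI)
    fix w assume "w \<in> Poly_Mapping.keys q"
    then have "set (letters w) \<subseteq> X" using q by (auto simp: words_def)
    from csubD(3)[OF N f[OF this]] show "Poly_Mapping.lookup q w \<odot>\<^bsub>M\<^esub> foldr \<rho> (letters w) n \<in> N" .
  qed
qed

text \<open>What the Hodge decomposition uses of a unitary irreducible module: the form
  \<open>h\<close>, skewness of the real Lie algebra, \<kk>-finiteness, and the Casimir eigenvalue
  \<open>c0\<close>, valid in every orthonormal basis of the complexified algebra.\<close>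

locale unitary_pair = symmetric_pair +
  fixes h and c0 :: complex
  assumes spin: "spin_module br pp S \<gamma>"
    and h: "herm V h"
    and skew: "\<And>X u v. u \<in> carrier V \<Longrightarrow> v \<in> carrier V \<Longrightarrow> h (\<pi> (X, 0) u) v = - h u (\<pi> (X, 0) v)"
    and kfin: "\<And>v. v \<in> carrier V \<Longrightarrow> \<exists>E. finite E \<and> E \<subseteq> carrier V \<and> v \<in> spn V E \<and> (\<forall>x\<in>kk. \<forall>a\<in>spn V E. \<pi> x a \<in> spn V E)"
    and casimir: "\<And>l v es. lin_functional V l \<Longrightarrow> v \<in> carrier V \<Longrightarrow> orthonormal_basis br UNIV es \<Longrightarrow>
      (\<Sum>i<length es. l (\<pi> (es ! i) (\<pi> (es ! i) v))) = c0 * l v"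
begin

text \<open>Orthonormal lists in \<pp> without the spanning condition, so that an induction over the
  list stays inside the notion.\<close>

definition onl where "onl us \<longleftrightarrow> set us \<subseteq> pp \<and> distinct us \<and> (\<forall>a\<in>set us. \<forall>b\<in>set us. B a b = (if a = b then 1 else 0))"

lemma onl_basis: "orthonormal_basis br pp es \<Longrightarrow> onl es"
proof -
  assume e: "orthonormal_basis br pp es"
  have d: "distinct es" unfolding distinct_conv_nth
  proof (intro allI impI notI)
    fix i j assume "i < length es" "j < length es" "i \<noteq> j" "es ! i = es ! j"
    then show False using onb_B[OF e, of i i] onb_B[OF e, of i j] by simp
  qed
  have "B a b = (if a = b then 1 else 0)" if ab: "a \<in> set es" "b \<in> set es" for a b
  proof -
    obtain i j where "i < length es" "a = es ! i" "j < length es" "b = es ! j" using ab by (metis in_set_conv_nth)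
    then show ?thesis using onb_B[OF e] nth_eq_iff_index_eq[OF d] by simp
  qed
  then show ?thesis using d onb_in(1)[OF e] unfolding onl_def by blast
qed

lemma \<gamma>_square: "a \<in> pp \<Longrightarrow> B a a = 1 \<Longrightarrow> s \<in> carrier S \<Longrightarrow> \<gamma> a (\<gamma> a s) = s"
proof (rule functional_eqI[OF cvS])
  fix l assume *: "a \<in> pp" "B a a = 1" "s \<in> carrier S" and l: "lin_functional S l"
  have "2 * l (\<gamma> a (\<gamma> a s)) = 2 * l s" using anticommute[OF l *(1) *(1) *(3)] *(2) by simp
  then show "l (\<gamma> a (\<gamma> a s)) = l s" by simp
qed (simp_all add: \<gamma>_closed)

lemma \<gamma>_swap: "a \<in> pp \<Longrightarrow> b \<in> pp \<Longrightarrow> B a b = 0 \<Longrightarrow> s \<in> carrier S \<Longrightarrow> \<gamma> a (\<gamma> b s) = \<ominus>\<^bsub>S\<^esub> \<gamma> b (\<gamma> a s)"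
proof (rule functional_eqI[OF cvS])
  fix l assume *: "a \<in> pp" "b \<in> pp" "B a b = 0" "s \<in> carrier S" and l: "lin_functional S l"
  show "l (\<gamma> a (\<gamma> b s)) = l (\<ominus>\<^bsub>S\<^esub> \<gamma> b (\<gamma> a s))"
    using anticommute[OF l *(1,2,4)] *(3) lf_minus[OF cvS l \<gamma>_closed[OF *(2) \<gamma>_closed[OF *(1,4)]]] by simp
qed (simp_all add: \<gamma>_closed cvS)

text \<open>All products of sublists of the generators applied to \<open>s\<close>: at most
  \<open>2^n\<close> vectors. For a basis of \<pp> they span the Clifford submodule generated by
  \<open>s\<close>.\<close>

fun gset where
  "gset s [] = {s}"
| "gset s (a # us) = gset s us \<union> \<gamma> a ` gset s us"

lemma gset_finite: "finite (gset s us)"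
  by (induction us) auto

lemma gset_closed: "s \<in> carrier S \<Longrightarrow> set us \<subseteq> pp \<Longrightarrow> gset s us \<subseteq> carrier S"
  by (induction us) (auto simp: \<gamma>_closed)

lemma gset_base: "s \<in> gset s us"
  by (induction us) auto

text \<open>A generator is moved to its place in the ordered product. If it equals the leading one,
  it is either prefixed or cancels, since its square is \<open>1\<close>; otherwise it passes the
  leading one with a minus sign and the induction hypothesis takes over.\<close>

lemma gset_invariant:
  assumes s: "s \<in> carrier S"
  shows "onl us \<Longrightarrow> w \<in> set us \<Longrightarrow> x \<in> spn S (gset s us) \<Longrightarrow> \<gamma> w x \<in> spn S (gset s us)"
proof (induction us arbitrary: w x)
  case Nil
  then show ?case by simp
next
  case (Cons a us)
  let ?Y = "spn S (gset s (a # us))"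
  have a: "a \<in> pp" "set us \<subseteq> pp" "onl us" "B a a = 1" and wp: "w \<in> pp" using Cons.prems by (auto simp: onl_def)
  have c0: "gset s us \<subseteq> carrier S" by (rule gset_closed[OF s a(2)])
  have c1: "gset s (a # us) \<subseteq> carrier S" using gset_closed[OF s, of "a # us"] a by simp
  note Y = spn_csub[OF cvS c1] and base = spn_base[OF cvS c1]
  have mono: "spn S (gset s us) \<subseteq> ?Y" by (rule spn_mono[OF cvS c1]) simp
  have \<gamma>a: "\<gamma> a y \<in> ?Y" if "y \<in> spn S (gset s us)" for y
    by (rule spn_image[OF cvS cvS \<gamma>_lin[OF a(1)] c0 Y _ that]) (rule base, simp)
  show ?case
  proof (rule spn_image[OF cvS cvS \<gamma>_lin[OF wp] c1 Y _ Cons.prems(3)])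
    fix e assume e: "e \<in> gset s (a # us)"
    show "\<gamma> w e \<in> ?Y"
    proof (cases "w = a")
      case True
      from e consider "e \<in> gset s us" | e' where "e' \<in> gset s us" "e = \<gamma> a e'" by auto
      then show ?thesis
      proof cases
        case 1
        then show ?thesis using True by (intro base) simp
      next
        case 2
        have "e' \<in> carrier S" using 2 c0 by blast
        then have "\<gamma> w e = e'" using 2 True \<gamma>_square[OF a(1,4)] by simp
        then show ?thesis using 2 by (intro base[of "\<gamma> w e"]) simp
      qed
    next
      case False
      then have w: "w \<in> set us" "B w a = 0" using Cons.prems by (auto simp: onl_def)
      from e consider "e \<in> gset s us" | e' where "e' \<in> gset s us" "e = \<gamma> a e'" by auto
      then show ?thesis
      proof cases
        case 1
        then show ?thesis using Cons.IH[OF a(3) w(1) spn_base[OF cvS c0]] mono by blast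
      next
        case 2
        have e': "e' \<in> carrier S" using 2 c0 by blast
        have "\<gamma> a (\<gamma> w e') \<in> ?Y" using \<gamma>a[OF Cons.IH[OF a(3) w(1) spn_base[OF cvS c0 2(1)]]] .
        then have "(- 1) \<odot>\<^bsub>S\<^esub> \<gamma> a (\<gamma> w e') \<in> ?Y" by (rule csubD(3)[OF Y])
        then show ?thesis unfolding 2(2) \<gamma>_swap[OF wp a(1) w(2) e'] using cv_minus_eq[OF cvS] \<gamma>_closed a(1) wp e' by simp
      qed
    qed
  qed
qed

text \<open>A simple Clifford module is generated by any nonzero vector, and the submodule generated
  by it is the finite-dimensional span of \<open>gset\<close>.\<close>

lemma spin_finite: "\<exists>E. finite E \<and> E \<subseteq> carrier S \<and> spn S E = carrier S"
proof -
  have "\<zero>\<^bsub>S\<^esub> \<in> carrier S" using cvS by simp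
  moreover have ne: "carrier S \<noteq> {\<zero>\<^bsub>S\<^esub>}" using spin by (simp add: spin_module_def)
  ultimately obtain s where s: "s \<in> carrier S" "s \<noteq> \<zero>\<^bsub>S\<^esub>" by blast
  let ?E = "gset s ws"
  have on: "onl ws" by (rule onl_basis[OF onbp])
  have E: "?E \<subseteq> carrier S" using gset_closed[OF s(1)] on by (simp add: onl_def)
  note N = spn_csub[OF cvS E]
  have inv: "\<gamma> x n \<in> spn S ?E" if x: "x \<in> pp" and n: "n \<in> spn S ?E" for x n
  proof (rule csub_by_functionals[OF cvS N])
    have n': "n \<in> carrier S" using n csubD(1)[OF N] by blast
    show "\<gamma> x n \<in> carrier S" by (rule \<gamma>_closed[OF x n'])
    fix l assume l: "lin_functional S l" and z: "\<And>n. n \<in> spn S ?E \<Longrightarrow> l n = 0"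
    have "l (\<gamma> x n) = (\<Sum>i<length ws. B x (ws ! i) * l (\<gamma> (ws ! i) n))"
      by (rule clin_expand[OF onbp clin_\<gamma>[OF l n'] x])
    also have "\<dots> = 0" using gset_invariant[OF s(1) on _ n] z by (intro sum.neutral) simp
    finally show "l (\<gamma> x n) = 0" .
  qed
  have "alg_act S \<gamma> c n \<in> spn S ?E" if "c \<in> carrier (Cl_alg br pp)" "n \<in> spn S ?E" for c n
    using that by (intro alg_act_invariant[OF Cl_relations_closed[OF pp_subspace gen_act, of br] cvS N]) (auto simp: inv)
  then have "spn S ?E = {\<zero>\<^bsub>S\<^esub>} \<or> spn S ?E = carrier S"
    using spin N unfolding spin_module_def by blast
  moreover have "s \<in> spn S ?E" by (rule spn_base[OF cvS E gset_base])
  ultimately have "spn S ?E = carrier S" using s by blast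
  with E gset_finite show ?thesis by blast
qed

section \<open>A positive definite form on \<open>V \<otimes> S\<close> adapted to \<pp>\<close>

definition PX where "PX X = tensor_map V S V S (\<pi> (X, 0)) id"
definition gm where "gm a = tensor_map V S V S id (\<gamma> a)"

lemma PX_lin: "lin_map T1 T1 (PX X)"
  unfolding PX_def by (rule tensor_map_linear[OF cvV cvS cvV cvS \<pi>_lin lin_map_id(1)])

lemma PX_tens: "v \<in> carrier V \<Longrightarrow> s \<in> carrier S \<Longrightarrow> PX X (tn v s) = tn (\<pi> (X, 0) v) s"
  unfolding PX_def by (subst tensor_map_tens[OF cvV cvS cvV cvS \<pi>_lin lin_map_id(1)]) auto

lemma gm_lin: "a \<in> pp \<Longrightarrow> lin_map T1 T1 (gm a)"
  unfolding gm_def by (rule tensor_map_linear[OF cvV cvS cvV cvS lin_map_id(1) \<gamma>_lin])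

lemma gm_tens: "a \<in> pp \<Longrightarrow> v \<in> carrier V \<Longrightarrow> s \<in> carrier S \<Longrightarrow> gm a (tn v s) = tn v (\<gamma> a s)"
  unfolding gm_def by (subst tensor_map_tens[OF cvV cvS cvV cvS lin_map_id(1) \<gamma>_lin]) auto

lemmas PXc = lin_map_closed[OF PX_lin] and gmc = lin_map_closed[OF gm_lin]

lemma gm_square: "a \<in> pp \<Longrightarrow> B a a = 1 \<Longrightarrow> t \<in> carrier T1 \<Longrightarrow> gm a (gm a t) = t"
  by (rule tensor_ext[OF cvV cvS T1 lin_map_comp[OF gm_lin gm_lin] lin_map_id(2)])
    (auto simp: gm_tens \<gamma>_closed \<gamma>_square)

lemma gm_PX: "a \<in> pp \<Longrightarrow> t \<in> carrier T1 \<Longrightarrow> gm a (PX X t) = PX X (gm a t)"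
  by (rule tensor_ext[OF cvV cvS T1 lin_map_comp[OF PX_lin gm_lin] lin_map_comp[OF gm_lin PX_lin]])
    (auto simp: gm_tens PX_tens \<gamma>_closed \<pi>_closed)

lemma gm_swap:
  assumes "a \<in> pp" "b \<in> pp" "B a b = 0" "t \<in> carrier T1"
  shows "gm a (gm b t) = \<ominus>\<^bsub>T1\<^esub> gm b (gm a t)"
proof (rule functional_eqI[OF T1])
  fix l assume l: "lin_functional T1 l"
  have "l (gm a (gm b t)) = (- 1) * l (gm b (gm a t))"
  proof (rule tensor_lf_ext[OF cvV cvS lf_comp[OF gm_lin[OF assms(2)] lf_comp[OF gm_lin[OF assms(1)] l]]
        lf_cmult_intro[OF lf_comp[OF gm_lin[OF assms(1)] lf_comp[OF gm_lin[OF assms(2)] l]]] _ assms(4)])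
    fix v s assume v: "v \<in> carrier V" and s: "s \<in> carrier S"
    show "l (gm a (gm b (tn v s))) = (- 1) * l (gm b (gm a (tn v s)))"
      using v s assms lf_minus[OF cvS tlf(2)[OF l v], of "\<gamma> b (\<gamma> a s)"] \<gamma>_swap[OF assms(1-3) s] by (simp add: gm_tens \<gamma>_closed)
  qed
  then show "l (gm a (gm b t)) = l (\<ominus>\<^bsub>T1\<^esub> gm b (gm a t))" using assms by (simp add: lf_minus[OF T1 l] gmc)
qed (use assms T1 gmc in simp_all)

text \<open>\<open>c e\<close> contracts the spin factor with the dual functional of
  \<open>e\<close>, so a tensor \<open>z\<close> equals \<open>\<Sum> c e z \<otimes> e\<close>.
  Adding up \<open>h\<close> over these coefficients treats the tensor product as an orthogonal sum
  of copies of \<open>V\<close>; the form is definite because vanishing coefficients force the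
  tensor to vanish.\<close>

lemma exists_herm0: "\<exists>H. herm T1 H \<and> (\<forall>X. \<forall>u\<in>carrier T1. \<forall>v\<in>carrier T1. H (PX X u) v = - H u (PX X v))"
proof -
  obtain E0 where E0: "finite E0" "E0 \<subseteq> carrier S" "spn S E0 = carrier S" using spin_finite by blast
  obtain E f where E: "finite E" "E \<subseteq> carrier S" and f': "\<forall>e\<in>E. lin_functional S (f e)"
    and dual': "\<forall>s\<in>carrier S. \<forall>l. lin_functional S l \<longrightarrow> l s = (\<Sum>e\<in>E. f e s * l e)"
    using finite_dual_basis[OF cvS E0] by (elim exE conjE) (rule that)
  note f = bspec[OF f'] and dual = dual'[rule_format]
  define c where "c e = tlift V (\<lambda>v s. f e s \<odot>\<^bsub>V\<^esub> v)" for e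
  have bl: "bilin V S V (\<lambda>v s. f e s \<odot>\<^bsub>V\<^esub> v)" if e: "e \<in> E" for e
  proof (rule bilinI[OF cvV cvS cvV])
    show "f e s \<odot>\<^bsub>V\<^esub> v \<in> carrier V" if "v \<in> carrier V" for v s using that cvV by simp
    fix l assume l: "lin_functional V l"
    fix v s assume v: "v \<in> carrier V" and s: "s \<in> carrier S"
    note ls = lf_smult[OF l] lf_add[OF l] lf_add[OF f[OF e]] lf_smult[OF f[OF e]]
    show "l (f e s \<odot>\<^bsub>V\<^esub> (c \<odot>\<^bsub>V\<^esub> v)) = c * l (f e s \<odot>\<^bsub>V\<^esub> v)" "l (f e (c \<odot>\<^bsub>S\<^esub> s) \<odot>\<^bsub>V\<^esub> v) = c * l (f e s \<odot>\<^bsub>V\<^esub> v)" for c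
      using v s cvV by (simp_all add: ls)
    show "l (f e (s \<oplus>\<^bsub>S\<^esub> s') \<odot>\<^bsub>V\<^esub> v) = l (f e s \<odot>\<^bsub>V\<^esub> v) + l (f e s' \<odot>\<^bsub>V\<^esub> v)" if "s' \<in> carrier S" for s'
      using v s that cvV by (simp add: ls algebra_simps)
  next
    fix l assume l: "lin_functional V l"
    fix v v' s assume "v \<in> carrier V" "v' \<in> carrier V" "s \<in> carrier S"
    then show "l (f e s \<odot>\<^bsub>V\<^esub> (v \<oplus>\<^bsub>V\<^esub> v')) = l (f e s \<odot>\<^bsub>V\<^esub> v) + l (f e s \<odot>\<^bsub>V\<^esub> v')"
      using cvV by (simp add: lf_smult[OF l] lf_add[OF l] algebra_simps)
  qed
  note cl = tlift_linear[OF cvV cvS cvV bl, folded c_def] and ct = tlift_tens[OF cvV cvS cvV bl, folded c_def]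
  note cc = lin_map_closed[OF cl]
  define H where "H z z' = (\<Sum>e\<in>E. h (c e z) (c e z'))" for z z'
  have "herm T1 H"
    unfolding herm_def
  proof (intro conjI ballI impI)
    fix v assume v: "v \<in> carrier T1"
    show "lin_functional T1 (\<lambda>u. H u v)" unfolding H_def
      by (intro lf_sum_intro lf_comp[OF cl] hermD(1)[OF h] cc v)
    show "H u v = cnj (H v u)" if "u \<in> carrier T1" for u
      unfolding H_def cnj_sum by (intro sum.cong refl hermD(2)[OF h] cc v that)
    show "Re (H v v) > 0" if "v \<noteq> \<zero>\<^bsub>T1\<^esub>"
    proof -
      have "\<exists>e\<in>E. c e v \<noteq> \<zero>\<^bsub>V\<^esub>"
      proof (rule ccontr)
        assume "\<not> (\<exists>e\<in>E. c e v \<noteq> \<zero>\<^bsub>V\<^esub>)"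
        then have z: "c e v = \<zero>\<^bsub>V\<^esub>" if "e \<in> E" for e using that by blast
        have "v = \<zero>\<^bsub>T1\<^esub>"
        proof (rule functional_eqI[OF T1 v])
          fix l assume l: "lin_functional T1 l"
          have Ec: "e \<in> carrier S" if "e \<in> E" for e using that E by blast
          have lf: "lin_functional T1 (\<lambda>z. \<Sum>e\<in>E. l (tn (c e z) e))"
            by (intro lf_sum_intro lf_comp[OF cl tlf(1)[OF l]] Ec)
          have "l v = (\<Sum>e\<in>E. l (tn (c e v) e))"
          proof (rule tensor_lf_ext[OF cvV cvS l lf _ v])
            fix w s assume w: "w \<in> carrier V" and s: "s \<in> carrier S"
            have "l (tn w s) = (\<Sum>e\<in>E. f e s * l (tn w e))" by (rule dual[OF s tlf(2)[OF l w]])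
            also have "\<dots> = (\<Sum>e\<in>E. l (tn (c e (tn w s)) e))"
              using w s Ec by (intro sum.cong refl) (simp add: ct lf_smult[OF tlf(1)[OF l]])
            finally show "l (tn w s) = (\<Sum>e\<in>E. l (tn (c e (tn w s)) e))" .
          qed
          also have "\<dots> = 0" using z lf_zero[OF cvV tlf(1)[OF l Ec]] by simp
          finally show "l v = l \<zero>\<^bsub>T1\<^esub>" using lf_zero[OF T1 l] by simp
        qed (use T1 in simp)
        then show False using that by blast
      qed
      then obtain e where e: "e \<in> E" "c e v \<noteq> \<zero>\<^bsub>V\<^esub>" by blast
      have "Re (H v v) = (\<Sum>e\<in>E. Re (h (c e v) (c e v)))" by (simp add: H_def)
      also have "\<dots> > 0"
        using e hermD(3)[OF h cc[OF e(1) v] e(2)] herm_nonneg[OF cvV h cc[OF _ v]]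
        by (intro sum_pos2[OF E(1) e(1)]) auto
      finally show ?thesis .
    qed
  qed
  moreover have "H (PX X u) v = - H u (PX X v)" if u: "u \<in> carrier T1" and v: "v \<in> carrier T1" for X u v
  proof -
    have cP: "c e (PX X t) = \<pi> (X, 0) (c e t)" if e: "e \<in> E" and t: "t \<in> carrier T1" for e t
      by (rule tensor_ext[OF cvV cvS cvV lin_map_comp[OF PX_lin cl[OF e]] lin_map_comp[OF cl[OF e] \<pi>_lin] _ t])
        (simp add: PX_tens ct[OF e] \<pi>_closed lin_map_smult[OF \<pi>_lin])
    show ?thesis unfolding H_def sum_negf[symmetric]
      by (intro sum.cong refl) (simp add: cP u v skew cc)
  qed
  ultimately show ?thesis by blast
qed

text \<open>Averaging over the finite group generated by the operators \<open>gm a\<close>, one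
  generator at a time. The averaged form is invariant under \<open>gm a\<close>, whose square is
  \<open>1\<close>, and stays invariant under the other generators, which commute with
  \<open>gm a\<close> up to a sign that a Hermitian form does not see.\<close>

lemma exists_herm:
  "onl us \<Longrightarrow> \<exists>H. herm T1 H \<and> (\<forall>X. \<forall>u\<in>carrier T1. \<forall>v\<in>carrier T1. H (PX X u) v = - H u (PX X v)) \<and>
     (\<forall>a\<in>set us. \<forall>u\<in>carrier T1. \<forall>v\<in>carrier T1. H (gm a u) (gm a v) = H u v)"
proof (induction us)
  case Nil
  then show ?case using exists_herm0 by simp
next
  case (Cons a us)
  then have a: "onl us" "a \<in> pp" "B a a = 1" "set us \<subseteq> pp" and ab: "\<And>b. b \<in> set us \<Longrightarrow> B a b = 0" by (auto simp: onl_def)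
  obtain H where H: "herm T1 H" and P: "\<And>X u v. u \<in> carrier T1 \<Longrightarrow> v \<in> carrier T1 \<Longrightarrow> H (PX X u) v = - H u (PX X v)"
    and G: "\<And>b u v. b \<in> set us \<Longrightarrow> u \<in> carrier T1 \<Longrightarrow> v \<in> carrier T1 \<Longrightarrow> H (gm b u) (gm b v) = H u v"
    using Cons.IH[OF a(1)] by blast
  let ?H = "\<lambda>u v. H u v + H (gm a u) (gm a v)"
  have "herm T1 ?H" by (rule herm_average[OF T1 H gm_lin[OF a(2)]])
  moreover have "?H (PX X u) v = - ?H u (PX X v)" if "u \<in> carrier T1" "v \<in> carrier T1" for X u v
    using that a by (simp add: P gm_PX gmc)
  moreover have "?H (gm b u) (gm b v) = ?H u v" if b: "b \<in> set (a # us)" and u: "u \<in> carrier T1" and v: "v \<in> carrier T1" for b u v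
  proof (cases "b = a")
    case True
    then show ?thesis using a u v by (simp add: gm_square)
  next
    case False
    then have b': "b \<in> set us" "b \<in> pp" using b a by auto
    show ?thesis
      using b' a u v by (simp add: G gm_swap[OF a(2) b'(2) ab[OF b'(1)]] herm_minus[OF T1 H] gmc)
  qed
  ultimately show ?case by (intro exI[of _ ?H] conjI) blast+
qed

text \<open>The part symmetric in the two indices collapses by the Clifford relation, where basis
  vectors have square \<open>1\<close>, to the \<pp>-part of the Casimir element, that is, to
  \<open>c0\<close> minus the \<kk>-part. The antisymmetric part involves only
  \<open>[\<pp>, \<pp>]\<close>. So, up to a scalar, only \<kk> acts on \<open>V\<close>, and that
  is enough for local finiteness.\<close>

lemma D1_D1:
  assumes l: "lin_functional T1 l" and v: "v \<in> carrier V" and s: "s \<in> carrier S"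
    and zs: "orthonormal_basis br pp zs" and ys: "orthonormal_basis br kk ys"
  shows "l (D1 (D1 (tn v s))) = c0 * l (tn v s) - (\<Sum>i<length ys. l (tn (\<pi> (ys ! i) (\<pi> (ys ! i) v)) s)) +
    1/2 * (\<Sum>i<length zs. \<Sum>j<length zs. l (tn (\<pi> (cb (zs ! j) (zs ! i)) v) (\<gamma> (zs ! j) (\<gamma> (zs ! i) s))))"
proof -
  note zin = onb_in(2)[OF zs]
  let ?P = "\<lambda>i. \<pi> (zs ! i)" and ?G = "\<lambda>i. \<gamma> (zs ! i)"
  let ?f = "\<lambda>i j. l (tn (?P j (?P i v)) (?G j (?G i s)))"
  have D: "l (D1 (D1 (tn v s))) = (\<Sum>i<length zs. \<Sum>j<length zs. ?f i j)"
    using v s zin by (simp add: D1_tens[OF lf_comp[OF D1_lin l] v s zs] D1_tens[OF l _ _ zs] \<pi>_closed \<gamma>_closed)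
  have "?f i j + ?f j i = l (tn (\<pi> (cb (zs ! j) (zs ! i)) v) (?G j (?G i s))) + (if i = j then 2 * l (tn (?P i (?P i v)) s) else 0)"
    if i: "i < length zs" and j: "j < length zs" for i j
  proof -
    have m: "?P i (?P j v) \<in> carrier V" using v by (simp add: \<pi>_closed)
    have a: "?f j i = 2 * B (zs ! i) (zs ! j) * l (tn (?P i (?P j v)) s) - l (tn (?P i (?P j v)) (?G j (?G i s)))"
      by (rule anticommute[OF tlf(2)[OF l m] zin[OF i] zin[OF j] s])
    have b: "l (tn (\<pi> (cb (zs ! j) (zs ! i)) v) (?G j (?G i s))) = ?f i j - l (tn (?P i (?P j v)) (?G j (?G i s)))"
      using lf_\<pi>_bracket[OF tlf(1)[OF l \<gamma>_closed[OF zin[OF j] \<gamma>_closed[OF zin[OF i] s]]] v] .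
    show ?thesis using a b onb_B[OF zs i j] by auto
  qed
  then have "(\<Sum>i<length zs. \<Sum>j<length zs. ?f i j + ?f j i) =
    (\<Sum>i<length zs. \<Sum>j<length zs. l (tn (\<pi> (cb (zs ! j) (zs ! i)) v) (?G j (?G i s))) + (if i = j then 2 * l (tn (?P i (?P i v)) s) else 0))"
    by (intro sum.cong) auto
  also have "\<dots> = (\<Sum>i<length zs. \<Sum>j<length zs. l (tn (\<pi> (cb (zs ! j) (zs ! i)) v) (?G j (?G i s)))) + 2 * (\<Sum>i<length zs. l (tn (?P i (?P i v)) s))"
    by (simp add: sum.distrib sum_distrib_left)
  also have "(\<Sum>i<length zs. \<Sum>j<length zs. ?f i j + ?f j i) = 2 * (\<Sum>i<length zs. \<Sum>j<length zs. ?f i j)"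
    by (simp add: sum.distrib sum.swap[of "\<lambda>i j. ?f j i"])
  also have "(\<Sum>i<length zs. l (tn (?P i (?P i v)) s)) = c0 * l (tn v s) - (\<Sum>i<length ys. l (tn (\<pi> (ys ! i) (\<pi> (ys ! i) v)) s))"
  proof -
    have "{x + y | x y. x \<in> pp \<and> y \<in> kk} = UNIV"
      using decompose ppart_in kpart_in by blast
    then have "orthonormal_basis br UNIV (zs @ ys)" using onb_append[OF zs ys] by simp
    from casimir[OF tlf(1)[OF l s] v this]
    show ?thesis unfolding sum_append[of "\<lambda>x. l (tn (\<pi> x (\<pi> x v)) s)"] by (simp add: eq_diff_eq)
  qed
  finally show ?thesis unfolding D by (simp add: field_simps)
qed

text \<open>For a pure tensor the stable space is a finite-dimensional \<kk>-stable subspace of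
  \<open>V\<close> tensored with the whole spin module, which is finite-dimensional. Sums are
  handled by uniting the spanning sets.\<close>

lemma D1_locally_finite:
  assumes "z \<in> carrier T1"
  shows "\<exists>E. finite E \<and> E \<subseteq> carrier T1 \<and> z \<in> spn T1 E \<and> (\<forall>y\<in>spn T1 E. D1 (D1 y) \<in> spn T1 E)"
proof -
  define LF where "LF = {z \<in> carrier T1. \<exists>E. finite E \<and> E \<subseteq> carrier T1 \<and> z \<in> spn T1 E \<and> (\<forall>y\<in>spn T1 E. D1 (D1 y) \<in> spn T1 E)}"
  have DD: "lin_map T1 T1 (\<lambda>y. D1 (D1 y))" by (rule lin_map_comp[OF D1_lin D1_lin])
  have LFI: "z \<in> LF" if "finite E" "E \<subseteq> carrier T1" "z \<in> spn T1 E" "\<And>e. e \<in> E \<Longrightarrow> D1 (D1 e) \<in> spn T1 E" for z E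
  proof -
    have "\<forall>y\<in>spn T1 E. D1 (D1 y) \<in> spn T1 E"
      using spn_image[OF T1 T1 DD that(2) spn_csub[OF T1 that(2)] that(4)] by blast
    moreover have "z \<in> carrier T1" using that(3) csubD(1)[OF spn_csub[OF T1 that(2)]] by blast
    ultimately show ?thesis using that unfolding LF_def by blast
  qed
  have "csub LF T1"
  proof (rule csubI[OF T1])
    show "LF \<subseteq> carrier T1" by (auto simp: LF_def)
    show "\<zero>\<^bsub>T1\<^esub> \<in> LF" by (rule LFI[of "{}"]) (use csubD(4)[OF spn_csub[OF T1, of "{}"]] in auto)
  next
    fix x y assume "x \<in> LF" "y \<in> LF"
    then obtain E F where E: "finite E" "E \<subseteq> carrier T1" "x \<in> spn T1 E" "\<forall>y\<in>spn T1 E. D1 (D1 y) \<in> spn T1 E"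
      and F: "finite F" "F \<subseteq> carrier T1" "y \<in> spn T1 F" "\<forall>y\<in>spn T1 F. D1 (D1 y) \<in> spn T1 F" unfolding LF_def by blast
    have EF: "E \<union> F \<subseteq> carrier T1" using E F by blast
    have m: "spn T1 E \<subseteq> spn T1 (E \<union> F)" "spn T1 F \<subseteq> spn T1 (E \<union> F)" by (rule spn_mono[OF T1 EF]; blast)+
    show "x \<oplus>\<^bsub>T1\<^esub> y \<in> LF"
    proof (rule LFI[OF _ EF])
      show "x \<oplus>\<^bsub>T1\<^esub> y \<in> spn T1 (E \<union> F)" using E F m by (intro csubD(2)[OF spn_csub[OF T1 EF]]) blast+
      show "D1 (D1 e) \<in> spn T1 (E \<union> F)" if "e \<in> E \<union> F" for e
        using that E(4) F(4) m spn_base[OF T1 E(2)] spn_base[OF T1 F(2)] by blast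
    qed (use E F in auto)
  next
    fix a x assume "x \<in> LF"
    then obtain E where E: "finite E" "E \<subseteq> carrier T1" "x \<in> spn T1 E" "\<forall>y\<in>spn T1 E. D1 (D1 y) \<in> spn T1 E" unfolding LF_def by blast
    show "a \<odot>\<^bsub>T1\<^esub> x \<in> LF"
      by (rule LFI[OF E(1,2) csubD(3)[OF spn_csub[OF T1 E(2)] E(3)]]) (use E(4) spn_base[OF T1 E(2)] in blast)
  qed
  moreover have "tn v s \<in> LF" if v: "v \<in> carrier V" and s: "s \<in> carrier S" for v s
  proof -
    obtain E where E: "finite E" "E \<subseteq> carrier V" "v \<in> spn V E" "\<forall>x\<in>kk. \<forall>a\<in>spn V E. \<pi> x a \<in> spn V E" using kfin[OF v] by blast
    obtain F where F: "finite F" "F \<subseteq> carrier S" "spn S F = carrier S" using spin_finite by blast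
    obtain zs ys where zy: "orthonormal_basis br pp zs" "orthonormal_basis br kk ys"
      using exists_pp_basis exists_kk_basis by blast
    let ?Y = "(\<lambda>(a, e). tn a e) ` (E \<times> F)"
    have Y: "?Y \<subseteq> carrier T1" using E(2) F(2) by (auto intro!: tnc)
    note Yc = spn_csub[OF T1 Y]
    have Ec: "spn V E \<subseteq> carrier V" by (rule csubD(1)[OF spn_csub[OF cvV E(2)]])
    have van: "l (tn a e) = 0" if l: "lin_functional T1 l" and z: "\<And>n. n \<in> spn T1 ?Y \<Longrightarrow> l n = 0" and a: "a \<in> spn V E" and e: "e \<in> carrier S" for l a e
    proof -
      have 1: "l (tn a' e') = 0" if "a' \<in> E" "e' \<in> F" for a' e'
        using that by (intro z spn_base[OF T1 Y]) auto
      have 2: "l (tn a e') = 0" if "e' \<in> F" for e'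
        by (rule lf_vanish_spn[OF cvV E(2) tlf(1)[OF l] _ a]) (use that F 1 in auto)
      have a': "a \<in> carrier V" using a Ec by blast
      show ?thesis by (rule lf_vanish_spn[OF cvS F(2) tlf(2)[OF l a']]) (use 2 e F in auto)
    qed
    have in_span: "tn a e \<in> spn T1 ?Y" if a: "a \<in> spn V E" and e: "e \<in> carrier S" for a e
      by (rule csub_by_functionals[OF T1 Yc tnc[OF subsetD[OF Ec a] e]]) (rule van[OF _ _ a e])
    have "D1 (D1 (tn a e)) \<in> spn T1 ?Y" if a: "a \<in> spn V E" and e: "e \<in> carrier S" for a e
    proof (rule csub_by_functionals[OF T1 Yc])
      have a': "a \<in> carrier V" using a Ec by blast
      show "D1 (D1 (tn a e)) \<in> carrier T1" by (rule lin_map_closed[OF DD tnc[OF a' e]])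
      fix l assume l: "lin_functional T1 l" and z: "\<And>n. n \<in> spn T1 ?Y \<Longrightarrow> l n = 0"
      note van' = van[OF l z]
      have "l (tn a e) = 0" by (rule van'[OF _ a e])
      moreover have "l (tn (\<pi> (ys ! i) (\<pi> (ys ! i) a)) e) = 0" if "i < length ys" for i
        using onb_in(2)[OF zy(2) that] E(4) a e by (intro van') auto
      moreover have "l (tn (\<pi> (cb (zs ! j) (zs ! i)) a) (\<gamma> (zs ! j) (\<gamma> (zs ! i) e))) = 0" if "i < length zs" "j < length zs" for i j
        using onb_in(2)[OF zy(1) that(1)] onb_in(2)[OF zy(1) that(2)] cb_pp E(4) a e by (intro van') (auto simp: \<gamma>_closed)
      ultimately show "l (D1 (D1 (tn a e))) = 0" unfolding D1_D1[OF l a' e zy] by simp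
    qed
    then have inv: "D1 (D1 y) \<in> spn T1 ?Y" if "y \<in> ?Y" for y
      using that spn_base[OF cvV E(2)] F(2) by auto
    show ?thesis
      by (rule LFI[OF _ Y in_span[OF E(3) s] inv]) (use E F in auto)
  qed
  ultimately have "z \<in> LF" by (rule tensor_induct[OF cvV cvS _ _ assms])
  then show ?thesis unfolding LF_def by blast
qed

text \<open>In a basis of real vectors each summand is the product of the skew operator
  \<open>PX\<close> with \<open>gm\<close>, which is unitary with square \<open>1\<close> and so
  self-adjoint. The two factors commute, hence their product is skew.\<close>

theorem hodge_D1: "hodge T1 D1"
proof -
  obtain us where us: "\<forall>u\<in>set us. \<theta> u = - u" "orthonormal_basis br pp (map (\<lambda>u. cscale 1 (u, 0)) us)"
    using exists_pp_basis by blast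
  define zs where "zs = map (\<lambda>u. (u, 0::'a)) us"
  have zs: "orthonormal_basis br pp zs" using us(2) by (simp add: zs_def cscale_def)
  have zi: "zs ! i = (us ! i, 0)" if "i < length zs" for i using that by (simp add: zs_def)
  obtain H where H: "herm T1 H" and P: "\<And>X u v. u \<in> carrier T1 \<Longrightarrow> v \<in> carrier T1 \<Longrightarrow> H (PX X u) v = - H u (PX X v)"
    and G: "\<And>b u v. b \<in> set zs \<Longrightarrow> u \<in> carrier T1 \<Longrightarrow> v \<in> carrier T1 \<Longrightarrow> H (gm b u) (gm b v) = H u v"
    using exists_herm[OF onl_basis[OF zs]] by blast
  have z: "zs ! i \<in> set zs" "zs ! i \<in> pp" "B (zs ! i) (zs ! i) = 1" if "i < length zs" for i
    using that onb_in(2)[OF zs that] onb_B[OF zs that that] by auto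
  have D: "l (D1 t) = (\<Sum>i<length zs. l (PX (us ! i) (gm (zs ! i) t)))" if l: "lin_functional T1 l" and t: "t \<in> carrier T1" for l t
  proof (rule tensor_lf_ext[OF cvV cvS lf_comp[OF D1_lin l] _ _ t])
    show "lin_functional T1 (\<lambda>t. \<Sum>i<length zs. l (PX (us ! i) (gm (zs ! i) t)))"
      by (intro lf_sum_intro lf_comp[OF gm_lin lf_comp[OF PX_lin l]]) (simp add: z)
    fix v s assume vs: "v \<in> carrier V" "s \<in> carrier S"
    then show "l (D1 (tn v s)) = (\<Sum>i<length zs. l (PX (us ! i) (gm (zs ! i) (tn v s))))"
      by (subst D1_tens[OF l vs zs]) (intro sum.cong refl, simp_all add: gm_tens PX_tens z \<gamma>_closed, simp add: zi)
  qed
  have adj: "H (PX (us ! i) (gm (zs ! i) u)) v = - H u (PX (us ! i) (gm (zs ! i) v))"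
    if i: "i < length zs" and u: "u \<in> carrier T1" and v: "v \<in> carrier T1" for i u v
  proof -
    note zi = z[OF i]
    have "H (PX (us ! i) (gm (zs ! i) u)) v = - H (gm (zs ! i) u) (PX (us ! i) v)" using u v zi by (simp add: P gmc)
    also have "H (gm (zs ! i) u) (PX (us ! i) v) = H (gm (zs ! i) (gm (zs ! i) u)) (gm (zs ! i) (PX (us ! i) v))"
      using u v zi by (simp only: G gmc PXc)
    also have "\<dots> = H u (PX (us ! i) (gm (zs ! i) v))" using u v zi by (simp add: gm_square gm_PX)
    finally show ?thesis .
  qed
  show ?thesis
  proof (rule skew_hodge[OF T1 D1_lin H _ D1_locally_finite])
    fix u v assume u: "u \<in> carrier T1" and v: "v \<in> carrier T1"
    have "H (D1 u) v = (\<Sum>i<length zs. - H u (PX (us ! i) (gm (zs ! i) v)))"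
      using u v by (simp add: D[OF hermD(1)[OF H v] u] adj)
    also have "\<dots> = - cnj (\<Sum>i<length zs. H (PX (us ! i) (gm (zs ! i) v)) u)"
      unfolding sum_negf cnj_sum
      by (intro arg_cong[where f = uminus] sum.cong refl hermD(2)[OF H] u PXc gmc v) (simp add: z)
    also have "\<dots> = - cnj (H (D1 v) u)" by (simp only: D[OF hermD(1)[OF H u] v])
    also have "\<dots> = - H u (D1 v)" using hermD(2)[OF H u lin_map_closed[OF D1_lin v]] by simp
    finally show "H (D1 u) v = - H u (D1 v)" .
  qed
qed

end

section \<open>Dixmier's form of Schur's lemma\<close>

text \<open>The number \<open>l (p(T) u)\<close>, available without forming the operator
  \<open>p(T)\<close> in the carrier.\<close>

definition pe :: "('a \<Rightarrow> 'a) \<Rightarrow> ('a \<Rightarrow> complex) \<Rightarrow> complex poly \<Rightarrow> 'a \<Rightarrow> complex" where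
  "pe T l p u = (\<Sum>i\<le>degree p. coeff p i * l ((T ^^ i) u))"

lemma pe_bound: "degree p \<le> n \<Longrightarrow> pe T l p u = (\<Sum>i\<le>n. coeff p i * l ((T ^^ i) u))"
  unfolding pe_def by (rule sum.mono_neutral_left) (auto simp: coeff_eq_0)

lemma pe_add: "pe T l (p + q) u = pe T l p u + pe T l q u"
  using degree_add_le_max[of p q]
  by (simp add: pe_bound[of _ "max (degree p) (degree q)"] distrib_right sum.distrib)

lemma pe_smult: "pe T l (Polynomial.smult c p) u = c * pe T l p u"
  using degree_smult_le[of c p] by (simp add: pe_bound[of _ "degree p"] sum_distrib_left mult.assoc)

lemma pe_zero: "pe T l 0 u = 0"
  by (simp add: pe_def)

lemma pe_sum: "pe T l (\<Sum>i\<in>I. p i) u = (\<Sum>i\<in>I. pe T l (p i) u)"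
  by (induction I rule: infinite_finite_induct) (simp_all add: pe_add pe_zero)

lemma pe_one: "pe T l 1 u = l u"
  by (simp add: pe_def)

lemma pe_pCons0: "pe T l (pCons 0 p) u = pe T (\<lambda>x. l (T x)) p u"
proof -
  have "pe T l (pCons 0 p) u = (\<Sum>i\<le>Suc (degree p). coeff (pCons 0 p) i * l ((T ^^ i) u))"
    by (rule pe_bound) (simp add: degree_pCons_le)
  also have "\<dots> = pe T (\<lambda>x. l (T x)) p u"
    by (subst sum.atMost_Suc_shift) (simp add: pe_def)
  finally show ?thesis .
qed

context
  fixes V :: "(complex, 'a) module" and T
  assumes V: "cvspace V" and T: "lin_map V V T"
begin

lemma pow_lin: "lin_map V V (\<lambda>x. (T ^^ k) x)"
  by (induction k) (simp_all add: lin_map_id lin_map_comp[OF _ T])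

lemmas powc = lin_map_closed[OF pow_lin] and Tc = lin_map_closed[OF T]

definition sh where "sh \<mu> u = T u \<ominus>\<^bsub>V\<^esub> \<mu> \<odot>\<^bsub>V\<^esub> u"

lemma lf_sh: "lin_functional V l \<Longrightarrow> u \<in> carrier V \<Longrightarrow> l (sh \<mu> u) = l (T u) - \<mu> * l u"
  unfolding sh_def by (simp add: lf_diff[OF V] lf_smult V Tc)

lemma sh_lin: "lin_map V V (sh \<mu>)"
proof (rule lin_mapI[OF V V])
  show "x \<in> carrier V \<Longrightarrow> sh \<mu> x \<in> carrier V" for x by (simp add: sh_def V Tc)
  fix l x y assume l: "lin_functional V l" and xy: "x \<in> carrier V" "y \<in> carrier V"
  then show "l (sh \<mu> (x \<oplus>\<^bsub>V\<^esub> y)) = l (sh \<mu> x) + l (sh \<mu> y)"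
    by (simp add: lf_sh[OF l] V lin_map_add[OF T] lf_add[OF l] Tc algebra_simps)
next
  fix l c x assume l: "lin_functional V l" and x: "x \<in> carrier V"
  then show "l (sh \<mu> (c \<odot>\<^bsub>V\<^esub> x)) = c * l (sh \<mu> x)"
    by (simp add: lf_sh[OF l] V lin_map_smult[OF T] lf_smult[OF l] Tc algebra_simps)
qed

lemmas shc = lin_map_closed[OF sh_lin]

text \<open>A linear factor of the polynomial can be taken out on the side of the functional or on
  the side of the vector, because powers of \<open>T\<close> commute with
  \<open>T - \<mu>\<close>.\<close>

lemma pe_linear_factor:
  assumes l: "lin_functional V l" and u: "u \<in> carrier V"
  shows "pe T l ([:- \<mu>, 1:] * p) u = pe T (\<lambda>x. l (sh \<mu> x)) p u" "pe T l ([:- \<mu>, 1:] * p) u = pe T l p (sh \<mu> u)"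
proof -
  have "[:- \<mu>, 1:] * p = pCons 0 p + Polynomial.smult (- \<mu>) p" by simp
  then have "pe T l ([:- \<mu>, 1:] * p) u = pe T (\<lambda>x. l (T x)) p u + (- \<mu>) * pe T l p u"
    by (simp only: pe_add pe_smult pe_pCons0)
  also have "\<dots> = (\<Sum>i\<le>degree p. coeff p i * (l (T ((T ^^ i) u)) - \<mu> * l ((T ^^ i) u)))"
    by (simp add: pe_def sum_distrib_left sum.distrib[symmetric] sum_subtractf[symmetric] algebra_simps)
  finally have *: "pe T l ([:- \<mu>, 1:] * p) u = (\<Sum>i\<le>degree p. coeff p i * (l (T ((T ^^ i) u)) - \<mu> * l ((T ^^ i) u)))" .
  then show "pe T l ([:- \<mu>, 1:] * p) u = pe T (\<lambda>x. l (sh \<mu> x)) p u"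
    unfolding pe_def[of T "\<lambda>x. l (sh \<mu> x)"] using lf_sh[OF l powc[OF u]] by simp
  have "l ((T ^^ i) (sh \<mu> u)) = l (T ((T ^^ i) u)) - \<mu> * l ((T ^^ i) u)" for i
    using lf_sh[OF lf_comp[OF pow_lin l] u, of i \<mu>] funpow_swap1[of T i u] by simp
  then show "pe T l ([:- \<mu>, 1:] * p) u = pe T l p (sh \<mu> u)"
    unfolding * pe_def[of T l p] by simp
qed

text \<open>Over the complex numbers \<open>p\<close> splits into linear factors, each acting
  injectively; the induction on the degree removes one root at a time.\<close>

lemma pe_injective:
  assumes inj: "\<And>\<mu> u. u \<in> carrier V \<Longrightarrow> sh \<mu> u = \<zero>\<^bsub>V\<^esub> \<Longrightarrow> u = \<zero>\<^bsub>V\<^esub>"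
  shows "p \<noteq> 0 \<Longrightarrow> u \<in> carrier V \<Longrightarrow> (\<And>l. lin_functional V l \<Longrightarrow> pe T l p u = 0) \<Longrightarrow> u = \<zero>\<^bsub>V\<^esub>"
proof (induction "degree p" arbitrary: p u rule: less_induct)
  case less
  show ?case
  proof (cases "degree p = 0")
    case True
    then obtain a where a: "p = [:a:]" "a \<noteq> 0" using less.prems(1) by (metis degree_eq_zeroE pCons_eq_0_iff)
    show ?thesis
    proof (rule functional_eqI[OF V less.prems(2)])
      fix l assume l: "lin_functional V l"
      have "a * l u = 0" using less.prems(3)[OF l] by (simp add: pe_def a)
      then show "l u = l \<zero>\<^bsub>V\<^esub>" using a lf_zero[OF V l] by simp
    qed (simp add: V)
  next
    case False
    then have "\<not> constant (poly p)" by (simp add: constant_degree)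
    from fundamental_theorem_of_algebra[OF this] obtain z where "poly p z = 0" by blast
    then obtain q where q: "p = [:- z, 1:] * q" by (metis poly_eq_0_iff_dvd dvdE)
    have "q \<noteq> 0" using less.prems(1) q by auto
    moreover from this have "degree q < degree p" unfolding q by (subst degree_mult_eq) auto
    moreover have "pe T l q (sh z u) = 0" if l: "lin_functional V l" for l
      using pe_linear_factor(2)[OF l less.prems(2), of z q] less.prems(3)[OF l] q by simp
    ultimately have "sh z u = \<zero>\<^bsub>V\<^esub>" using less.hyps shc less.prems(2) by blast
    then show ?thesis by (rule inj[OF less.prems(2)])
  qed
qed

text \<open>If \<open>T\<close> were not a scalar, the resolvents applied to a vector \<open>v\<close> would be linearly independent
  for all complex \<open>\<mu>\<close>, which is impossible in countable dimension.\<close>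

lemma resolvent_independent:
  assumes inj: "\<And>\<mu> u. u \<in> carrier V \<Longrightarrow> sh \<mu> u = \<zero>\<^bsub>V\<^esub> \<Longrightarrow> u = \<zero>\<^bsub>V\<^esub>"
    and surj: "\<And>\<mu>. sh \<mu> ` carrier V = carrier V"
    and v: "v \<in> carrier V" and r: "\<And>\<mu>. r \<mu> \<in> carrier V \<and> sh \<mu> (r \<mu>) = v"
    and S: "finite S" "\<mu>0 \<in> S" "c \<mu>0 \<noteq> 0" and rel: "\<And>l. lin_functional V l \<Longrightarrow> (\<Sum>\<mu>\<in>S. c \<mu> * l (r \<mu>)) = 0"
  shows "v = \<zero>\<^bsub>V\<^esub>"
proof -
  let ?P = "\<lambda>S. \<Prod>\<mu>\<in>S. [:- \<mu>, 1:]"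
  \<comment> \<open>A common denominator for the resolvents: the product of all
    \<open>T - \<mu>\<close> sends \<open>u\<close> to \<open>v\<close>. It is found by inverting
    one factor at a time, using surjectivity.\<close>
  have "\<exists>u\<in>carrier V. \<forall>l. lin_functional V l \<longrightarrow> pe T l (?P S) u = l v" using S(1)
  proof (induction S)
    case empty
    then show ?case using v by (intro bexI[of _ v]) (simp_all add: pe_one)
  next
    case (insert \<mu> S)
    then obtain u where u: "u \<in> carrier V" "\<forall>l. lin_functional V l \<longrightarrow> pe T l (?P S) u = l v" by blast
    obtain u' where u': "u' \<in> carrier V" "sh \<mu> u' = u"
    proof -
      have "u \<in> sh \<mu> ` carrier V" unfolding surj by (rule u(1))
      then show ?thesis by (elim imageE) (use that in simp)
    qed
    have "pe T l (?P (insert \<mu> S)) u' = l v" if l: "lin_functional V l" for l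
      unfolding prod.insert[OF insert.hyps] pe_linear_factor(2)[OF l u'(1)] u'(2) by (rule u(2)[rule_format, OF l])
    with u'(1) show ?case by blast
  qed
  then obtain u where u: "u \<in> carrier V" and pu: "\<And>l. lin_functional V l \<Longrightarrow> pe T l (?P S) u = l v" by blast
  \<comment> \<open>Injectivity of \<open>T - \<mu>\<close> identifies the resolvent
    \<open>r \<mu>\<close> with the product over the other points applied to \<open>u\<close>, so
    that the linear relation becomes \<open>?q(T) u = 0\<close>.\<close>
  have rk: "l (r \<mu>) = pe T l (?P (S - {\<mu>})) u" if l: "lin_functional V l" and \<mu>: "\<mu> \<in> S" for l \<mu>
  proof -
    let ?p = "?P (S - {\<mu>})"
    define w where "w = finsum V (\<lambda>i. coeff ?p i \<odot>\<^bsub>V\<^esub> (T ^^ i) u) {..degree ?p}"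
    have fc: "(\<lambda>i. coeff ?p i \<odot>\<^bsub>V\<^esub> (T ^^ i) u) \<in> {..degree ?p} \<rightarrow> carrier V" using powc[OF u] V by auto
    have w: "w \<in> carrier V" unfolding w_def by (rule cv_finsum_closed[OF V fc])
    have lw: "l w = pe T l ?p u" if l: "lin_functional V l" for l
      unfolding w_def pe_def lf_finsum[OF V l fc] using powc[OF u] by (simp add: lf_smult[OF l])
    have "sh \<mu> (w \<ominus>\<^bsub>V\<^esub> r \<mu>) = \<zero>\<^bsub>V\<^esub>"
    proof (rule functional_eqI[OF V])
      fix l assume l: "lin_functional V l"
      have "l (sh \<mu> w) = pe T (\<lambda>x. l (sh \<mu> x)) ?p u" by (rule lw[OF lf_comp[OF sh_lin l]])
      also have "\<dots> = pe T l ([:- \<mu>, 1:] * ?p) u" by (rule pe_linear_factor(1)[OF l u, symmetric])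
      also have "[:- \<mu>, 1:] * ?p = ?P S" using S(1) \<mu> by (simp add: prod.remove)
      finally have "l (sh \<mu> w) = l v" using pu[OF l] by simp
      then show "l (sh \<mu> (w \<ominus>\<^bsub>V\<^esub> r \<mu>)) = l \<zero>\<^bsub>V\<^esub>"
        using w r[of \<mu>] v lf_zero[OF V l] by (simp add: lin_map_diff[OF V V sh_lin] lf_diff[OF V l] shc)
    qed (use w r[of \<mu>] V shc in simp_all)
    then have "w \<ominus>\<^bsub>V\<^esub> r \<mu> = \<zero>\<^bsub>V\<^esub>" by (rule inj[rotated]) (use w r[of \<mu>] V in simp)
    then have "w = r \<mu>" using cv_diff_zero[OF V w] r[of \<mu>] by blast
    then show ?thesis using lw[OF l] by simp
  qed
  let ?q = "\<Sum>\<mu>\<in>S. Polynomial.smult (c \<mu>) (?P (S - {\<mu>}))"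
  have "pe T l ?q u = 0" if l: "lin_functional V l" for l
  proof -
    have "pe T l ?q u = (\<Sum>\<mu>\<in>S. c \<mu> * l (r \<mu>))"
      unfolding pe_sum pe_smult by (rule sum.cong) (simp_all only: rk[OF l])
    then show ?thesis using rel[OF l] by simp
  qed
  \<comment> \<open>At \<open>\<mu>0\<close> every summand but one contains the factor
    \<open>\<mu>0 - \<mu>0\<close>, so the value is \<open>c \<mu>0\<close> times a product of
    nonzero differences.\<close>
  moreover have "?q \<noteq> 0"
  proof -
    have q: "poly ?q \<mu>0 = (\<Sum>\<mu>\<in>S. c \<mu> * (\<Prod>\<nu>\<in>S - {\<mu>}. \<mu>0 - \<nu>))"
      by (simp only: poly_sum poly_smult poly_prod) simp
    have z: "(\<Prod>\<nu>\<in>S - {\<mu>}. \<mu>0 - \<nu>) = 0" if "\<mu> \<in> S - {\<mu>0}" for \<mu>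
      by (rule prod_zero) (use that S in auto)
    have "(\<Sum>\<mu>\<in>S - {\<mu>0}. c \<mu> * (\<Prod>\<nu>\<in>S - {\<mu>}. \<mu>0 - \<nu>)) = 0"
      by (intro sum.neutral ballI) (simp only: z mult_zero_right)
    then have "poly ?q \<mu>0 = c \<mu>0 * (\<Prod>\<nu>\<in>S - {\<mu>0}. \<mu>0 - \<nu>)"
      using q sum.remove[OF S(1,2), of "\<lambda>\<mu>. c \<mu> * (\<Prod>\<nu>\<in>S - {\<mu>}. \<mu>0 - \<nu>)"] by (simp only: add_0_right)
    moreover have "(\<Prod>\<nu>\<in>S - {\<mu>0}. \<mu>0 - \<nu>) \<noteq> 0" using S(1) by (simp add: prod_zero_iff)
    ultimately have "poly ?q \<mu>0 \<noteq> 0" using S(3) by simp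
    then show ?thesis by (metis poly_0)
  qed
  ultimately have "u = \<zero>\<^bsub>V\<^esub>" by (intro pe_injective[where p = ?q, OF _ _ u]) (use inj in assumption)+
  then have "l v = l \<zero>\<^bsub>V\<^esub>" if l: "lin_functional V l" for l
    using pu[OF l] lin_map_zero[OF V V pow_lin] lf_zero[OF V l] by (simp add: pe_def)
  then show ?thesis using functional_eqI[OF V v] V by simp
qed

text \<open>Each resolvent \<open>r \<mu>\<close> lies in the span of a finite subset of
  \<open>C\<close>. There are countably many finite subsets but uncountably many \<mu>, so
  infinitely many resolvents share one finite set \<open>E\<close>, and any
  \<open>card E + 1\<close> of them are dependent.\<close>

theorem dixmier_schur:
  assumes irr: "\<And>\<mu>. {u \<in> carrier V. sh \<mu> u = \<zero>\<^bsub>V\<^esub>} \<in> {{\<zero>\<^bsub>V\<^esub>}, carrier V}" "\<And>\<mu>. sh \<mu> ` carrier V \<in> {{\<zero>\<^bsub>V\<^esub>}, carrier V}"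
    and C: "countable C" "C \<subseteq> carrier V" "spn V C = carrier V"
  shows "\<exists>\<mu>. \<forall>u\<in>carrier V. T u = \<mu> \<odot>\<^bsub>V\<^esub> u"
proof (rule ccontr)
  assume not: "\<not> ?thesis"
  have scalar: "\<exists>u\<in>carrier V. sh \<mu> u \<noteq> \<zero>\<^bsub>V\<^esub>" for \<mu>
  proof (rule ccontr)
    assume "\<not> (\<exists>u\<in>carrier V. sh \<mu> u \<noteq> \<zero>\<^bsub>V\<^esub>)"
    then have "\<forall>u\<in>carrier V. T u = \<mu> \<odot>\<^bsub>V\<^esub> u" unfolding sh_def using cv_diff_zero[OF V] Tc V by simp
    then show False using not by blast
  qed
  have inj: "u = \<zero>\<^bsub>V\<^esub>" if "u \<in> carrier V" "sh \<mu> u = \<zero>\<^bsub>V\<^esub>" for \<mu> u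
    using irr(1)[of \<mu>] scalar[of \<mu>] that by blast
  have surj: "sh \<mu> ` carrier V = carrier V" for \<mu>
    using irr(2)[of \<mu>] scalar[of \<mu>] by blast
  obtain v where v: "v \<in> carrier V" "v \<noteq> \<zero>\<^bsub>V\<^esub>"
  proof -
    obtain u where "u \<in> carrier V" "sh 0 u \<noteq> \<zero>\<^bsub>V\<^esub>" using scalar by blast
    then show ?thesis using that[of "sh 0 u"] shc by blast
  qed
  define r where "r \<mu> = (SOME w. w \<in> carrier V \<and> sh \<mu> w = v)" for \<mu>
  have r: "r \<mu> \<in> carrier V \<and> sh \<mu> (r \<mu>) = v" for \<mu>
    unfolding r_def by (rule someI_ex) (use surj[of \<mu>] v(1) image_iff[of v "sh \<mu>" "carrier V"] in fastforce)
  define F where "F \<mu> = (SOME E. finite E \<and> E \<subseteq> C \<and> r \<mu> \<in> spn V E)" for \<mu>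
  have F: "finite (F \<mu>) \<and> F \<mu> \<subseteq> C \<and> r \<mu> \<in> spn V (F \<mu>)" for \<mu>
    unfolding F_def
  proof (rule someI_ex)
    have "r \<mu> \<in> spn V C" using r C(3) by simp
    then obtain p where p: "Poly_Mapping.keys p \<subseteq> C" "r \<mu> = lext V id p" unfolding spn_def by auto
    then show "\<exists>E. finite E \<and> E \<subseteq> C \<and> r \<mu> \<in> spn V E"
      unfolding spn_def by (intro exI[of _ "Poly_Mapping.keys p"]) auto
  qed
  have "\<exists>E. infinite {\<mu>. F \<mu> = E}"
  proof (rule ccontr)
    assume fin: "\<not> (\<exists>E. infinite {\<mu>. F \<mu> = E})"
    have "(UNIV :: complex set) = (\<Union>E\<in>{E. finite E \<and> E \<subseteq> C}. {\<mu>. F \<mu> = E})" using F by blast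
    moreover have "countable (\<Union>E\<in>{E. finite E \<and> E \<subseteq> C}. {\<mu>. F \<mu> = E})"
    proof (rule countable_UN)
      show "countable {E. finite E \<and> E \<subseteq> C}" by (rule countable_Collect_finite_subset[OF C(1)])
      show "countable {\<mu>. F \<mu> = E}" for E using fin by (intro countable_finite) simp
    qed
    ultimately show False using uncountable_UNIV_complex by simp
  qed
  then obtain E where E: "infinite {\<mu>. F \<mu> = E}" by blast
  then obtain \<mu>0 where "F \<mu>0 = E" using infinite_imp_nonempty by blast
  then have E': "finite E" "E \<subseteq> carrier V" using F[of \<mu>0] C(2) by auto
  obtain S where S: "finite S" "card S = Suc (card E)" "S \<subseteq> {\<mu>. F \<mu> = E}"
    using infinite_arbitrarily_large[OF E] by blast
  obtain m where m: "bij_betw m {..card E} S"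
    using ex_bij_betw_nat_finite[OF S(1)] by (auto simp: S(2) atLeast0LessThan lessThan_Suc_atMost)
  have "r (m k) \<in> spn V E" if k: "k \<le> card E" for k
  proof -
    have "m k \<in> S" using bij_betwE[OF m] k by blast
    then have "F (m k) = E" using S(3) by blast
    then show ?thesis using F[of "m k"] by simp
  qed
  then have "\<exists>c. (\<exists>k\<le>card E. c k \<noteq> 0) \<and> (\<forall>l. lin_functional V l \<longrightarrow> (\<Sum>k\<le>card E. c k * l (r (m k))) = 0)"
    by (rule linear_dependence[OF V E'])
  then obtain c where cc: "(\<exists>k\<le>card E. c k \<noteq> 0) \<and> (\<forall>l. lin_functional V l \<longrightarrow> (\<Sum>k\<le>card E. c k * l (r (m k))) = 0)" ..
  note c = conjunct1[OF cc] conjunct2[OF cc]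
  obtain k where k: "k \<le> card E" "c k \<noteq> 0" using c(1) by blast
  let ?c = "\<lambda>\<mu>. c (inv_into {..card E} m \<mu>)"
  have inv: "inv_into {..card E} m (m j) = j" if "j \<le> card E" for j
    using m that by (intro inv_into_f_f) (auto simp: bij_betw_def)
  have rel: "(\<Sum>\<mu>\<in>S. ?c \<mu> * l (r \<mu>)) = 0" if l: "lin_functional V l" for l
  proof -
    have "(\<Sum>\<mu>\<in>S. ?c \<mu> * l (r \<mu>)) = (\<Sum>j\<in>{..card E}. ?c (m j) * l (r (m j)))"
      by (rule sum.reindex_bij_betw[OF m, symmetric])
    also have "\<dots> = 0" using c(2)[rule_format, OF l] inv by simp
    finally show ?thesis .
  qed
  have mk: "m k \<in> S" "?c (m k) \<noteq> 0" using bij_betwE[OF m] k inv by auto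
  have A: "\<And>\<mu> u. u \<in> carrier V \<Longrightarrow> sh \<mu> u = \<zero>\<^bsub>V\<^esub> \<Longrightarrow> u = \<zero>\<^bsub>V\<^esub>" by (rule inj)
  have "v = \<zero>\<^bsub>V\<^esub>"
    using A surj v(1) r S(1) mk rel by (rule resolvent_independent)
  with v(2) show False by contradiction
qed

end

text \<open>A longest list in \<open>Y\<close> with no entry in the span of its predecessors spans
  \<open>Y\<close>; its length is bounded by \<open>card F\<close> through
  \<open>linear_dependence\<close>.\<close>

lemma finite_span_subspace:
  assumes V: "cvspace V" and F: "finite F" "F \<subseteq> carrier V" and Y: "csub Y V" "Y \<subseteq> spn V F"
  shows "\<exists>E. finite E \<and> E \<subseteq> carrier V \<and> spn V E = Y"
proof -
  let ?I = "\<lambda>ys. set ys \<subseteq> Y \<and> (\<forall>k<length ys. ys ! k \<notin> spn V (set (take k ys)))"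
  have Yc: "Y \<subseteq> carrier V" by (rule csubD(1)[OF Y(1)])
  have bound: "length ys \<le> card F" if ys: "?I ys" for ys
  proof (rule ccontr)
    assume "\<not> length ys \<le> card F"
    then have len: "card F < length ys" by simp
    have "ys ! k \<in> spn V F" if "k \<le> card F" for k using that len ys Y(2) nth_mem[of k ys] subsetD by fastforce
    then have "\<exists>c. (\<exists>k\<le>card F. c k \<noteq> 0) \<and> (\<forall>l. lin_functional V l \<longrightarrow> (\<Sum>k\<le>card F. c k * l (ys ! k)) = 0)"
      by (rule linear_dependence[OF V F])
    then obtain c where cc: "(\<exists>k\<le>card F. c k \<noteq> 0) \<and> (\<forall>l. lin_functional V l \<longrightarrow> (\<Sum>k\<le>card F. c k * l (ys ! k)) = 0)" ..
    note c = conjunct1[OF cc] conjunct2[OF cc]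
    \<comment> \<open>The last vector with nonzero coefficient: the relation expresses it through
      its predecessors, against the property of the list.\<close>
    define j where "j = Max {k. k \<le> card F \<and> c k \<noteq> 0}"
    have fin: "finite {k. k \<le> card F \<and> c k \<noteq> 0}" by simp
    have j: "j \<le> card F" "c j \<noteq> 0" using Max_in[OF fin] c(1) unfolding j_def by auto
    have jmax: "c k = 0" if "k \<le> card F" "j < k" for k
    proof (rule ccontr)
      assume "c k \<noteq> 0"
      then have "k \<le> j" unfolding j_def using that(1) by (intro Max_ge[OF fin]) simp
      then show False using that(2) by simp
    qed
    have tk: "set (take j ys) \<subseteq> carrier V" using ys Yc set_take_subset[of j ys] by blast
    have "ys ! j \<in> spn V (set (take j ys))"
    proof (rule csub_by_functionals[OF V spn_csub[OF V tk]])
      show "ys ! j \<in> carrier V" proof -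
        have "ys ! j \<in> set ys" using j len by simp
        then show ?thesis using ys Yc by blast
      qed
      fix l assume l: "lin_functional V l" and z: "\<And>n. n \<in> spn V (set (take j ys)) \<Longrightarrow> l n = 0"
      have "(\<Sum>k\<le>card F. c k * l (ys ! k)) = (\<Sum>k\<in>{j}. c k * l (ys ! k))"
      proof (rule sum.mono_neutral_right)
        show "\<forall>k\<in>{..card F} - {j}. c k * l (ys ! k) = 0"
        proof
          fix k assume k: "k \<in> {..card F} - {j}"
          show "c k * l (ys ! k) = 0"
          proof (cases "j < k")
            case False
            then have "k < j" using k by simp
            then have "ys ! k \<in> set (take j ys)" using len j by (auto simp: in_set_conv_nth intro!: exI[of _ k])
            then show ?thesis using z spn_base[OF V tk] by simp
          qed (use jmax k in simp)
        qed
      qed (use j in auto)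
      then show "l (ys ! j) = 0" using c(2)[rule_format, OF l] j by simp
    qed
    then show False using ys j len by simp
  qed
  define n where "n = (GREATEST n. \<exists>ys. ?I ys \<and> length ys = n)"
  have ex: "\<exists>n. \<exists>ys. ?I ys \<and> length ys = n" by (rule exI[of _ 0], rule exI[of _ "[]"]) simp
  have bd: "\<forall>n. (\<exists>ys. ?I ys \<and> length ys = n) \<longrightarrow> n \<le> card F" using bound by blast
  from ex obtain n0 where n0: "\<exists>ys. ?I ys \<and> length ys = n0" by blast
  have "\<exists>ys. ?I ys \<and> length ys = n"
    unfolding n_def by (rule GreatestI_nat[of _ n0 "card F"]) (use n0 bd in blast)+
  then obtain ys where ys: "?I ys" "length ys = n" by blast
  have max: "length zs \<le> n" if "?I zs" for zs
    unfolding n_def by (rule Greatest_le_nat[of _ _ "card F"]) (use that bd in blast)+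
  have yc: "set ys \<subseteq> carrier V" using ys Yc by blast
  have "y \<in> spn V (set ys)" if y: "y \<in> Y" for y
  proof (rule ccontr)
    assume "y \<notin> spn V (set ys)"
    then have "?I (ys @ [y])" using ys y by (auto simp: nth_append less_Suc_eq)
    then show False using max[of "ys @ [y]"] ys by simp
  qed
  moreover have "spn V (set ys) \<subseteq> Y" by (rule spn_minimal[OF V Y(1)]) (use ys in blast)
  ultimately show ?thesis using yc by (intro exI[of _ "set ys"]) auto
qed

section \<open>The Casimir operator of an irreducible module\<close>

text \<open>An algebraic shadow of an irreducible \<open>(g, K)\<close>-module: \<open>KK\<close> is
  a bare set closed under \<open>m\<close>, and analysis survives only in \<open>kderiv\<close>, by
  which subspaces stable under \<open>K\<close> are stable under the \<theta>-fixed real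
  vectors.\<close>

locale irreducible_pair = cartan +
  fixes V \<pi> and KK :: "'k set" and \<kappa> :: "'k \<Rightarrow> 'c \<Rightarrow> 'c" and AA :: "'k \<Rightarrow> 'a \<Rightarrow> 'a" and e m
  assumes V: "lie_module br UNIV V \<pi>"
    and \<kappa>_lin: "k \<in> KK \<Longrightarrow> lin_map V V (\<kappa> k)"
    and e: "e \<in> KK" "v \<in> carrier V \<Longrightarrow> \<kappa> e v = v"
    and m: "k \<in> KK \<Longrightarrow> k' \<in> KK \<Longrightarrow> m k k' \<in> KK"
      "k \<in> KK \<Longrightarrow> k' \<in> KK \<Longrightarrow> v \<in> carrier V \<Longrightarrow> \<kappa> (m k k') v = \<kappa> k (\<kappa> k' v)"
    and loc_fin: "v \<in> carrier V \<Longrightarrow> \<exists>F. finite F \<and> F \<subseteq> carrier V \<and> (\<forall>k\<in>KK. \<kappa> k v \<in> spn V F)"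
    and equiv: "k \<in> KK \<Longrightarrow> v \<in> carrier V \<Longrightarrow> \<kappa> k (\<pi> x v) = \<pi> (cmap (AA k) x) (\<kappa> k v)"
    and AA: "k \<in> KK \<Longrightarrow> linear (AA k)" "k \<in> KK \<Longrightarrow> surj (AA k)" "k \<in> KK \<Longrightarrow> K (AA k X) (AA k Y) = K X Y"
    and kderiv: "\<theta> X = X \<Longrightarrow> csub N V \<Longrightarrow> (\<And>k n. k \<in> KK \<Longrightarrow> n \<in> N \<Longrightarrow> \<kappa> k n \<in> N) \<Longrightarrow> y \<in> N \<Longrightarrow> \<pi> (X, 0) y \<in> N"
    and nontrivial: "carrier V \<noteq> {\<zero>\<^bsub>V\<^esub>}"
    and irreducible: "csub N V \<Longrightarrow> (\<And>x n. n \<in> N \<Longrightarrow> \<pi> x n \<in> N) \<Longrightarrow> (\<And>k n. k \<in> KK \<Longrightarrow> n \<in> N \<Longrightarrow> \<kappa> k n \<in> N) \<Longrightarrow>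
      N = {\<zero>\<^bsub>V\<^esub>} \<or> N = carrier V"
begin

lemma V_act: "generators_act UNIV V \<pi>"
  using V by (simp add: lie_module_def)

lemmas cvV = generators_actD(1)[OF V_act]
lemma \<pi>_lin: "lin_map V V (\<pi> x)" by (rule generators_actD(2)[OF V_act]) simp
lemma \<pi>_closed: "v \<in> carrier V \<Longrightarrow> \<pi> x v \<in> carrier V" by (rule generators_actD(3)[OF V_act]) simp_all
lemmas \<kappa>_closed = lin_map_closed[OF \<kappa>_lin]

lemma lf_\<pi>_bracket: "lin_functional V l \<Longrightarrow> v \<in> carrier V \<Longrightarrow> l (\<pi> (cb x y) v) = l (\<pi> x (\<pi> y v)) - l (\<pi> y (\<pi> x v))"
proof -
  assume l: "lin_functional V l" and v: "v \<in> carrier V"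
  then have "\<pi> (cb x y) v = \<pi> x (\<pi> y v) \<ominus>\<^bsub>V\<^esub> \<pi> y (\<pi> x v)" using V unfolding lie_module_def by blast
  then show ?thesis using v by (simp add: lf_diff[OF cvV l] \<pi>_closed)
qed

lemma clin_\<pi>: "lin_functional V l \<Longrightarrow> v \<in> carrier V \<Longrightarrow> clin W (\<lambda>x. l (\<pi> x v))"
  using clin_generators[OF V_act] by (auto simp: clin_def)

text \<open>The span of the \<open>K\<close>-orbit of \<open>v\<close> is finite-dimensional and
  \<open>K\<close>-stable, hence stable under the fixed vectors of \<theta> by \<open>kderiv\<close>
  and under \<kk> by complex linearity.\<close>

lemma locally_k_finite:
  assumes v: "v \<in> carrier V"
  shows "\<exists>E. finite E \<and> E \<subseteq> carrier V \<and> v \<in> spn V E \<and> (\<forall>x\<in>kk. \<forall>a\<in>spn V E. \<pi> x a \<in> spn V E)"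
proof -
  obtain F where F: "finite F" "F \<subseteq> carrier V" "\<forall>k\<in>KK. \<kappa> k v \<in> spn V F" using loc_fin[OF v] by (elim exE conjE)
  let ?O = "(\<lambda>k. \<kappa> k v) ` KK"
  define Y where "Y = spn V ?O"
  have O: "?O \<subseteq> carrier V" using \<kappa>_closed v by (intro image_subsetI)
  have Y: "csub Y V" unfolding Y_def by (rule spn_csub[OF cvV O])
  have "\<kappa> k y \<in> Y" if k: "k \<in> KK" and y: "y \<in> Y" for k y
  proof (rule spn_image[OF cvV cvV \<kappa>_lin[OF k] O Y _ y[unfolded Y_def]])
    fix a assume "a \<in> ?O"
    then obtain k' where k': "k' \<in> KK" "a = \<kappa> k' v" by (elim imageE)
    then have "\<kappa> k a = \<kappa> (m k k') v" using m(2)[OF k k'(1) v] by simp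
    then show "\<kappa> k a \<in> Y" unfolding Y_def using m(1)[OF k k'(1)] by (simp add: spn_base[OF cvV O])
  qed
  note inv = kderiv[OF _ Y this]
  have kY: "\<pi> x a \<in> Y" if x: "x \<in> kk" and a: "a \<in> Y" for x a
  proof -
    have ac: "a \<in> carrier V" using csubD(1)[OF Y] a by (rule subsetD)
    have "x = (fst x, 0) + cscale \<i> (snd x, 0)" by (simp add: cscale_def prod_eq_iff)
    then have "\<pi> x a = \<pi> (fst x, 0) a \<oplus>\<^bsub>V\<^esub> \<i> \<odot>\<^bsub>V\<^esub> \<pi> (snd x, 0) a"
      using generators_actD(4)[OF V_act UNIV_I UNIV_I ac] generators_actD(5)[OF V_act UNIV_I ac] by metis
    moreover have "\<pi> (fst x, 0) a \<in> Y" "\<pi> (snd x, 0) a \<in> Y" using x a by (auto simp: kk_iff intro: inv)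
    ultimately show ?thesis using csubD(2)[OF Y] csubD(3)[OF Y] by simp
  qed
  have "Y \<subseteq> spn V F" unfolding Y_def
    by (rule spn_minimal[OF cvV spn_csub[OF cvV F(2)]]) (use F(3) in blast)
  from finite_span_subspace[OF cvV F(1,2) Y this]
  obtain E where E: "finite E" "E \<subseteq> carrier V" "spn V E = Y" by (elim exE conjE)
  have "v \<in> Y" unfolding Y_def by (rule spn_base[OF cvV O]) (use e v in \<open>simp add: image_iff, metis\<close>)
  with E kY show ?thesis by (intro exI[of _ E]) simp
qed

lemma cmap_simps:
  assumes k: "k \<in> KK"
  shows "cmap (AA k) (x + y) = cmap (AA k) x + cmap (AA k) y" "cmap (AA k) (cscale c x) = cscale c (cmap (AA k) x)"
    "B (cmap (AA k) x) (cmap (AA k) y) = B x y"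
  using AA(3)[OF k] linear_add[OF AA(1)[OF k]] linear_diff[OF AA(1)[OF k]] linear_cmul[OF AA(1)[OF k]]
  by (simp_all add: cmap_def cscale_def B_K)

text \<open>\<open>AA k\<close> preserves the Killing form, so it moves one orthonormal basis to
  another; with basis independence of the Casimir sum this makes the Casimir operator commute with
  \<open>K\<close>.\<close>

lemma cmap_onb:
  assumes k: "k \<in> KK" and es: "orthonormal_basis br UNIV es"
  shows "orthonormal_basis br UNIV (map (cmap (AA k)) es)"
proof -
  have "x \<in> cs.span (set (map (cmap (AA k)) es))" for x
  proof -
    obtain X Y where XY: "fst x = AA k X" "snd x = AA k Y" using AA(2)[OF k] by (metis surjD)
    then have "x = cmap (AA k) (X, Y)" by (simp add: cmap_def prod_eq_iff)
    moreover have "cmap (AA k) y \<in> cs.span (set (map (cmap (AA k)) es))" if "y \<in> cs.span (set es)" for y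
      using that
    proof (induction rule: cs.span_induct_alt)
      case base
      show ?case using cs.span_zero linear_0[OF AA(1)[OF k]] by (simp add: cmap_def zero_prod_def[symmetric])
    next
      case (step c x y)
      then show ?case by (simp only: cmap_simps[OF k]) (intro cs.span_add cs.span_scale, auto intro: cs.span_base)
    qed
    moreover have "cs.span (set es) = UNIV" using es by (simp add: orthonormal_basis_def)
    ultimately show ?thesis by simp
  qed
  then show ?thesis using es unfolding orthonormal_basis_def by (auto simp: cmap_simps(3)[OF k])
qed

context
  fixes es assumes es: "orthonormal_basis br UNIV es"
begin

definition Cas where "Cas v = finsum V (\<lambda>i. \<pi> (es ! i) (\<pi> (es ! i) v)) {..<length es}"

lemma Cas_closed: "v \<in> carrier V \<Longrightarrow> Cas v \<in> carrier V"
  unfolding Cas_def by (rule cv_finsum_closed[OF cvV]) (simp add: \<pi>_closed)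

lemma lf_Cas: "lin_functional V l \<Longrightarrow> v \<in> carrier V \<Longrightarrow> l (Cas v) = (\<Sum>i<length es. l (\<pi> (es ! i) (\<pi> (es ! i) v)))"
  unfolding Cas_def by (rule lf_finsum[OF cvV]) (simp_all add: \<pi>_closed)

lemma Cas_lin: "lin_map V V Cas"
proof (rule lin_mapI[OF cvV cvV Cas_closed])
  fix l x y assume l: "lin_functional V l" and xy: "x \<in> carrier V" "y \<in> carrier V"
  show "l (Cas (x \<oplus>\<^bsub>V\<^esub> y)) = l (Cas x) + l (Cas y)"
    using xy by (simp add: lf_Cas[OF l] cvV lin_map_add[OF \<pi>_lin] \<pi>_closed lf_add[OF l] sum.distrib)
next
  fix l c x assume l: "lin_functional V l" and x: "x \<in> carrier V"
  show "l (Cas (c \<odot>\<^bsub>V\<^esub> x)) = c * l (Cas x)"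
    using x by (simp add: lf_Cas[OF l] cvV lin_map_smult[OF \<pi>_lin] \<pi>_closed lf_smult[OF l] sum_distrib_left)
qed

lemma cbil_\<pi>\<pi>: "lin_functional V l \<Longrightarrow> v \<in> carrier V \<Longrightarrow> cbil UNIV (\<lambda>a b. l (\<pi> a (\<pi> b v)))"
  unfolding cbil_def using clin_\<pi>[of l "\<pi> _ v"] clin_\<pi>[OF lf_comp[OF \<pi>_lin]] \<pi>_closed by simp

lemma Cas_\<pi>:
  assumes v: "v \<in> carrier V"
  shows "Cas (\<pi> x v) = \<pi> x (Cas v)"
proof (rule functional_eqI[OF cvV])
  fix l assume l: "lin_functional V l"
  let ?F = "\<lambda>a b. l (\<pi> a (\<pi> b v))"
  have "l (\<pi> x (\<pi> a (\<pi> a v))) = ?F (cb x a) a + (?F a (cb x a) + l (\<pi> a (\<pi> a (\<pi> x v))))" for a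
    using lf_\<pi>_bracket[OF l \<pi>_closed[OF v], of x a a] lf_\<pi>_bracket[OF lf_comp[OF \<pi>_lin l] v, of a x a] by simp
  then have "l (\<pi> x (Cas v)) = (\<Sum>i<length es. ?F (cb x (es ! i)) (es ! i)) + ((\<Sum>i<length es. ?F (es ! i) (cb x (es ! i))) + l (Cas (\<pi> x v)))"
    by (simp add: lf_Cas[OF lf_comp[OF \<pi>_lin l] v] lf_Cas[OF l \<pi>_closed[OF v]] sum.distrib)
  then show "l (Cas (\<pi> x v)) = l (\<pi> x (Cas v))"
    using contraction_invariant[OF es cbil_\<pi>\<pi>[OF l v], of x] by simp
qed (use v Cas_closed \<pi>_closed in simp_all)

lemma Cas_\<kappa>:
  assumes k: "k \<in> KK" and v: "v \<in> carrier V"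
  shows "Cas (\<kappa> k v) = \<kappa> k (Cas v)"
proof (rule functional_eqI[OF cvV])
  fix l assume l: "lin_functional V l"
  let ?es = "map (cmap (AA k)) es"
  have "l (\<kappa> k (Cas v)) = (\<Sum>i<length es. l (\<kappa> k (\<pi> (es ! i) (\<pi> (es ! i) v))))"
    by (rule lf_Cas[OF lf_comp[OF \<kappa>_lin[OF k] l] v])
  also have "\<dots> = (\<Sum>i<length ?es. l (\<pi> (?es ! i) (\<pi> (?es ! i) (\<kappa> k v))))"
    by (simp add: equiv[OF k] \<pi>_closed v)
  also have "\<dots> = l (Cas (\<kappa> k v))"
    unfolding lf_Cas[OF l \<kappa>_closed[OF k v]]
    by (rule contraction_independent[OF es cmap_onb[OF k es] cbil_\<pi>\<pi>[OF l \<kappa>_closed[OF k v]]])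
  finally show "l (Cas (\<kappa> k v)) = l (\<kappa> k (Cas v))" by simp
qed (use v Cas_closed \<kappa>_closed[OF k] in simp_all)

lemma sh_commute:
  assumes P: "lin_map V V P" and c: "Cas (P u) = P (Cas u)" and u: "u \<in> carrier V"
  shows "sh V Cas \<mu> (P u) = P (sh V Cas \<mu> u)"
  using u by (simp add: sh_def[OF cvV Cas_lin] c lin_map_diff[OF cvV cvV P] lin_map_smult[OF P] Cas_closed cvV)

text \<open>Kernel and range of \<open>Cas - \<mu>\<close> are stable under \<pi> and \<kappa>, so
  each is zero or everything: the input to Dixmier's argument.\<close>

lemma sh_irreducible: "{u \<in> carrier V. sh V Cas \<mu> u = \<zero>\<^bsub>V\<^esub>} \<in> {{\<zero>\<^bsub>V\<^esub>}, carrier V}"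
  "sh V Cas \<mu> ` carrier V \<in> {{\<zero>\<^bsub>V\<^esub>}, carrier V}"
proof -
  note L = sh_lin[OF cvV Cas_lin, of \<mu>]
  have 1: "sh V Cas \<mu> (\<pi> x u) = \<pi> x (sh V Cas \<mu> u)" if "u \<in> carrier V" for x u
    by (rule sh_commute[OF \<pi>_lin Cas_\<pi>[OF that] that])
  have 2: "sh V Cas \<mu> (\<kappa> k u) = \<kappa> k (sh V Cas \<mu> u)" if "k \<in> KK" "u \<in> carrier V" for k u
    by (rule sh_commute[OF \<kappa>_lin[OF that(1)] Cas_\<kappa>[OF that] that(2)])
  have "{u \<in> carrier V. sh V Cas \<mu> u = \<zero>\<^bsub>V\<^esub>} = {\<zero>\<^bsub>V\<^esub>} \<or> {u \<in> carrier V. sh V Cas \<mu> u = \<zero>\<^bsub>V\<^esub>} = carrier V"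
    by (rule irreducible[OF csub_kernel[OF cvV cvV L]])
      (simp_all add: 1 2 \<pi>_closed \<kappa>_closed lin_map_zero[OF cvV cvV \<pi>_lin] lin_map_zero[OF cvV cvV \<kappa>_lin])
  moreover have "sh V Cas \<mu> ` carrier V = {\<zero>\<^bsub>V\<^esub>} \<or> sh V Cas \<mu> ` carrier V = carrier V"
  proof (rule irreducible[OF csub_range[OF cvV cvV L]])
    show "\<pi> x n \<in> sh V Cas \<mu> ` carrier V" if "n \<in> sh V Cas \<mu> ` carrier V" for x n
      using that by (elim imageE) (simp add: 1[symmetric] \<pi>_closed)
    show "\<kappa> k n \<in> sh V Cas \<mu> ` carrier V" if "k \<in> KK" "n \<in> sh V Cas \<mu> ` carrier V" for k n
      using that by (elim imageE) (simp add: 2[symmetric] \<kappa>_closed)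
  qed
  ultimately show "{u \<in> carrier V. sh V Cas \<mu> u = \<zero>\<^bsub>V\<^esub>} \<in> {{\<zero>\<^bsub>V\<^esub>}, carrier V}"
    "sh V Cas \<mu> ` carrier V \<in> {{\<zero>\<^bsub>V\<^esub>}, carrier V}" by simp_all
qed

lemma foldr_\<pi>_closed: "v \<in> carrier V \<Longrightarrow> foldr \<pi> w v \<in> carrier V"
  by (induction w) (simp_all add: \<pi>_closed)

lemma foldr_\<pi>_lin: "lin_map V V (foldr \<pi> w)"
  by (induction w) (simp_all add: o_def lin_map_id lin_map_comp[OF _ \<pi>_lin] id_def)

text \<open>Words in a finite basis applied to a \<open>K\<close>-orbit span a submodule, but an
  orbit may be uncountable. Replacing it by a finite set \<open>F\<close> whose span contains it
  makes the family countable and keeps the span large enough: \<open>G\<close> serves for stability,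
  \<open>C\<close> for counting.\<close>

lemma countable_spanning: "\<exists>C. countable C \<and> C \<subseteq> carrier V \<and> spn V C = carrier V"
proof -
  have "\<zero>\<^bsub>V\<^esub> \<in> carrier V" using cvV by simp
  then obtain v where v: "v \<in> carrier V" "v \<noteq> \<zero>\<^bsub>V\<^esub>" using nontrivial by blast
  obtain F where F: "finite F" "F \<subseteq> carrier V" "\<forall>k\<in>KK. \<kappa> k v \<in> spn V F" using loc_fin[OF v(1)] by (elim exE conjE)
  define C where "C = (\<lambda>(w, f). foldr \<pi> w f) ` (lists (set es) \<times> F)"
  define G where "G = (\<lambda>(w, k). foldr \<pi> w (\<kappa> k v)) ` (lists (set es) \<times> KK)"
  define N where "N = spn V G"
  have C: "countable C" "C \<subseteq> carrier V"
  proof -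
    have "countable (lists (set es) \<times> F)" by (intro countable_SIGMA countable_lists countable_finite F(1)) simp
    then show "countable C" unfolding C_def by (rule countable_image)
    show "C \<subseteq> carrier V" unfolding C_def using F(2) foldr_\<pi>_closed by auto
  qed
  have G: "G \<subseteq> carrier V" unfolding G_def using foldr_\<pi>_closed \<kappa>_closed v(1) by auto
  have N: "csub N V" unfolding N_def by (rule spn_csub[OF cvV G])
  have NC: "N \<subseteq> spn V C" unfolding N_def
  proof (rule spn_minimal[OF cvV spn_csub[OF cvV C(2)]], rule subsetI)
    fix g assume "g \<in> G"
    then obtain w k where wk: "w \<in> lists (set es)" "k \<in> KK" "g = foldr \<pi> w (\<kappa> k v)" unfolding G_def by auto
    show "g \<in> spn V C" unfolding wk(3)
    proof (rule spn_image[OF cvV cvV foldr_\<pi>_lin F(2) spn_csub[OF cvV C(2)]])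
      show "foldr \<pi> w a \<in> spn V C" if "a \<in> F" for a
        by (rule spn_base[OF cvV C(2)]) (use that wk(1) in \<open>auto simp: C_def image_iff\<close>)
      show "\<kappa> k v \<in> spn V F" using F(3) wk(2) by blast
    qed
  qed
  have ei: "es ! i \<in> set es" if "i < length es" for i using that by simp
  have eN: "\<pi> (es ! i) n \<in> N" if i: "i < length es" and n: "n \<in> N" for i n
  proof (rule spn_image[OF cvV cvV \<pi>_lin G N _ n[unfolded N_def]])
    fix g assume "g \<in> G"
    then obtain w k where wk: "w \<in> lists (set es)" "k \<in> KK" "g = foldr \<pi> w (\<kappa> k v)" unfolding G_def by auto
    have "\<pi> (es ! i) g = foldr \<pi> (es ! i # w) (\<kappa> k v)" by (simp add: wk)
    moreover have "es ! i # w \<in> lists (set es)" using wk(1) ei[OF i] by simp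
    ultimately have "\<pi> (es ! i) g \<in> G" unfolding G_def using wk(2) by (intro image_eqI[of _ _ "(es ! i # w, k)"]) simp_all
    then show "\<pi> (es ! i) g \<in> N" unfolding N_def by (rule spn_base[OF cvV G])
  qed
  have \<pi>N: "\<pi> x n \<in> N" if n: "n \<in> N" for x n
  proof (rule csub_by_functionals[OF cvV N])
    have nc: "n \<in> carrier V" using csubD(1)[OF N] n by (rule subsetD)
    then show "\<pi> x n \<in> carrier V" by (rule \<pi>_closed)
    fix l assume l: "lin_functional V l" and z: "\<And>n. n \<in> N \<Longrightarrow> l n = 0"
    have "l (\<pi> x n) = (\<Sum>i<length es. B x (es ! i) * l (\<pi> (es ! i) n))"
      by (rule clin_expand[OF es clin_\<pi>[OF l nc]]) simp
    also have "\<dots> = 0" using z[OF eN[OF _ n]] by simp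
    finally show "l (\<pi> x n) = 0" .
  qed
  have fN: "foldr \<pi> w n \<in> N" if "n \<in> N" for w n using that by (induction w) (simp_all add: \<pi>N)
  have oN: "\<kappa> k v \<in> N" if "k \<in> KK" for k
  proof -
    have "\<kappa> k v \<in> G" unfolding G_def using that by (intro image_eqI[of _ _ "([], k)"]) auto
    then show ?thesis unfolding N_def by (rule spn_base[OF cvV G])
  qed
  have "N = {\<zero>\<^bsub>V\<^esub>} \<or> N = carrier V"
  proof (rule irreducible[OF N \<pi>N])
    fix k n assume k: "k \<in> KK" and n: "n \<in> N"
    show "\<kappa> k n \<in> N"
    proof (rule spn_image[OF cvV cvV \<kappa>_lin[OF k] G N _ n[unfolded N_def]])
      fix g assume "g \<in> G"
      then obtain w k' where wk: "w \<in> lists (set es)" "k' \<in> KK" "g = foldr \<pi> w (\<kappa> k' v)" unfolding G_def by auto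
      have "\<kappa> k (foldr \<pi> w u) = foldr \<pi> (map (cmap (AA k)) w) (\<kappa> k u)" if "u \<in> carrier V" for u
        using that by (induction w) (simp_all add: equiv[OF k] foldr_\<pi>_closed)
      then have "\<kappa> k g = foldr \<pi> (map (cmap (AA k)) w) (\<kappa> (m k k') v)"
        using wk m(2)[OF k wk(2) v(1)] \<kappa>_closed[OF wk(2) v(1)] by simp
      then show "\<kappa> k g \<in> N" using fN oN m(1)[OF k wk(2)] by simp
    qed
  qed
  moreover have "v \<in> N" using oN[OF e(1)] e(2)[OF v(1)] by simp
  ultimately have "N = carrier V" using v(2) by blast
  then have "spn V C = carrier V" using NC csubD(1)[OF spn_csub[OF cvV C(2)]] by blast
  with C show ?thesis by blast
qed

lemma Cas_scalar: "\<exists>\<mu>. \<forall>u\<in>carrier V. Cas u = \<mu> \<odot>\<^bsub>V\<^esub> u"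
proof -
  obtain C where "countable C" "C \<subseteq> carrier V" "spn V C = carrier V" using countable_spanning by (elim exE conjE)
  from dixmier_schur[OF cvV Cas_lin sh_irreducible this] show ?thesis .
qed

end

text \<open>The eigenvalue is found in one basis and holds in all by basis independence; in the
  absence of an orthonormal basis the claim is empty.\<close>

lemma casimir_scalar:
  "\<exists>c. \<forall>l v es. lin_functional V l \<longrightarrow> v \<in> carrier V \<longrightarrow> orthonormal_basis br UNIV es \<longrightarrow>
    (\<Sum>i<length es. l (\<pi> (es ! i) (\<pi> (es ! i) v))) = c * l v"
proof (cases "\<exists>es. orthonormal_basis br UNIV es")
  case True
  then obtain es where es: "orthonormal_basis br UNIV es" ..
  obtain \<mu> where \<mu>: "\<forall>u\<in>carrier V. Cas es u = \<mu> \<odot>\<^bsub>V\<^esub> u" using Cas_scalar[OF es] ..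
  have "(\<Sum>i<length us. l (\<pi> (us ! i) (\<pi> (us ! i) v))) = \<mu> * l v"
    if l: "lin_functional V l" and v: "v \<in> carrier V" and us: "orthonormal_basis br UNIV us" for l v us
    using contraction_independent[OF es us cbil_\<pi>\<pi>[OF es l v]] lf_Cas[OF es l v] \<mu> v lf_smult[OF l v] by simp
  then show ?thesis by blast
qed simp

end

section \<open>Smooth functions\<close>

lemma Ck_SucD: "Ck_on (Suc n) f S \<Longrightarrow> x \<in> S \<Longrightarrow> (f has_derivative frechet_derivative f (at x)) (at x)"
  by (simp add: frechet_derivative_works)

lemma Ck_mono: "Ck_on (Suc n) f S \<Longrightarrow> Ck_on n f S"
proof (induction n arbitrary: f)
  case 0
  then show ?case
    by (auto intro!: continuous_at_imp_continuous_on differentiable_imp_continuous_within)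
next
  case (Suc n)
  have "Ck_on n (\<lambda>x. frechet_derivative f (at x) v) S" for v
    by (rule Suc.IH) (use Suc.prems in simp)
  then show ?case using Suc.prems by simp
qed

lemma Ck_cong: "open S \<Longrightarrow> (\<And>x. x \<in> S \<Longrightarrow> f x = g x) \<Longrightarrow> Ck_on n f S \<Longrightarrow> Ck_on n g S"
proof (induction n arbitrary: f g)
  case 0
  then show ?case using continuous_on_cong[of S S f g] by simp
next
  case (Suc n)
  have g: "(g has_derivative frechet_derivative f (at x)) (at x)" if "x \<in> S" for x
    using Suc.prems(1) that by (rule has_derivative_transform_within_open[OF Ck_SucD[OF Suc.prems(3) that]]) (rule Suc.prems(2))
  have "Ck_on n (\<lambda>x. frechet_derivative g (at x) v) S" for v
  proof (rule Suc.IH[OF Suc.prems(1)])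
    show "frechet_derivative f (at x) v = frechet_derivative g (at x) v" if "x \<in> S" for x
      by (simp only: frechet_derivative_at[OF g[OF that]])
    show "Ck_on n (\<lambda>x. frechet_derivative f (at x) v) S" using Suc.prems(3) by simp
  qed
  then show ?case using g by (auto simp: differentiable_def)
qed

text \<open>Replaces the chosen \<open>frechet_derivative\<close> by any explicit derivative, so
  that the differentiation rules can be proved by induction on the order.\<close>

lemma Ck_SucI:
  assumes "open S" "\<And>x. x \<in> S \<Longrightarrow> (f has_derivative D x) (at x)" "\<And>v. Ck_on n (\<lambda>x. D x v) S"
  shows "Ck_on (Suc n) f S"
proof -
  have "Ck_on n (\<lambda>x. frechet_derivative f (at x) v) S" for v
    by (rule Ck_cong[OF assms(1) _ assms(3)[of v]]) (simp only: frechet_derivative_at[OF assms(2)])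
  then show ?thesis using assms(2) by (auto simp: differentiable_def)
qed

lemma Ck_const: "open S \<Longrightarrow> Ck_on n (\<lambda>x. c) S"
proof (induction n arbitrary: c)
  case (Suc n)
  show ?case by (rule Ck_SucI[OF Suc.prems]) (rule has_derivative_const, rule Suc.IH[OF Suc.prems])
qed simp

lemma Ck_linear:
  assumes L: "bounded_linear L" and S: "open S"
  shows "Ck_on n L S"
proof (cases n)
  case 0
  then show ?thesis using linear_continuous_on[OF L] by simp
next
  case (Suc m)
  show ?thesis unfolding Suc
    by (rule Ck_SucI[OF S]) (rule bounded_linear_imp_has_derivative[OF L], rule Ck_const[OF S])
qed

lemma Ck_add: "open S \<Longrightarrow> Ck_on n f S \<Longrightarrow> Ck_on n g S \<Longrightarrow> Ck_on n (\<lambda>x. f x + g x) S"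
proof (induction n arbitrary: f g)
  case (Suc n)
  show ?case
  proof (rule Ck_SucI[OF Suc.prems(1)])
    show "x \<in> S \<Longrightarrow> ((\<lambda>x. f x + g x) has_derivative (\<lambda>v. frechet_derivative f (at x) v + frechet_derivative g (at x) v)) (at x)" for x
      by (intro has_derivative_add Ck_SucD[OF Suc.prems(2)] Ck_SucD[OF Suc.prems(3)])
    show "Ck_on n (\<lambda>x. frechet_derivative f (at x) v + frechet_derivative g (at x) v) S" for v
      using Suc.prems by (intro Suc.IH) auto
  qed
qed (auto intro: continuous_on_add)

lemma Ck_sum: "open S \<Longrightarrow> (\<And>i. i \<in> I \<Longrightarrow> Ck_on n (f i) S) \<Longrightarrow> Ck_on n (\<lambda>x. \<Sum>i\<in>I. f i x) S"
  by (induction I rule: infinite_finite_induct) (simp_all add: Ck_const Ck_add)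

lemma Ck_bilinear:
  assumes bil: "bounded_bilinear p" and S: "open S"
  shows "Ck_on n f S \<Longrightarrow> Ck_on n g S \<Longrightarrow> Ck_on n (\<lambda>x. p (f x) (g x)) S"
proof (induction n arbitrary: f g)
  case 0
  then show ?case using bounded_bilinear.continuous_on[OF bil] by simp
next
  case (Suc n)
  show ?case
  proof (rule Ck_SucI[OF S])
    show "x \<in> S \<Longrightarrow> ((\<lambda>x. p (f x) (g x)) has_derivative
        (\<lambda>v. p (f x) (frechet_derivative g (at x) v) + p (frechet_derivative f (at x) v) (g x))) (at x)" for x
      by (intro bounded_bilinear.FDERIV[OF bil] Ck_SucD[OF Suc.prems(1)] Ck_SucD[OF Suc.prems(2)])
    show "Ck_on n (\<lambda>x. p (f x) (frechet_derivative g (at x) v) + p (frechet_derivative f (at x) v) (g x)) S" for v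
      using Suc.prems Ck_mono[OF Suc.prems(1)] Ck_mono[OF Suc.prems(2)] by (intro Ck_add[OF S] Suc.IH) auto
  qed
qed

text \<open>\<open>Ck_on\<close> speaks of derivatives in constant directions, while the chain rule
  evaluates the derivative of \<open>g\<close> in the moving direction \<open>f'(x) v\<close>.
  Expanding that direction in \<open>Basis\<close> restores constant directions; this is why the
  middle space is Euclidean.\<close>

lemma Ck_compose:
  fixes f :: "'a::real_normed_vector \<Rightarrow> 'b::euclidean_space" and g :: "'b \<Rightarrow> 'c::real_normed_vector"
  assumes S: "open S"
  shows "Ck_on n f S \<Longrightarrow> Ck_on n g T \<Longrightarrow> f ` S \<subseteq> T \<Longrightarrow> Ck_on n (\<lambda>x. g (f x)) S"
proof (induction n arbitrary: g)
  case 0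
  then show ?case using continuous_on_compose2[of T g S f] by simp
next
  case (Suc n)
  have D: "((\<lambda>x. g (f x)) has_derivative
      (\<lambda>v. \<Sum>b\<in>Basis. (frechet_derivative f (at x) v \<bullet> b) *\<^sub>R frechet_derivative g (at (f x)) b)) (at x)" if "x \<in> S" for x
  proof -
    have g: "(g has_derivative frechet_derivative g (at (f x))) (at (f x))"
      by (rule Ck_SucD[OF Suc.prems(2)]) (use that Suc.prems(3) in blast)
    have "frechet_derivative g (at (f x)) (frechet_derivative f (at x) v) =
       (\<Sum>b\<in>Basis. (frechet_derivative f (at x) v \<bullet> b) *\<^sub>R frechet_derivative g (at (f x)) b)" for v
      by (subst euclidean_representation[of "frechet_derivative f (at x) v", symmetric])
        (simp only: linear_sum[OF has_derivative_linear[OF g]] linear_cmul[OF has_derivative_linear[OF g]])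
    with diff_chain_at[OF Ck_SucD[OF Suc.prems(1) that] g] show ?thesis by (simp add: o_def)
  qed
  show ?case
  proof (rule Ck_SucI[OF S D])
    fix v
    show "Ck_on n (\<lambda>x. \<Sum>b\<in>Basis. (frechet_derivative f (at x) v \<bullet> b) *\<^sub>R frechet_derivative g (at (f x)) b) S"
    proof (intro Ck_sum[OF S] Ck_bilinear[OF bounded_bilinear_scaleR S])
      fix b :: 'b
      show "Ck_on n (\<lambda>x. frechet_derivative f (at x) v \<bullet> b) S"
        using Suc.prems(1) by (intro Ck_bilinear[OF bounded_bilinear_inner S] Ck_const[OF S]) simp
      show "Ck_on n (\<lambda>x. frechet_derivative g (at (f x)) b) S"
        using Suc.prems(2) by (intro Suc.IH[OF Ck_mono[OF Suc.prems(1)] _ Suc.prems(3)]) simp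
    qed
  qed
qed

text \<open>Derivatives are taken at points and not within the set, so smoothness patches together
  from neighbourhoods.\<close>

lemma Ck_local: "(\<And>x. x \<in> S \<Longrightarrow> \<exists>T. open T \<and> x \<in> T \<and> Ck_on n f T) \<Longrightarrow> Ck_on n f S"
proof (induction n arbitrary: f)
  case 0
  have "isCont f x" if "x \<in> S" for x
    using 0[OF that] by (elim exE conjE) (simp add: continuous_on_eq_continuous_at)
  then show ?case by (simp add: continuous_at_imp_continuous_on)
next
  case (Suc n)
  show ?case unfolding Ck_on.simps(2)
  proof (intro conjI ballI allI)
    fix x assume "x \<in> S"
    from Suc.prems[OF this] show "f differentiable (at x)" by (elim exE conjE) simp
  next
    fix v
    show "Ck_on n (\<lambda>x. frechet_derivative f (at x) v) S"
    proof (rule Suc.IH)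
      fix x assume "x \<in> S"
      from Suc.prems[OF this] show "\<exists>T. open T \<and> x \<in> T \<and> Ck_on n (\<lambda>x. frechet_derivative f (at x) v) T"
        by (elim exE conjE) (intro exI conjI, assumption, assumption, simp)
    qed
  qed
qed

lemma smooth_local: "(\<And>x. x \<in> S \<Longrightarrow> \<exists>T. open T \<and> x \<in> T \<and> smooth_on f T) \<Longrightarrow> smooth_on f S"
  unfolding smooth_on_def by (intro allI Ck_local) blast

lemma smooth_cong: "open S \<Longrightarrow> (\<And>x. x \<in> S \<Longrightarrow> f x = g x) \<Longrightarrow> smooth_on f S \<Longrightarrow> smooth_on g S"
  unfolding smooth_on_def using Ck_cong by blast

lemma smooth_compose:
  fixes f :: "'a::real_normed_vector \<Rightarrow> 'b::euclidean_space" and g :: "'b \<Rightarrow> 'c::real_normed_vector"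
  shows "open S \<Longrightarrow> smooth_on f S \<Longrightarrow> smooth_on g T \<Longrightarrow> f ` S \<subseteq> T \<Longrightarrow> smooth_on (\<lambda>x. g (f x)) S"
  unfolding smooth_on_def using Ck_compose by blast

lemma smooth_add: "open S \<Longrightarrow> smooth_on f S \<Longrightarrow> smooth_on g S \<Longrightarrow> smooth_on (\<lambda>x. f x + g x) S"
  unfolding smooth_on_def using Ck_add by blast

lemma smooth_const: "open S \<Longrightarrow> smooth_on (\<lambda>x. c) S"
  unfolding smooth_on_def using Ck_const by blast

lemma smooth_bilinear: "bounded_bilinear p \<Longrightarrow> open S \<Longrightarrow> smooth_on f S \<Longrightarrow> smooth_on g S \<Longrightarrow> smooth_on (\<lambda>x. p (f x) (g x)) S"
  unfolding smooth_on_def using Ck_bilinear by blast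

lemma smooth_linear: "bounded_linear L \<Longrightarrow> open S \<Longrightarrow> smooth_on L S"
  unfolding smooth_on_def using Ck_linear by blast

subsection \<open>Bump functions\<close>

text \<open>\<open>exp (- 1/t) / t^n\<close>, extended by zero. The power is carried along because
  the derivative of a member of the family is a combination of the members \<open>n + 1\<close> and
  \<open>n + 2\<close>, so one induction shows all of them smooth.\<close>

definition flat :: "nat \<Rightarrow> real \<Rightarrow> real" where
  "flat n t = (if t > 0 then exp (- inverse t) * inverse t ^ n else 0)"

text \<open>From \<open>exp u \<ge> (u / m)^m\<close> with \<open>m = n + 2\<close>: two powers
  beyond \<open>n\<close> leave a factor \<open>t\<^sup>2\<close>, so that the difference quotient
  at zero tends to zero.\<close>

lemma flat_bound: "\<bar>flat n t\<bar> \<le> real (n + 2) ^ (n + 2) * t\<^sup>2"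
proof (cases "t > 0")
  case True
  let ?m = "n + 2"
  have "(inverse t / real ?m) ^ ?m \<le> (1 + inverse t / real ?m) ^ ?m"
    using True by (intro power_mono) auto
  also have "\<dots> \<le> exp (inverse t)"
    by (rule exp_ge_one_plus_x_over_n_power_n) (use True in auto, smt inverse_positive_iff_positive of_nat_0_le_iff)
  finally have "inverse t ^ ?m \<le> exp (inverse t) * real ?m ^ ?m"
    unfolding power_divide by (subst (asm) pos_divide_le_eq) auto
  then have "exp (- inverse t) * inverse t ^ ?m \<le> exp (- inverse t) * (exp (inverse t) * real ?m ^ ?m)"
    by (rule mult_left_mono) simp
  then have "exp (- inverse t) * inverse t ^ n * (inverse t)\<^sup>2 \<le> real ?m ^ ?m"
    by (simp only: power_add mult.assoc[symmetric] exp_add[symmetric]) simp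
  then have "exp (- inverse t) * inverse t ^ n * (inverse t)\<^sup>2 * t\<^sup>2 \<le> real ?m ^ ?m * t\<^sup>2"
    by (rule mult_right_mono) simp
  moreover have "(inverse t)\<^sup>2 * t\<^sup>2 = 1" using True by (simp add: power_mult_distrib[symmetric])
  ultimately have "exp (- inverse t) * inverse t ^ n \<le> real ?m ^ ?m * t\<^sup>2"
    by (simp only: mult.assoc mult_1_right)
  then show ?thesis using True by (simp add: flat_def abs_mult)
qed (simp add: flat_def)

lemma flat_deriv: "(flat n has_real_derivative (flat (n + 2) t - real n * flat (n + 1) t)) (at t)"
proof -
  consider "t > 0" | "t < 0" | "t = 0" by linarith
  then show ?thesis
  proof cases
    case 1
    have "((\<lambda>t. exp (- inverse t) * inverse t ^ n) has_real_derivative (flat (n + 2) t - real n * flat (n + 1) t)) (at t)"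
    proof -
      let ?u = "inverse t"
      have i: "(inverse has_real_derivative - (?u\<^sup>2)) (at t)" using DERIV_inverse[of t UNIV] 1 by (simp add: numeral_2_eq_2)
      have "((\<lambda>t. exp (- inverse t) * inverse t ^ n) has_real_derivative
          exp (- ?u) * (- (- (?u\<^sup>2))) * ?u ^ n + real n * (- (?u\<^sup>2) * ?u ^ (n - Suc 0)) * exp (- ?u)) (at t)"
        by (intro DERIV_mult DERIV_fun_exp DERIV_minus DERIV_power i)
      moreover have "exp (- ?u) * (- (- (?u\<^sup>2))) * ?u ^ n + real n * (- (?u\<^sup>2) * ?u ^ (n - Suc 0)) * exp (- ?u) =
          flat (n + 2) t - real n * flat (n + 1) t"
        using 1 by (cases n) (simp_all add: flat_def power2_eq_square algebra_simps)
      ultimately show ?thesis by simp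
    qed
    then show ?thesis
      by (rule DERIV_cong_ev[THEN iffD1, rotated 3]) (use 1 in \<open>auto simp: flat_def eventually_nhds intro!: exI[of _ "{0<..}"]\<close>)
  next
    case 2
    have "((\<lambda>t. 0) has_real_derivative (flat (n + 2) t - real n * flat (n + 1) t)) (at t)"
      using 2 by (simp add: flat_def)
    then show ?thesis
      by (rule DERIV_cong_ev[THEN iffD1, rotated 3]) (use 2 in \<open>auto simp: flat_def eventually_nhds intro!: exI[of _ "{..<0}"]\<close>)
  next
    case 3
    have "((\<lambda>h. flat n h / h) \<longlongrightarrow> 0) (at 0)"
    proof (rule Lim_null_comparison)
      show "\<forall>\<^sub>F h in at 0. norm (flat n h / h) \<le> real (n + 2) ^ (n + 2) * \<bar>h\<bar>"
      proof (rule always_eventually, rule allI)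
        fix h
        show "norm (flat n h / h) \<le> real (n + 2) ^ (n + 2) * \<bar>h\<bar>"
          using flat_bound[of n h] by (cases "h = 0") (auto simp: abs_divide divide_le_eq power2_eq_square abs_mult[symmetric] mult.assoc)
      qed
      show "((\<lambda>h. real (n + 2) ^ (n + 2) * \<bar>h\<bar>) \<longlongrightarrow> 0) (at 0)"
        by (auto intro!: tendsto_eq_intros)
    qed
    then show ?thesis using 3 by (simp add: DERIV_def flat_def)
  qed
qed

lemma flat_smooth: "smooth_on (flat n) UNIV"
proof -
  have "Ck_on k (flat n) UNIV" for k
  proof (induction k arbitrary: n)
    case 0
    show ?case using DERIV_isCont[OF flat_deriv] by (simp add: continuous_at_imp_continuous_on)
  next
    case (Suc k)
    show ?case
    proof (rule Ck_SucI)
      show "(flat n has_derivative (\<lambda>v. (flat (n + 2) x + (- real n) * flat (n + 1) x) * v)) (at x)" for x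
        using flat_deriv[of n x] by (simp add: has_field_derivative_def)
      show "Ck_on k (\<lambda>x. (flat (n + 2) x + (- real n) * flat (n + 1) x) * v) UNIV" for v
        by (intro Ck_bilinear[OF bounded_bilinear_mult] Ck_add Ck_const Suc.IH open_UNIV)
    qed simp
  qed
  then show ?thesis by (simp add: smooth_on_def)
qed

lemma smooth_bump:
  fixes x0 :: "'a::euclidean_space"
  shows "smooth_on (\<lambda>x. flat 0 (r\<^sup>2 + (-1) * ((x - x0) \<bullet> (x - x0)))) UNIV"
proof (rule smooth_compose[OF open_UNIV _ flat_smooth])
  have s: "smooth_on (\<lambda>x. x + (- x0)) UNIV"
    by (intro smooth_add smooth_const smooth_linear[OF bounded_linear_ident] open_UNIV)
  show "smooth_on (\<lambda>x. r\<^sup>2 + (-1) * ((x - x0) \<bullet> (x - x0))) UNIV"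
    using s by (intro smooth_add smooth_const smooth_bilinear[OF bounded_bilinear_mult] smooth_bilinear[OF bounded_bilinear_inner] open_UNIV) simp_all
qed simp

section \<open>Differentials of homomorphisms of Lie groups\<close>

locale lie_grp =
  fixes G :: "'g::{t2_space, second_countable_topology} monoid" (structure)
    and A :: "('g, 'l::euclidean_space) atlas"
  assumes G: "lie_group G A"
begin

sublocale group G using G by (simp add: lie_group_def)

lemma carrier_UNIV [simp]: "x \<in> carrier G"
  using G by (simp add: lie_group_def)

lemma atlas: "smooth_atlas A"
  using G by (simp add: lie_group_def)

lemma chart:
  assumes "(U, \<phi>) \<in> A"
  shows "open U" "open (\<phi> ` U)" "homeomorphism U (\<phi> ` U) \<phi> (inv_into U \<phi>)" "x \<in> U \<Longrightarrow> inv_into U \<phi> (\<phi> x) = x"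
proof -
  show "open U" "open (\<phi> ` U)" and h: "homeomorphism U (\<phi> ` U) \<phi> (inv_into U \<phi>)"
    using bspec[OF atlas[unfolded smooth_atlas_def, THEN conjunct2, THEN conjunct1] assms] by simp_all
  show "x \<in> U \<Longrightarrow> inv_into U \<phi> (\<phi> x) = x" by (rule homeomorphism_apply1[OF h])
qed

lemma chart_at: "\<exists>U \<phi>. (U, \<phi>) \<in> A \<and> p \<in> U"
proof -
  have "p \<in> (\<Union>(U, \<phi>)\<in>A. U)" using atlas[unfolded smooth_atlas_def, THEN conjunct1] by simp
  then show ?thesis by auto
qed

lemma transition: "(U, \<phi>) \<in> A \<Longrightarrow> (V, \<psi>) \<in> A \<Longrightarrow> smooth_on (\<lambda>x. \<psi> (inv_into U \<phi> x)) (\<phi> ` (U \<inter> V))"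
  using bspec[OF atlas[unfolded smooth_atlas_def, THEN conjunct2, THEN conjunct2], of "(U, \<phi>)"] by (auto dest: bspec)

lemma open_chart_image:
  assumes c: "(U, \<phi>) \<in> A" and N: "open N" "N \<subseteq> U"
  shows "open (\<phi> ` N)"
proof -
  have "openin (top_of_set U) N" using N by (simp add: open_subset)
  then have "openin (top_of_set (\<phi> ` U)) (\<phi> ` N)" by (rule homeomorphism_imp_open_map[OF chart(3)[OF c]])
  then show ?thesis using chart(2)[OF c] by (rule openin_open_trans)
qed

text \<open>Smoothness near each point of a chart suffices; functions defined by cases on and off a
  chart are handled in this way.\<close>

lemma smooth_funI:
  assumes "\<And>U \<phi> p. (U, \<phi>) \<in> A \<Longrightarrow> p \<in> U \<Longrightarrow> \<exists>N. open N \<and> N \<subseteq> U \<and> p \<in> N \<and> smooth_on (\<lambda>x. f (inv_into U \<phi> x)) (\<phi> ` N)"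
  shows "smooth_fun A f"
  unfolding smooth_fun_def
proof (intro ballI, clarify, rule smooth_local)
  fix U \<phi> x assume c: "(U, \<phi>) \<in> A" and "x \<in> \<phi> ` U"
  then obtain p where p: "p \<in> U" "x = \<phi> p" by blast
  obtain N where "open N" "N \<subseteq> U" "p \<in> N" "smooth_on (\<lambda>x. f (inv_into U \<phi> x)) (\<phi> ` N)" using assms[OF c p(1)] by blast
  then show "\<exists>T. open T \<and> x \<in> T \<and> smooth_on (\<lambda>x. f (inv_into U \<phi> x)) T"
    using open_chart_image[OF c] p by blast
qed

lemma smooth_fun_chart: "smooth_fun A f \<Longrightarrow> (U, \<phi>) \<in> A \<Longrightarrow> smooth_on (\<lambda>x. f (inv_into U \<phi> x)) (\<phi> ` U)"
  unfolding smooth_fun_def by (auto dest: bspec)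

lemma smooth_fun_comp:
  assumes m: "smooth_map A \<Psi>" and f: "smooth_fun A f"
  shows "smooth_fun A (\<lambda>g. f (\<Psi> g))"
proof (rule smooth_funI)
  fix U \<phi> p assume c: "(U, \<phi>) \<in> A" and p: "p \<in> U"
  obtain V \<psi> where d: "(V, \<psi>) \<in> A" "\<Psi> p \<in> V" using chart_at by blast
  let ?N = "U \<inter> \<Psi> -` V"
  have N: "open ?N" using m chart(1)[OF c] chart(1)[OF d(1)] by (simp add: smooth_map_def open_Int open_vimage)
  have o: "open (\<phi> ` ?N)" by (rule open_chart_image[OF c N]) blast
  have in_V: "\<Psi> (inv_into U \<phi> x) \<in> V" if "x \<in> \<phi> ` ?N" for x using that chart(4)[OF c] by auto
  have "smooth_on (\<lambda>x. f (inv_into V \<psi> (\<psi> (\<Psi> (inv_into U \<phi> x))))) (\<phi> ` ?N)"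
    by (rule smooth_compose[OF o _ smooth_fun_chart[OF f d(1)]])
      (use m c d(1) in_V in \<open>auto simp: smooth_map_def\<close>)
  then have "smooth_on (\<lambda>x. f (\<Psi> (inv_into U \<phi> x))) (\<phi> ` ?N)"
    by (rule smooth_cong[OF o, rotated]) (simp add: chart(4)[OF d(1)] in_V)
  then show "\<exists>N. open N \<and> N \<subseteq> U \<and> p \<in> N \<and> smooth_on (\<lambda>x. f (\<Psi> (inv_into U \<phi> x))) (\<phi> ` N)"
    using N p d(2) by (intro exI[of _ ?N]) auto
qed

lemma continuous_mult:
  assumes "continuous_on UNIV a" "continuous_on UNIV b"
  shows "continuous_on UNIV (\<lambda>x. a x \<otimes> b x)"
proof -
  have "continuous_on UNIV (\<lambda>(g, h). g \<otimes> h)" using G by (simp add: lie_group_def)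
  from continuous_on_compose2[OF this continuous_on_Pair[OF assms]] show ?thesis by simp
qed

lemma smooth_mult:
  assumes "(U, \<phi>) \<in> A" "(V, \<psi>) \<in> A" "(W, \<eta>) \<in> A"
  shows "smooth_on (\<lambda>(x, y). \<eta> (inv_into U \<phi> x \<otimes> inv_into V \<psi> y)) {(\<phi> g, \<psi> h) | g h. g \<in> U \<and> h \<in> V \<and> g \<otimes> h \<in> W}"
proof -
  have "\<forall>(U, \<phi>)\<in>A. \<forall>(V, \<psi>)\<in>A. \<forall>(W, \<eta>)\<in>A.
        smooth_on (\<lambda>(x, y). \<eta> (inv_into U \<phi> x \<otimes> inv_into V \<psi> y))
          {(\<phi> g, \<psi> h) | g h. g \<in> U \<and> h \<in> V \<and> g \<otimes> h \<in> W}"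
    using G unfolding lie_group_def by (elim conjE)
  from this[THEN bspec, OF assms(1), unfolded prod.case, THEN bspec, OF assms(2), unfolded prod.case, THEN bspec, OF assms(3)]
  show ?thesis by simp
qed

lemma left_translation: "smooth_map A (\<lambda>g. a \<otimes> g)"
  unfolding smooth_map_def
proof (intro conjI ballI, rule continuous_mult, rule continuous_on_const, rule continuous_on_id, clarify)
  fix V \<psi> W \<eta> assume c: "(V, \<psi>) \<in> A" "(W, \<eta>) \<in> A"
  obtain U \<phi> where d: "(U, \<phi>) \<in> A" "a \<in> U" using chart_at by blast
  let ?N = "V \<inter> (\<lambda>g. a \<otimes> g) -` W"
  have "open ?N" using chart(1)[OF c(1)] chart(1)[OF c(2)]
    by (intro open_Int open_vimage continuous_mult continuous_on_const continuous_on_id)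
  then have o: "open (\<psi> ` ?N)" by (rule open_chart_image[OF c(1)]) blast
  \<comment> \<open>Left translation is multiplication restricted to a slice; the slice map is
    written as a constant plus a linear map, which makes its smoothness visible.\<close>
  have "smooth_on (\<lambda>y. (\<phi> a, 0) + (0, y)) (\<psi> ` ?N)"
    by (intro smooth_add smooth_const smooth_linear o bounded_linear_intros)
  from smooth_compose[OF o this smooth_mult[OF d(1) c]]
  show "smooth_on (\<lambda>x. \<eta> (a \<otimes> inv_into V \<psi> x)) (\<psi> ` ?N)" using d(2) by (fastforce simp: chart(4)[OF d(1)])
qed

lemma right_translation: "smooth_map A (\<lambda>g. g \<otimes> a)"
  unfolding smooth_map_def
proof (intro conjI ballI, rule continuous_mult, rule continuous_on_id, rule continuous_on_const, clarify)
  fix V \<psi> W \<eta> assume c: "(V, \<psi>) \<in> A" "(W, \<eta>) \<in> A"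
  obtain U \<phi> where d: "(U, \<phi>) \<in> A" "a \<in> U" using chart_at by blast
  let ?N = "V \<inter> (\<lambda>g. g \<otimes> a) -` W"
  have "open ?N" using chart(1)[OF c(1)] chart(1)[OF c(2)]
    by (intro open_Int open_vimage continuous_mult continuous_on_const continuous_on_id)
  then have o: "open (\<psi> ` ?N)" by (rule open_chart_image[OF c(1)]) blast
  have "smooth_on (\<lambda>y. (y, 0) + (0, \<phi> a)) (\<psi> ` ?N)"
    by (intro smooth_add smooth_const smooth_linear o bounded_linear_intros)
  from smooth_compose[OF o this smooth_mult[OF c(1) d(1) c(2)]]
  show "smooth_on (\<lambda>x. \<eta> (inv_into V \<psi> x \<otimes> a)) (\<psi> ` ?N)" using d(2) by (fastforce simp: chart(4)[OF d(1)])
qed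

lemma smooth_translate:
  assumes "smooth_fun A f"
  shows "smooth_fun A (\<lambda>g. f (a \<otimes> g))" "smooth_fun A (\<lambda>g. f (g \<otimes> b))" "smooth_fun A (\<lambda>g. f (a \<otimes> g \<otimes> b))"
proof -
  show "smooth_fun A (\<lambda>g. f (a \<otimes> g))" by (rule smooth_fun_comp[OF left_translation assms])
  show b: "smooth_fun A (\<lambda>g. f (g \<otimes> b))" by (rule smooth_fun_comp[OF right_translation assms])
  show "smooth_fun A (\<lambda>g. f (a \<otimes> g \<otimes> b))" by (rule smooth_fun_comp[OF left_translation b])
qed

text \<open>A bump in chart coordinates, extended by zero. Smoothness off the chart requires the set
  \<open>C\<close> that carries it to be closed in the whole group, and it is, being compact in a
  Hausdorff space.\<close>

lemma smooth_fun_bump: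
  assumes U: "open U" "p \<in> U"
  shows "\<exists>f. smooth_fun A f \<and> f p > 0 \<and> (\<forall>g. g \<notin> U \<longrightarrow> f g = 0)"
proof -
  obtain V \<phi> where c: "(V, \<phi>) \<in> A" "p \<in> V" using chart_at by blast
  have o: "open (\<phi> ` (V \<inter> U))" by (rule open_chart_image[OF c(1)]) (use U chart(1)[OF c(1)] in auto)
  have "\<phi> p \<in> \<phi> ` (V \<inter> U)" using c(2) U(2) by simp
  from open_contains_cball[THEN iffD1, OF o, THEN bspec, OF this]
  obtain r where r: "r > 0" "cball (\<phi> p) r \<subseteq> \<phi> ` (V \<inter> U)" by (elim exE conjE)
  define b where "b x = flat 0 (r\<^sup>2 + (-1) * ((x - \<phi> p) \<bullet> (x - \<phi> p)))" for x
  have b0: "b x = 0" if "x \<notin> cball (\<phi> p) r" for x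
  proof -
    have "r < norm (x - \<phi> p)" using that by (simp add: dist_norm norm_minus_commute)
    then have "r\<^sup>2 < (norm (x - \<phi> p))\<^sup>2" using r(1) by (intro power_strict_mono) auto
    then show ?thesis by (simp add: b_def flat_def power2_norm_eq_inner)
  qed
  define f where "f g = (if g \<in> V then b (\<phi> g) else 0)" for g
  define C where "C = inv_into V \<phi> ` cball (\<phi> p) r"
  have "continuous_on (cball (\<phi> p) r) (inv_into V \<phi>)"
    using homeomorphism_cont2[OF chart(3)[OF c(1)]] by (rule continuous_on_subset) (use r(2) in blast)
  then have C: "closed C" unfolding C_def by (intro compact_imp_closed compact_continuous_image compact_cball)
  have CU: "C \<subseteq> V \<inter> U"
  proof
    fix g assume "g \<in> C"
    then obtain y where y: "y \<in> cball (\<phi> p) r" "g = inv_into V \<phi> y" unfolding C_def by blast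
    then obtain u where "u \<in> V" "u \<in> U" "y = \<phi> u" using r(2) by blast
    then show "g \<in> V \<inter> U" using y(2) chart(4)[OF c(1)] by simp
  qed
  have fC: "f g = 0" if g: "g \<notin> C" for g
  proof (cases "g \<in> V")
    case True
    have "\<phi> g \<notin> cball (\<phi> p) r"
    proof
      assume "\<phi> g \<in> cball (\<phi> p) r"
      then have "inv_into V \<phi> (\<phi> g) \<in> C" unfolding C_def by (rule imageI)
      then show False using g chart(4)[OF c(1) True] by simp
    qed
    then show ?thesis using b0 by (simp add: f_def)
  qed (simp add: f_def)
  have "smooth_fun A f"
  proof (rule smooth_funI)
    fix W \<eta> q assume d: "(W, \<eta>) \<in> A" and q: "q \<in> W"
    show "\<exists>N. open N \<and> N \<subseteq> W \<and> q \<in> N \<and> smooth_on (\<lambda>x. f (inv_into W \<eta> x)) (\<eta> ` N)"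
    proof (cases "q \<in> V")
      case True
      have N: "open (W \<inter> V)" using chart(1)[OF d] chart(1)[OF c(1)] by (rule open_Int)
      have o: "open (\<eta> ` (W \<inter> V))" by (rule open_chart_image[OF d N]) blast
      have "smooth_on (\<lambda>x. b (\<phi> (inv_into W \<eta> x))) (\<eta> ` (W \<inter> V))"
        unfolding b_def by (rule smooth_compose[OF o transition[OF d c(1)] smooth_bump]) simp
      then have "smooth_on (\<lambda>x. f (inv_into W \<eta> x)) (\<eta> ` (W \<inter> V))"
        by (rule smooth_cong[OF o, rotated]) (use chart(4)[OF d] in \<open>auto simp: f_def\<close>)
      then show ?thesis using N q True by (intro exI[of _ "W \<inter> V"]) auto
    next
      case False
      have N: "open (W - C)" using chart(1)[OF d] C by (rule open_Diff)
      have o: "open (\<eta> ` (W - C))" by (rule open_chart_image[OF d N]) blast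
      have "smooth_on (\<lambda>x. f (inv_into W \<eta> x)) (\<eta> ` (W - C))"
        by (rule smooth_cong[OF o _ smooth_const[OF o, of 0]]) (use chart(4)[OF d] fC in auto)
      then show ?thesis using N q False CU by (intro exI[of _ "W - C"]) auto
    qed
  qed
  moreover have "f p > 0" using c(2) r(1) by (simp add: f_def b_def flat_def)
  ultimately show ?thesis using fC CU by blast
qed

lemma smooth_fun_continuous:
  assumes f: "smooth_fun A f"
  shows "continuous_on UNIV f"
proof (rule continuous_at_imp_continuous_on, rule ballI)
  fix p
  obtain U \<phi> where c: "(U, \<phi>) \<in> A" "p \<in> U" using chart_at by blast
  have "Ck_on 0 (\<lambda>x. f (inv_into U \<phi> x)) (\<phi> ` U)" using smooth_fun_chart[OF f c(1)] unfolding smooth_on_def by blast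
  then have "continuous_on (\<phi> ` U) (\<lambda>x. f (inv_into U \<phi> x))" by simp
  from continuous_on_compose2[OF this homeomorphism_cont1[OF chart(3)[OF c(1)]]]
  have "continuous_on U (\<lambda>g. f (inv_into U \<phi> (\<phi> g)))" by simp
  then have "continuous_on U f" by (rule continuous_on_cong[THEN iffD1, rotated 2]) (simp_all add: chart(4)[OF c(1)])
  then show "isCont f p" using chart(1)[OF c(1)] c(2) by (simp add: continuous_on_eq_continuous_at)
qed

text \<open>Bump functions separate points, so an equation between group elements can be proved by
  evaluating smooth functions.\<close>

lemma smooth_separate:
  assumes "\<And>f. smooth_fun A f \<Longrightarrow> f a = f b"
  shows "a = b"
proof (rule ccontr)
  assume "a \<noteq> b"
  then obtain U where "open U" "a \<in> U" "b \<notin> U" by (meson t1_space)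
  then obtain f where "smooth_fun A f" "f a > 0" "f b = 0" using smooth_fun_bump[of U a] by blast
  then show False using assms[of f] by simp
qed

text \<open>Bump functions detect neighbourhoods. This is needed because
  \<open>lie_algebra_of\<close> constrains the curves \<open>ex (t X)\<close> only through their
  composites with smooth functions.\<close>

lemma curve_continuous:
  fixes c :: "real \<Rightarrow> 'g"
  assumes "\<And>f. smooth_fun A f \<Longrightarrow> continuous_on UNIV (\<lambda>t. f (c t))"
  shows "continuous_on UNIV c"
proof -
  have "open (c -` U)" if U: "open U" for U
  proof (subst open_subopen, rule ballI)
    fix t assume "t \<in> c -` U"
    then obtain f where f: "smooth_fun A f" "f (c t) > 0" "\<forall>g. g \<notin> U \<longrightarrow> f g = 0" using smooth_fun_bump[OF U, of "c t"] by blast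
    have "open {s. 0 < f (c s)}" by (intro open_Collect_less continuous_on_const assms f(1))
    moreover have "{s. 0 < f (c s)} \<subseteq> c -` U" using f(3) by force
    ultimately show "\<exists>T. open T \<and> t \<in> T \<and> T \<subseteq> c -` U" using f(2) by blast
  qed
  then show ?thesis by (simp add: continuous_on_open_vimage)
qed

end

section \<open>Exponential curves and left-invariant fields\<close>

locale lie_grp_alg = lie_grp G A for G :: "'g::{t2_space, second_countable_topology} monoid" (structure)
    and A :: "('g, 'l::euclidean_space) atlas" +
  fixes br and ex :: "'l \<Rightarrow> 'g"
  assumes alg: "lie_algebra_of G A br ex"
begin

abbreviation "fld \<equiv> field_of G A ex"

lemma ex_add: "ex ((s + t) *\<^sub>R X) = ex (s *\<^sub>R X) \<otimes> ex (t *\<^sub>R X)"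
  using alg unfolding lie_algebra_of_def by simp

lemma ex_zero: "ex 0 = \<one>"
proof -
  have "ex 0 \<otimes> ex 0 = ex 0" using ex_add[of 0 0 0] by simp
  then show ?thesis by (simp add: r_cancel_one)
qed

lemma ex_commute: "ex (s *\<^sub>R X) \<otimes> ex (t *\<^sub>R X) = ex (t *\<^sub>R X) \<otimes> ex (s *\<^sub>R X)"
  by (simp add: ex_add[symmetric] add.commute)

lemma ex_minus: "ex (t *\<^sub>R X) \<otimes> ex ((- t) *\<^sub>R X) = \<one>"
  using ex_add[of t "- t" X] ex_zero by simp

lemma fld_bij: "bij_betw fld UNIV (left_inv_fields G A)"
  using alg by (simp add: lie_algebra_of_def)

lemma fld_inj: "fld X = fld Y \<Longrightarrow> X = Y"
  using fld_bij by (auto simp: bij_betw_def dest: injD)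

lemma fld_left_inv: "fld X \<in> left_inv_fields G A"
  using fld_bij by (auto simp: bij_betw_def)

lemma fld_nonsmooth: "\<not> smooth_fun A f \<Longrightarrow> fld X f = (\<lambda>_. 0)"
  by (simp add: field_of_def)

lemma fld_simps:
  assumes f: "smooth_fun A f" and h: "smooth_fun A h"
  shows "smooth_fun A (fld X f)" "fld X (\<lambda>g. f g + h g) = (\<lambda>g. fld X f g + fld X h g)"
    "fld X (\<lambda>g. c * f g) = (\<lambda>g. c * fld X f g)"
    "fld X (\<lambda>g. f g * h g) = (\<lambda>g. fld X f g * h g + f g * fld X h g)"
    "fld X (\<lambda>g. f (a \<otimes> g)) = (\<lambda>g. fld X f (a \<otimes> g))"
  using fld_left_inv[of X] f h unfolding left_inv_fields_def by simp_all

lemma fld_alg: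
  assumes f: "smooth_fun A f"
  shows "fld (X + Y) f g = fld X f g + fld Y f g" "fld (c *\<^sub>R X) f g = c * fld X f g"
    "fld (br X Y) f g = fld X (fld Y f) g - fld Y (fld X f) g"
  using alg f unfolding lie_algebra_of_def by simp_all

lemma ex_smooth: "smooth_fun A f \<Longrightarrow> smooth_on (\<lambda>t. f (ex (t *\<^sub>R X))) UNIV"
  using alg unfolding lie_algebra_of_def by simp

lemma fld_deriv:
  assumes f: "smooth_fun A f"
  shows "((\<lambda>t. f (g \<otimes> ex (t *\<^sub>R X))) has_real_derivative fld X f g) (at 0)"
proof -
  have "Ck_on (Suc 0) (\<lambda>t. f (g \<otimes> ex (t *\<^sub>R X))) UNIV"
    using ex_smooth[OF smooth_translate(1)[OF f]] unfolding smooth_on_def by blast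
  then have "(\<lambda>t. f (g \<otimes> ex (t *\<^sub>R X))) differentiable (at 0)" by simp
  then show ?thesis using f by (simp add: field_of_def DERIV_deriv_iff_real_differentiable)
qed

text \<open>\<open>c\<close> is tangent to the field of \<open>X\<close> at the identity. Left
  translation by \<open>c s\<close>, together with the fact that \<open>ex (t X)\<close> and
  \<open>ex (r X)\<close> commute, carries this to every point
  \<open>c s \<otimes> ex (t X)\<close>.\<close>

lemma flow_derivative:
  assumes c: "\<And>s r. c (s + r) = c s \<otimes> c r"
    and d: "\<And>F. smooth_fun A F \<Longrightarrow> ((\<lambda>r. F (c r)) has_real_derivative fld X F \<one>) (at 0)"
    and f: "smooth_fun A f"
  shows "((\<lambda>s. f (c s \<otimes> ex (t *\<^sub>R X))) has_real_derivative fld X f (c s \<otimes> ex (t *\<^sub>R X))) (at s)"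
proof -
  let ?y = "ex (t *\<^sub>R X)"
  let ?F = "\<lambda>g. f (c s \<otimes> g \<otimes> ?y)"
  have F: "smooth_fun A ?F" by (rule smooth_translate(3)[OF f])
  have "?F (\<one> \<otimes> ex (r *\<^sub>R X)) = f ((c s \<otimes> ?y) \<otimes> ex (r *\<^sub>R X))" for r
    by (simp add: m_assoc ex_commute)
  then have "fld X ?F \<one> = fld X f (c s \<otimes> ?y)"
    using F f by (simp add: field_of_def)
  with d[OF F] have "((\<lambda>r. f (c (r + s) \<otimes> ?y)) has_real_derivative fld X f (c s \<otimes> ?y)) (at 0)"
    by (simp add: c add.commute[of _ s])
  then show ?thesis using DERIV_shift[of "\<lambda>s. f (c s \<otimes> ?y)" "fld X f (c s \<otimes> ?y)" 0 s] by simp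
qed

lemma ex_derivative: "smooth_fun A F \<Longrightarrow> ((\<lambda>r. F (ex (r *\<^sub>R X))) has_real_derivative fld X F \<one>) (at 0)"
  using fld_deriv[of F \<one> X] by simp

lemma ex_continuous: "continuous_on UNIV (\<lambda>t. ex (t *\<^sub>R X))"
proof (rule curve_continuous)
  fix f assume "smooth_fun A f"
  from ex_smooth[OF this] have "Ck_on 0 (\<lambda>t. f (ex (t *\<^sub>R X))) UNIV" unfolding smooth_on_def by blast
  then show "continuous_on UNIV (\<lambda>t. f (ex (t *\<^sub>R X)))" by simp
qed

text \<open>Both \<open>c\<close> and \<open>t \<mapsto> ex (t X)\<close> are integral curves of the same field; the mean value theorem on
  the difference of the two flows avoids joint differentiability of \<open>(s, t) \<mapsto> f (c s ex (t X))\<close>.\<close>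

lemma one_parameter_subgroup_unique:
  assumes c: "\<And>s r. c (s + r) = c s \<otimes> c r" and cont: "continuous_on UNIV c"
    and d: "\<And>F. smooth_fun A F \<Longrightarrow> ((\<lambda>r. F (c r)) has_real_derivative fld X F \<one>) (at 0)"
  shows "c t = ex (t *\<^sub>R X)"
proof -
  let ?e = "\<lambda>t. ex (t *\<^sub>R X)"
  have c0: "c 0 = \<one>" using c[of 0 0] by (simp add: r_cancel_one)
  have zero: "((\<lambda>h. F (c h \<otimes> ?e (- h))) has_real_derivative 0) (at 0)" if F: "smooth_fun A F" for F
  proof -
    let ?g = "fld X F"
    \<comment> \<open>The difference of the field along the two flows. It is continuous in both
      variables and zero at the origin, where both curves pass through the identity.\<close>
    let ?R = "\<lambda>p. ?g (c (fst p) \<otimes> ?e (- snd p)) - ?g (?e (fst p) \<otimes> ?e (- snd p))"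
    have g: "continuous_on UNIV ?g" by (rule smooth_fun_continuous[OF fld_simps(1)[OF F F]])
    have co: "continuous_on UNIV (\<lambda>p::real \<times> real. c (fst p))" "continuous_on UNIV (\<lambda>p::real \<times> real. ?e (fst p))"
      "continuous_on UNIV (\<lambda>p::real \<times> real. ?e (- snd p))"
      using continuous_on_compose2[OF cont, of UNIV "fst"] continuous_on_compose2[OF ex_continuous, of UNIV "fst"]
        continuous_on_compose2[OF ex_continuous, of UNIV "\<lambda>p. - snd p"]
      by (simp_all add: continuous_on_fst continuous_on_snd continuous_on_minus continuous_on_id)
    have R: "continuous_on UNIV ?R"
      by (intro continuous_on_diff continuous_on_compose2[OF g] continuous_mult co subset_UNIV)
    have "(\<lambda>h. (F (c (0 + h) \<otimes> ?e (- (0 + h))) - F (c 0 \<otimes> ?e (- 0))) / h) \<midarrow>0\<rightarrow> 0"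
    proof (rule LIM_I)
      fix r :: real assume r: "0 < r"
      have "\<exists>\<delta>>0. \<forall>p. dist p (0, 0) < \<delta> \<longrightarrow> dist (?R p) (?R (0, 0)) < r / 2"
        using R r unfolding continuous_on_iff by (metis UNIV_I half_gt_zero)
      then obtain \<delta> where \<delta>: "\<delta> > 0" "\<And>p. dist p (0, 0) < \<delta> \<Longrightarrow> dist (?R p) (?R (0, 0)) < r / 2" by blast
      have R0: "?R (0, 0) = 0" by (simp add: c0 ex_zero)
      show "\<exists>s>0. \<forall>h. h \<noteq> 0 \<and> norm (h - 0) < s \<longrightarrow>
          norm ((F (c (0 + h) \<otimes> ?e (- (0 + h))) - F (c 0 \<otimes> ?e (- 0))) / h - 0) < r"
      proof (intro exI[of _ "\<delta> / 2"] conjI allI impI)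
        show "0 < \<delta> / 2" using \<delta>(1) by simp
        fix h :: real assume h: "h \<noteq> 0 \<and> norm (h - 0) < \<delta> / 2"
        let ?Q = "\<lambda>s. F (c s \<otimes> ?e (- h)) - F (?e s \<otimes> ?e (- h))"
        \<comment> \<open>The second factor is frozen at \<open>- h\<close> while the first runs
          along either curve; the derivative of the difference is \<open>?R (s, h)\<close>, small
          near the origin. As \<open>?e h\<close> and \<open>?e (- h)\<close> cancel and both curves
          start at the identity, the increment of \<open>?Q\<close> is the numerator of the
          difference quotient sought.\<close>
        have "norm (?Q h - ?Q 0) \<le> r / 2 * norm (h - 0)"
        proof (rule field_differentiable_bound[of "{- \<bar>h\<bar>..\<bar>h\<bar>}" ?Q "\<lambda>s. ?R (s, h)"])
          fix s assume s: "s \<in> {- \<bar>h\<bar>..\<bar>h\<bar>}"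
          show "(?Q has_real_derivative ?R (s, h)) (at s within {- \<bar>h\<bar>..\<bar>h\<bar>})"
            using DERIV_diff[OF flow_derivative[OF c d F, of "- h" s] flow_derivative[OF ex_add ex_derivative F, of X "- h" s]]
            by (simp add: has_field_derivative_at_within)
          have "norm s \<le> norm h" using s by auto
          then have "dist (s, h) (0, 0) < \<delta>"
            using h norm_Pair_le[of s h] by (simp add: dist_norm)
          from \<delta>(2)[OF this] show "norm (?R (s, h)) \<le> r / 2" unfolding R0 by (simp add: dist_norm)
        qed auto
        also have "?Q h - ?Q 0 = F (c (0 + h) \<otimes> ?e (- (0 + h))) - F (c 0 \<otimes> ?e (- 0))"
          using ex_minus[of h X] by (simp add: c0 ex_zero)
        finally show "norm ((F (c (0 + h) \<otimes> ?e (- (0 + h))) - F (c 0 \<otimes> ?e (- 0))) / h - 0) < r"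
          using h r by (simp add: abs_divide divide_less_eq) (smt (verit) mult_pos_pos zero_less_abs_iff)
      qed
    qed
    then show ?thesis by (simp add: DERIV_def)
  qed
  have "c t \<otimes> ?e (- t) = \<one>"
  proof (rule smooth_separate)
    fix f assume f: "smooth_fun A f"
    let ?\<Phi> = "\<lambda>t. f (c t \<otimes> ?e (- t))"
    have "(?\<Phi> has_real_derivative 0) (at s)" for s
    proof -
      \<comment> \<open>The one-parameter property turns the derivative at \<open>s\<close> into a
        derivative at \<open>0\<close> of a translated function, already known to vanish.\<close>
      have "?\<Phi> (h + s) = f (c s \<otimes> (c h \<otimes> ?e (- h)) \<otimes> ?e (- s))" for h
        using c[of s h] ex_add[of "- h" "- s" X] by (simp add: m_assoc add.commute)
      then have "((\<lambda>h. ?\<Phi> (h + s)) has_real_derivative 0) (at 0)"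
        using zero[OF smooth_translate(3)[OF f, of "c s" "?e (- s)"]] by simp
      then show ?thesis using DERIV_shift[of ?\<Phi> 0 0 s] by simp
    qed
    then have "?\<Phi> t = ?\<Phi> 0" by (intro DERIV_isconst_all) blast
    then show "f (c t \<otimes> ?e (- t)) = f \<one>" by (simp add: c0 ex_zero)
  qed
  then have "c t \<otimes> ?e (- t) \<otimes> ?e t = ?e t" by simp
  then show ?thesis using ex_minus[of "- t" X] by (simp add: m_assoc)
qed

text \<open>\<Theta> sends \<open>ex (t X)\<close> to a one-parameter subgroup tangent to
  \<open>\<theta> X = X\<close>, and uniqueness identifies the two.\<close>

lemma fixed_one_parameter_subgroup:
  assumes \<Theta>: "global_cartan_involution G A ex \<Theta> \<theta>" and X: "\<theta> X = X"
  shows "ex (t *\<^sub>R X) \<in> fixed_group \<Theta>"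
proof -
  have hom: "\<Theta> (x \<otimes> y) = \<Theta> x \<otimes> \<Theta> y" for x y using \<Theta> unfolding global_cartan_involution_def hom_def by simp
  then have one: "\<Theta> \<one> = \<one>" using r_cancel_one[of "\<Theta> \<one>" "\<Theta> \<one>"] by (metis carrier_UNIV l_one)
  have sm: "smooth_map A \<Theta>" and df: "is_differential G A ex \<Theta> \<theta>" using \<Theta> by (simp_all add: global_cartan_involution_def)
  have "\<Theta> (ex (t *\<^sub>R X)) = ex (t *\<^sub>R X)"
  proof (rule one_parameter_subgroup_unique)
    show "\<Theta> (ex ((s + r) *\<^sub>R X)) = \<Theta> (ex (s *\<^sub>R X)) \<otimes> \<Theta> (ex (r *\<^sub>R X))" for s r by (simp add: ex_add hom)
    show "continuous_on UNIV (\<lambda>t. \<Theta> (ex (t *\<^sub>R X)))"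
      by (rule continuous_on_compose2[OF _ ex_continuous subset_UNIV]) (use sm in \<open>simp add: smooth_map_def\<close>)
    fix F assume F: "smooth_fun A F"
    have "fld X (\<lambda>h. F (\<Theta> h)) \<one> = fld X F \<one>"
      using df F X one unfolding is_differential_def by metis
    then show "((\<lambda>r. F (\<Theta> (ex (r *\<^sub>R X)))) has_real_derivative fld X F \<one>) (at 0)"
      using ex_derivative[OF smooth_fun_comp[OF sm F], of X] by simp
  qed
  then show ?thesis by (simp add: fixed_group_def)
qed

section \<open>Conjugation and its differential \<open>Ad\<close>\<close>

context
  fixes k :: 'g
begin

abbreviation "cj g \<equiv> k \<otimes> g \<otimes> inv k"
abbreviation "cj' g \<equiv> inv k \<otimes> g \<otimes> k"

lemma cj_cj': "cj (cj' g) = g" "cj' (cj g) = g"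
proof -
  have "k \<otimes> (inv k \<otimes> x) = x" "inv k \<otimes> (k \<otimes> x) = x" for x by (simp_all add: m_assoc[symmetric])
  then show "cj (cj' g) = g" "cj' (cj g) = g" by (simp_all add: m_assoc)
qed

lemma cj_mult: "cj (x \<otimes> y) = cj x \<otimes> cj y" "cj' (x \<otimes> y) = cj' x \<otimes> cj' y"
proof -
  have "k \<otimes> (inv k \<otimes> x) = x" "inv k \<otimes> (k \<otimes> x) = x" for x by (simp_all add: m_assoc[symmetric])
  then show "cj (x \<otimes> y) = cj x \<otimes> cj y" "cj' (x \<otimes> y) = cj' x \<otimes> cj' y" by (simp_all add: m_assoc)
qed

lemma fld_eqI:
  assumes "\<And>f g. smooth_fun A f \<Longrightarrow> fld X f (cj g) = fld Y f (cj g)"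
  shows "X = Y"
proof (rule fld_inj, rule ext, rule ext)
  fix f g
  show "fld X f g = fld Y f g"
    using assms[of f "cj' g"] fld_nonsmooth[of f] by (cases "smooth_fun A f") (simp_all add: cj_cj')
qed

text \<open>The push-forward of a left-invariant field under conjugation is left-invariant, because
  \<open>a \<otimes> cj h = cj (cj' a \<otimes> h)\<close>. As every left-invariant field is
  \<open>fld Y\<close> for some \<open>Y\<close>, this produces the differential of
  conjugation.\<close>

lemma transported_field:
  "(\<lambda>f. if smooth_fun A f then (\<lambda>g. fld X (\<lambda>h. f (cj h)) (cj' g)) else (\<lambda>_. 0)) \<in> left_inv_fields G A"
  (is "?D \<in> _")
proof -
  note s = smooth_translate(3)[where a = k and b = "inv k"]
  have sum: "smooth_fun A (\<lambda>g. f g + h g)" "smooth_fun A (\<lambda>g. f g * h g)" "smooth_fun A (\<lambda>g. c * f g)" if "smooth_fun A f" "smooth_fun A h" for f h and c :: real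
    using that unfolding smooth_fun_def
    by (auto intro!: smooth_add smooth_bilinear[OF bounded_bilinear_mult] smooth_const chart(2))
  show ?thesis
    unfolding left_inv_fields_def
  proof (intro CollectI conjI allI impI)
    fix f assume f: "smooth_fun A f"
    show "smooth_fun A (?D f)" using smooth_translate(3)[OF fld_simps(1)[OF s[OF f] s[OF f]], where a = "inv k" and b = k] f by simp
    show "?D (\<lambda>g. c * f g) = (\<lambda>g. c * ?D f g)" for c
      using f sum(3)[OF f f] fld_simps(3)[OF s[OF f] s[OF f]] by simp
    show "?D (\<lambda>g. f (a \<otimes> g)) = (\<lambda>g. ?D f (a \<otimes> g))" for a
    proof -
      have "a \<otimes> cj h = cj (cj' a \<otimes> h)" for h by (subst cj_mult(1)) (simp only: cj_cj'(1))
      then show ?thesis using f smooth_translate(1)[OF f, of a] fld_simps(5)[OF s[OF f] s[OF f], where X = X and a = "cj' a"]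
        by (simp only: if_True cj_mult)
    qed
    fix h assume h: "smooth_fun A h"
    show "?D (\<lambda>g. f g + h g) = (\<lambda>g. ?D f g + ?D h g)"
      using f h sum(1)[OF f h] fld_simps(2)[OF s[OF f] s[OF h]] by simp
    show "?D (\<lambda>g. f g * h g) = (\<lambda>g. ?D f g * h g + f g * ?D h g)"
      using f h sum(2)[OF f h] fld_simps(4)[OF s[OF f] s[OF h]] by (simp add: cj_cj')
  qed simp
qed

text \<open>\<open>Ad\<close> is defined by \<open>THE\<close>, so conjugation must be shown to have
  exactly one differential: existence comes from the transported field, uniqueness from injectivity
  of \<open>fld\<close>.\<close>

lemma Ad_differential:
  assumes f: "smooth_fun A f"
  shows "fld X (\<lambda>h. f (cj h)) g = fld (Ad G A ex k X) f (cj g)"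
proof -
  define L where "L X = inv_into UNIV fld (\<lambda>f. if smooth_fun A f then (\<lambda>g. fld X (\<lambda>h. f (cj h)) (cj' g)) else (\<lambda>_. 0))" for X
  have L: "fld (L X) = (\<lambda>f. if smooth_fun A f then (\<lambda>g. fld X (\<lambda>h. f (cj h)) (cj' g)) else (\<lambda>_. 0))" for X
    unfolding L_def using transported_field[of X] fld_bij by (intro f_inv_into_f) (simp only: bij_betw_def)
  have "is_differential G A ex cj L"
    unfolding is_differential_def by (simp add: L cj_cj')
  moreover have "L' = L" if "is_differential G A ex cj L'" for L'
  proof
    fix X
    show "L' X = L X" using that calculation unfolding is_differential_def by (intro fld_eqI) metis
  qed
  ultimately have "is_differential G A ex cj (Ad G A ex k)"
    unfolding Ad_def by (rule theI)
  then show ?thesis using f unfolding is_differential_def by blast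
qed

lemma Ad_linear: "linear (Ad G A ex k)"
proof (rule linearI)
  show "Ad G A ex k (X + Y) = Ad G A ex k X + Ad G A ex k Y" for X Y
    by (rule fld_eqI) (simp add: Ad_differential[symmetric] fld_alg smooth_translate(3))
  show "Ad G A ex k (c *\<^sub>R X) = c *\<^sub>R Ad G A ex k X" for c X
    by (rule fld_eqI) (simp add: Ad_differential[symmetric] fld_alg smooth_translate(3))
qed

text \<open>Brackets are commutators of fields, and the commutators of fields related by conjugation
  are again related.\<close>

lemma Ad_br: "Ad G A ex k (br X Y) = br (Ad G A ex k X) (Ad G A ex k Y)"
proof (rule fld_eqI)
  fix f g assume f: "smooth_fun A f"
  have D: "fld Z (\<lambda>h. f (cj h)) = (\<lambda>h. fld (Ad G A ex k Z) f (cj h))" for Z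
    by (rule ext) (rule Ad_differential[OF f])
  show "fld (Ad G A ex k (br X Y)) f (cj g) = fld (br (Ad G A ex k X) (Ad G A ex k Y)) f (cj g)"
    using f by (simp add: Ad_differential[OF f, symmetric] fld_alg smooth_translate(3))
      (simp add: D Ad_differential fld_simps(1)[OF f f])
qed

end

text \<open>Conjugations by \<open>k\<close> and \<open>inv k\<close> cancel. The inverse is what
  surjectivity of \<open>Ad\<close> and its invariance of the Killing form rest on.\<close>

lemma Ad_inverse: "Ad G A ex k (Ad G A ex (inv k) X) = X"
proof (rule fld_eqI[where k = k])
  fix f g assume f: "smooth_fun A f"
  have s: "smooth_fun A (\<lambda>h. f (k \<otimes> h \<otimes> inv k))" by (rule smooth_translate(3)[OF f])
  have "fld (Ad G A ex k (Ad G A ex (inv k) X)) f (k \<otimes> g \<otimes> inv k) = fld (Ad G A ex (inv k) X) (\<lambda>h. f (k \<otimes> h \<otimes> inv k)) g"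
    by (rule Ad_differential[OF f, symmetric])
  also have "\<dots> = fld (Ad G A ex (inv k) X) (\<lambda>h. f (k \<otimes> h \<otimes> inv k)) (inv k \<otimes> (k \<otimes> g \<otimes> inv k) \<otimes> inv (inv k))"
    using cj_cj'(2)[of k g] by simp
  also have "\<dots> = fld X (\<lambda>h. f (k \<otimes> (inv k \<otimes> h \<otimes> inv (inv k)) \<otimes> inv k)) (k \<otimes> g \<otimes> inv k)"
    by (rule Ad_differential[OF s, symmetric])
  also have "\<dots> = fld X f (k \<otimes> g \<otimes> inv k)" using cj_cj'(1)[of k] by simp
  finally show "fld (Ad G A ex k (Ad G A ex (inv k) X)) f (k \<otimes> g \<otimes> inv k) = fld X f (k \<otimes> g \<otimes> inv k)" .
qed

end

section \<open>Unitary modules of a Lie group\<close>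

text \<open>Translates the analytic axioms into the algebraic locale: finite sums with varying
  coefficients become spans, and differentiability of matrix coefficients becomes stability of
  subspaces.\<close>

lemma (in lie_grp_alg) gK_irreducible_pair:
  assumes ci: "cartan_involution br \<theta>" and \<Theta>: "global_cartan_involution G A ex \<Theta> \<theta>"
    and mod: "gK_module G A br ex (fixed_group \<Theta>) V \<pi> \<kappa>" and irr: "gK_irreducible (fixed_group \<Theta>) V \<pi> \<kappa>"
  shows "irreducible_pair br \<theta> V \<pi> (fixed_group \<Theta>) \<kappa> (Ad G A ex) \<one> (mult G)"
proof -
  interpret cartan br \<theta> using ci alg by unfold_locales (simp_all add: lie_algebra_of_def)
  let ?K = "fixed_group \<Theta>"
  have hom: "\<Theta> (x \<otimes> y) = \<Theta> x \<otimes> \<Theta> y" for x y using \<Theta> unfolding global_cartan_involution_def hom_def by simp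
  have one: "\<Theta> \<one> = \<one>" using r_cancel_one[of "\<Theta> \<one>" "\<Theta> \<one>"] hom by (metis carrier_UNIV l_one)
  note m = mod[unfolded gK_module_def]
  have V: "lie_module br UNIV V \<pi>" using m by (elim conjE)
  then have cv: "cvspace V" by (simp add: lie_module_def generators_act_def)
  have lin: "\<forall>k\<in>?K. lin_map V V (\<kappa> k)" using m by (elim conjE)
  have k1: "\<forall>v\<in>carrier V. \<kappa> \<one> v = v" using m by (elim conjE)
  have km: "\<forall>k\<in>?K. \<forall>k'\<in>?K. \<forall>v\<in>carrier V. \<kappa> (k \<otimes> k') v = \<kappa> k (\<kappa> k' v)" using m by (elim conjE)
  have fin: "\<forall>v\<in>carrier V. \<exists>F. finite F \<and> F \<subseteq> carrier V \<and> (\<forall>k\<in>?K. \<exists>c. \<kappa> k v = finsum V (\<lambda>f. c f \<odot>\<^bsub>V\<^esub> f) F)"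
    using m by (elim conjE)
  have der: "\<forall>X v l. (\<forall>t. ex (t *\<^sub>R X) \<in> ?K) \<longrightarrow> v \<in> carrier V \<longrightarrow> lin_functional V l \<longrightarrow>
      ((\<lambda>t. l (\<kappa> (ex (t *\<^sub>R X)) v)) has_vector_derivative l (\<pi> (X, 0) v)) (at 0)" using m by (elim conjE)
  have eq: "\<forall>k\<in>?K. \<forall>x. \<forall>v\<in>carrier V. \<kappa> k (\<pi> x v) = \<pi> (cmap (Ad G A ex k) x) (\<kappa> k v)" using m by (elim conjE)
  have fx: "k \<in> ?K \<longleftrightarrow> \<Theta> k = k" for k by (simp add: fixed_group_def)
  show ?thesis
  proof (intro irreducible_pair.intro irreducible_pair_axioms.intro)
    show "cartan br \<theta>" by unfold_locales
    show "lie_module br UNIV V \<pi>" by (rule V)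
    show "lin_map V V (\<kappa> k)" if "k \<in> ?K" for k using lin that by blast
    show "\<one> \<in> ?K" by (simp add: fx one)
    show "\<kappa> \<one> v = v" if "v \<in> carrier V" for v using k1 that by blast
    show "k \<otimes> k' \<in> ?K" if "k \<in> ?K" "k' \<in> ?K" for k k' using that by (simp add: fx hom)
    show "\<kappa> (k \<otimes> k') v = \<kappa> k (\<kappa> k' v)" if "k \<in> ?K" "k' \<in> ?K" "v \<in> carrier V" for k k' v using km that by blast
    show "\<exists>F. finite F \<and> F \<subseteq> carrier V \<and> (\<forall>k\<in>?K. \<kappa> k v \<in> spn V F)" if v: "v \<in> carrier V" for v
    proof -
      from bspec[OF fin v] obtain F where F: "finite F" "F \<subseteq> carrier V"
        "\<forall>k\<in>?K. \<exists>c. \<kappa> k v = finsum V (\<lambda>f. c f \<odot>\<^bsub>V\<^esub> f) F" by (elim exE conjE)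
      have "finsum V (\<lambda>f. c f \<odot>\<^bsub>V\<^esub> f) F \<in> spn V F" for c
        by (rule csub_finsum[OF cv spn_csub[OF cv F(2)]]) (simp add: csubD(3)[OF spn_csub[OF cv F(2)]] spn_base[OF cv F(2)])
      then have "\<forall>k\<in>?K. \<kappa> k v \<in> spn V F" using F(3) by metis
      with F show ?thesis by blast
    qed
    show "\<kappa> k (\<pi> x v) = \<pi> (cmap (Ad G A ex k) x) (\<kappa> k v)" if "k \<in> ?K" "v \<in> carrier V" for k v x using eq that by blast
    show "linear (Ad G A ex k)" for k by (rule Ad_linear)
    show "surj (Ad G A ex k)" for k using Ad_inverse by (rule surjI)
    show "K (Ad G A ex k X) (Ad G A ex k Y) = K X Y" for k X Y
      using Ad_inverse[of "inv k"] by (intro K_automorphism[of _ "Ad G A ex (inv k)"] Ad_linear Ad_br Ad_inverse) simp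
    show "\<pi> (X, 0) y \<in> N" if X: "\<theta> X = X" and N: "csub N V" and inv: "\<And>k n. k \<in> ?K \<Longrightarrow> n \<in> N \<Longrightarrow> \<kappa> k n \<in> N" and y: "y \<in> N" for X N y
    proof (rule csub_by_functionals[OF cv N])
      have yc: "y \<in> carrier V" using csubD(1)[OF N] y by (rule subsetD)
      then show "\<pi> (X, 0) y \<in> carrier V" using V by (auto simp: lie_module_def intro: generators_actD(3))
      fix l assume l: "lin_functional V l" and z: "\<And>n. n \<in> N \<Longrightarrow> l n = 0"
      have K: "ex (t *\<^sub>R X) \<in> ?K" for t by (rule fixed_one_parameter_subgroup[OF \<Theta> X])
      have "((\<lambda>t. l (\<kappa> (ex (t *\<^sub>R X)) y)) has_vector_derivative l (\<pi> (X, 0) y)) (at 0)"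
        using der K yc l by blast
      \<comment> \<open>The curve stays in \<open>N\<close>, where \<open>l\<close> vanishes, so its
        derivative \<open>l (\<pi> (X, 0) y)\<close> is zero.\<close>
      moreover have "(\<lambda>t. l (\<kappa> (ex (t *\<^sub>R X)) y)) = (\<lambda>t. 0)" using z[OF inv[OF K y]] by simp
      ultimately have "((\<lambda>t. 0) has_vector_derivative l (\<pi> (X, 0) y)) (at (0::real))" by simp
      from vector_derivative_unique_at[OF this has_vector_derivative_const] show "l (\<pi> (X, 0) y) = 0" .
    qed
    show "carrier V \<noteq> {\<zero>\<^bsub>V\<^esub>}" using irr unfolding gK_irreducible_def by (elim conjE)
    show "N = {\<zero>\<^bsub>V\<^esub>} \<or> N = carrier V"
      if "csub N V" "\<And>x n. n \<in> N \<Longrightarrow> \<pi> x n \<in> N" "\<And>k n. k \<in> ?K \<Longrightarrow> n \<in> N \<Longrightarrow> \<kappa> k n \<in> N" for N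
      using irr that unfolding gK_irreducible_def by simp
  qed
qed

text \<open>Merges the two parity cases into one pair of commuting signs, so that the two-stage
  argument runs only once.\<close>

lemma graded_spin_action_signs:
  assumes "graded_spin_action \<theta> P Q Sp \<gamma>p Sk \<gamma>k \<gamma>" and act: "generators_act P Sp \<gamma>p" "generators_act Q Sk \<gamma>k"
  shows "\<exists>\<epsilon>l \<epsilon>r sg. lin_map Sp Sp \<epsilon>l \<and> (\<forall>s\<in>carrier Sp. \<epsilon>l (\<epsilon>l s) = s) \<and>
      (\<forall>x\<in>P. \<forall>s\<in>carrier Sp. \<epsilon>l (\<gamma>p x s) = sg \<odot>\<^bsub>Sp\<^esub> \<gamma>p x (\<epsilon>l s)) \<and>
      lin_map Sk Sk \<epsilon>r \<and> (\<forall>s\<in>carrier Sk. \<epsilon>r (\<epsilon>r s) = s) \<and>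
      (\<forall>x\<in>Q. \<forall>s\<in>carrier Sk. \<epsilon>r (\<gamma>k x s) = (- sg) \<odot>\<^bsub>Sk\<^esub> \<gamma>k x (\<epsilon>r s)) \<and> sg * sg = 1 \<and>
      (\<forall>x z. \<gamma> x z = tensor_map Sp Sk Sp Sk (\<gamma>p ((1/2) *\<^sub>R (x - cmap \<theta> x))) \<epsilon>r z \<oplus>\<^bsub>tensor Sp Sk\<^esub>
         tensor_map Sp Sk Sp Sk \<epsilon>l (\<gamma>k ((1/2) *\<^sub>R (x + cmap \<theta> x))) z)"
proof -
  note Sp = generators_actD(1,3)[OF act(1)] and Sk = generators_actD(1,3)[OF act(2)]
  consider \<epsilon> where "parity_operator P Sp \<gamma>p \<epsilon>" "\<gamma> = graded_left \<theta> Sp \<gamma>p \<epsilon> Sk \<gamma>k"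
    | \<epsilon> where "parity_operator Q Sk \<gamma>k \<epsilon>" "\<gamma> = graded_right \<theta> Sp \<gamma>p Sk \<gamma>k \<epsilon>"
    using assms(1) unfolding graded_spin_action_def by blast
  then show ?thesis
  proof cases
    case 1
    note p = 1(1)[unfolded parity_operator_def]
    have "lin_map Sp Sp \<epsilon>" using p by (elim conjE)
    then have "(-1) \<odot>\<^bsub>Sp\<^esub> \<gamma>p x (\<epsilon> s) = \<epsilon> (\<gamma>p x s)" if "x \<in> P" "s \<in> carrier Sp" for x s
      using that p Sp(2)[OF that(1), of "\<epsilon> s"] cv_minus_eq[OF Sp(1)] lin_map_closed[of Sp Sp \<epsilon> s] by simp
    then show ?thesis
      using p Sk 1(2) by (intro exI[of _ \<epsilon>] exI[of _ id] exI[of _ "-1"]) (simp add: graded_left_def lin_map_id)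
  next
    case 2
    note p = 2(1)[unfolded parity_operator_def]
    have "lin_map Sk Sk \<epsilon>" using p by (elim conjE)
    then have "(-1) \<odot>\<^bsub>Sk\<^esub> \<gamma>k x (\<epsilon> s) = \<epsilon> (\<gamma>k x s)" if "x \<in> Q" "s \<in> carrier Sk" for x s
      using that p Sk(2)[OF that(1), of "\<epsilon> s"] cv_minus_eq[OF Sk(1)] lin_map_closed[of Sk Sk \<epsilon> s] by simp
    then show ?thesis
      using p Sp 2(2) by (intro exI[of _ id] exI[of _ \<epsilon>] exI[of _ 1]) (simp add: graded_right_def lin_map_id)
  qed
qed

theorem corollary5p6:
  fixes G :: "'g::{t2_space, second_countable_topology} monoid"
    and A :: "('g, 'l::euclidean_space) atlas"
    and br :: "'l \<Rightarrow> 'l \<Rightarrow> 'l" and ex :: "'l \<Rightarrow> 'g"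
    and \<theta> :: "'l \<Rightarrow> 'l" and \<Theta> :: "'g \<Rightarrow> 'g" and K :: "'g set"
    and \<gg> \<kk> \<pp> \<rr> \<ss> :: "('l \<times> 'l) set"
    and ws_p ws_k ws_s :: "('l \<times> 'l) list"
    and V :: "(complex, 'v) module" and \<pi> :: "'l \<times> 'l \<Rightarrow> 'v \<Rightarrow> 'v" and \<kappa> :: "'g \<Rightarrow> 'v \<Rightarrow> 'v"
    and Sp :: "(complex, 's) module" and \<gamma>p :: "'l \<times> 'l \<Rightarrow> 's \<Rightarrow> 's"
    and Sk :: "(complex, 't) module" and \<gamma>k :: "'l \<times> 'l \<Rightarrow> 't \<Rightarrow> 't"
    and \<gamma> :: "'l \<times> 'l \<Rightarrow> ('s \<times> 't \<Rightarrow>\<^sub>0 complex) set \<Rightarrow> ('s \<times> 't \<Rightarrow>\<^sub>0 complex) set"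
  assumes "lie_group G A" and "connected (UNIV :: 'g set)"
    and "lie_algebra_of G A br ex" and "semisimple br" and "finite (group_center G)"
    and "cartan_involution br \<theta>" and "global_cartan_involution G A ex \<Theta> \<theta>"
    and "K = fixed_group \<Theta>"
    and "\<gg> = UNIV" and "\<kk> = k_part \<theta>" and "\<pp> = p_part \<theta>"
    and "\<rr> \<subseteq> \<kk>" and "subalgebra br \<rr>" and "reductive br \<rr>" and "nondegenerate_on br \<rr>"
    and "\<ss> = orth br \<gg> \<rr>"
    and "even (cdim \<pp>) \<or> even (cdim (\<ss> \<inter> \<kk>))"
    and "gK_module G A br ex K V \<pi> \<kappa>" and "gK_irreducible K V \<pi> \<kappa>" and "gK_unitary K V \<pi> \<kappa>"
    and "orthonormal_basis br \<pp> ws_p" and "orthonormal_basis br (\<ss> \<inter> \<kk>) ws_k"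
    and "orthonormal_basis br \<ss> ws_s"
    and "spin_module br \<pp> Sp \<gamma>p" and "spin_module br (\<ss> \<inter> \<kk>) Sk \<gamma>k"
    and "graded_spin_action \<theta> \<pp> (\<ss> \<inter> \<kk>) Sp \<gamma>p Sk \<gamma>k \<gamma>"
  shows "let H = dirac_cohomology br \<gg> \<kk> ws_p V \<pi> Sp \<gamma>p;
             \<rho> = cohomology_action br \<gg> \<kk> ws_p V \<pi> Sp \<gamma>p;
             S = tensor Sp Sk
         in \<exists>\<Phi>. lin_map (dirac_cohomology br \<kk> \<rr> ws_k H \<rho> Sk \<gamma>k)
                        (dirac_cohomology br \<gg> \<rr> ws_s V \<pi> S \<gamma>) \<Phi> \<and>
                bij_betw \<Phi> (carrier (dirac_cohomology br \<kk> \<rr> ws_k H \<rho> Sk \<gamma>k))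
                           (carrier (dirac_cohomology br \<gg> \<rr> ws_s V \<pi> S \<gamma>)) \<and>
                (\<forall>(n::nat) x y.
                   let z = finsum (tensor H Sk)
                             (\<lambda>i. tens H Sk (dirac_class br \<gg> \<kk> ws_p V \<pi> Sp \<gamma>p (x i)) (y i)) {..<n};
                       z' = finsum (tensor V S) (\<lambda>i. tens_assoc V Sp Sk (x i) (y i)) {..<n}
                   in (\<forall>i<n. x i \<in> dirac_ker br \<gg> \<kk> ws_p V \<pi> Sp \<gamma>p \<and> y i \<in> carrier Sk) \<and>
                      z \<in> dirac_ker br \<kk> \<rr> ws_k H \<rho> Sk \<gamma>k \<longrightarrow>
                      z' \<in> dirac_ker br \<gg> \<rr> ws_s V \<pi> S \<gamma> \<and>
                      \<Phi> (dirac_class br \<kk> \<rr> ws_k H \<rho> Sk \<gamma>k z) = dirac_class br \<gg> \<rr> ws_s V \<pi> S \<gamma> z')"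
proof -
  interpret lg: lie_grp_alg G A br ex using assms(1,3) by unfold_locales
  interpret i: irreducible_pair br \<theta> V \<pi> "fixed_group \<Theta>" \<kappa> "Ad G A ex" "\<one>\<^bsub>G\<^esub>" "mult G"
    using assms(6,7,18,19) unfolding assms(8) by (rule lg.gK_irreducible_pair)
  \<comment> \<open>Irreducibility of \<open>V\<close> is spent here: later steps retain of it only
    this eigenvalue.\<close>
  obtain c0 where c0: "\<forall>l v es. lin_functional V l \<longrightarrow> v \<in> carrier V \<longrightarrow> orthonormal_basis br UNIV es \<longrightarrow>
      (\<Sum>i<length es. l (\<pi> (es ! i) (\<pi> (es ! i) v))) = c0 * l v" using i.casimir_scalar ..
  have "\<exists>h. herm V h \<and> (\<forall>X. \<forall>u\<in>carrier V. \<forall>v\<in>carrier V. h (\<pi> (X, 0) u) v = - h u (\<pi> (X, 0) v))"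
    using assms(20) unfolding gK_unitary_def herm_def by (elim exE conjE) (intro exI conjI, assumption+)
  then obtain h where h: "herm V h" "\<forall>X. \<forall>u\<in>carrier V. \<forall>v\<in>carrier V. h (\<pi> (X, 0) u) v = - h u (\<pi> (X, 0) v)"
    by (elim exE conjE) (rule that)
  have sp: "spin_module br (p_part \<theta>) Sp \<gamma>p" and clp: "clifford_module br (p_part \<theta>) Sp \<gamma>p"
    and ob: "orthonormal_basis br (p_part \<theta>) ws_p"
    using assms(11,21,24) by (simp_all add: spin_module_def)
  interpret u: unitary_pair br \<theta> V \<pi> Sp \<gamma>p ws_p h c0
  proof unfold_locales
    show "lie_module br UNIV V \<pi>" by (rule i.V)
    show "clifford_module br (p_part \<theta>) Sp \<gamma>p" by (rule clp)
    show "orthonormal_basis br (p_part \<theta>) ws_p" by (rule ob)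
    show "spin_module br (p_part \<theta>) Sp \<gamma>p" by (rule sp)
    show "herm V h" by (rule h(1))
    show "h (\<pi> (X, 0) u) v = - h u (\<pi> (X, 0) v)" if "u \<in> carrier V" "v \<in> carrier V" for X u v using h(2) that by blast
    show "\<exists>E. finite E \<and> E \<subseteq> carrier V \<and> v \<in> spn V E \<and> (\<forall>x\<in>k_part \<theta>. \<forall>a\<in>spn V E. \<pi> x a \<in> spn V E)"
      if "v \<in> carrier V" for v by (rule i.locally_k_finite[OF that])
    show "(\<Sum>i<length es. l (\<pi> (es ! i) (\<pi> (es ! i) v))) = c0 * l v"
      if "lin_functional V l" "v \<in> carrier V" "orthonormal_basis br UNIV es" for l v es using c0 that by blast
  qed
  have ss: "\<ss> = orth br UNIV \<rr>" using assms(9,16) by simp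
  have clk: "clifford_module br (\<ss> \<inter> k_part \<theta>) Sk \<gamma>k" and obk: "orthonormal_basis br (\<ss> \<inter> k_part \<theta>) ws_k"
    using assms(10,22,25) by (simp_all add: spin_module_def)
  have actp: "generators_act (p_part \<theta>) Sp \<gamma>p" and actk: "generators_act (\<ss> \<inter> k_part \<theta>) Sk \<gamma>k"
    using clp clk by (simp_all add: clifford_module_def)
  from assms(26) have "graded_spin_action \<theta> (p_part \<theta>) (\<ss> \<inter> k_part \<theta>) Sp \<gamma>p Sk \<gamma>k \<gamma>" by (simp only: assms(10,11))
  from graded_spin_action_signs[OF this actp actk]
  obtain \<epsilon>l \<epsilon>r sg where signs: "lin_map Sp Sp \<epsilon>l" "\<forall>s\<in>carrier Sp. \<epsilon>l (\<epsilon>l s) = s"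
      "\<forall>x\<in>p_part \<theta>. \<forall>s\<in>carrier Sp. \<epsilon>l (\<gamma>p x s) = sg \<odot>\<^bsub>Sp\<^esub> \<gamma>p x (\<epsilon>l s)"
      "lin_map Sk Sk \<epsilon>r" "\<forall>s\<in>carrier Sk. \<epsilon>r (\<epsilon>r s) = s"
      "\<forall>x\<in>\<ss> \<inter> k_part \<theta>. \<forall>s\<in>carrier Sk. \<epsilon>r (\<gamma>k x s) = (- sg) \<odot>\<^bsub>Sk\<^esub> \<gamma>k x (\<epsilon>r s)" "sg * sg = 1"
      "\<forall>x z. \<gamma> x z = tensor_map Sp Sk Sp Sk (\<gamma>p ((1/2) *\<^sub>R (x - cmap \<theta> x))) \<epsilon>r z \<oplus>\<^bsub>tensor Sp Sk\<^esub>
         tensor_map Sp Sk Sp Sk \<epsilon>l (\<gamma>k ((1/2) *\<^sub>R (x + cmap \<theta> x))) z"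
    by (elim exE conjE) (rule that)
  interpret t: two_stage_hodge br \<theta> V \<pi> Sp \<gamma>p ws_p \<rr> \<ss> Sk \<gamma>k ws_k ws_s \<gamma> \<epsilon>l \<epsilon>r sg
  proof (intro two_stage_hodge.intro two_stage.intro two_stage_axioms.intro two_stage_hodge_axioms.intro)
    show "symmetric_pair br \<theta> V \<pi> Sp \<gamma>p ws_p" by unfold_locales
    show "\<rr> \<subseteq> k_part \<theta>" using assms(10,12) by simp
    show "\<ss> = orth br UNIV \<rr>" by (rule ss)
    \<comment> \<open>Unitarity reaches the two-stage argument through this decomposition
      alone.\<close>
    show "hodge (tensor V Sp) (tensor_act V \<pi> Sp \<gamma>p (dirac br UNIV (k_part \<theta>) ws_p))" by (rule u.hodge_D1)
    show "\<epsilon>l (\<epsilon>l s) = s" if "s \<in> carrier Sp" for s using signs(2) that by blast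
    show "\<epsilon>r (\<epsilon>r s) = s" if "s \<in> carrier Sk" for s using signs(5) that by blast
    show "\<epsilon>l (\<gamma>p x s) = sg \<odot>\<^bsub>Sp\<^esub> \<gamma>p x (\<epsilon>l s)" if "x \<in> p_part \<theta>" "s \<in> carrier Sp" for x s
      using signs(3) that by blast
    show "\<epsilon>r (\<gamma>k x s) = (- sg) \<odot>\<^bsub>Sk\<^esub> \<gamma>k x (\<epsilon>r s)" if "x \<in> \<ss> \<inter> k_part \<theta>" "s \<in> carrier Sk" for x s
      using signs(6) that by blast
    show "\<gamma> x z = tensor_map Sp Sk Sp Sk (\<gamma>p ((1/2) *\<^sub>R (x - cmap \<theta> x))) \<epsilon>r z \<oplus>\<^bsub>tensor Sp Sk\<^esub>
         tensor_map Sp Sk Sp Sk \<epsilon>l (\<gamma>k ((1/2) *\<^sub>R (x + cmap \<theta> x))) z" for x z using signs(8) by blast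
  qed (fact signs assms(13) clk obk assms(23))+
  show ?thesis using t.cohomology_in_stages unfolding Let_def assms(9-11) .
qed

end
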